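(* There exists a family $\{V_\alpha\}_{\alpha\in(0,1)}$ of pairwise distinct single-well potentials on $\mathbb R$ which are all isospectral modulo $O(\hbar^\infty)$; that is, for all $\alpha,\beta\in(0,1)$ and every $f\in C^\infty(\mathbb R)$ whose support is bounded above, $$2\pi\hbar\Big(\operatorname{trace} f\Big(-\tfrac{\hbar^2}{2}\tfrac{d^2}{dx^2}+V_\alpha\Big)-\operatorname{trace} f\Big(-\tfrac{\hbar^2}{2}\tfrac{d^2}{dx^2}+V_\beta\Big)\Big)=O(\hbar^\infty)\qquad(\hbar\to0).$$
   Context: A single-well potential here is a function $V\in C^\infty(\mathbb R)$ with a unique critical point, located at $x=0$ and nondegenerate, with $V(0)=0$, increasing for $x>0$, decreasing for $x<0$, and with $V(x)\to+\infty$ as $x\to\pm\infty$. For such $V$ the operator $-\frac{\hbar^2}{2}\frac{d^2}{dx^2}+V$ on $L^2(\mathbb R)$ has discrete spectrum, and the trace of $f$ of this operator is the sum of $f$ over its eigenvalues counted with multiplicity. $O(\hbar^\infty)$ means $O(\hbar^N)$ for every $N$. *)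

theory Defs
  imports
    "HOL-Analysis.Analysis"
    "HOL-Library.Function_Algebras"
    "HOL-Library.Landau_Symbols"
begin

definition smooth :: "(real \<Rightarrow> 'a::real_normed_vector) \<Rightarrow> bool" where
  "smooth f \<longleftrightarrow> (\<exists>D :: nat \<Rightarrow> real \<Rightarrow> 'a. D 0 = f \<and>
     (\<forall>n x. (D n has_vector_derivative D (Suc n) x) (at x)))"

definition single_well :: "(real \<Rightarrow> real) \<Rightarrow> bool" where
  "single_well V \<longleftrightarrow>
     smooth V \<and>
     (\<forall>x. deriv V x = 0 \<longleftrightarrow> x = 0) \<and> deriv (deriv V) 0 \<noteq> 0 \<and>
     V 0 = 0 \<and>
     strict_mono_on {0<..} V \<and> strict_antimono_on {..<0} V \<and>
     filterlim V at_top at_top \<and> filterlim V at_top at_bot"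

definition L2 :: "(real \<Rightarrow> complex) set" where
  "L2 = {u. u \<in> borel_measurable lebesgue \<and> integrable lebesgue (\<lambda>x. (cmod (u x))\<^sup>2)}"

(* The graph of the operator -(h^2/2) d^2/dx^2 + V in L^2(R): "schroedinger h V u w" says that
   u is in the domain and w is (a.e.) its image. The domain is the maximal one, i.e. all u in L^2
   with u and u' locally absolutely continuous and -(h^2/2) u'' + V u in L^2; for continuous V
   bounded below this is the domain of the unique self-adjoint realisation. An element of the
   domain is represented by its continuous representative, so distinct functions u are distinct
   elements of L^2. *)
definition schroedinger ::
    "real \<Rightarrow> (real \<Rightarrow> real) \<Rightarrow> (real \<Rightarrow> complex) \<Rightarrow> (real \<Rightarrow> complex) \<Rightarrow> bool" where
  "schroedinger h V u w \<longleftrightarrow>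
     u \<in> L2 \<and> w \<in> L2 \<and>
     (\<exists>u' u''.
        (\<forall>x. (u has_vector_derivative u' x) (at x)) \<and>
        (\<forall>a b. a \<le> b \<longrightarrow> set_integrable lebesgue {a..b} u'' \<and>
           u' b - u' a = set_lebesgue_integral lebesgue {a..b} u'') \<and>
        (AE x in lebesgue. w x = - of_real (h\<^sup>2 / 2) * u'' x + of_real (V x) * u x))"

definition eigenspace :: "real \<Rightarrow> (real \<Rightarrow> real) \<Rightarrow> real \<Rightarrow> (real \<Rightarrow> complex) set" where
  "eigenspace h V E = {u. schroedinger h V u (\<lambda>x. of_real E * u x)}"

(* The operator is self-adjoint, so only real eigenvalues have to be considered. *)
definition eigenvalues :: "real \<Rightarrow> (real \<Rightarrow> real) \<Rightarrow> real set" where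
  "eigenvalues h V = {E. \<exists>u \<in> eigenspace h V E. u \<noteq> 0}"

lemma vector_space_fun: "vector_space (\<lambda>(c::complex) (u::real \<Rightarrow> complex) x. c * u x)"
  by unfold_locales (simp_all add: fun_eq_iff algebra_simps)

definition multiplicity :: "real \<Rightarrow> (real \<Rightarrow> real) \<Rightarrow> real \<Rightarrow> nat" where
  "multiplicity h V E =
     vector_space.dim (\<lambda>(c::complex) (u::real \<Rightarrow> complex) x. c * u x) (eigenspace h V E)"

definition trace_fun :: "(real \<Rightarrow> complex) \<Rightarrow> real \<Rightarrow> (real \<Rightarrow> real) \<Rightarrow> complex" where
  "trace_fun f h V = (\<Sum>\<^sub>\<infinity>E\<in>eigenvalues h V. of_nat (multiplicity h V E) * f E)"

end

theory Submission
  imports Defs "HOL-Real_Asymp.Real_Asymp"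
begin

text \<open>The wells are $2x^2$ plus one bump for each $j$, placed on $[2j+1,2j+2]$ or on its mirror image; the
  clean gaps $2j \le |x| \le 2j+1$ carry no bump. Eigenvalues below $E$ are counted by the dimension of
  families of test functions on which $\int v'^2 + 2h^{-2}(V-E)v^2$ is negative. Reflecting the whole
  potential outside $[-y,y]$, with $y$ in a clean gap, changes these counts only by a shift of $E$ by
  $O(h^N)$. For energies above the gap, there is a WKB amplitude $g$, even in the gap, for which
  $2h^{-2}(V-E) = g''/g - g^{-4} + O(h^N)$ on $[-y,y]$; up to this error the inner region is
  reflectionless, so that test functions can be reflected outside in $x$ and inside in the coordinate
  $\int g^{-2}$. For lower energies the eigenfunctions reach the gap only with exponentially small tails
  and can be truncated. Finitely many reflections followed by a change of the bumps outside the
  classically allowed region lead from any sign sequence to any other; the sequence used for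
  $\alpha$ records which rationals lie below $\alpha$.\<close>

section \<open>Linear second-order equations with a parameter\<close>

text \<open>The comparison runs through \<open>neg_family\<close> because negative directions can be
  cut off, glued and reflected, which destroys the property of being an eigenfunction; the price is
  an energy shift at each conversion, harmless at order h^N. A WKB amplitude exists only away from
  turning points, and its bounds deteriorate as E approaches the values of the potential on the
  inner region. Hence each gap holds several nested radii: the energy 2(2j+1/2)^2 separating the two
  regimes is strictly above the potential on \<bar>x\<bar> < 2j+3/8, where the amplitude lives, and
  strictly below it for \<bar>x\<bar> \<ge> 2j+5/8, where tails decay, so both regimes are uniform
  in E. A single bump cannot be reflected directly; all bumps from index j on can, and doing this
  for increasing j repairs one index at a time. This would never end, but f vanishes above some b,
  and bumps far outside change energies up to b only by exponentially small amounts. The traces run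
  over O(1/h) eigenvalues, so each eigenvalue must be close at order N+1 to obtain order N for the
  sum.\<close>

definition prim :: "(real \<Rightarrow> real) \<Rightarrow> real \<Rightarrow> real" where
  "prim f x = integral {0..1} (\<lambda>t. x * f (t * x))"

lemma prim_has_derivative:
  assumes "continuous_on UNIV f"
  shows "(prim f has_real_derivative f x) (at x)"
proof -
  have "\<exists>F. \<forall>x. -\<infinity> < ereal x \<longrightarrow> ereal x < \<infinity> \<longrightarrow> (F has_vector_derivative f x) (at x)"
    by (rule einterval_antiderivative) (use assms in \<open>auto simp: continuous_on_eq_continuous_at\<close>)
  then obtain F where F: "\<And>x. (F has_real_derivative f x) (at x)"
    by (auto simp: has_real_derivative_iff_has_vector_derivative)
  have "prim f x = F x - F 0" for x
  proof -
    have "((\<lambda>t. x * f (t * x)) has_integral (F (1 * x) - F (0 * x))) {0..1}"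
    proof (rule fundamental_theorem_of_calculus)
      fix t :: real
      have "((\<lambda>t. F (t * x)) has_real_derivative (f (t * x) * x)) (at t)"
        by (rule DERIV_chain'[OF _ F]) (auto intro!: derivative_eq_intros)
      then show "((\<lambda>t. F (t * x)) has_vector_derivative x * f (t * x)) (at t within {0..1})"
        by (simp add: has_real_derivative_iff_has_vector_derivative mult.commute
            has_vector_derivative_at_within)
    qed simp
    from integral_unique[OF this] show ?thesis unfolding prim_def by (simp only: mult_1 mult_zero_left)
  qed
  then have "prim f = (\<lambda>x. F x - F 0)" by auto
  then show ?thesis by (auto intro!: derivative_eq_intros F)
qed

lemma prim_0 [simp]: "prim f 0 = 0"
  by (simp add: prim_def)

lemma prim_bound:
  assumes f: "continuous_on UNIV f" and B: "\<And>t. \<bar>t\<bar> \<le> X \<Longrightarrow> \<bar>f t\<bar> \<le> B * \<bar>t\<bar> ^ n"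
    and x: "\<bar>x\<bar> \<le> X"
  shows "\<bar>prim f x\<bar> \<le> B * \<bar>x\<bar> ^ Suc n / real (Suc n)"
proof -
  have c: "continuous_on {0..1} (\<lambda>t. x * f (t * x))"
    by (intro continuous_intros continuous_on_compose2[OF f]) auto
  have "((\<lambda>t. B * \<bar>x\<bar> ^ Suc n * (t ^ Suc n / real (Suc n))) has_vector_derivative
      B * \<bar>x\<bar> ^ Suc n * t ^ n) (at t within {0..1})" for t :: real
    unfolding has_real_derivative_iff_has_vector_derivative[symmetric]
    using DERIV_cmult[OF DERIV_cdivide[OF DERIV_pow[of "Suc n" t "{0..1}"], of "real (Suc n)"],
        of "B * \<bar>x\<bar> ^ Suc n"] by simp
  then have "((\<lambda>t. B * \<bar>x\<bar> ^ Suc n * t ^ n) has_integral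
      (B * \<bar>x\<bar> ^ Suc n * (1 ^ Suc n / real (Suc n)) - B * \<bar>x\<bar> ^ Suc n * (0 ^ Suc n / real (Suc n)))) {0..1}"
    by (intro fundamental_theorem_of_calculus) auto
  then have i: "((\<lambda>t. B * \<bar>x\<bar> ^ Suc n * t ^ n) has_integral B * \<bar>x\<bar> ^ Suc n / real (Suc n)) {0..1}"
    by simp
  have "norm (integral {0..1} (\<lambda>t. x * f (t * x))) \<le> integral {0..1} (\<lambda>t. B * \<bar>x\<bar> ^ Suc n * t ^ n)"
  proof (rule integral_norm_bound_integral)
    show "(\<lambda>t. x * f (t * x)) integrable_on {0..1}" using c by (rule integrable_continuous_real)
    show "(\<lambda>t. B * \<bar>x\<bar> ^ Suc n * t ^ n) integrable_on {0..1}" using i by blast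
    fix t :: real assume t: "t \<in> {0..1}"
    have "\<bar>t * x\<bar> \<le> X" using t x mult_mono[of "\<bar>t\<bar>" 1 "\<bar>x\<bar>" X] by (auto simp: abs_mult)
    from B[OF this] have "\<bar>x\<bar> * \<bar>f (t * x)\<bar> \<le> \<bar>x\<bar> * (B * \<bar>t * x\<bar> ^ n)"
      by (rule mult_left_mono) simp
    then show "norm (x * f (t * x)) \<le> B * \<bar>x\<bar> ^ Suc n * t ^ n"
      using t by (simp add: abs_mult power_mult_distrib ac_simps)
  qed
  then show ?thesis unfolding prim_def integral_unique[OF i] by (simp only: real_norm_def)
qed

lemma continuous_prim_param:
  assumes "continuous_on UNIV (\<lambda>(E, x). f E x)"
  shows "continuous_on UNIV (\<lambda>(E::real, x::real). prim (f E) x)"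
proof -
  have "continuous_on (UNIV \<times> cbox 0 1) (\<lambda>(p, t). snd p * f (fst p) (t * snd p))"
    unfolding split_beta
    by (intro continuous_intros continuous_on_compose2[OF assms[unfolded split_beta],
          of _ "\<lambda>x. (fst (fst x), snd x * snd (fst x))", simplified])
  then have "continuous_on UNIV (\<lambda>p. integral (cbox 0 1) (\<lambda>t. snd p * f (fst p) (t * snd p)))"
    by (rule integral_continuous_on_param)
  then show ?thesis by (simp add: prim_def split_beta)
qed

lemma continuous_param_section:
  assumes "continuous_on UNIV (\<lambda>(E, x). f E x)"
  shows "continuous_on A (f E)"
  by (rule continuous_on_compose2[OF assms, of _ "\<lambda>x. (E, x)", simplified]) (intro continuous_intros)

section \<open>Picard series with continuous dependence on the energy\<close>

context
  fixes K :: "real \<Rightarrow> real \<Rightarrow> real" and a b :: "real \<Rightarrow> real"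
  assumes K: "continuous_on UNIV (\<lambda>(E, t). K E t)"
    and a: "continuous_on UNIV a" and b: "continuous_on UNIV b"
begin

text \<open>Terms of the Picard series, not its partial sums: each is a double primitive of
  \<open>K\<close> times the previous one, so the solution is their sum. The data \<open>a\<close>
  and \<open>b\<close> may depend on the energy because shooting needs solutions jointly continuous
  in \<open>E\<close> and \<open>t\<close>.\<close>

fun picard :: "nat \<Rightarrow> real \<Rightarrow> real \<Rightarrow> real" where
  "picard 0 E x = a E + b E * x"
| "picard (Suc n) E x = prim (prim (\<lambda>t. K E t * picard n E t)) x"

fun dpicard :: "nat \<Rightarrow> real \<Rightarrow> real \<Rightarrow> real" where
  "dpicard 0 E x = b E"
| "dpicard (Suc n) E x = prim (\<lambda>t. K E t * picard n E t) x"

lemma cont_picard: "continuous_on UNIV (\<lambda>(E, x). picard n E x)"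
proof (induction n)
  case 0
  show ?case unfolding picard.simps split_beta
    by (intro continuous_intros continuous_on_compose2[OF a] continuous_on_compose2[OF b]) auto
next
  case (Suc n)
  have "continuous_on UNIV (\<lambda>(E, x). K E x * picard n E x)"
    using continuous_on_mult[OF K Suc] by (simp add: split_beta)
  then show ?case
    unfolding picard.simps by (intro continuous_prim_param)
qed

lemma cont_Kpicard: "continuous_on UNIV (\<lambda>(E, x). K E x * picard n E x)"
  using continuous_on_mult[OF K cont_picard[of n]] by (simp add: split_beta)

lemma cont_dpicard: "continuous_on UNIV (\<lambda>(E, x). dpicard n E x)"
proof (cases n)
  case 0
  show ?thesis unfolding 0 dpicard.simps split_beta
    by (intro continuous_intros continuous_on_compose2[OF b]) auto
next
  case (Suc m)
  show ?thesis unfolding Suc dpicard.simps by (intro continuous_prim_param cont_Kpicard)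
qed

lemma picard_deriv: "(picard n E has_real_derivative dpicard n E x) (at x)"
proof (cases n)
  case 0
  have "picard 0 E = (\<lambda>x. a E + b E * x)" by auto
  then show ?thesis unfolding 0 by (auto intro!: derivative_eq_intros)
next
  case (Suc m)
  have "picard (Suc m) E = prim (prim (\<lambda>t. K E t * picard m E t))" by auto
  moreover have "continuous_on UNIV (prim (\<lambda>t. K E t * picard m E t))"
    by (rule continuous_param_section[OF continuous_prim_param[OF cont_Kpicard]])
  ultimately show ?thesis unfolding Suc by (simp add: prim_has_derivative)
qed

lemma dpicard_deriv:
  "(dpicard n E has_real_derivative (if n = 0 then 0 else K E x * picard (n - 1) E x)) (at x)"
proof (cases n)
  case 0
  have "dpicard 0 E = (\<lambda>x. b E)" by auto
  then show ?thesis unfolding 0 by (auto intro!: derivative_eq_intros)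
next
  case (Suc m)
  have "dpicard (Suc m) E = prim (\<lambda>t. K E t * picard m E t)" by auto
  moreover have "continuous_on UNIV (\<lambda>t. K E t * picard m E t)"
    by (rule continuous_param_section[OF cont_Kpicard])
  ultimately show ?thesis unfolding Suc using prim_has_derivative by simp
qed

text \<open>Two primitives gain two powers of \<bar>x\<bar> per step, but one of them is traded for
  the factor \<open>X\<close>. What remains, a single power over a factorial, already yields an
  exponential series, and the bounds for \<open>picard\<close> and \<open>dpicard\<close> feed each
  other through \<open>prim_bound\<close>.\<close>

lemma picard_bounds:
  assumes Q: "\<And>t. \<bar>t\<bar> \<le> X \<Longrightarrow> \<bar>K E t\<bar> \<le> Q" and A: "\<And>t. \<bar>t\<bar> \<le> X \<Longrightarrow> \<bar>a E + b E * t\<bar> \<le> A"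
    and X: "0 \<le> X"
  shows "\<bar>x\<bar> \<le> X \<Longrightarrow> \<bar>picard n E x\<bar> \<le> A * (Q * X) ^ n / fact n * \<bar>x\<bar> ^ n"
    and "\<bar>x\<bar> \<le> X \<Longrightarrow> \<bar>dpicard (Suc n) E x\<bar> \<le> Q * (A * (Q * X) ^ n) / fact (Suc n) * \<bar>x\<bar> ^ Suc n"
proof -
  have Q0: "0 \<le> Q" using Q[of 0] X by simp
  have A0: "0 \<le> A" using A[of 0] X by simp
  have D: "\<bar>x\<bar> \<le> X \<Longrightarrow> \<bar>dpicard (Suc n) E x\<bar> \<le> Q * (A * (Q * X) ^ n) / fact (Suc n) * \<bar>x\<bar> ^ Suc n"
    if P: "\<And>x. \<bar>x\<bar> \<le> X \<Longrightarrow> \<bar>picard n E x\<bar> \<le> A * (Q * X) ^ n / fact n * \<bar>x\<bar> ^ n" for n x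
  proof -
    assume x: "\<bar>x\<bar> \<le> X"
    have "\<bar>prim (\<lambda>t. K E t * picard n E t) x\<bar> \<le> (Q * (A * (Q * X) ^ n / fact n)) * \<bar>x\<bar> ^ Suc n / real (Suc n)"
    proof (rule prim_bound[OF _ _ x])
      show "continuous_on UNIV (\<lambda>t. K E t * picard n E t)"
        by (rule continuous_param_section[OF cont_Kpicard])
      fix t assume t: "\<bar>t\<bar> \<le> X"
      have "\<bar>K E t\<bar> * \<bar>picard n E t\<bar> \<le> Q * (A * (Q * X) ^ n / fact n * \<bar>t\<bar> ^ n)"
        by (intro mult_mono Q P t) (use Q0 in auto)
      then show "\<bar>K E t * picard n E t\<bar> \<le> Q * (A * (Q * X) ^ n / fact n) * \<bar>t\<bar> ^ n"
        by (simp add: abs_mult mult.assoc)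
    qed
    then show ?thesis by (simp add: field_simps)
  qed
  have P: "\<bar>x\<bar> \<le> X \<Longrightarrow> \<bar>picard n E x\<bar> \<le> A * (Q * X) ^ n / fact n * \<bar>x\<bar> ^ n" for n x
  proof (induction n arbitrary: x)
    case 0 then show ?case using A by simp
  next
    case (Suc n)
    have "\<bar>prim (dpicard (Suc n) E) x\<bar> \<le> Q * (A * (Q * X) ^ n) / fact (Suc n) * \<bar>x\<bar> ^ Suc (Suc n) / real (Suc (Suc n))"
      by (rule prim_bound[OF continuous_param_section[OF cont_dpicard] D[OF Suc.IH] Suc.prems])
    also have "\<dots> \<le> Q * (A * (Q * X) ^ n) / fact (Suc n) * \<bar>x\<bar> ^ Suc (Suc n) / 1"
      using Q0 A0 X by (intro divide_left_mono) auto
    also have "\<dots> = Q * (A * (Q * X) ^ n) / fact (Suc n) * (\<bar>x\<bar> * \<bar>x\<bar> ^ Suc n)" by simp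
    also have "\<dots> \<le> Q * (A * (Q * X) ^ n) / fact (Suc n) * (X * \<bar>x\<bar> ^ Suc n)"
      using Q0 A0 X Suc.prems by (intro mult_left_mono mult_right_mono) auto
    also have "\<dots> = A * (Q * X) ^ Suc n / fact (Suc n) * \<bar>x\<bar> ^ Suc n" by simp
    finally show ?case
      by (subst picard.simps) (simp add: dpicard.simps(2)[abs_def] del: fact_Suc)
  qed
  show "\<bar>x\<bar> \<le> X \<Longrightarrow> \<bar>picard n E x\<bar> \<le> A * (Q * X) ^ n / fact n * \<bar>x\<bar> ^ n"
    and "\<bar>x\<bar> \<le> X \<Longrightarrow> \<bar>dpicard (Suc n) E x\<bar> \<le> Q * (A * (Q * X) ^ n) / fact (Suc n) * \<bar>x\<bar> ^ Suc n"
    using P D by blast+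
qed

lemma picard_uniform:
  assumes X: "0 \<le> X"
  shows "\<exists>M. summable M \<and> (\<forall>n E x. \<bar>E\<bar> \<le> B \<longrightarrow> \<bar>x\<bar> \<le> X \<longrightarrow>
    \<bar>picard n E x\<bar> \<le> M n \<and> \<bar>dpicard n E x\<bar> \<le> M n \<and>
    \<bar>if n = 0 then 0 else K E x * picard (n - 1) E x\<bar> \<le> M n)"
proof -
  let ?S = "{-B..B} \<times> {-X..X}"
  have c: "compact ?S" by (intro compact_Times) auto
  have "bounded ((\<lambda>(E, t). K E t) ` ?S)"
    by (intro compact_imp_bounded compact_continuous_image c continuous_on_subset[OF K]) auto
  then obtain Q where Q: "\<And>E t. \<bar>E\<bar> \<le> B \<Longrightarrow> \<bar>t\<bar> \<le> X \<Longrightarrow> \<bar>K E t\<bar> \<le> Q" and Q0: "0 \<le> Q"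
    unfolding bounded_pos by (fastforce simp: abs_le_iff intro: less_imp_le)
  have "bounded ((\<lambda>p. a (fst p) + b (fst p) * snd p) ` ?S)"
    by (intro compact_imp_bounded compact_continuous_image c continuous_intros
        continuous_on_compose2[OF a] continuous_on_compose2[OF b]) auto
  then obtain A where A: "\<And>E t. \<bar>E\<bar> \<le> B \<Longrightarrow> \<bar>t\<bar> \<le> X \<Longrightarrow> \<bar>a E + b E * t\<bar> \<le> A" and A0: "0 \<le> A"
    unfolding bounded_pos by (fastforce simp: abs_le_iff intro: less_imp_le)
  have "bounded (b ` {-B..B})"
    by (intro compact_imp_bounded compact_continuous_image continuous_on_subset[OF b]) auto
  then obtain C where C: "\<And>E. \<bar>E\<bar> \<le> B \<Longrightarrow> \<bar>b E\<bar> \<le> C" and C0: "0 \<le> C"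
    unfolding bounded_pos by (fastforce simp: abs_le_iff intro: less_imp_le)
  define m where "m n = A * ((Q * X * X) ^ n /\<^sub>R fact n)" for n
  have sm: "summable m" unfolding m_def by (intro summable_mult summable_exp_generic)
  have m0: "0 \<le> m n" for n unfolding m_def using A0 Q0 X by simp
  have pm: "\<bar>picard n E x\<bar> \<le> m n" if "\<bar>E\<bar> \<le> B" "\<bar>x\<bar> \<le> X" for n E x
  proof -
    have "\<bar>picard n E x\<bar> \<le> A * (Q * X) ^ n / fact n * \<bar>x\<bar> ^ n"
      by (rule picard_bounds(1)[OF _ _ X]) (use that Q A in auto)
    also have "\<dots> \<le> A * (Q * X) ^ n / fact n * X ^ n"
      using that A0 Q0 X by (intro mult_left_mono power_mono) auto
    also have "\<dots> = m n" by (simp add: m_def power_mult_distrib field_simps)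
    finally show ?thesis .
  qed
  have dm: "\<bar>dpicard (Suc n) E x\<bar> \<le> Q * X * m n" if "\<bar>E\<bar> \<le> B" "\<bar>x\<bar> \<le> X" for n E x
  proof -
    have "\<bar>dpicard (Suc n) E x\<bar> \<le> Q * (A * (Q * X) ^ n) / fact (Suc n) * \<bar>x\<bar> ^ Suc n"
      by (rule picard_bounds(2)[OF _ _ X]) (use that Q A in auto)
    also have "\<dots> \<le> Q * (A * (Q * X) ^ n) / fact n * X ^ Suc n"
      using that A0 Q0 X by (intro mult_mono power_mono divide_left_mono fact_mono) auto
    also have "\<dots> = Q * X * m n" by (simp add: m_def power_mult_distrib field_simps)
    finally show ?thesis .
  qed
  \<comment> \<open>One majorant for the terms and their first two derivatives: \<open>C\<close>
    bounds \<open>dpicard 0\<close>, which is the constant \<open>b E\<close>; \<open>Q * X\<close>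
    accounts for a primitive of \<open>K\<close> times the previous term and \<open>Q\<close> for
    that product itself.\<close>
  define M where "M n = m n + (if n = 0 then C else (Q * X + Q) * m (n - 1))" for n
  have "summable (\<lambda>n. (if n = 0 then C else (Q * X + Q) * m (n - 1)))"
    by (subst summable_Suc_iff[symmetric]) (simp add: summable_mult sm)
  then have 1: "summable M" unfolding M_def by (intro summable_add sm)
  have ge: "0 \<le> (Q * X) * m n" "0 \<le> Q * m n" for n using m0 Q0 X by auto
  show ?thesis
  proof (intro exI[of _ M] conjI allI impI 1)
    fix n E x assume *: "\<bar>E\<bar> \<le> B" "\<bar>x\<bar> \<le> X"
    show "\<bar>picard n E x\<bar> \<le> M n"
      using pm[OF *, of n] C0 ge[of "n - 1"] unfolding M_def
      by (cases n) (simp_all add: algebra_simps del: picard.simps)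
    show "\<bar>dpicard n E x\<bar> \<le> M n"
    proof (cases n)
      case 0 then show ?thesis using C[OF *(1)] m0[of 0] by (simp add: M_def)
    next
      case (Suc j) then show ?thesis using dm[OF *, of j] m0[of n] ge[of j]
        by (simp add: M_def algebra_simps del: dpicard.simps)
    qed
    show "\<bar>if n = 0 then 0 else K E x * picard (n - 1) E x\<bar> \<le> M n"
    proof (cases n)
      case 0 then show ?thesis using m0[of 0] C0 by (simp add: M_def)
    next
      case (Suc j)
      have "\<bar>K E x\<bar> * \<bar>picard j E x\<bar> \<le> Q * m j"
        by (intro mult_mono Q pm *) (use Q0 in auto)
      then show ?thesis using m0[of n] ge[of j] Suc
        by (simp add: M_def algebra_simps abs_mult del: picard.simps)
    qed
  qed
qed

text \<open>Continuity is local, so the majorant of the Weierstrass test may depend on a box around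
  the point.\<close>

lemma cont_suminf:
  fixes g :: "nat \<Rightarrow> real \<Rightarrow> real \<Rightarrow> real"
  assumes g: "\<And>n. continuous_on UNIV (\<lambda>(E, x). g n E x)"
    and M: "\<And>B X. 0 \<le> X \<Longrightarrow> \<exists>M. summable M \<and> (\<forall>n E x. \<bar>E\<bar> \<le> B \<longrightarrow> \<bar>x\<bar> \<le> X \<longrightarrow> \<bar>g n E x\<bar> \<le> M n)"
  shows "continuous_on UNIV (\<lambda>(E, x). suminf (\<lambda>n. g n E x))"
proof -
  have "isCont (\<lambda>(E, x). suminf (\<lambda>n. g n E x)) p" for p
  proof -
    define B where "B = \<bar>fst p\<bar> + 1" define X where "X = \<bar>snd p\<bar> + 1"
    let ?S = "{-B<..<B} \<times> {-X<..<X}"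
    obtain M where M': "summable M" "\<And>n E x. \<bar>E\<bar> \<le> B \<Longrightarrow> \<bar>x\<bar> \<le> X \<Longrightarrow> \<bar>g n E x\<bar> \<le> M n"
      using M[of X B] by (auto simp: X_def)
    have "uniform_limit ?S (\<lambda>n p. \<Sum>i<n. (\<lambda>(E, x). g i E x) p) (\<lambda>p. suminf (\<lambda>i. (\<lambda>(E, x). g i E x) p)) sequentially"
      by (rule Weierstrass_m_test[OF _ M'(1)]) (auto intro!: M'(2))
    then have "continuous_on ?S (\<lambda>p. suminf (\<lambda>i. (\<lambda>(E, x). g i E x) p))"
      by (rule uniform_limit_theorem[rotated])
        (auto intro!: always_eventually continuous_on_sum continuous_on_subset[OF g])
    moreover have "p \<in> ?S" "open ?S" by (auto simp: B_def X_def mem_Times_iff abs_less_iff intro: open_Times)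
    ultimately have "isCont (\<lambda>p. suminf (\<lambda>i. (\<lambda>(E, x). g i E x) p)) p"
      using continuous_on_eq_continuous_at by blast
    then show ?thesis by (simp add: case_prod_unfold)
  qed
  then show ?thesis by (simp add: continuous_on_eq_continuous_at)
qed

lemma linear_ode_exists:
  obtains u u' where
    "\<And>E t. (u E has_real_derivative u' E t) (at t)"
    "\<And>E t. (u' E has_real_derivative K E t * u E t) (at t)"
    "\<And>E. u E 0 = a E" "\<And>E. u' E 0 = b E"
    "continuous_on UNIV (\<lambda>(E, t). u E t)" "continuous_on UNIV (\<lambda>(E, t). u' E t)"
proof -
  define u where "u E x = suminf (\<lambda>n. picard n E x)" for E x
  define u' where "u' E x = suminf (\<lambda>n. dpicard n E x)" for E x
  let ?k = "\<lambda>n E x. if n = 0 then 0 else K E x * picard (n - 1) E x"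
  have sums: "summable (\<lambda>n. picard n E x)" "summable (\<lambda>n. dpicard n E x)" for E x
  proof -
    from picard_uniform[OF abs_ge_zero[of x], of "\<bar>E\<bar>"]
    obtain M where M1: "summable M" and M2: "\<forall>n E' x'. \<bar>E'\<bar> \<le> \<bar>E\<bar> \<longrightarrow> \<bar>x'\<bar> \<le> \<bar>x\<bar> \<longrightarrow>
        \<bar>picard n E' x'\<bar> \<le> M n \<and> \<bar>dpicard n E' x'\<bar> \<le> M n \<and> \<bar>?k n E' x'\<bar> \<le> M n"
      by (elim exE conjE)
    note M = M1 M2[rule_format, OF order_refl order_refl, THEN conjunct1]
      M2[rule_format, OF order_refl order_refl, THEN conjunct2, THEN conjunct1]
    show "summable (\<lambda>n. picard n E x)"
      by (rule summable_comparison_test'[OF M(1), of 0]) (simp only: real_norm_def M(2))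
    show "summable (\<lambda>n. dpicard n E x)"
      by (rule summable_comparison_test'[OF M(1), of 0]) (simp only: real_norm_def M(3))
  qed
  have der: "((\<lambda>x. suminf (\<lambda>n. f n x)) has_real_derivative suminf (\<lambda>n. f' n x)) (at x)"
    if f: "\<And>n x. (f n has_real_derivative f' n x) (at x)" and s: "\<And>x. summable (\<lambda>n. f n x)"
      and M: "summable M" "\<And>n x'. \<bar>x'\<bar> \<le> \<bar>x\<bar> + 1 \<Longrightarrow> \<bar>f' n x'\<bar> \<le> M n" for f f' x and M :: "nat \<Rightarrow> real"
  proof -
    let ?S = "{-(\<bar>x\<bar> + 1)<..<\<bar>x\<bar> + 1}"
    have x: "x \<in> ?S" by auto
    have "\<exists>g. \<forall>x\<in>?S. (\<lambda>n. f n x) sums g x \<and> (g has_real_derivative suminf (\<lambda>n. f' n x)) (at x within ?S)"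
    proof (rule has_field_derivative_series[OF _ _ _ x s])
      show "uniform_limit ?S (\<lambda>n x. \<Sum>i<n. f' i x) (\<lambda>x. suminf (\<lambda>n. f' n x)) sequentially"
        by (rule Weierstrass_m_test[OF _ M(1)]) (auto intro!: M(2))
    qed (auto intro: has_field_derivative_at_within f)
    then obtain g where g: "\<And>y. y \<in> ?S \<Longrightarrow> (\<lambda>n. f n y) sums g y"
      "\<And>y. y \<in> ?S \<Longrightarrow> (g has_real_derivative suminf (\<lambda>n. f' n y)) (at y within ?S)" by blast
    have "(g has_real_derivative suminf (\<lambda>n. f' n x)) (at x)"
      using g(2)[OF x] at_within_open[OF x] by simp
    then show ?thesis
      by (rule has_field_derivative_transform_within_open[OF _ _ x])
        (use g(1) in \<open>auto simp: sums_iff\<close>)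
  qed
  have Kd: "suminf (\<lambda>n. ?k n E x) = K E x * u E x" for E x
  proof -
    have "(\<lambda>n. K E x * picard n E x) sums (K E x * u E x)"
      unfolding u_def by (intro sums_mult summable_sums sums)
    then have "(\<lambda>n. ?k (Suc n) E x) sums (K E x * u E x)" by simp
    then have "(\<lambda>n. ?k n E x) sums (K E x * u E x)"
      by (subst (asm) sums_Suc_iff) simp
    then show ?thesis by (simp add: sums_iff)
  qed
  show thesis
  proof (rule that)
    fix E t :: real
    have "0 \<le> \<bar>t\<bar> + 1" by simp
    from picard_uniform[OF this, of "\<bar>E\<bar>"]
    obtain M where M1: "summable M" and M2: "\<forall>n E' x'. \<bar>E'\<bar> \<le> \<bar>E\<bar> \<longrightarrow> \<bar>x'\<bar> \<le> \<bar>t\<bar> + 1 \<longrightarrow>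
        \<bar>picard n E' x'\<bar> \<le> M n \<and> \<bar>dpicard n E' x'\<bar> \<le> M n \<and> \<bar>?k n E' x'\<bar> \<le> M n"
      by (elim exE conjE)
    note M = M1 M2[rule_format, OF order_refl, THEN conjunct2, THEN conjunct1]
      M2[rule_format, OF order_refl, THEN conjunct2, THEN conjunct2]
    show "(u E has_real_derivative u' E t) (at t)"
      unfolding u_def[abs_def] u'_def
      by (rule der[OF picard_deriv sums(1) M(1)]) (erule M(2))
    have "(u' E has_real_derivative suminf (\<lambda>n. ?k n E t)) (at t)"
      unfolding u'_def[abs_def]
      by (rule der[OF dpicard_deriv sums(2) M(1)]) (erule M(3))
    then show "(u' E has_real_derivative K E t * u E t) (at t)" using Kd by simp
    have "picard n E 0 = 0" if "n \<notin> {0}" for n using that by (cases n) auto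
    then have "(\<lambda>n. picard n E 0) sums (\<Sum>n\<in>{0}. picard n E 0)" by (rule sums_finite[rotated]) auto
    then show "u E 0 = a E" unfolding u_def by (simp add: sums_iff)
    have "dpicard n E 0 = 0" if "n \<notin> {0}" for n using that by (cases n) auto
    then have "(\<lambda>n. dpicard n E 0) sums (\<Sum>n\<in>{0}. dpicard n E 0)" by (rule sums_finite[rotated]) auto
    then show "u' E 0 = b E" unfolding u'_def by (simp add: sums_iff)
  next
    show "continuous_on UNIV (\<lambda>(E, t). u E t)" unfolding u_def
      proof (rule cont_suminf[OF cont_picard])
      fix B X :: real assume "0 \<le> X"
      from picard_uniform[OF this, of B]
      show "\<exists>M. summable M \<and> (\<forall>n E x. \<bar>E\<bar> \<le> B \<longrightarrow> \<bar>x\<bar> \<le> X \<longrightarrow> \<bar>picard n E x\<bar> \<le> M n)"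
        by (elim ex_forward) simp
    qed
    show "continuous_on UNIV (\<lambda>(E, t). u' E t)" unfolding u'_def
      proof (rule cont_suminf[OF cont_dpicard])
      fix B X :: real assume "0 \<le> X"
      from picard_uniform[OF this, of B]
      show "\<exists>M. summable M \<and> (\<forall>n E x. \<bar>E\<bar> \<le> B \<longrightarrow> \<bar>x\<bar> \<le> X \<longrightarrow> \<bar>dpicard n E x\<bar> \<le> M n)"
        by (elim ex_forward) simp
    qed
  qed
qed

end

section \<open>Solutions on the whole line: uniqueness, Wronskians, decay\<close>

definition solves :: "(real \<Rightarrow> real) \<Rightarrow> (real \<Rightarrow> real) \<Rightarrow> (real \<Rightarrow> real) \<Rightarrow> bool" where
  "solves k u u' \<longleftrightarrow> (\<forall>x. (u has_real_derivative u' x) (at x) \<and>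
     (u' has_real_derivative k x * u x) (at x))"

lemma solvesD:
  assumes "solves k u u'"
  shows "(u has_real_derivative u' x) (at x within A)" "(u' has_real_derivative k x * u x) (at x within A)"
    "continuous_on A u" "continuous_on A u'"
proof -
  show *: "(u has_real_derivative u' x) (at x within A)" "(u' has_real_derivative k x * u x) (at x within A)" for x A
    using assms unfolding solves_def by (auto intro: has_field_derivative_at_within)
  show "continuous_on A u" "continuous_on A u'"
    by (rule DERIV_continuous_on[OF *(1)], rule DERIV_continuous_on[OF *(2)])
qed

lemma solves_reflect:
  assumes "solves k u u'"
  shows "solves (\<lambda>x. k (c - x)) (\<lambda>x. u (c - x)) (\<lambda>x. - u' (c - x))"
  unfolding solves_def
proof (intro allI conjI)
  fix x
  have d: "((\<lambda>x. c - x) has_real_derivative -1) (at x)" by (auto intro!: derivative_eq_intros)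
  show "((\<lambda>x. u (c - x)) has_real_derivative - u' (c - x)) (at x)"
    using DERIV_chain'[OF d solvesD(1)[OF assms, of _ UNIV]] by simp
  show "((\<lambda>x. - u' (c - x)) has_real_derivative k (c - x) * u (c - x)) (at x)"
    using DERIV_minus[OF DERIV_chain'[OF d solvesD(2)[OF assms, of _ UNIV]]] by simp
qed

lemma solves_shift:
  assumes "solves k u u'"
  shows "solves (\<lambda>x. k (x + c)) (\<lambda>x. u (x + c)) (\<lambda>x. u' (x + c))"
  unfolding solves_def
proof (intro allI conjI)
  fix x
  have d: "((\<lambda>x. x + c) has_real_derivative 1) (at x)" by (auto intro!: derivative_eq_intros)
  show "((\<lambda>x. u (x + c)) has_real_derivative u' (x + c)) (at x)"
    using DERIV_chain'[OF d solvesD(1)[OF assms, of _ UNIV]] by simp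
  show "((\<lambda>x. u' (x + c)) has_real_derivative k (x + c) * u (x + c)) (at x)"
    using DERIV_chain'[OF d solvesD(2)[OF assms, of _ UNIV]] by simp
qed

lemma solves_combination:
  assumes "solves k u u'" "solves k v v'"
  shows "solves k (\<lambda>x. a * u x + b * v x) (\<lambda>x. a * u' x + b * v' x)"
  unfolding solves_def
  by (auto intro!: derivative_eq_intros solvesD(1,2)[OF assms(1), where A=UNIV, simplified]
      solvesD(1,2)[OF assms(2), where A=UNIV, simplified] simp: algebra_simps)

text \<open>Gronwall for u^2 + u'^2, whose derivative 2uu'(1 + k) is at most (1 + C) times itself on
  a compact interval. Points to the left of \<open>x0\<close> are reached by reflecting the
  equation.\<close>

lemma solves_zero:
  assumes k: "continuous_on UNIV k" and s: "solves k u u'" and z: "u x0 = 0" "u' x0 = 0"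
  shows "u x = 0 \<and> u' x = 0"
proof -
  have right: "u x = 0 \<and> u' x = 0" if k: "continuous_on UNIV k" and s: "solves k u u'"
    and z: "u x0 = 0" "u' x0 = 0" and le: "x0 \<le> x" for k u u' x0 x
  proof -
    have "bounded (k ` {x0..x})"
      by (intro compact_imp_bounded compact_continuous_image continuous_on_subset[OF k]) auto
    then obtain C where "\<forall>t\<in>{x0..x}. \<bar>k t\<bar> \<le> C" unfolding bounded_iff by auto
    then have C: "\<And>t. x0 \<le> t \<Longrightarrow> t \<le> x \<Longrightarrow> \<bar>k t\<bar> \<le> C" by simp
    define g where "g t = (u t)\<^sup>2 + (u' t)\<^sup>2" for t
    have d: "((\<lambda>t. g t * exp (- (1 + C) * t)) has_real_derivative
       (2 * u t * u' t * (1 + k t) - (1 + C) * g t) * exp (- (1 + C) * t)) (at t)" for t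
      unfolding g_def
      by (rule derivative_eq_intros solvesD(1)[OF s] solvesD(2)[OF s] refl)+
        (simp add: algebra_simps power2_eq_square)
    have "g x * exp (- (1 + C) * x) \<le> g x0 * exp (- (1 + C) * x0)"
    proof (rule DERIV_nonpos_imp_nonincreasing[OF le])
      fix t assume t: "x0 \<le> t" "t \<le> x"
      have "2 * u t * u' t * (1 + k t) \<le> \<bar>2 * u t * u' t\<bar> * \<bar>1 + k t\<bar>"
        by (metis abs_ge_self abs_mult)
      also have "\<dots> \<le> g t * (1 + C)"
      proof (intro mult_mono)
        show "\<bar>2 * u t * u' t\<bar> \<le> g t" unfolding g_def
          using sum_squares_bound[of "\<bar>u t\<bar>" "\<bar>u' t\<bar>"] by (simp add: abs_mult)
      qed (use C[OF t] in \<open>auto simp: g_def\<close>)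
      finally have "2 * u t * u' t * (1 + k t) - (1 + C) * g t \<le> 0" by (simp add: mult.commute)
      then show "\<exists>y. ((\<lambda>t. g t * exp (- (1 + C) * t)) has_real_derivative y) (at t) \<and> y \<le> 0"
        using d[of t] by (auto intro!: exI mult_nonpos_nonneg)
    qed
    then have "g x * exp (- (1 + C) * x) \<le> 0" using z by (simp add: g_def)
    then have "g x \<le> 0" by (simp add: mult_le_0_iff)
    then show ?thesis unfolding g_def
      by (metis add_nonneg_eq_0_iff antisym power2_eq_iff zero_le_power2 add_nonneg_nonneg zero_eq_power2)
  qed
  show ?thesis
  proof (cases "x0 \<le> x")
    case True then show ?thesis using right[OF k s z] by blast
  next
    case False
    have "u (0 - (- x)) = 0 \<and> - u' (0 - (- x)) = 0"
      by (rule right[OF _ solves_reflect[OF s], of _ "- x0"])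
        (use z False in \<open>auto intro!: continuous_intros continuous_on_compose2[OF k]\<close>)
    then show ?thesis by simp
  qed
qed

lemma solves_unique:
  assumes "continuous_on UNIV k" "solves k u u'" "solves k v v'" "u x0 = v x0" "u' x0 = v' x0"
  shows "u x = v x" "u' x = v' x"
  using solves_zero[OF assms(1) solves_combination[OF assms(2,3), of 1 "-1"], of x0 x] assms(4,5) by auto

lemma wronskian_deriv:
  assumes "solves k u u'" "solves l v v'"
  shows "((\<lambda>x. u x * v' x - u' x * v x) has_real_derivative (l x - k x) * (u x * v x)) (at x within A)"
  by (rule derivative_eq_intros solvesD(1,2)[OF assms(1)] solvesD(1,2)[OF assms(2)] refl)+
    (simp add: algebra_simps)

lemma wronskian_const:
  assumes "solves k u u'" "solves k v v'"
  shows "u x * v' x - u' x * v x = u y * v' y - u' y * v y"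
  by (rule DERIV_isconst_all) (use wronskian_deriv[OF assms, where A=UNIV] in simp)

lemma solves_proportional:
  assumes k: "continuous_on UNIV k" and u: "solves k u u'" and v: "solves k v v'"
    and W: "u x0 * v' x0 = u' x0 * v x0" and nz: "u x0 \<noteq> 0 \<or> u' x0 \<noteq> 0"
  shows "\<exists>c. \<forall>x. v x = c * u x \<and> v' x = c * u' x"
proof -
  define d where "d = (u x0)\<^sup>2 + (u' x0)\<^sup>2"
  \<comment> \<open>Orthogonal projection of the data of \<open>v\<close> at \<open>x0\<close> onto
    those of \<open>u\<close>; it avoids distinguishing whether \<open>u x0\<close> or
    \<open>u' x0\<close> is the nonzero one.\<close>
  define c where "c = (u x0 * v x0 + u' x0 * v' x0) / d"
  have d: "d \<noteq> 0" using nz by (auto simp: d_def sum_power2_eq_zero_iff)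
  have cd: "c * d = u x0 * v x0 + u' x0 * v' x0" using d by (simp add: c_def)
  have "d * v x0 = c * d * u x0" unfolding cd unfolding d_def using W by algebra
  then have 1: "v x0 = c * u x0" using d by simp
  have "d * v' x0 = c * d * u' x0" unfolding cd unfolding d_def using W by algebra
  then have 2: "v' x0 = c * u' x0" using d by simp
  show ?thesis
    using solves_unique[OF k v solves_combination[OF u u, of c 0], of x0] 1 2 by auto
qed

text \<open>Factor y'' - m^2 y through w = y' + m y: then w' - m w is nonnegative, so a positive
  value of w would grow like exp(m x), which a nonincreasing nonnegative y cannot support. Hence w
  is nonpositive, that is, y exp(m x) does not increase.\<close>

lemma exponential_decay:
  fixes y y' y'' :: "real \<Rightarrow> real"
  assumes y: "\<And>x. X \<le> x \<Longrightarrow> (y has_real_derivative y' x) (at x)"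
    and y': "\<And>x. X \<le> x \<Longrightarrow> (y' has_real_derivative y'' x) (at x)"
    and pos: "\<And>x. X \<le> x \<Longrightarrow> 0 \<le> y x" and dec: "\<And>x. X \<le> x \<Longrightarrow> y' x \<le> 0"
    and conv: "\<And>x. X \<le> x \<Longrightarrow> m\<^sup>2 * y x \<le> y'' x" and m: "0 < m"
    and le: "X \<le> a" "a \<le> x"
  shows "y x \<le> y a * exp (- m * (x - a))"
proof -
  define w where "w x = y' x + m * y x" for x
  have w0: "w x1 \<le> 0" if x1: "X \<le> x1" for x1
  proof (rule ccontr)
    assume "\<not> w x1 \<le> 0"
    then have w1: "0 < w x1" by simp
    \<comment> \<open>At this point the linear lower bound for the exponential growth of
      \<open>w\<close> equals w(x1) + m y(x1), which exceeds the upper bound m y(x1) for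
      w(x2).\<close>
    define x2 where "x2 = x1 + y x1 / w x1"
    have x12: "x1 \<le> x2" using w1 pos[OF x1] by (simp add: x2_def)
    have dw: "((\<lambda>t. w t * exp (- m * t)) has_real_derivative
      (y'' t - m\<^sup>2 * y t) * exp (- m * t)) (at t)" if "x1 \<le> t" for t
      unfolding w_def using x1 that
      by (auto intro!: derivative_eq_intros y y' simp: algebra_simps power2_eq_square)
    have "w x1 * exp (- m * x1) \<le> w x2 * exp (- m * x2)"
    proof (rule DERIV_nonneg_imp_nondecreasing[OF x12])
      fix t assume "x1 \<le> t" "t \<le> x2"
      then show "\<exists>z. ((\<lambda>t. w t * exp (- m * t)) has_real_derivative z) (at t) \<and> 0 \<le> z"
        using dw[of t] conv[of t] x1 by (intro exI[of _ "(y'' t - m\<^sup>2 * y t) * exp (- m * t)"]) auto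
    qed
    then have "w x1 * exp (- m * x1) * exp (m * x2) \<le> w x2 * exp (- m * x2) * exp (m * x2)"
      by (rule mult_right_mono) simp
    then have "w x1 * exp (m * (x2 - x1)) \<le> w x2"
      by (simp add: mult.assoc exp_add[symmetric] algebra_simps)
    moreover have "w x1 * (1 + m * (x2 - x1)) \<le> w x1 * exp (m * (x2 - x1))"
      using w1 by (intro mult_left_mono exp_ge_add_one_self) auto
    moreover have "w x1 * (1 + m * (x2 - x1)) = w x1 + m * y x1"
      using w1 by (simp add: x2_def field_simps)
    moreover have "w x2 \<le> m * y x2" using dec[of x2] x1 x12 by (simp add: w_def)
    moreover have "y x2 \<le> y x1"
      by (rule DERIV_nonpos_imp_nonincreasing[OF x12]) (meson dec order_trans x1 y)
    ultimately show False using w1 m mult_left_mono[of "y x2" "y x1" m] by linarith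
  qed
  have "y x * exp (m * x) \<le> y a * exp (m * a)"
  proof (rule DERIV_nonpos_imp_nonincreasing[OF le(2)])
    fix t assume t: "a \<le> t" "t \<le> x"
    then have "((\<lambda>t. y t * exp (m * t)) has_real_derivative w t * exp (m * t)) (at t)"
      unfolding w_def using le by (auto intro!: derivative_eq_intros y simp: algebra_simps)
    then show "\<exists>z. ((\<lambda>t. y t * exp (m * t)) has_real_derivative z) (at t) \<and> z \<le> 0"
      using w0[of t] t le by (auto intro!: exI mult_nonpos_nonneg)
  qed
  then have "y x * exp (m * x) * exp (- m * x) \<le> y a * exp (m * a) * exp (- m * x)"
    by (rule mult_right_mono) simp
  then show ?thesis by (simp add: mult.assoc exp_add[symmetric] algebra_simps)
qed

text \<open>Square integrability expressed by integrals over compact intervals, so that the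
  arguments on solutions stay with integrals of continuous functions;
  \<open>l2_bounded_integrable\<close> converts it to Lebesgue integrability on the line.\<close>

definition l2_bounded :: "(real \<Rightarrow> real) \<Rightarrow> bool" where
  "l2_bounded u \<longleftrightarrow> (\<exists>B. \<forall>a b. integral {a..b} (\<lambda>x. (u x)\<^sup>2) \<le> B)"

text \<open>The derivative of u u' is u'^2 + k u^2, nonnegative where k is. Once positive, u u'
  stays positive, u^2 stays bounded away from 0 and its integral diverges.\<close>

lemma l2_solution_decreasing:
  assumes s: "solves k u u'" and l2: "l2_bounded u" and k: "\<And>x. X \<le> x \<Longrightarrow> 0 \<le> k x" and x1: "X \<le> x1"
  shows "u x1 * u' x1 \<le> 0"
proof (rule ccontr)
  assume "\<not> ?thesis"
  then have d: "0 < u x1 * u' x1" by simp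
  have dd: "((\<lambda>x. u x * u' x) has_real_derivative (u' x)\<^sup>2 + k x * (u x)\<^sup>2) (at x)" for x
    by (rule derivative_eq_intros solvesD(1,2)[OF s] refl)+ (simp add: power2_eq_square)
  have p: "0 \<le> u x * u' x" if "x1 \<le> x" for x
  proof -
    have "u x1 * u' x1 \<le> u x * u' x"
    proof (rule DERIV_nonneg_imp_nondecreasing[OF that])
      fix t assume "x1 \<le> t" "t \<le> x"
      then show "\<exists>z. ((\<lambda>x. u x * u' x) has_real_derivative z) (at t) \<and> 0 \<le> z"
        using dd[of t] k[of t] x1 by (auto intro!: exI)
    qed
    then show ?thesis using d by linarith
  qed
  have ge: "(u x1)\<^sup>2 \<le> (u x)\<^sup>2" if "x1 \<le> x" for x
  proof (rule DERIV_nonneg_imp_nondecreasing[OF that])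
    fix t assume t: "x1 \<le> t" "t \<le> x"
    have "((\<lambda>x. (u x)\<^sup>2) has_real_derivative 2 * (u t * u' t)) (at t)"
      by (auto intro!: derivative_eq_intros solvesD(1)[OF s])
    then show "\<exists>z. ((\<lambda>x. (u x)\<^sup>2) has_real_derivative z) (at t) \<and> 0 \<le> z"
      using p[of t] t by (auto intro!: exI)
  qed
  obtain B where B: "\<And>a b. integral {a..b} (\<lambda>x. (u x)\<^sup>2) \<le> B" using l2 by (auto simp: l2_bounded_def)
  \<comment> \<open>A length over which the constant lower bound \<open>(u x1)\<^sup>2\<close>
    integrates to more than \<open>B\<close>.\<close>
  define n where "n = (\<bar>B\<bar> + 1) / (u x1)\<^sup>2"
  have u0: "0 < (u x1)\<^sup>2" using d by auto
  have n0: "0 \<le> n" unfolding n_def by simp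
  have "integral {x1..x1 + n} (\<lambda>x. (u x1)\<^sup>2) \<le> integral {x1..x1 + n} (\<lambda>x. (u x)\<^sup>2)"
    by (intro integral_le integrable_continuous_real continuous_intros solvesD(3)[OF s] ge) auto
  then have "n * (u x1)\<^sup>2 \<le> B" using B[of x1 "x1 + n"] n0 by simp
  then show False using u0 by (simp add: n_def)
qed

text \<open>\<open>exponential_decay\<close> is applied to u^2 instead of u, which removes the
  question of the sign of u: the second derivative 2u'^2 + 2k u^2 is at least 2k u^2, whence the
  hypothesis on 2k. The derivative is only shown not to grow, which is enough for
  Wronskians.\<close>

lemma l2_solution_decay:
  assumes s: "solves k u u'" and l2: "l2_bounded u" and k: "\<And>x. X \<le> x \<Longrightarrow> m\<^sup>2 \<le> 2 * k x" and m: "0 < m"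
    and le: "X \<le> a" "a \<le> x"
  shows "(u x)\<^sup>2 \<le> (u a)\<^sup>2 * exp (- m * (x - a))" "(u' x)\<^sup>2 \<le> (u' a)\<^sup>2"
proof -
  have k0: "0 \<le> k x" if "X \<le> x" for x using k[OF that] zero_le_power2[of m] by linarith
  note dec = l2_solution_decreasing[OF s l2 k0]
  show "(u x)\<^sup>2 \<le> (u a)\<^sup>2 * exp (- m * (x - a))"
  proof (rule exponential_decay[OF _ _ _ _ _ m le])
    fix x assume x: "X \<le> x"
    show "((\<lambda>x. (u x)\<^sup>2) has_real_derivative 2 * (u x * u' x)) (at x)"
      by (auto intro!: derivative_eq_intros solvesD(1)[OF s])
    show "((\<lambda>x. 2 * (u x * u' x)) has_real_derivative 2 * ((u' x)\<^sup>2 + k x * (u x)\<^sup>2)) (at x)"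
      by (rule derivative_eq_intros solvesD(1,2)[OF s] refl)+ (simp add: power2_eq_square)
    show "2 * (u x * u' x) \<le> 0" using dec[OF _ x] by simp
    show "m\<^sup>2 * (u x)\<^sup>2 \<le> 2 * ((u' x)\<^sup>2 + k x * (u x)\<^sup>2)"
    proof -
      have "m\<^sup>2 * (u x)\<^sup>2 \<le> 2 * (k x * (u x)\<^sup>2)"
        using mult_right_mono[OF k[OF x], of "(u x)\<^sup>2"] by (simp add: algebra_simps)
      also have "\<dots> \<le> 2 * ((u' x)\<^sup>2 + k x * (u x)\<^sup>2)" by simp
      finally show ?thesis .
    qed
  qed simp
  show "(u' x)\<^sup>2 \<le> (u' a)\<^sup>2"
  proof (rule DERIV_nonpos_imp_nonincreasing[OF le(2)])
    fix t assume t: "a \<le> t" "t \<le> x"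
    have "((\<lambda>x. (u' x)\<^sup>2) has_real_derivative 2 * (k t * (u t * u' t))) (at t)"
      by (auto intro!: derivative_eq_intros solvesD(2)[OF s])
    moreover have "k t * (u t * u' t) \<le> 0"
      using k0[of t] dec[of t t] t le by (intro mult_nonneg_nonpos[of "k t"]) auto
    ultimately show "\<exists>z. ((\<lambda>x. (u' x)\<^sup>2) has_real_derivative z) (at t) \<and> z \<le> 0" by (auto intro!: exI)
  qed
qed

section \<open>Recessive solutions on a half-line, continuous in the energy\<close>

lemma linear_ode_solves:
  fixes K :: "real \<Rightarrow> real \<Rightarrow> real" and a b :: "real \<Rightarrow> real"
  assumes "continuous_on UNIV (\<lambda>(E, t). K E t)" "continuous_on UNIV a" "continuous_on UNIV b"
  shows "\<exists>u u'. (\<forall>E. solves (K E) (u E) (u' E)) \<and> (\<forall>E. u E 0 = a E) \<and> (\<forall>E. u' E 0 = b E) \<and>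
    continuous_on UNIV (\<lambda>(E, t). u E t) \<and> continuous_on UNIV (\<lambda>(E, t). u' E t)"
proof -
  obtain u u' where "\<And>E t. (u E has_real_derivative u' E t) (at t)"
    "\<And>E t. (u' E has_real_derivative K E t * u E t) (at t)"
    "\<And>E. u E 0 = a E" "\<And>E. u' E 0 = b E"
    "continuous_on UNIV (\<lambda>(E, t). u E t)" "continuous_on UNIV (\<lambda>(E, t). u' E t)"
    by (rule linear_ode_exists[OF assms]) (rule that)
  then show ?thesis unfolding solves_def by (intro exI[of _ u] exI[of _ u'] conjI allI)
qed

text \<open>Reduction of order: if c and s have data (1,0) and (0,1), the recessive solution is I c
  - s = c (I - s/c), where I is the integral of 1/c^2 over the half-line and s/c is its partial
  integral. The slope at 0 is normalised to -1, so \<open>I E\<close> alone encodes the boundary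
  condition at infinity, and its continuity in the energy is what shooting requires.\<close>

lemma decaying_data:
  fixes K :: "real \<Rightarrow> real \<Rightarrow> real"
  assumes K: "continuous_on UNIV (\<lambda>(E, t). K E t)" and pos: "\<And>E t. 0 \<le> t \<Longrightarrow> \<kappa> \<le> K E t" and \<kappa>: "0 < \<kappa>"
  obtains I where "continuous_on UNIV I" "\<And>E. 0 < I E"
    "\<And>E y y' t. solves (K E) y y' \<Longrightarrow> y 0 = I E \<Longrightarrow> y' 0 = -1 \<Longrightarrow> 0 \<le> t \<Longrightarrow> 0 \<le> y t \<and> y' t \<le> 0"
proof -
  obtain c c' where c: "\<And>E. solves (K E) (c E) (c' E)" and c0: "\<And>E. c E 0 = 1" "\<And>E. c' E 0 = 0"
    and cc: "continuous_on UNIV (\<lambda>(E, t). c E t)"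
    using linear_ode_solves[OF K continuous_on_const[of _ 1] continuous_on_const[of _ 0]]
    by (elim exE conjE) (rule that; (erule spec | assumption))
  obtain s s' where s: "\<And>E. solves (K E) (s E) (s' E)" and s0: "\<And>E. s E 0 = 0" "\<And>E. s' E 0 = 1"
    and cs: "continuous_on UNIV (\<lambda>(E, t). s E t)"
    using linear_ode_solves[OF K continuous_on_const[of _ 0] continuous_on_const[of _ 1]]
    by (elim exE conjE) (rule that; (erule spec | assumption))
  have W: "c E t * s' E t - c' E t * s E t = 1" for E t
    using wronskian_const[OF c s, of E t 0] by (simp add: c0 s0)
  have cc': "0 \<le> c E t * c' E t" if "0 \<le> t" for E t
  proof -
    have "c E 0 * c' E 0 \<le> c E t * c' E t"
    proof (rule DERIV_nonneg_imp_nondecreasing[OF that])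
      fix x assume x: "0 \<le> x" "x \<le> t"
      have "((\<lambda>t. c E t * c' E t) has_real_derivative (c' E x)\<^sup>2 + K E x * (c E x)\<^sup>2) (at x)"
        by (rule derivative_eq_intros solvesD(1,2)[OF c] refl)+ (simp add: power2_eq_square)
      moreover have "0 \<le> K E x" using pos[OF x(1), of E] \<kappa> by linarith
      ultimately show "\<exists>z. ((\<lambda>t. c E t * c' E t) has_real_derivative z) (at x) \<and> 0 \<le> z"
        by (intro exI[of _ "(c' E x)\<^sup>2 + K E x * (c E x)\<^sup>2"]) simp
    qed
    then show ?thesis by (simp add: c0)
  qed
  have csq: "1 \<le> (c E t)\<^sup>2" if "0 \<le> t" for E t
  proof -
    have "(c E 0)\<^sup>2 \<le> (c E t)\<^sup>2"
    proof (rule DERIV_nonneg_imp_nondecreasing[OF that])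
      fix x assume x: "0 \<le> x" "x \<le> t"
      have "((\<lambda>t. (c E t)\<^sup>2) has_real_derivative 2 * (c E x * c' E x)) (at x)"
        by (auto intro!: derivative_eq_intros solvesD(1)[OF c])
      then show "\<exists>z. ((\<lambda>t. (c E t)\<^sup>2) has_real_derivative z) (at x) \<and> 0 \<le> z"
        using cc'[OF x(1), of E] by (intro exI[of _ "2 * (c E x * c' E x)"]) simp
    qed
    then show ?thesis by (simp add: c0)
  qed
  have c1: "1 \<le> c E t" if t: "0 \<le> t" for E t
  proof (rule ccontr)
    assume "\<not> 1 \<le> c E t"
    then have "c E t \<le> 0"
      using csq[OF t, of E] by (smt (verit) one_power2 power2_le_imp_le power_mono_iff zero_less_numeral power_less_one_iff)
    then obtain x where "0 \<le> x" "x \<le> t" "c E x = 0"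
      using IVT2'[of "c E" t 0 0] t c0(1)[of E] solvesD(3)[OF c] by auto
    then show False using csq[of x E] by simp
  qed
  have c'0: "0 \<le> c' E t" if t: "0 \<le> t" for E t
    using cc'[OF t, of E] c1[OF t, of E] by (simp add: zero_le_mult_iff)
  have c'mono: "c' E x \<le> c' E t" if "0 \<le> x" "x \<le> t" for E x t
  proof (rule DERIV_nonneg_imp_nondecreasing[OF that(2)])
    fix r assume r: "x \<le> r" "r \<le> t"
    then have "0 \<le> K E r * c E r" using pos[of r E] c1[of r E] \<kappa> that by (intro mult_nonneg_nonneg) auto
    then show "\<exists>z. (c' E has_real_derivative z) (at r) \<and> 0 \<le> z" using solvesD(2)[OF c] by blast
  qed
  have c'lin: "\<kappa> * t \<le> c' E t" if "0 \<le> t" for E t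
  proof -
    have "c' E 0 - \<kappa> * 0 \<le> c' E t - \<kappa> * t"
    proof (rule DERIV_nonneg_imp_nondecreasing[OF that])
      fix r assume r: "0 \<le> r" "r \<le> t"
      have "\<kappa> * 1 \<le> K E r * c E r" using pos[of r E] c1[of r E] \<kappa> r by (intro mult_mono) auto
      moreover have "((\<lambda>t. c' E t - \<kappa> * t) has_real_derivative K E r * c E r - \<kappa>) (at r)"
        by (auto intro!: derivative_eq_intros solvesD(2)[OF c])
      ultimately show "\<exists>z. ((\<lambda>t. c' E t - \<kappa> * t) has_real_derivative z) (at r) \<and> 0 \<le> z"
        by (intro exI[of _ "K E r * c E r - \<kappa>"]) simp
    qed
    then show ?thesis by (simp add: c0)
  qed
  \<comment> \<open>Convexity gives c \<ge> 1 + \<kappa> t^2/2, and (1 + q)^2 \<ge> 4q turns this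
    into a minorant of c^2 independent of the energy. The tails of the integral of 1/c^2 are
    therefore small uniformly in \<open>E\<close>, which makes \<open>I\<close> continuous.\<close>
  have cquad: "2 * \<kappa> * t\<^sup>2 \<le> (c E t)\<^sup>2" if t: "0 \<le> t" for E t
  proof -
    have "c E 0 - \<kappa> * 0\<^sup>2 / 2 \<le> c E t - \<kappa> * t\<^sup>2 / 2"
    proof (rule DERIV_nonneg_imp_nondecreasing[OF t])
      fix r assume r: "0 \<le> r" "r \<le> t"
      have "((\<lambda>t. c E t - \<kappa> * t\<^sup>2 / 2) has_real_derivative c' E r - \<kappa> * r) (at r)"
        by (auto intro!: derivative_eq_intros solvesD(1)[OF c])
      then show "\<exists>z. ((\<lambda>t. c E t - \<kappa> * t\<^sup>2 / 2) has_real_derivative z) (at r) \<and> 0 \<le> z"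
        using c'lin[of r E] r by (intro exI[of _ "c' E r - \<kappa> * r"]) simp
    qed
    then have "1 + \<kappa> * t\<^sup>2 / 2 \<le> c E t" by (simp add: c0)
    then have "(1 + \<kappa> * t\<^sup>2 / 2)\<^sup>2 \<le> (c E t)\<^sup>2" using \<kappa> by (intro power_mono) auto
    moreover have "2 * \<kappa> * t\<^sup>2 \<le> (1 + \<kappa> * t\<^sup>2 / 2)\<^sup>2"
      using zero_le_power2[of "1 - \<kappa> * t\<^sup>2 / 2"] by (simp add: power2_eq_square algebra_simps)
    ultimately show ?thesis by linarith
  qed
  define r where "r E t = s E t / c E t" for E t
  have r: "(r E has_real_derivative 1 / (c E t)\<^sup>2) (at t)" if "0 \<le> t" for E t
  proof -
    have "(r E has_real_derivative (s' E t * c E t - s E t * c' E t) / (c E t * c E t)) (at t)"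
      unfolding r_def using c1[OF that, of E] by (intro DERIV_divide solvesD(1)[OF c] solvesD(1)[OF s]) auto
    moreover have "s' E t * c E t - s E t * c' E t = 1" using W[of E t] by (simp add: mult.commute)
    ultimately show ?thesis by (simp add: power2_eq_square)
  qed
  have rmono: "r E x \<le> r E t" if "0 \<le> x" "x \<le> t" for E x t
    by (rule DERIV_nonneg_imp_nondecreasing[OF that(2)]) (use r that in \<open>meson order_trans zero_le_divide_1_iff zero_le_power2\<close>)
  have rdiff: "r E t - r E x \<le> 1 / (2 * \<kappa> * x)" if "0 < x" "x \<le> t" for E x t
  proof -
    have "r E t + 1 / (2 * \<kappa> * t) \<le> r E x + 1 / (2 * \<kappa> * x)"
    proof (rule DERIV_nonpos_imp_nonincreasing[OF that(2)])
      fix y assume y: "x \<le> y" "y \<le> t"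
      have "((\<lambda>t. r E t + 1 / (2 * \<kappa> * t)) has_real_derivative 1 / (c E y)\<^sup>2 - 1 / (2 * \<kappa> * y\<^sup>2)) (at y)"
      proof -
        have "((\<lambda>t. 1 / (2 * \<kappa> * t)) has_real_derivative - (1 / (2 * \<kappa> * y\<^sup>2))) (at y)"
          using that y \<kappa> by (auto intro!: derivative_eq_intros simp: power2_eq_square)
        from DERIV_add[OF r[of y E] this] show ?thesis using that y by simp
      qed
      moreover have "1 / (c E y)\<^sup>2 \<le> 1 / (2 * \<kappa> * y\<^sup>2)"
        by (rule frac_le) (use that y \<kappa> cquad[of y E] in auto)
      ultimately show "\<exists>z. ((\<lambda>t. r E t + 1 / (2 * \<kappa> * t)) has_real_derivative z) (at y) \<and> z \<le> 0"
        by (intro exI[of _ "1 / (c E y)\<^sup>2 - 1 / (2 * \<kappa> * y\<^sup>2)"]) simp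
    qed
    moreover have "0 \<le> 1 / (2 * \<kappa> * t)" using that \<kappa> by simp
    ultimately show ?thesis by linarith
  qed
  define I where "I E = (SUP n::nat. r E (real n))" for E
  have bdd: "bdd_above (range (\<lambda>n::nat. r E (real n)))" for E
  proof (rule bdd_aboveI2)
    fix n :: nat
    have "r E (real n) \<le> r E (real (n + 1))" by (rule rmono) auto
    moreover have "r E (real (n + 1)) - r E 1 \<le> 1 / (2 * \<kappa> * 1)" by (rule rdiff) auto
    ultimately show "r E (real n) \<le> r E 1 + 1 / (2 * \<kappa>)" by simp
  qed
  have rI: "r E t \<le> I E" if "0 \<le> t" for E t
  proof -
    have "r E t \<le> r E (real (nat \<lceil>t\<rceil>))" by (rule rmono) (use that in \<open>auto simp: real_nat_ceiling_ge\<close>)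
    also have "\<dots> \<le> I E" unfolding I_def by (rule cSUP_upper[OF _ bdd]) simp
    finally show ?thesis .
  qed
  have Ir: "I E \<le> r E t + 1 / (2 * \<kappa> * t)" if t: "0 < t" for E t
    unfolding I_def
  proof (rule cSUP_least)
    fix n :: nat
    have "r E (real n) \<le> r E (max t (real n))" by (rule rmono) auto
    also have "\<dots> \<le> r E t + 1 / (2 * \<kappa> * t)" using rdiff[OF t, of "max t (real n)" E] by simp
    finally show "r E (real n) \<le> r E t + 1 / (2 * \<kappa> * t)" .
  qed simp
  have lim: "((\<lambda>t. 1 / (2 * \<kappa> * t)) \<longlongrightarrow> 0) at_top"
    using \<kappa> by real_asymp
  have "uniform_limit UNIV (\<lambda>t E. r E t) I at_top"
  proof (rule uniform_limitI)
    fix e :: real assume e: "0 < e"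
    have "\<forall>\<^sub>F t in at_top. 1 / (2 * \<kappa> * t) < e" using order_tendstoD(2)[OF lim e] .
    then show "\<forall>\<^sub>F t in at_top. \<forall>E\<in>UNIV. dist (r E t) (I E) < e"
      using eventually_gt_at_top[of 0]
    proof eventually_elim
      case (elim t)
      show ?case
      proof
        fix E
        show "dist (r E t) (I E) < e" using rI[of t E] Ir[of t E] elim by (simp add: dist_real_def abs_less_iff)
      qed
    qed
  qed
  then have contI: "continuous_on UNIV I"
  proof (rule uniform_limit_theorem[rotated])
    have cont1: "continuous_on UNIV (\<lambda>E. g E t)" if "continuous_on UNIV (\<lambda>(E, t). g E t)"
      for g :: "real \<Rightarrow> real \<Rightarrow> real" and t
      by (rule continuous_on_compose2[OF that, of _ "\<lambda>E. (E, t)", simplified]) (intro continuous_intros)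
    show "\<forall>\<^sub>F t in at_top. continuous_on UNIV (\<lambda>E. r E t)"
      using eventually_gt_at_top[of "0::real"]
    proof eventually_elim
      case (elim t)
      show ?case unfolding r_def
      proof (intro continuous_on_divide cont1 cc cs ballI)
        fix E show "c E t \<noteq> 0" using c1[of t E] elim by simp
      qed
    qed
  qed simp
  have Ipos: "0 < I E" for E
  proof -
    have "r E 0 < r E 1"
    proof (rule DERIV_pos_imp_increasing[of 0 1])
      fix t :: real assume "0 \<le> t" "t \<le> 1"
      then show "\<exists>y. (r E has_real_derivative y) (at t) \<and> 0 < y"
        using r[of t E] c1[of t E] by (intro exI[of _ "1 / (c E t)\<^sup>2"]) auto
    qed simp
    then show ?thesis using rI[of 1 E] by (simp add: r_def s0)
  qed
  \<comment> \<open>As c' is nondecreasing, the integral of 1/c^2 beyond t is at most 1/c'(t) times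
    that of c'/c^2, that is 1/(c(t) c'(t)). This bound is what makes the slope of the recessive
    solution nonpositive.\<close>
  have key: "c' E t * (I E - r E t) \<le> 1 / c E t" if t: "0 \<le> t" for E t
  proof -
    have rr: "r E x \<le> r E t + (1 / c E t) / c' E t" if c'p: "0 < c' E t" and x: "t \<le> x" for x
    proof -
      have "r E x * c' E t + 1 / c E x \<le> r E t * c' E t + 1 / c E t"
      proof (rule DERIV_nonpos_imp_nonincreasing[OF x])
        fix y assume y: "t \<le> y" "y \<le> x"
        have cy: "c E y > 0" using c1[of y E] y t by simp
        have "((\<lambda>y. r E y * c' E t + 1 / c E y) has_real_derivative
            1 / (c E y)\<^sup>2 * c' E t - c' E y / (c E y)\<^sup>2) (at y)"
          using cy y t by (auto intro!: derivative_eq_intros r solvesD(1)[OF c] simp: power2_eq_square)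
        moreover have "1 / (c E y)\<^sup>2 * c' E t - c' E y / (c E y)\<^sup>2 \<le> 0"
          using c'mono[OF t y(1), of E] cy by (simp add: divide_right_mono)
        ultimately show "\<exists>z. ((\<lambda>y. r E y * c' E t + 1 / c E y) has_real_derivative z) (at y) \<and> z \<le> 0" by blast
      qed
      moreover have "0 \<le> 1 / c E x" using c1[of x E] x t by simp
      ultimately have "r E x * c' E t \<le> r E t * c' E t + 1 / c E t" by linarith
      also have "\<dots> = (r E t + (1 / c E t) / c' E t) * c' E t" using c'p by (simp add: distrib_right)
      finally show ?thesis using c'p by (rule mult_right_le_imp_le)
    qed
    show ?thesis
    proof (cases "c' E t = 0")
      case True then show ?thesis using c1[OF t, of E] by simp
    next
      case False
      then have c'p: "0 < c' E t" using c'0[OF t, of E] by simp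
      have "I E \<le> r E t + (1 / c E t) / c' E t"
        unfolding I_def
      proof (rule cSUP_least)
        fix n :: nat
        have "r E (real n) \<le> r E (max t (real n))" by (rule rmono) auto
        also have "\<dots> \<le> r E t + (1 / c E t) / c' E t" by (rule rr[OF c'p]) simp
        finally show "r E (real n) \<le> r E t + (1 / c E t) / c' E t" .
      qed simp
      then have "c' E t * (I E - r E t) \<le> c' E t * ((1 / c E t) / c' E t)"
        using c'p by (intro mult_left_mono) auto
      then show ?thesis using c'p by simp
    qed
  qed
  show thesis
  proof (rule that[OF contI Ipos])
    fix E t :: real and y y' assume y: "solves (K E) y y'" "y 0 = I E" "y' 0 = -1" and t: "0 \<le> t"
    have KE: "continuous_on UNIV (K E)" by (rule continuous_param_section[OF K])
    have yt: "y t = I E * c E t + -1 * s E t" "y' t = I E * c' E t + -1 * s' E t"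
      by (rule solves_unique[OF KE y(1) solves_combination[OF c s], of 0]; simp add: y c0 s0)+
    have ct: "0 < c E t" using c1[OF t, of E] by simp
    have 1: "y t = c E t * (I E - r E t)" using ct by (simp add: yt r_def field_simps)
    have "c E t * y' t = c' E t * y t - (c E t * s' E t - c' E t * s E t)"
      unfolding yt by (simp add: algebra_simps)
    also have "\<dots> = c E t * (c' E t * (I E - r E t)) - 1" unfolding W 1 by simp
    also have "\<dots> \<le> c E t * (1 / c E t) - 1"
      using mult_left_mono[OF key[OF t, of E], of "c E t"] ct by linarith
    also have "\<dots> = 0" using ct by simp
    finally have "y' t \<le> 0" using ct by (simp add: mult_le_0_iff)
    moreover have "0 \<le> y t" unfolding 1 using ct rI[OF t, of E] by simp
    ultimately show "0 \<le> y t \<and> y' t \<le> 0" by simp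
  qed
qed

section \<open>Negative directions of the energy form\<close>

text \<open>One pivot of Gaussian elimination per equation; the index set is arbitrary so that the
  pivot index can be removed from it. It supplies, in both counting arguments, a nontrivial
  combination of test functions that vanishes at prescribed points.\<close>

lemma linear_system_kernel:
  fixes L :: "nat \<Rightarrow> 'i \<Rightarrow> real"
  assumes "finite I" "m < card I"
  shows "\<exists>c. (\<exists>i\<in>I. c i \<noteq> 0) \<and> (\<forall>j<m. (\<Sum>i\<in>I. c i * L j i) = 0)"
  using assms
proof (induction m arbitrary: I L)
  case 0
  then obtain p where "p \<in> I" by fastforce
  then show ?case by (intro exI[of _ "\<lambda>_. 1"]) auto
next
  case (Suc m)
  show ?case
  proof (cases "\<exists>p\<in>I. L m p \<noteq> 0")
    case False
    obtain c where c: "\<exists>i\<in>I. c i \<noteq> 0" "\<forall>j<m. (\<Sum>i\<in>I. c i * L j i) = 0"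
      using Suc.IH[of I L] Suc.prems by auto
    then show ?thesis using False by (intro exI[of _ c]) (auto simp: less_Suc_eq)
  next
    case True
    then obtain p where p: "p \<in> I" "L m p \<noteq> 0" by blast
    define L' where "L' j i = L j i - L j p * L m i / L m p" for j i
    have "m < card (I - {p})" using Suc.prems p by simp
    from Suc.IH[OF _ this, of L'] obtain c where c: "\<exists>i\<in>I-{p}. c i \<noteq> 0"
      "\<forall>j<m. (\<Sum>i\<in>I-{p}. c i * L' j i) = 0" using Suc.prems by auto
    define S where "S = (\<Sum>i\<in>I-{p}. c i * L m i)"
    define d where "d i = (if i = p then - S / L m p else c i)" for i
    have sum: "(\<Sum>i\<in>I. d i * L j i) = (\<Sum>i\<in>I-{p}. c i * L j i) - S / L m p * L j p" for j
    proof -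
      have "(\<Sum>i\<in>I. d i * L j i) = d p * L j p + (\<Sum>i\<in>I-{p}. d i * L j i)"
        using Suc.prems p by (simp add: sum.remove)
      also have "(\<Sum>i\<in>I-{p}. d i * L j i) = (\<Sum>i\<in>I-{p}. c i * L j i)"
        by (rule sum.cong) (auto simp: d_def)
      finally show ?thesis by (simp add: d_def)
    qed
    have "(\<Sum>i\<in>I. d i * L j i) = 0" if "j < Suc m" for j
    proof (cases "j = m")
      case True then show ?thesis using sum[of m] p by (simp add: S_def)
    next
      case False
      then have "(\<Sum>i\<in>I-{p}. c i * L' j i) = 0" using that c by simp
      moreover have "(\<Sum>i\<in>I-{p}. c i * L' j i) = (\<Sum>i\<in>I-{p}. c i * L j i) - S / L m p * L j p"
      proof -
        have "(\<Sum>i\<in>I-{p}. c i * L' j i) = (\<Sum>i\<in>I-{p}. c i * L j i - (c i * L m i) * (L j p / L m p))"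
          by (rule sum.cong) (simp_all add: L'_def algebra_simps)
        also have "\<dots> = (\<Sum>i\<in>I-{p}. c i * L j i) - S * (L j p / L m p)"
          unfolding S_def by (simp only: sum_subtractf sum_distrib_right)
        finally show ?thesis by simp
      qed
      ultimately show ?thesis using sum by simp
    qed
    moreover have "\<exists>i\<in>I. d i \<noteq> 0" using c(1) by (auto simp: d_def)
    ultimately show ?thesis by blast
  qed
qed

definition test_function :: "real \<Rightarrow> (real \<Rightarrow> real) \<Rightarrow> (real \<Rightarrow> real) \<Rightarrow> bool" where
  "test_function R v v' \<longleftrightarrow> (\<forall>x. (v has_real_derivative v' x) (at x)) \<and> continuous_on UNIV v' \<and>
     (\<forall>x. R \<le> \<bar>x\<bar> \<longrightarrow> v x = 0)"

definition energy :: "(real \<Rightarrow> real) \<Rightarrow> real \<Rightarrow> real \<Rightarrow> (real \<Rightarrow> real) \<Rightarrow> (real \<Rightarrow> real) \<Rightarrow> real" where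
  "energy k a b v v' = integral {a..b} (\<lambda>x. (v' x)\<^sup>2 + k x * (v x)\<^sup>2)"

text \<open>By Glazman's principle, for \<open>k\<close> = 2(V - E)/h^2 the largest such
  \<open>n\<close> is the number of eigenvalues below E. Strict negativity for every nonzero
  coefficient vector already forces linear independence.\<close>

definition neg_family :: "(real \<Rightarrow> real) \<Rightarrow> nat \<Rightarrow> bool" where
  "neg_family k n \<longleftrightarrow> (\<exists>R v v'. 0 < R \<and> (\<forall>i<n. test_function R (v i) (v' i)) \<and>
     (\<forall>c::nat \<Rightarrow> real. (\<exists>i<n. c i \<noteq> 0) \<longrightarrow>
        energy k (-R) R (\<lambda>x. \<Sum>i<n. c i * v i x) (\<lambda>x. \<Sum>i<n. c i * v' i x) < 0))"

lemma test_functionD: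
  assumes "test_function R v v'"
  shows "(v has_real_derivative v' x) (at x within A)" "continuous_on A v" "continuous_on A v'"
    "R \<le> \<bar>x\<bar> \<Longrightarrow> v x = 0"
proof -
  have d: "(v has_real_derivative v' x) (at x within A)" for x A
    using assms unfolding test_function_def by (auto intro: has_field_derivative_at_within)
  show "(v has_real_derivative v' x) (at x within A)" by (rule d)
  show "continuous_on A v" by (rule DERIV_continuous_on[OF d])
  show "continuous_on A v'" "R \<le> \<bar>x\<bar> \<Longrightarrow> v x = 0"
    using assms unfolding test_function_def by (auto intro: continuous_on_subset)
qed

lemma test_function_mono: "test_function R v v' \<Longrightarrow> R \<le> R' \<Longrightarrow> test_function R' v v'"
  unfolding test_function_def by fastforce

lemma test_function_sum:
  assumes "\<And>i. i < n \<Longrightarrow> test_function R (v i) (v' i)"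
  shows "test_function R (\<lambda>x. \<Sum>i<n. c i * v i x) (\<lambda>x. \<Sum>i<n. c i * v' i x)"
  unfolding test_function_def
proof (intro conjI allI impI)
  show "((\<lambda>x. \<Sum>i<n. c i * v i x) has_real_derivative (\<Sum>i<n. c i * v' i x)) (at x)" for x
    by (intro DERIV_sum DERIV_cmult test_functionD(1)[OF assms]) simp
  show "continuous_on UNIV (\<lambda>x. \<Sum>i<n. c i * v' i x)"
    by (intro continuous_intros test_functionD(3)[OF assms]) simp
  show "(\<Sum>i<n. c i * v i x) = 0" if "R \<le> \<bar>x\<bar>" for x
    using test_functionD(4)[OF assms that] by simp
qed

lemma energy_integrable:
  assumes "continuous_on {a..b} k" "test_function R v v'"
  shows "(\<lambda>x. (v' x)\<^sup>2 + k x * (v x)\<^sup>2) integrable_on {a..b}"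
  by (intro integrable_continuous_real continuous_intros assms(1) test_functionD[OF assms(2)])

lemma energy_split:
  assumes "continuous_on UNIV k" "test_function R v v'" "a \<le> c" "c \<le> b"
  shows "energy k a b v v' = energy k a c v v' + energy k c b v v'"
  unfolding energy_def
  by (rule Henstock_Kurzweil_Integration.integral_combine[symmetric])
    (use assms energy_integrable continuous_on_subset in \<open>blast intro: subset_UNIV\<close>)+

lemma test_function_deriv_zero:
  assumes "test_function R v v'" "R < \<bar>x\<bar>"
  shows "v' x = 0"
proof -
  have o: "open {x. R < \<bar>x\<bar>}" by (intro open_Collect_less continuous_intros)
  have "(v has_real_derivative 0) (at x)"
    by (rule has_field_derivative_transform_within_open[OF DERIV_const o])
      (use assms(2) test_functionD(4)[OF assms(1)] in auto)
  then show ?thesis using DERIV_unique test_functionD(1)[OF assms(1)] by blast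
qed

lemma energy_outside:
  assumes "test_function R v v'" "b \<le> -R \<or> R \<le> a"
  shows "energy k a b v v' = 0"
proof -
  have "integral {a..b} (\<lambda>x. (v' x)\<^sup>2 + k x * (v x)\<^sup>2) = integral {a..b} (\<lambda>x. 0)"
  proof (rule integral_spike[of "{-R, R}"])
    fix x assume x: "x \<in> {a..b} - {-R, R}"
    have "R < \<bar>x\<bar>"
      using x assms(2) by (auto simp: abs_if)
    then show "0 = (v' x)\<^sup>2 + k x * (v x)\<^sup>2"
      using test_function_deriv_zero[OF assms(1), of x] test_functionD(4)[OF assms(1), of x] by simp
  qed simp
  then show ?thesis by (simp add: energy_def)
qed

lemma energy_extend:
  assumes k: "continuous_on UNIV k" and v: "test_function R v v'" and R: "0 \<le> R" "R \<le> R'"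
  shows "energy k (-R') R' v v' = energy k (-R) R v v'"
  using energy_split[OF k v, of "-R'" "-R" R'] energy_split[OF k v, of "-R" R R'] R
    energy_outside[OF v, of "-R" "-R'" k] energy_outside[OF v, of R' R k] by simp

lemma neg_family_radius:
  assumes k: "continuous_on UNIV k" and n: "neg_family k n"
  obtains R v v' where "r \<le> R" "0 < R" "\<And>i. i < n \<Longrightarrow> test_function R (v i) (v' i)"
    "\<And>c. \<exists>i<n. c i \<noteq> 0 \<Longrightarrow>
        energy k (-R) R (\<lambda>x. \<Sum>i<n. c i * v i x) (\<lambda>x. \<Sum>i<n. c i * v' i x) < 0"
proof -
  obtain R v v' where R: "0 < R" and v: "\<And>i. i < n \<Longrightarrow> test_function R (v i) (v' i)"
    and e: "\<And>c. \<exists>i<n. c i \<noteq> 0 \<Longrightarrow>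
        energy k (-R) R (\<lambda>x. \<Sum>i<n. c i * v i x) (\<lambda>x. \<Sum>i<n. c i * v' i x) < 0"
    using n unfolding neg_family_def by blast
  show thesis
  proof (rule that[of "max R r"])
    show "test_function (max R r) (v i) (v' i)" if "i < n" for i
      by (rule test_function_mono[OF v[OF that]]) simp
    show "energy k (-max R r) (max R r) (\<lambda>x. \<Sum>i<n. c i * v i x) (\<lambda>x. \<Sum>i<n. c i * v' i x) < 0"
      if "\<exists>i<n. c i \<noteq> 0" for c
      using e[OF that] energy_extend[OF k test_function_sum[of n R v v' c, OF v], of "max R r"] R by simp
  qed (use R in auto)
qed

lemma neg_family_mono:
  assumes k: "continuous_on UNIV k" "continuous_on UNIV l" and le: "\<And>x. l x \<le> k x" and n: "neg_family k n"
  shows "neg_family l n"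
proof -
  obtain R v v' where R: "0 < R" and v: "\<And>i. i < n \<Longrightarrow> test_function R (v i) (v' i)"
    and e: "\<And>c. \<exists>i<n. c i \<noteq> 0 \<Longrightarrow>
        energy k (-R) R (\<lambda>x. \<Sum>i<n. c i * v i x) (\<lambda>x. \<Sum>i<n. c i * v' i x) < 0"
    using n unfolding neg_family_def by blast
  have le: "energy l (-R) R (\<lambda>x. \<Sum>i<n. c i * v i x) (\<lambda>x. \<Sum>i<n. c i * v' i x)
    \<le> energy k (-R) R (\<lambda>x. \<Sum>i<n. c i * v i x) (\<lambda>x. \<Sum>i<n. c i * v' i x)" for c
    unfolding energy_def
    by (intro integral_le energy_integrable[OF _ test_function_sum[of n R v v' c, OF v]]
        continuous_on_subset[OF k(1)] continuous_on_subset[OF k(2)] add_left_mono mult_right_mono le) auto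
  have "energy l (-R) R (\<lambda>x. \<Sum>i<n. c i * v i x) (\<lambda>x. \<Sum>i<n. c i * v' i x) < 0"
    if "\<exists>i<n. c i \<noteq> 0" for c
    using le_less_trans[OF le e[OF that]] .
  then show ?thesis using R v unfolding neg_family_def by blast
qed

text \<open>Picone's identity: v'^2 + (w/u) v^2 is the derivative of (u'/u) v^2 plus the square of
  v' - (u'/u) v, and w \<le> k u allows k in place of w/u. A positive supersolution thus bounds the
  energy below by boundary terms alone. At a simple zero of u the test function has to vanish as
  well, and the default value of division by 0 makes that boundary term 0.\<close>

lemma jacobi_inequality:
  fixes u u' w :: "real \<Rightarrow> real"
  assumes ab: "a \<le> b" and k: "continuous_on {a..b} k"
    and u: "\<And>x. a \<le> x \<Longrightarrow> x \<le> b \<Longrightarrow> (u has_real_derivative u' x) (at x)"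
    and u': "\<And>x. a \<le> x \<Longrightarrow> x \<le> b \<Longrightarrow> (u' has_real_derivative w x) (at x)"
    and pos: "\<And>x. a < x \<Longrightarrow> x < b \<Longrightarrow> 0 < u x" and w: "\<And>x. a < x \<Longrightarrow> x < b \<Longrightarrow> w x \<le> k x * u x"
    and v: "test_function R v v'"
    and za: "u a = 0 \<Longrightarrow> v a = 0 \<and> u' a \<noteq> 0" and zb: "u b = 0 \<Longrightarrow> v b = 0 \<and> u' b \<noteq> 0"
  shows "u' b / u b * (v b)\<^sup>2 - u' a / u a * (v a)\<^sup>2 \<le> energy k a b v v'"
proof -
  define B where "B x = u' x / u x * (v x)\<^sup>2" for x
  define F where "F x = integral {a..x} (\<lambda>x. (v' x)\<^sup>2 + k x * (v x)\<^sup>2)" for x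
  have i: "continuous_on {a..b} (\<lambda>x. (v' x)\<^sup>2 + k x * (v x)\<^sup>2)"
    by (intro continuous_intros k test_functionD[OF v])
  have cF: "continuous_on {a..b} F" unfolding F_def
    by (intro indefinite_integral_continuous_1 integrable_continuous_real i)
  have B: "isCont B x" if x: "a \<le> x" "x \<le> b" and z: "u x = 0 \<Longrightarrow> v x = 0 \<and> u' x \<noteq> 0" for x
  proof (cases "u x = 0")
    case False
    then show ?thesis unfolding B_def
      by (intro continuous_intros DERIV_isCont[OF u[OF x]] DERIV_isCont[OF u'[OF x]]
          DERIV_isCont[OF test_functionD(1)[OF v]])
  next
    case True
    have v0: "v x = 0" and u'x: "u' x \<noteq> 0" using z[OF True] by auto
    have 1: "((\<lambda>y. (v y - v x) / (y - x)) \<longlongrightarrow> v' x) (at x)"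
      using test_functionD(1)[OF v, of x UNIV] by (simp add: has_field_derivative_iff)
    have 2: "((\<lambda>y. (u y - u x) / (y - x)) \<longlongrightarrow> u' x) (at x)"
      using u[OF x] by (simp add: has_field_derivative_iff)
    have 3: "(u' \<longlongrightarrow> u' x) (at x)" using DERIV_isCont[OF u'[OF x]] by (simp add: isCont_def)
    have 4: "((\<lambda>y. y - x) \<longlongrightarrow> 0) (at x)" by (auto intro!: tendsto_eq_intros)
    \<comment> \<open>Near a common zero, v^2/u behaves like (y - x) v'(x)^2/u'(x). Written with
      difference quotients it visibly tends to 0, the value that division by 0 gives to
      \<open>B\<close> there.\<close>
    have "((\<lambda>y. u' y * (((v y - v x) / (y - x))\<^sup>2 * (y - x) / ((u y - u x) / (y - x)))) \<longlongrightarrow>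
      u' x * ((v' x)\<^sup>2 * 0 / u' x)) (at x)"
      using u'x by (intro tendsto_intros 1 2 3 4)
    moreover have "\<forall>\<^sub>F y in at x. u' y * (((v y - v x) / (y - x))\<^sup>2 * (y - x) / ((u y - u x) / (y - x))) = B y"
      unfolding eventually_at_filter B_def
      by (rule always_eventually) (simp add: True v0 power2_eq_square)
    ultimately have "(B \<longlongrightarrow> 0) (at x)" by (simp add: tendsto_cong)
    then show ?thesis by (simp add: isCont_def B_def v0)
  qed
  have cB: "continuous_on {a..b} B"
  proof (rule continuous_at_imp_continuous_on, rule ballI)
    fix x assume x: "x \<in> {a..b}"
    show "isCont B x"
      by (rule B) (use x za zb pos[of x] in \<open>auto simp: less_eq_real_def\<close>)
  qed
  have "F a - B a \<le> F b - B b"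
  proof (rule DERIV_nonneg_imp_increasing_open[OF ab])
    fix x assume x: "a < x" "x < b"
    have ux: "0 < u x" by (rule pos[OF x])
    have dF: "(F has_real_derivative (v' x)\<^sup>2 + k x * (v x)\<^sup>2) (at x)"
    proof -
      have "(F has_real_derivative (v' x)\<^sup>2 + k x * (v x)\<^sup>2) (at x within {a..b})"
        unfolding F_def by (rule integral_has_real_derivative[OF i]) (use x in auto)
      moreover have "at x within {a..b} = at x" using x by (simp add: at_within_Icc_at)
      ultimately show ?thesis by simp
    qed
    have dB: "(B has_real_derivative
        ((w x * u x - u' x * u' x) / (u x * u x)) * (v x)\<^sup>2 + u' x / u x * (2 * v x * v' x)) (at x)"
    proof -
      have "((\<lambda>x. u' x / u x) has_real_derivative (w x * u x - u' x * u' x) / (u x * u x)) (at x)"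
        using x ux by (intro DERIV_divide u u') auto
      moreover have "((\<lambda>x. (v x)\<^sup>2) has_real_derivative 2 * v x * v' x) (at x)"
        by (auto intro!: derivative_eq_intros test_functionD(1)[OF v])
      ultimately show ?thesis
        unfolding B_def by (rule DERIV_cong[OF DERIV_mult]) (simp add: mult.commute)
    qed
    have "w x / u x * (v x)\<^sup>2 \<le> k x * (v x)\<^sup>2"
      using w[OF x] ux by (intro mult_right_mono) (auto simp: field_simps)
    moreover have "(v' x)\<^sup>2 - (((w x * u x - u' x * u' x) / (u x * u x)) * (v x)\<^sup>2 + u' x / u x * (2 * v x * v' x))
       = (v' x - u' x / u x * v x)\<^sup>2 - w x / u x * (v x)\<^sup>2"
      using ux by (simp add: field_simps power2_eq_square)
    ultimately have "0 \<le> (v' x)\<^sup>2 + k x * (v x)\<^sup>2 -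
      (((w x * u x - u' x * u' x) / (u x * u x)) * (v x)\<^sup>2 + u' x / u x * (2 * v x * v' x))"
      by (smt (verit) zero_le_power2)
    with DERIV_diff[OF dF dB]
    show "\<exists>z. ((\<lambda>x. F x - B x) has_real_derivative z) (at x) \<and> 0 \<le> z" by blast
  qed (intro continuous_intros cF cB)
  then show ?thesis by (simp add: F_def B_def energy_def)
qed

text \<open>A crude Weyl bound by bracketing: the region where k may be negative is cut into cells
  of length at most 1/sqrt K, on each of which a cosine solving u'' = -K u stays positive. A
  combination vanishing at all nodes has nonnegative energy, so n cannot exceed the number of
  nodes.\<close>

lemma neg_family_bound:
  assumes k: "continuous_on UNIV k" and n: "neg_family k n"
    and lb: "\<And>x. - K \<le> k x" and K: "0 < K" and out: "\<And>x. R0 \<le> \<bar>x\<bar> \<Longrightarrow> 0 \<le> k x" and R0: "0 < R0"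
  shows "real n \<le> 2 * R0 * sqrt K + 2"
proof (rule ccontr)
  assume neg: "\<not> ?thesis"
  define m where "m = nat \<lceil>2 * R0 * sqrt K\<rceil>"
  define s where "s = 2 * R0 / m"
  have K': "0 < sqrt K" using K by simp
  have RK: "0 < 2 * R0 * sqrt K" using R0 K' by simp
  then have m0: "0 < m" by (simp add: m_def)
  have mge: "2 * R0 * sqrt K \<le> m" by (simp add: m_def real_nat_ceiling_ge)
  have "real m \<le> 2 * R0 * sqrt K + 1" using RK unfolding m_def by linarith
  \<comment> \<open>There are m + 1 nodes, both ends included, so \<open>n\<close> has to exceed
    \<open>Suc m\<close> for the coefficients to exist.\<close>
  then have mn: "Suc m < n" using neg by linarith
  have s0: "0 < s" using R0 m0 by (simp add: s_def)
  have sK: "sqrt K * s \<le> 1" using mge m0 by (simp add: s_def field_simps)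
  obtain R v v' where R: "R0 \<le> R" "0 < R" and v: "\<And>i. i < n \<Longrightarrow> test_function R (v i) (v' i)"
    and e: "\<And>c. \<exists>i<n. c i \<noteq> 0 \<Longrightarrow>
        energy k (-R) R (\<lambda>x. \<Sum>i<n. c i * v i x) (\<lambda>x. \<Sum>i<n. c i * v' i x) < 0"
    by (rule neg_family_radius[OF k n, of R0]) blast
  define g where "g j = - R0 + real j * s" for j
  have gm: "g m = R0" using m0 by (simp add: g_def s_def)
  have "\<exists>c. (\<exists>i\<in>{..<n}. c i \<noteq> 0) \<and> (\<forall>j<Suc m. (\<Sum>i\<in>{..<n}. c i * v i (g j)) = 0)"
    by (rule linear_system_kernel) (use mn in auto)
  then obtain c where c: "\<exists>i<n. c i \<noteq> 0" "\<And>j. j < Suc m \<Longrightarrow> (\<Sum>i<n. c i * v i (g j)) = 0" by auto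
  define f where "f x = (\<Sum>i<n. c i * v i x)" for x
  define f' where "f' x = (\<Sum>i<n. c i * v' i x)" for x
  have f: "test_function R f f'" unfolding f_def[abs_def] f'_def[abs_def] by (rule test_function_sum[OF v])
  have cell: "0 \<le> energy k (g j) (g (Suc j)) f f'" if "j < m" for j
  proof -
    let ?u = "\<lambda>x. cos (sqrt K * (x - g j))"
    let ?u' = "\<lambda>x. - sqrt K * sin (sqrt K * (x - g j))"
    have gj: "g (Suc j) = g j + s" by (simp add: g_def algebra_simps)
    have arg: "0 \<le> sqrt K * (x - g j) \<and> sqrt K * (x - g j) \<le> 1" if "g j \<le> x" "x \<le> g (Suc j)" for x
    proof -
      have "sqrt K * (x - g j) \<le> sqrt K * s" using that gj K' by (intro mult_left_mono) auto
      then have "sqrt K * (x - g j) \<le> 1" using sK by linarith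
      then show ?thesis using that K' by simp
    qed
    have cp: "0 < ?u x" if "g j \<le> x" "x \<le> g (Suc j)" for x
      using arg[OF that] pi_gt3 by (intro cos_gt_zero_pi) linarith+
    have "?u' (g (Suc j)) / ?u (g (Suc j)) * (f (g (Suc j)))\<^sup>2 - ?u' (g j) / ?u (g j) * (f (g j))\<^sup>2
        \<le> energy k (g j) (g (Suc j)) f f'"
    proof (rule jacobi_inequality[OF _ _ _ _ _ _ f])
      show "(?u has_real_derivative ?u' x) (at x)" for x
        by (auto intro!: derivative_eq_intros)
      show "(?u' has_real_derivative - K * ?u x) (at x)" for x
        using K by (auto intro!: derivative_eq_intros simp: power2_eq_square[symmetric] mult.assoc[symmetric])
      show "- K * ?u x \<le> k x * ?u x" if "g j < x" "x < g (Suc j)" for x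
        using cp[of x] that lb[of x] by (intro mult_right_mono) auto
    qed (use cp[of "g j"] cp[of "g (Suc j)"] cp s0 gj continuous_on_subset[OF k] in auto)
    then show ?thesis using c(2)[of "Suc j"] that by (simp add: f_def)
  qed
  have "0 \<le> energy k (-R0) (g j) f f'" if "j \<le> m" for j
    using that
  proof (induction j)
    case 0 then show ?case by (simp add: g_def energy_def)
  next
    case (Suc j)
    have "energy k (-R0) (g (Suc j)) f f' = energy k (-R0) (g j) f f' + energy k (g j) (g (Suc j)) f f'"
      by (rule energy_split[OF k f]) (use s0 in \<open>auto simp: g_def algebra_simps\<close>)
    then show ?case using Suc cell[of j] by simp
  qed
  from this[of m] have inner: "0 \<le> energy k (-R0) R0 f f'" by (simp add: gm)
  have outer: "0 \<le> energy k a b f f'" if "\<And>x. a \<le> x \<Longrightarrow> x \<le> b \<Longrightarrow> R0 \<le> \<bar>x\<bar>" for a b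
    unfolding energy_def
    by (rule Henstock_Kurzweil_Integration.integral_nonneg[OF energy_integrable[OF continuous_on_subset[OF k] f]])
      (use that out in auto)
  have "energy k (-R) R f f' = energy k (-R) (-R0) f f' + energy k (-R0) R0 f f' + energy k R0 R f f'"
    using energy_split[OF k f, of "-R" "-R0" R] energy_split[OF k f, of "-R0" R0 R] R R0 by simp
  also have "\<dots> \<ge> 0" using inner outer[of "-R" "-R0"] outer[of R0 R] R0 by fastforce
  finally show False using e[OF c(1)] by (simp add: f_def[abs_def] f'_def[abs_def])
qed

section \<open>Negative directions produce bound states\<close>

definition bound_state :: "(real \<Rightarrow> real) \<Rightarrow> bool" where
  "bound_state k \<longleftrightarrow> (\<exists>u u'. solves k u u' \<and> l2_bounded u \<and> (\<exists>x. u x \<noteq> 0))"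

text \<open>The first zero after a positive value is approached from above, against the positive
  slope required at zeros. For the Pruefer angle minus a multiple of pi this says that multiples of
  pi are only passed upwards.\<close>

lemma upward_crossing:
  fixes f f' :: "real \<Rightarrow> real"
  assumes f: "\<And>x. (f has_real_derivative f' x) (at x)" and up: "\<And>x. f x = 0 \<Longrightarrow> 0 < f' x"
    and x: "x1 < x2" and f1: "0 \<le> f x1"
  shows "0 < f x2"
proof (rule ccontr)
  assume "\<not> 0 < f x2"
  then have f2: "f x2 \<le> 0" by simp
  have "\<exists>y. x1 \<le> y \<and> y < x2 \<and> 0 < f y"
  proof (cases "f x1 = 0")
    case False then show ?thesis using f1 x by (intro exI[of _ x1]) auto
  next
    case True
    obtain d where d: "0 < d" "\<And>h. 0 < h \<Longrightarrow> h < d \<Longrightarrow> f x1 < f (x1 + h)"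
      using DERIV_pos_inc_right[OF f up[OF True]] by auto
    define h where "h = min (d / 2) ((x2 - x1) / 2)"
    have "0 < h" "h < d" "x1 + h < x2" using d(1) x by (auto simp: h_def min_def field_simps)
    then show ?thesis using d(2)[of h] True by (intro exI[of _ "x1 + h"]) auto
  qed
  then obtain y where y: "y < x2" "0 < f y" by blast
  have cf: "continuous_on UNIV f" by (rule DERIV_continuous_on[OF f])
  define A where "A = {y..x2} \<inter> {x. f x \<le> 0}"
  have "closed A" unfolding A_def
    by (intro closed_Int closed_Collect_le cf continuous_on_const) simp
  then have cA: "compact A" unfolding A_def by (metis bounded_closed_interval bounded_Int compact_eq_bounded_closed)
  have "x2 \<in> A" using f2 y by (simp add: A_def)
  then have neA: "A \<noteq> {}" by blast
  obtain s where s: "s \<in> A" "\<And>t. t \<in> A \<Longrightarrow> s \<le> t"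
    using compact_attains_inf[OF cA neA] by blast
  have sy: "y < s" "s \<le> x2" "f s \<le> 0" using s(1) y by (auto simp: A_def less_le)
  have below: "0 < f t" if "y \<le> t" "t < s" for t
    using s(2)[of t] that sy by (auto simp: A_def not_le[symmetric])
  have "f s = 0"
  proof (rule ccontr)
    assume "f s \<noteq> 0"
    then have "f s < 0" using sy by simp
    then obtain t where "y \<le> t" "t \<le> s" "f t = 0"
      using IVT2'[of f s 0 y] y sy continuous_on_subset[OF cf] by auto
    then show False using below[of t] \<open>f s \<noteq> 0\<close> by (cases "t = s") auto
  qed
  then obtain d where d: "0 < d" "\<And>h. 0 < h \<Longrightarrow> h < d \<Longrightarrow> f (s - h) < f s"
    using DERIV_pos_inc_left[OF f up] by auto
  define h where "h = min (d / 2) ((s - y) / 2)"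
  have "0 < h" "h < d" "y \<le> s - h" using d(1) sy by (auto simp: h_def min_def field_simps)
  then show False using d(2)[of h] below[of "s - h"] \<open>f s = 0\<close> by simp
qed

text \<open>The angle is given by its differential equation rather than by inverting a tangent,
  which keeps it continuous across branches. The unit vectors along (y, y') and (sin, cos) rotate at
  the same speed, so their inner product keeps its initial value 1 and they coincide.\<close>

lemma pruefer_angle:
  assumes s: "solves k y y'" and nz: "\<And>t. 0 < (y t)\<^sup>2 + (y' t)\<^sup>2"
    and th: "\<And>t. (\<theta> has_real_derivative ((y' t)\<^sup>2 - k t * (y t)\<^sup>2) / ((y t)\<^sup>2 + (y' t)\<^sup>2)) (at t)"
    and init: "y 0 = sqrt ((y 0)\<^sup>2 + (y' 0)\<^sup>2) * sin (\<theta> 0)" "y' 0 = sqrt ((y 0)\<^sup>2 + (y' 0)\<^sup>2) * cos (\<theta> 0)"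
  shows "y t = sqrt ((y t)\<^sup>2 + (y' t)\<^sup>2) * sin (\<theta> t)" "y' t = sqrt ((y t)\<^sup>2 + (y' t)\<^sup>2) * cos (\<theta> t)"
proof -
  define \<rho> where "\<rho> t = sqrt ((y t)\<^sup>2 + (y' t)\<^sup>2)" for t
  define \<omega> where "\<omega> t = ((y' t)\<^sup>2 - k t * (y t)\<^sup>2) / ((y t)\<^sup>2 + (y' t)\<^sup>2)" for t
  have \<rho>0: "0 < \<rho> t" for t using nz by (simp add: \<rho>_def)
  have \<rho>2: "\<rho> t * \<rho> t = (y t)\<^sup>2 + (y' t)\<^sup>2" for t
    using nz[of t] by (simp add: \<rho>_def)
  have d\<rho>: "(\<rho> has_real_derivative y t * y' t * (1 + k t) / \<rho> t) (at t)" for t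
  proof -
    have "((\<lambda>t. (y t)\<^sup>2 + (y' t)\<^sup>2) has_real_derivative 2 * (y t * y' t * (1 + k t))) (at t)"
      by (auto intro!: derivative_eq_intros solvesD(1,2)[OF s] simp: algebra_simps)
    note DERIV_chain'[OF this DERIV_real_sqrt[OF nz]]
    moreover have "inverse s / 2 * (2 * A) = A / s" for s A :: real by (simp add: field_simps)
    ultimately show ?thesis unfolding \<rho>_def by (rule DERIV_cong)
  qed
  define a where "a t = y t / \<rho> t" for t
  define b where "b t = y' t / \<rho> t" for t
  have da: "(a has_real_derivative b t * \<omega> t) (at t)" for t
  proof -
    have "(a has_real_derivative (y' t * \<rho> t - y t * (y t * y' t * (1 + k t) / \<rho> t)) / (\<rho> t * \<rho> t)) (at t)"
      unfolding a_def using \<rho>0[of t] by (intro DERIV_divide solvesD(1)[OF s] d\<rho>) auto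
    moreover have "(y' t * \<rho> t - y t * (y t * y' t * (1 + k t) / \<rho> t)) =
       y' t * (\<rho> t * \<rho> t - y t * y t * (1 + k t)) / \<rho> t"
      using \<rho>0[of t] by (simp add: field_simps)
    moreover have "\<rho> t * \<rho> t - y t * y t * (1 + k t) = (y' t)\<^sup>2 - k t * (y t)\<^sup>2"
      unfolding \<rho>2 by (simp add: power2_eq_square algebra_simps)
    ultimately show ?thesis unfolding b_def \<omega>_def \<rho>2[symmetric] by (simp add: mult.commute mult.left_commute)
  qed
  have db: "(b has_real_derivative - a t * \<omega> t) (at t)" for t
  proof -
    have "(b has_real_derivative (k t * y t * \<rho> t - y' t * (y t * y' t * (1 + k t) / \<rho> t)) / (\<rho> t * \<rho> t)) (at t)"
      unfolding b_def using \<rho>0[of t] by (intro DERIV_divide solvesD(2)[OF s] d\<rho>) auto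
    moreover have "(k t * y t * \<rho> t - y' t * (y t * y' t * (1 + k t) / \<rho> t)) =
       - y t * (y' t * y' t * (1 + k t) - k t * (\<rho> t * \<rho> t)) / \<rho> t"
      using \<rho>0[of t] by (simp add: field_simps)
    moreover have "y' t * y' t * (1 + k t) - k t * (\<rho> t * \<rho> t) = (y' t)\<^sup>2 - k t * (y t)\<^sup>2"
      unfolding \<rho>2 by (simp add: power2_eq_square algebra_simps)
    ultimately show ?thesis unfolding a_def \<omega>_def \<rho>2[symmetric] by (simp add: mult.commute mult.left_commute)
  qed
  have dth: "(\<theta> has_real_derivative \<omega> t) (at t)" for t using th by (simp add: \<omega>_def)
  have "((\<lambda>t. a t * sin (\<theta> t) + b t * cos (\<theta> t)) has_real_derivative 0) (at t)" for t
    by (rule derivative_eq_intros da db dth refl)+ (simp add: algebra_simps)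
  then have "a t * sin (\<theta> t) + b t * cos (\<theta> t) = a 0 * sin (\<theta> 0) + b 0 * cos (\<theta> 0)"
    by (intro DERIV_isconst_all) simp
  moreover have "y 0 = \<rho> 0 * sin (\<theta> 0)" "y' 0 = \<rho> 0 * cos (\<theta> 0)"
    unfolding \<rho>_def by (fact init)+
  then have "a 0 = sin (\<theta> 0)" "b 0 = cos (\<theta> 0)"
    using \<rho>0[of 0] by (simp_all add: a_def b_def)
  ultimately have 1: "a t * sin (\<theta> t) + b t * cos (\<theta> t) = 1"
    using sin_cos_squared_add[of "\<theta> 0"] by (simp add: power2_eq_square)
  have 2: "(a t)\<^sup>2 + (b t)\<^sup>2 = 1"
  proof -
    have "(a t)\<^sup>2 + (b t)\<^sup>2 = ((y t)\<^sup>2 + (y' t)\<^sup>2) / (\<rho> t * \<rho> t)"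
      by (simp add: a_def b_def power_divide add_divide_distrib power2_eq_square)
    then show ?thesis unfolding \<rho>2 divide_self[OF less_imp_neq[OF nz, symmetric]] .
  qed
  have "(a t - sin (\<theta> t))\<^sup>2 + (b t - cos (\<theta> t))\<^sup>2 =
     (a t)\<^sup>2 + (b t)\<^sup>2 + ((sin (\<theta> t))\<^sup>2 + (cos (\<theta> t))\<^sup>2) - 2 * (a t * sin (\<theta> t) + b t * cos (\<theta> t))"
    by (simp add: power2_eq_square algebra_simps)
  also have "\<dots> = 0" unfolding 1 2 by simp
  finally have "a t = sin (\<theta> t)" "b t = cos (\<theta> t)" by (simp_all add: sum_power2_eq_zero_iff)
  then have "y t = \<rho> t * sin (\<theta> t)" "y' t = \<rho> t * cos (\<theta> t)"
    using \<rho>0[of t] unfolding a_def b_def by (simp_all add: field_simps)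
  from this[unfolded \<rho>_def]
  show "y t = sqrt ((y t)\<^sup>2 + (y' t)\<^sup>2) * sin (\<theta> t)" "y' t = sqrt ((y t)\<^sup>2 + (y' t)\<^sup>2) * cos (\<theta> t)" .
qed

text \<open>Since z decreases, \<kappa> z^2 \<le> z(X) k z = z(X) z'', and integrating z'' leaves
  only slopes.\<close>

lemma decaying_half_line:
  assumes s: "solves k z z'" and k: "continuous_on UNIV k" and \<kappa>: "0 < \<kappa>" and T: "X \<le> T"
    and lb: "\<And>x. X \<le> x \<Longrightarrow> \<kappa> \<le> k x" and z: "\<And>x. X \<le> x \<Longrightarrow> 0 \<le> z x \<and> z' x \<le> 0"
  shows "integral {X..T} (\<lambda>x. (z x)\<^sup>2) \<le> z X * (- z' X) / \<kappa>"
proof -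
  have "((\<lambda>x. k x * z x) has_integral z' T - z' X) {X..T}"
    by (rule fundamental_theorem_of_calculus[OF T])
      (simp add: has_real_derivative_iff_has_vector_derivative[symmetric] solvesD(2)[OF s])
  then have i: "((\<lambda>x. z X * (k x * z x)) has_integral z X * (z' T - z' X)) {X..T}"
    by (rule has_integral_mult_right)
  have "\<kappa> * integral {X..T} (\<lambda>x. (z x)\<^sup>2) = integral {X..T} (\<lambda>x. \<kappa> * (z x)\<^sup>2)" by simp
  also have "\<dots> \<le> integral {X..T} (\<lambda>x. z X * (k x * z x))"
  proof (intro integral_le integrable_continuous_real continuous_intros solvesD(3)[OF s] continuous_on_subset[OF k])
    fix x assume x: "x \<in> {X..T}"
    have "z x \<le> z X"
      by (rule DERIV_nonpos_imp_nonincreasing[of X x]) (use x z solvesD(1)[OF s, of _ UNIV] in auto)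
    then have "\<kappa> * (z x * z x) \<le> k x * (z X * z x)"
      using x z[of x] lb[of x] \<kappa> by (intro mult_mono mult_right_mono) auto
    then show "\<kappa> * (z x)\<^sup>2 \<le> z X * (k x * z x)" by (simp add: power2_eq_square mult_ac)
  qed auto
  also have "\<dots> = z X * (z' T - z' X)" using i by (rule integral_unique)
  also have "\<dots> \<le> z X * (- z' X)" using z[OF T] z[of X] by (intro mult_left_mono) auto
  finally show ?thesis using \<kappa> by (simp add: field_simps)
qed

lemma l2_bounded_halves:
  assumes c: "continuous_on UNIV u" and X: "0 \<le> X" and R: "\<And>T. X \<le> T \<Longrightarrow> integral {X..T} (\<lambda>x. (u x)\<^sup>2) \<le> B1"
    and L: "\<And>T. X \<le> T \<Longrightarrow> integral {X..T} (\<lambda>x. (u (- x))\<^sup>2) \<le> B2"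
  shows "l2_bounded u"
  unfolding l2_bounded_def
proof (intro exI allI)
  fix a b
  define T where "T = \<bar>a\<bar> + \<bar>b\<bar> + X"
  have T: "- T \<le> - X" "- X \<le> T" "- X \<le> X" "X \<le> T" using X by (auto simp: T_def)
  have i: "(\<lambda>x. (u x)\<^sup>2) integrable_on {c..d}" for c d
    by (intro integrable_continuous_real continuous_intros continuous_on_subset[OF c]) simp
  have "integral {a..b} (\<lambda>x. (u x)\<^sup>2) \<le> integral {-T..T} (\<lambda>x. (u x)\<^sup>2)"
    by (rule integral_subset_le[OF _ i i]) (use X in \<open>auto simp: T_def\<close>)
  also have "\<dots> = integral {-T..-X} (\<lambda>x. (u x)\<^sup>2) + integral {-X..X} (\<lambda>x. (u x)\<^sup>2) + integral {X..T} (\<lambda>x. (u x)\<^sup>2)"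
    using Henstock_Kurzweil_Integration.integral_combine[OF _ _ i, of "-T" "-X" T]
      Henstock_Kurzweil_Integration.integral_combine[OF _ _ i, of "-X" X T] T
    by simp
  also have "integral {-T..-X} (\<lambda>x. (u x)\<^sup>2) = integral {X..T} (\<lambda>x. (u (- x))\<^sup>2)"
    using Henstock_Kurzweil_Integration.integral_reflect_real[of T X "\<lambda>x. (u (- x))\<^sup>2"] by simp
  also have "integral {X..T} (\<lambda>x. (u (- x))\<^sup>2) + integral {-X..X} (\<lambda>x. (u x)\<^sup>2) + integral {X..T} (\<lambda>x. (u x)\<^sup>2)
     \<le> B2 + integral {-X..X} (\<lambda>x. (u x)\<^sup>2) + B1"
    using R[of T] L[of T] by (simp add: T_def)
  finally show "integral {a..b} (\<lambda>x. (u x)\<^sup>2) \<le> B2 + integral {-X..X} (\<lambda>x. (u x)\<^sup>2) + B1" .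
qed

lemma sin_sign: "real j * pi < t \<Longrightarrow> t < (real j + 1) * pi \<Longrightarrow> 0 < (-1) ^ j * sin t"
proof -
  assume "real j * pi < t" "t < (real j + 1) * pi"
  then have "0 < sin (t - real j * pi)" by (intro sin_gt_zero) (auto simp: algebra_simps)
  then show ?thesis by (simp add: sin_diff mult.commute)
qed

text \<open>Let $\theta_E$ be the Pruefer angle of the solution decaying at $-\infty$ and $k\pi$ the last multiple
  of $\pi$ below its value at the right end for the top energy. The conditions $v(z_j) = 0$ at the $k$
  zeros of that solution cut down the test functions to ones of nonnegative energy, so that
  $n$ cannot exceed the number of crossings; each energy at which the angle matches the solution
  decaying at $+\infty$ is that of a bound state.\<close>
lemma neg_family_bound_states:
  fixes K :: "real \<Rightarrow> real \<Rightarrow> real"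
  assumes K: "continuous_on UNIV (\<lambda>(E, x). K E x)"
    and out: "\<And>E x. E \<le> Es \<Longrightarrow> X0 \<le> \<bar>x\<bar> \<Longrightarrow> \<kappa> \<le> K E x" and \<kappa>: "0 < \<kappa>"
    and low: "\<And>x. 0 < K E0 x" and E0: "E0 < Es" and nf: "neg_family (K Es) n"
  shows "\<exists>S. finite S \<and> card S = n \<and> (\<forall>E\<in>S. E0 < E \<and> E < Es \<and> bound_state (K E))"
proof -
  have KEs: "continuous_on UNIV (K E)" for E by (rule continuous_param_section[OF K])
  obtain X v v' where X: "max X0 0 \<le> X" "0 < X" and v: "\<And>i. i < n \<Longrightarrow> test_function X (v i) (v' i)"
    and en: "\<And>c. \<exists>i<n. c i \<noteq> 0 \<Longrightarrow>
        energy (K Es) (-X) X (\<lambda>x. \<Sum>i<n. c i * v i x) (\<lambda>x. \<Sum>i<n. c i * v' i x) < 0"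
    by (rule neg_family_radius[OF KEs nf, of "max X0 0"]) (rule that)
  \<comment> \<open>Freezing the energy at \<open>Es\<close> from above makes the lower bound
    outside \<open>X\<close> hold for all real energies, as \<open>decaying_data\<close> demands;
    energies up to \<open>Es\<close> are unaffected.\<close>
  define Kc where "Kc E x = K (min E Es) x" for E x
  have KcE: "Kc E = K E" if "E \<le> Es" for E using that by (auto simp: Kc_def)
  have Kc: "continuous_on UNIV (\<lambda>(E, t). Kc E (g t))" if "continuous_on UNIV g" for g
    unfolding Kc_def split_beta
    by (rule continuous_on_compose2[OF K, of _ "\<lambda>p. (min (fst p) Es, g (snd p))", simplified split_beta fst_conv snd_conv])
      (intro continuous_intros continuous_on_compose2[OF that], auto)
  have Kcs: "continuous_on UNIV (Kc E)" for E
    by (rule continuous_param_section[OF Kc[OF continuous_on_id, unfolded id_def]])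
  have outc: "\<kappa> \<le> Kc E x" if "X \<le> \<bar>x\<bar>" for E x unfolding Kc_def using that X by (intro out) auto
  obtain I where I: "continuous_on UNIV I" "\<And>E. 0 < I E"
    "\<And>E y y' t. solves (\<lambda>t. Kc E (t + X)) y y' \<Longrightarrow> y 0 = I E \<Longrightarrow> y' 0 = -1 \<Longrightarrow> 0 \<le> t \<Longrightarrow> 0 \<le> y t \<and> y' t \<le> 0"
    by (rule decaying_data[of "\<lambda>E t. Kc E (t + X)" \<kappa>, OF Kc _ \<kappa>])
      (use X outc in \<open>auto intro!: continuous_intros\<close>)
  obtain J where J: "continuous_on UNIV J" "\<And>E. 0 < J E"
    "\<And>E y y' t. solves (\<lambda>t. Kc E (- X - t)) y y' \<Longrightarrow> y 0 = J E \<Longrightarrow> y' 0 = -1 \<Longrightarrow> 0 \<le> t \<Longrightarrow> 0 \<le> y t \<and> y' t \<le> 0"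
    by (rule decaying_data[of "\<lambda>E t. Kc E (- X - t)" \<kappa>, OF Kc _ \<kappa>])
      (use X outc in \<open>auto intro!: continuous_intros\<close>)
  have cg: "continuous_on UNIV (\<lambda>t::real. t - X)" by (intro continuous_intros)
  \<comment> \<open>The left solution in the variable t = x + X, so that its data sit at t = 0. The
    slope there is +1 because the half-line on which \<open>J\<close> was obtained is traversed
    backwards.\<close>
  obtain w w' where w: "\<And>E. solves (\<lambda>t. Kc E (t - X)) (w E) (w' E)"
    and w0: "\<And>E. w E 0 = J E" "\<And>E. w' E 0 = 1"
    and cw: "continuous_on UNIV (\<lambda>(E, t). w E t)" "continuous_on UNIV (\<lambda>(E, t). w' E t)"
    using linear_ode_solves[OF Kc[OF cg] J(1) continuous_on_const[of _ 1]]
    by (elim exE conjE) (rule that; (erule spec | assumption))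
  have cKw: "continuous_on UNIV (\<lambda>t. Kc E (t - X))" for E
    by (intro continuous_on_compose2[OF Kcs] continuous_intros) auto
  have nz: "0 < (w E t)\<^sup>2 + (w' E t)\<^sup>2" for E t
  proof -
    have "\<not> (w E t = 0 \<and> w' E t = 0)"
      using solves_zero[OF cKw w, of E t 0] w0 by auto
    then show ?thesis by (auto simp: sum_power2_gt_zero_iff)
  qed
  define \<omega> where "\<omega> E t = ((w' E t)\<^sup>2 - Kc E (t - X) * (w E t)\<^sup>2) / ((w E t)\<^sup>2 + (w' E t)\<^sup>2)" for E t
  have c\<omega>: "continuous_on UNIV (\<lambda>(E, t). \<omega> E t)"
  proof -
    have "continuous_on UNIV (\<lambda>(E, t). Kc E (t - X))" by (intro Kc continuous_intros)
    then show ?thesis using cw nz unfolding \<omega>_def split_beta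
      by (intro continuous_intros) (auto simp: less_le)
  qed
  define \<theta> where "\<theta> E t = arctan (J E) + prim (\<omega> E) t" for E t
  have th: "(\<theta> E has_real_derivative \<omega> E t) (at t)" for E t
    unfolding \<theta>_def using prim_has_derivative[OF continuous_param_section[OF c\<omega>]]
    by (auto intro!: derivative_eq_intros)
  have cth: "continuous_on UNIV (\<lambda>E. \<theta> E t)" for t
  proof -
    have "continuous_on UNIV (\<lambda>E. prim (\<omega> E) t)"
      by (rule continuous_on_compose2[OF continuous_prim_param[OF c\<omega>], of _ "\<lambda>E. (E, t)", simplified])
        (intro continuous_intros)
    then show ?thesis unfolding \<theta>_def by (intro continuous_intros J(1))
  qed
  have cth': "continuous_on A (\<theta> E)" for A E by (rule DERIV_continuous_on[OF has_field_derivative_at_within[OF th]])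
  define \<rho> where "\<rho> E t = sqrt ((w E t)\<^sup>2 + (w' E t)\<^sup>2)" for E t
  have \<rho>: "0 < \<rho> E t" for E t using nz by (simp add: \<rho>_def)
  have polar: "w E t = \<rho> E t * sin (\<theta> E t)" "w' E t = \<rho> E t * cos (\<theta> E t)" for E t
  proof -
    have "\<theta> E 0 = arctan (J E)" by (simp add: \<theta>_def)
    then have "w E 0 = sqrt ((w E 0)\<^sup>2 + (w' E 0)\<^sup>2) * sin (\<theta> E 0)"
      "w' E 0 = sqrt ((w E 0)\<^sup>2 + (w' E 0)\<^sup>2) * cos (\<theta> E 0)"
      using w0 nz[of E 0] by (simp_all add: sin_arctan cos_arctan add.commute field_simps)
    from pruefer_angle[OF w nz th[unfolded \<omega>_def] this]
    show "w E t = \<rho> E t * sin (\<theta> E t)" "w' E t = \<rho> E t * cos (\<theta> E t)" unfolding \<rho>_def by auto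
  qed
  have th0: "0 < \<theta> E 0" "\<theta> E 0 < pi / 2" for E
    using J(2)[of E] arctan_ubound[of "J E"] by (auto simp: \<theta>_def)
  \<comment> \<open>At a multiple of pi the solution vanishes and the angle has speed 1, whatever
    the coefficient is.\<close>
  have cross: "real j * pi < \<theta> E t" if "real j * pi \<le> \<theta> E s" "s < t" for j E s t
  proof -
    have "0 < \<theta> E t - real j * pi"
    proof (rule upward_crossing[where f = "\<lambda>t. \<theta> E t - real j * pi" and f' = "\<omega> E" and ?x1.0 = s])
      show "((\<lambda>t. \<theta> E t - real j * pi) has_real_derivative \<omega> E x) (at x)" for x
        by (auto intro!: derivative_eq_intros th)
      fix x assume "\<theta> E x - real j * pi = 0"
      then have "\<theta> E x = real j * pi" by simp
      then have wx: "w E x = 0" using polar(1)[of E x] by (simp add: sin_npi)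
      then show "0 < \<omega> E x" using nz[of E x] by (simp add: \<omega>_def)
    qed (use that in auto)
    then show ?thesis by simp
  qed
  define L where "L = 2 * X"
  have L: "0 < L" using X by (simp add: L_def)
  have thpos: "0 < \<theta> E t" if "0 \<le> t" for E t
    using cross[of 0 E 0 t] th0[of E] that by (cases "t = 0") auto
  \<comment> \<open>the number of zeros of the left solution at the top energy\<close>
  define k where "k = nat (\<lceil>\<theta> Es L / pi\<rceil> - 1)"
  \<comment> \<open>Ceiling minus one makes the lower inequality strict and the upper one weak: a
    zero of the left solution exactly at the right end is not counted.\<close>
  have kL: "real k * pi < \<theta> Es L" "\<theta> Es L \<le> (real k + 1) * pi"
  proof -
    have p: "0 < \<theta> Es L / pi" using thpos[of L Es] L by simp
    then have "1 \<le> \<lceil>\<theta> Es L / pi\<rceil>" by linarith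
    then have rk: "real k = of_int \<lceil>\<theta> Es L / pi\<rceil> - 1" unfolding k_def by simp
    have "real k < \<theta> Es L / pi" "\<theta> Es L / pi \<le> real k + 1" unfolding rk by linarith+
    then show "real k * pi < \<theta> Es L" "\<theta> Es L \<le> (real k + 1) * pi"
      by (simp_all add: field_simps)
  qed
  have "\<exists>t. 0 < t \<and> t < L \<and> \<theta> Es t = real j * pi" if j: "1 \<le> j" "j \<le> k" for j
  proof -
    have a: "\<theta> Es 0 < real j * pi"
    proof -
      have "1 * pi \<le> real j * pi" by (rule mult_right_mono) (use j in auto)
      then show ?thesis using th0(2)[of Es] pi_gt_zero by linarith
    qed
    have b: "real j * pi < \<theta> Es L"
    proof -
      have "real j * pi \<le> real k * pi" by (rule mult_right_mono) (use j in auto)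
      then show ?thesis using kL(1) by linarith
    qed
    obtain t where "0 \<le> t" "t \<le> L" "\<theta> Es t = real j * pi"
      using IVT'[of "\<theta> Es" 0 "real j * pi" L] a b L cth' by auto
    moreover have "t \<noteq> 0" "t \<noteq> L" using a b calculation by auto
    ultimately show ?thesis by (intro exI[of _ t]) auto
  qed
  then obtain \<tau> where \<tau>: "\<And>j. 1 \<le> j \<Longrightarrow> j \<le> k \<Longrightarrow> 0 < \<tau> j \<and> \<tau> j < L \<and> \<theta> Es (\<tau> j) = real j * pi"
    by metis
  \<comment> \<open>Cell boundaries: the left end, the interior zeros of the left solution, the
    right end. On cell j the angle lies between j pi and (j+1) pi, so the solution has the sign
    (-1)^j there.\<close>
  define \<sigma> where "\<sigma> j = (if j = 0 then 0 else if j \<le> k then \<tau> j else L)" for j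
  have \<sigma>0: "\<sigma> 0 = 0" and \<sigma>k: "\<sigma> (Suc k) = L" by (auto simp: \<sigma>_def)
  have \<sigma>b: "0 \<le> \<sigma> j" "\<sigma> j \<le> L" for j using \<tau>[of j] L by (auto simp: \<sigma>_def)
  have \<sigma>lo: "real j * pi \<le> \<theta> Es (\<sigma> j)" if "j \<le> k" for j
    using \<tau>[of j] that th0[of Es] by (cases "j = 0") (auto simp: \<sigma>_def)
  have \<sigma>hi: "\<theta> Es (\<sigma> (Suc j)) \<le> real (Suc j) * pi" if "j \<le> k" for j
    using \<tau>[of "Suc j"] that kL(2) by (cases "j = k") (auto simp: \<sigma>_def algebra_simps)
  have \<sigma>lt: "\<sigma> j < \<sigma> (Suc j)" if "j \<le> k" for j
  proof (rule ccontr)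
    assume "\<not> \<sigma> j < \<sigma> (Suc j)"
    then have le: "\<sigma> (Suc j) \<le> \<sigma> j" by simp
    then have j0: "j \<noteq> 0" using \<tau>[of 1] L by (auto simp: \<sigma>_def split: if_splits)
    then have eq: "\<theta> Es (\<sigma> j) = real j * pi" "\<sigma> j < L" using \<tau>[of j] that by (auto simp: \<sigma>_def)
    then have "Suc j \<le> k" using le by (auto simp: \<sigma>_def split: if_splits)
    then have "\<theta> Es (\<sigma> (Suc j)) = real (Suc j) * pi" using \<tau>[of "Suc j"] by (auto simp: \<sigma>_def)
    with cross[of "Suc j" Es "\<sigma> (Suc j)" "\<sigma> j"] le eq(1)
    show False by (cases "\<sigma> (Suc j) = \<sigma> j") (auto simp: algebra_simps)
  qed
  have sgn: "0 < (-1) ^ j * w Es t" if "j \<le> k" "\<sigma> j < t" "t < \<sigma> (Suc j)" for j t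
  proof -
    have 1: "real j * pi < \<theta> Es t" by (rule cross[OF \<sigma>lo that(2)]) (use that in simp)
    have 2: "\<theta> Es t < real (Suc j) * pi"
      using cross[of "Suc j" Es t "\<sigma> (Suc j)"] \<sigma>hi[OF that(1)] that(3) by linarith
    have "0 < (-1) ^ j * sin (\<theta> Es t)" using sin_sign[OF 1] 2 by (simp add: algebra_simps)
    then have "0 < \<rho> Es t * ((-1) ^ j * sin (\<theta> Es t))" using \<rho> by simp
    then show ?thesis by (simp add: polar(1) algebra_simps)
  qed
  have nk: "n \<le> k"
  proof (rule ccontr)
    assume "\<not> n \<le> k"
    then have "\<exists>c. (\<exists>i\<in>{..<n}. c i \<noteq> 0) \<and> (\<forall>j<k. (\<Sum>i\<in>{..<n}. c i * v i (\<sigma> (Suc j) - X)) = 0)"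
      by (intro linear_system_kernel) auto
    then obtain c where c: "\<exists>i<n. c i \<noteq> 0" "\<And>j. j < k \<Longrightarrow> (\<Sum>i<n. c i * v i (\<sigma> (Suc j) - X)) = 0" by auto
    define f where "f x = (\<Sum>i<n. c i * v i x)" for x
    define f' where "f' x = (\<Sum>i<n. c i * v' i x)" for x
    have f: "test_function X f f'" unfolding f_def[abs_def] f'_def[abs_def] by (rule test_function_sum[OF v])
    have fz: "f (\<sigma> j - X) = 0" if jk: "j \<le> Suc k" for j
    proof -
      consider "j = 0" | "j = Suc k" | i where "j = Suc i" "i < k" using jk by (cases j) (auto simp: le_less)
      then show ?thesis
      proof cases
        case 1 then show ?thesis using test_functionD(4)[OF f, of "-X"] X by (simp add: \<sigma>0)
      next
        case 2 then show ?thesis using test_functionD(4)[OF f, of X] X by (simp add: \<sigma>k L_def)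
      next
        case 3 then show ?thesis using c(2) by (simp add: f_def)
      qed
    qed
    have cell: "0 \<le> energy (K Es) (\<sigma> j - X) (\<sigma> (Suc j) - X) f f'" if j: "j \<le> k" for j
    proof -
      let ?u = "\<lambda>x. (-1) ^ j * w Es (x + X)"
      let ?u' = "\<lambda>x. (-1) ^ j * w' Es (x + X)"
      have s: "solves (K Es) (\<lambda>x. w Es (x + X)) (\<lambda>x. w' Es (x + X))"
        using solves_shift[OF w, of Es X] by (simp add: KcE)
      have "?u' (\<sigma> (Suc j) - X) / ?u (\<sigma> (Suc j) - X) * (f (\<sigma> (Suc j) - X))\<^sup>2 -
          ?u' (\<sigma> j - X) / ?u (\<sigma> j - X) * (f (\<sigma> j - X))\<^sup>2 \<le> energy (K Es) (\<sigma> j - X) (\<sigma> (Suc j) - X) f f'"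
      proof (rule jacobi_inequality[OF _ _ _ _ _ _ f])
        show "(?u has_real_derivative ?u' x) (at x)" for x
          by (rule DERIV_cmult[OF solvesD(1)[OF s]])
        show "(?u' has_real_derivative (-1) ^ j * (K Es x * w Es (x + X))) (at x)" for x
          by (rule DERIV_cmult[OF solvesD(2)[OF s]])
        show "0 < ?u x" if "\<sigma> j - X < x" "x < \<sigma> (Suc j) - X" for x
          using sgn[OF j, of "x + X"] that by simp
        show "continuous_on {\<sigma> j - X..\<sigma> (Suc j) - X} (K Es)" by (rule continuous_on_subset[OF KEs]) simp
      qed (use \<sigma>lt[OF j] fz[of j] fz[of "Suc j"] j nz[of Es "\<sigma> j"] nz[of Es "\<sigma> (Suc j)"] in \<open>auto simp: algebra_simps\<close>)
      then show ?thesis using fz[of j] fz[of "Suc j"] j by simp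
    qed
    have "0 \<le> energy (K Es) (- X) (\<sigma> j - X) f f'" if "j \<le> Suc k" for j
      using that
    proof (induction j)
      case 0 then show ?case by (simp add: \<sigma>0 energy_def)
    next
      case (Suc j)
      have "energy (K Es) (- X) (\<sigma> (Suc j) - X) f f' =
        energy (K Es) (- X) (\<sigma> j - X) f f' + energy (K Es) (\<sigma> j - X) (\<sigma> (Suc j) - X) f f'"
        by (rule energy_split[OF KEs f]) (use \<sigma>b[of j] \<sigma>lt[of j] Suc in auto)
      then show ?case using Suc cell[of j] by simp
    qed
    from this[of "Suc k"] have "0 \<le> energy (K Es) (- X) X f f'" by (simp add: \<sigma>k L_def)
    then show False using en[OF c(1)] by (simp add: f_def[abs_def] f'_def[abs_def])
  qed
  \<comment> \<open>The solution decaying on the right has data proportional to (I E, -1) at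
    \<open>X\<close>, hence angle pi - arctan (I E) modulo pi. Where both angles agree modulo pi,
    the left solution decays on both sides.\<close>
  define \<eta> where "\<eta> E = pi - arctan (I E)" for E
  have c\<eta>: "continuous_on UNIV \<eta>" unfolding \<eta>_def by (intro continuous_intros I(1))
  have \<eta>: "pi / 2 < \<eta> E" "\<eta> E < pi" for E
    using arctan_ubound[of "I E"] I(2)[of E] by (auto simp: \<eta>_def)
  \<comment> \<open>At \<open>E0\<close> the coefficient is positive everywhere, so w w' cannot drop
    from its positive initial value; w' has no zero and the angle stays below pi/2.\<close>
  have lowE0: "\<theta> E0 L < pi / 2"
  proof (rule ccontr)
    assume "\<not> ?thesis"
    then obtain t where t: "0 \<le> t" "t \<le> L" "\<theta> E0 t = pi / 2"
      using IVT'[of "\<theta> E0" 0 "pi / 2" L] th0[of E0] L cth' by auto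
    have "w E0 0 * w' E0 0 \<le> w E0 t * w' E0 t"
    proof (rule DERIV_nonneg_imp_nondecreasing[OF t(1)])
      fix x :: real
      have "((\<lambda>x. w E0 x * w' E0 x) has_real_derivative (w' E0 x)\<^sup>2 + Kc E0 (x - X) * (w E0 x)\<^sup>2) (at x)"
        by (rule derivative_eq_intros solvesD(1,2)[OF w] refl)+ (simp add: power2_eq_square)
      moreover have "0 \<le> Kc E0 (x - X)" using low[of "x - X"] E0 by (simp add: Kc_def)
      ultimately show "\<exists>z. ((\<lambda>x. w E0 x * w' E0 x) has_real_derivative z) (at x) \<and> 0 \<le> z"
        by (intro exI[of _ "(w' E0 x)\<^sup>2 + Kc E0 (x - X) * (w E0 x)\<^sup>2"]) simp
    qed
    then show False using w0 J(2)[of E0] polar(2)[of E0 t] t(3) by simp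
  qed
  \<comment> \<open>The difference of the angles is negative at \<open>E0\<close> and exceeds (k-1)
    pi at \<open>Es\<close>; since n \<le> k it takes each of the values 0, pi, ..., (n-1) pi in
    between.\<close>
  have ex: "\<exists>E. E0 < E \<and> E < Es \<and> \<theta> E L - \<eta> E = real j * pi" if j: "j < n" for j
  proof -
    have a: "\<theta> E0 L - \<eta> E0 < real j * pi"
      using lowE0 \<eta>(1)[of E0] by (smt (verit) mult_nonneg_nonneg of_nat_0_le_iff pi_ge_zero)
    have "(real j + 1) * pi \<le> real k * pi" using j nk by (intro mult_right_mono) auto
    then have b: "real j * pi < \<theta> Es L - \<eta> Es" using kL(1) \<eta>(2)[of Es] by (simp add: algebra_simps)
    obtain E where "E0 \<le> E" "E \<le> Es" "\<theta> E L - \<eta> E = real j * pi"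
      using IVT'[of "\<lambda>E. \<theta> E L - \<eta> E" E0 "real j * pi" Es] a b E0
        continuous_on_subset[OF continuous_on_diff[OF cth[of L] c\<eta>], of "{E0..Es}"] by auto
    moreover have "E \<noteq> E0" "E \<noteq> Es" using a b calculation by auto
    ultimately show ?thesis by (intro exI[of _ E]) auto
  qed
  define \<epsilon> where "\<epsilon> j = (SOME E. E0 < E \<and> E < Es \<and> \<theta> E L - \<eta> E = real j * pi)" for j
  have \<epsilon>: "E0 < \<epsilon> j \<and> \<epsilon> j < Es \<and> \<theta> (\<epsilon> j) L - \<eta> (\<epsilon> j) = real j * pi" if "j < n" for j
    unfolding \<epsilon>_def by (rule someI_ex[OF ex[OF that]])
  have inj: "inj_on \<epsilon> {..<n}"
  proof (rule inj_onI)
    fix i j assume ij: "i \<in> {..<n}" "j \<in> {..<n}" and eq: "\<epsilon> i = \<epsilon> j"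
    have "\<theta> (\<epsilon> i) L - \<eta> (\<epsilon> i) = real i * pi" "\<theta> (\<epsilon> j) L - \<eta> (\<epsilon> j) = real j * pi"
      using ij by (auto intro: \<epsilon>[THEN conjunct2, THEN conjunct2])
    from this[unfolded eq] have "real i * pi = real j * pi" by (rule subst)
    then show "i = j" by simp
  qed
  have bs: "bound_state (K E)" if E: "E < Es" and q: "\<theta> E L - \<eta> E = real j * pi" for E j
  proof -
    define u where "u x = w E (x + X)" for x
    define u' where "u' x = w' E (x + X)" for x
    have s: "solves (K E) u u'"
      using solves_shift[OF w, of E X] E unfolding u_def u'_def by (simp add: KcE)
    have th: "\<theta> E L = real j * pi + (pi - arctan (I E))" using q by (simp add: \<eta>_def)
    \<comment> \<open>The factor by which the left solution at \<open>X\<close> multiplies the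
      normalised data (I E, -1); the sign comes from the j half turns.\<close>
    define \<sigma> where "\<sigma> = \<rho> E L * (-1) ^ j / sqrt (1 + (I E)\<^sup>2)"
    have \<sigma>nz: "\<sigma> \<noteq> 0" using \<rho>[of E L] by (simp add: \<sigma>_def) (smt (verit) zero_le_power2)
    have uX: "u X = \<sigma> * I E" "u' X = - \<sigma>"
    proof -
      have sc: "sin (\<theta> E L) = (-1) ^ j * (I E / sqrt (1 + (I E)\<^sup>2))"
        "cos (\<theta> E L) = - ((-1) ^ j * (1 / sqrt (1 + (I E)\<^sup>2)))"
        unfolding th by (simp_all add: sin_add cos_add sin_arctan cos_arctan)
      have "X + X = L" by (simp add: L_def)
      then have uw: "u X = w E L" "u' X = w' E L" by (simp_all only: u_def u'_def)
      show "u X = \<sigma> * I E" unfolding uw(1) polar(1) sc(1) \<sigma>_def by simp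
      show "u' X = - \<sigma>" unfolding uw(2) polar(2) sc(2) \<sigma>_def by simp
    qed
    have R: "0 \<le> u x / \<sigma> \<and> u' x / \<sigma> \<le> 0" if "X \<le> x" for x
    proof -
      have s1: "solves (\<lambda>t. Kc E (t + X)) (\<lambda>t. 1 / \<sigma> * u (t + X) + 0 * u (t + X)) (\<lambda>t. 1 / \<sigma> * u' (t + X) + 0 * u' (t + X))"
        using solves_combination[OF solves_shift[OF s, of X] solves_shift[OF s, of X], of "1 / \<sigma>" 0] E
        by (simp add: KcE)
      have "0 \<le> 1 / \<sigma> * u ((x - X) + X) + 0 * u ((x - X) + X) \<and> 1 / \<sigma> * u' ((x - X) + X) + 0 * u' ((x - X) + X) \<le> 0"
        by (rule I(3)[OF s1, of "x - X"]) (use uX \<sigma>nz that in auto)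
      then show ?thesis by simp
    qed
    have Lf: "0 \<le> u (- x) \<and> - u' (- x) \<le> 0" if "X \<le> x" for x
    proof -
      have s1: "solves (\<lambda>t. Kc E (- X - t)) (\<lambda>t. u (- X - t)) (\<lambda>t. - u' (- X - t))"
        using solves_reflect[OF s, of "- X"] E by (simp add: KcE)
      have "0 \<le> u (- X - (x - X)) \<and> - u' (- X - (x - X)) \<le> 0"
        by (rule J(3)[OF s1, of "x - X"]) (use w0 that in \<open>auto simp: u_def u'_def\<close>)
      then show ?thesis by simp
    qed
    have lb: "\<kappa> \<le> K E x" if "X \<le> \<bar>x\<bar>" for x using outc[OF that, of E] E by (simp add: KcE)
    have "l2_bounded u"
    proof (rule l2_bounded_halves[of u X])
      fix T assume T: "X \<le> T"
      have s1: "solves (K E) (\<lambda>t. 1 / \<sigma> * u t + 0 * u t) (\<lambda>t. 1 / \<sigma> * u' t + 0 * u' t)"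
        by (rule solves_combination[OF s s])
      have "integral {X..T} (\<lambda>x. (1 / \<sigma> * u x + 0 * u x)\<^sup>2)
        \<le> (1 / \<sigma> * u X + 0 * u X) * (- (1 / \<sigma> * u' X + 0 * u' X)) / \<kappa>"
        by (rule decaying_half_line[OF s1 KEs \<kappa> T]) (use R lb X in auto)
      then have "integral {X..T} (\<lambda>x. (1 / \<sigma>)\<^sup>2 * (u x)\<^sup>2) \<le> I E / \<kappa>"
        using uX \<sigma>nz by (simp add: power_divide)
      then have "(1 / \<sigma>)\<^sup>2 * integral {X..T} (\<lambda>x. (u x)\<^sup>2) \<le> I E / \<kappa>"
        by (simp only: integral_mult_right)
      then have "\<sigma>\<^sup>2 * ((1 / \<sigma>)\<^sup>2 * integral {X..T} (\<lambda>x. (u x)\<^sup>2)) \<le> \<sigma>\<^sup>2 * (I E / \<kappa>)"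
        by (rule mult_left_mono) simp
      then show "integral {X..T} (\<lambda>x. (u x)\<^sup>2) \<le> \<sigma>\<^sup>2 * (I E / \<kappa>)"
        using \<sigma>nz by (simp add: power_divide)
      have "integral {X..T} (\<lambda>x. (u (0 - x))\<^sup>2) \<le> u (0 - X) * (- (- u' (0 - X))) / \<kappa>"
        by (rule decaying_half_line[OF solves_reflect[OF s, of 0] _ \<kappa> T])
          (use Lf lb X in \<open>auto intro!: continuous_intros continuous_on_compose2[OF KEs]\<close>)
      then show "integral {X..T} (\<lambda>x. (u (- x))\<^sup>2) \<le> u (0 - X) * (- (- u' (0 - X))) / \<kappa>" by simp
    qed (use X solvesD(3)[OF s] in auto)
    moreover have "u (- X) \<noteq> 0" using w0 J(2)[of E] by (simp add: u_def)
    ultimately show ?thesis unfolding bound_state_def using s by blast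
  qed
  show ?thesis
  proof (intro exI[of _ "\<epsilon> ` {..<n}"] conjI ballI)
    show "card (\<epsilon> ` {..<n}) = n" using card_image[OF inj] by simp
    fix E assume "E \<in> \<epsilon> ` {..<n}"
    then obtain j where j: "j < n" "E = \<epsilon> j" by auto
    note e = \<epsilon>[OF j(1), folded j(2)]
    show "E0 < E" by (rule e[THEN conjunct1])
    show lt: "E < Es" by (rule e[THEN conjunct2, THEN conjunct1])
    show "bound_state (K E)" by (rule bs[OF lt e[THEN conjunct2, THEN conjunct2]])
  qed simp
qed

section \<open>Eigenvalues and bound states\<close>

text \<open>In each of the two products one solution decays exponentially while the derivative of
  the other does not grow.\<close>

lemma wronskian_decay:
  assumes u: "solves k u u'" "l2_bounded u" and v: "solves l v v'" "l2_bounded v"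
    and k: "\<And>x. X \<le> x \<Longrightarrow> m\<^sup>2 \<le> 2 * k x" and l: "\<And>x. X \<le> x \<Longrightarrow> m\<^sup>2 \<le> 2 * l x" and m: "0 < m"
    and x: "X \<le> x"
  shows "(u x * v' x - u' x * v x)\<^sup>2 \<le> 2 * ((u X)\<^sup>2 * (v' X)\<^sup>2 + (u' X)\<^sup>2 * (v X)\<^sup>2) * exp (- m * (x - X))"
proof -
  note du = l2_solution_decay[OF u k m order_refl x] and dv = l2_solution_decay[OF v l m order_refl x]
  have "(u x)\<^sup>2 * (v' x)\<^sup>2 \<le> ((u X)\<^sup>2 * exp (- m * (x - X))) * (v' X)\<^sup>2"
    by (intro mult_mono du dv) auto
  moreover have "(u' x)\<^sup>2 * (v x)\<^sup>2 \<le> (u' X)\<^sup>2 * ((v X)\<^sup>2 * exp (- m * (x - X)))"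
    by (intro mult_mono du dv) auto
  moreover have "(u x * v' x - u' x * v x)\<^sup>2 \<le> 2 * ((u x)\<^sup>2 * (v' x)\<^sup>2 + (u' x)\<^sup>2 * (v x)\<^sup>2)"
    using zero_le_power2[of "u x * v' x + u' x * v x"] by (simp add: power2_eq_square algebra_simps)
  ultimately have "(u x * v' x - u' x * v x)\<^sup>2 \<le> 2 * (((u X)\<^sup>2 * exp (- m * (x - X))) * (v' X)\<^sup>2 +
      (u' X)\<^sup>2 * ((v X)\<^sup>2 * exp (- m * (x - X))))"
    by (elim order_trans) (intro mult_left_mono add_mono, simp_all)
  then show ?thesis by (simp add: algebra_simps)
qed

lemma exp_decay_tendsto_0: "0 < m \<Longrightarrow> ((\<lambda>x. C * exp (- m * (x - X))) \<longlongrightarrow> 0) at_top" for m C X :: real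
  by real_asymp

lemma wronskian_tendsto_0:
  assumes u: "solves k u u'" "l2_bounded u" and v: "solves l v v'" "l2_bounded v"
    and k: "\<And>x. X \<le> x \<Longrightarrow> m\<^sup>2 \<le> 2 * k x" and l: "\<And>x. X \<le> x \<Longrightarrow> m\<^sup>2 \<le> 2 * l x" and m: "0 < m"
  shows "((\<lambda>x. u x * v' x - u' x * v x) \<longlongrightarrow> 0) at_top"
proof -
  have "((\<lambda>x. (u x * v' x - u' x * v x)\<^sup>2) \<longlongrightarrow> 0) at_top"
  proof (rule tendsto_sandwich[OF _ _ tendsto_const exp_decay_tendsto_0[OF m]])
    show "\<forall>\<^sub>F x in at_top. (u x * v' x - u' x * v x)\<^sup>2 \<le>
      2 * ((u X)\<^sup>2 * (v' X)\<^sup>2 + (u' X)\<^sup>2 * (v X)\<^sup>2) * exp (- m * (x - X))"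
      using eventually_ge_at_top[of X] by eventually_elim (rule wronskian_decay[OF u v k l m])
  qed simp
  from tendsto_real_sqrt[OF this] have "((\<lambda>x. \<bar>u x * v' x - u' x * v x\<bar>) \<longlongrightarrow> 0) at_top" by simp
  then show ?thesis by (rule tendsto_rabs_zero_cancel)
qed

text \<open>The Wronskian of two square-integrable solutions is constant and tends to 0, hence
  vanishes. This is the simplicity of the eigenvalues.\<close>

lemma bound_states_proportional:
  assumes kc: "continuous_on UNIV k" and u: "solves k u u'" "l2_bounded u" and nz: "u x0 \<noteq> 0"
    and v: "solves k v v'" "l2_bounded v"
    and k: "\<And>x. X \<le> x \<Longrightarrow> m\<^sup>2 \<le> 2 * k x" and m: "0 < m"
  shows "\<exists>c. \<forall>x. v x = c * u x"
proof -
  have "u x * v' x - u' x * v x = 0" for x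
  proof -
    have "((\<lambda>y. u y * v' y - u' y * v y) \<longlongrightarrow> 0) at_top"
      by (rule wronskian_tendsto_0[OF u v k k m])
    moreover have "(\<lambda>y. u y * v' y - u' y * v y) = (\<lambda>y. u x * v' x - u' x * v x)"
      by (rule ext) (rule wronskian_const[OF u(1) v(1)])
    ultimately have "((\<lambda>y::real. u x * v' x - u' x * v x) \<longlongrightarrow> 0) at_top" by (simp only:)
    then show ?thesis using tendsto_const_iff[OF trivial_limit_at_top_linorder] by blast
  qed
  then have "u x0 * v' x0 = u' x0 * v x0" by simp
  from solves_proportional[OF kc u(1) v(1) this] nz show ?thesis by blast
qed

text \<open>The coefficient that brings the eigenvalue equation -(h^2/2) u'' + V u = E u into the
  form u'' = k u.\<close>

definition schroedinger_coeff :: "real \<Rightarrow> (real \<Rightarrow> real) \<Rightarrow> real \<Rightarrow> real \<Rightarrow> real" where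
  "schroedinger_coeff h V E x = 2 * (V x - E) / h\<^sup>2"

lemma continuous_schroedinger_coeff:
  "continuous_on A V \<Longrightarrow> continuous_on A (schroedinger_coeff h V E)"
  unfolding schroedinger_coeff_def by (cases "h = 0") (auto intro!: continuous_intros)

text \<open>Elements of the domain satisfy the equation only almost everywhere, with u' an
  indefinite integral. But the equation makes u'' almost everywhere equal to the continuous function
  k u, so u' is continuously differentiable. As k is real, real and imaginary parts solve the
  equation separately.\<close>

lemma eigenspace_classical:
  assumes h: "0 < h" and V: "continuous_on UNIV V" and u: "u \<in> eigenspace h V E"
  obtains u' where "solves (schroedinger_coeff h V E) (\<lambda>x. Re (u x)) (\<lambda>x. Re (u' x))"
    "solves (schroedinger_coeff h V E) (\<lambda>x. Im (u x)) (\<lambda>x. Im (u' x))"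
    "l2_bounded (\<lambda>x. Re (u x))" "l2_bounded (\<lambda>x. Im (u x))"
proof -
  let ?k = "schroedinger_coeff h V E"
  have k: "continuous_on A ?k" for A by (rule continuous_schroedinger_coeff[OF continuous_on_subset[OF V]]) simp
  obtain u' u'' where L2: "u \<in> L2" and u': "\<And>x. (u has_vector_derivative u' x) (at x)"
    and u'': "\<And>a b. a \<le> b \<Longrightarrow> set_integrable lebesgue {a..b} u'' \<and>
           u' b - u' a = set_lebesgue_integral lebesgue {a..b} u''"
    and eq: "AE x in lebesgue. of_real E * u x = - of_real (h\<^sup>2 / 2) * u'' x + of_real (V x) * u x"
    using u unfolding eigenspace_def schroedinger_def by auto
  define g where "g x = of_real (?k x) * u x" for x
  have cu: "continuous_on A u" for A
    by (meson u' continuous_on_eq_continuous_within has_vector_derivative_continuous has_vector_derivative_at_within)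
  have cg: "continuous_on A g" for A unfolding g_def by (intro continuous_intros k cu)
  have AEg: "AE x in lebesgue. u'' x = g x"
    using eq
  proof eventually_elim
    case (elim x)
    have hz: "(of_real h :: complex) \<noteq> 0" using h by simp
    have "of_real (h\<^sup>2 / 2) * u'' x = of_real (V x - E) * u x"
      using elim by (simp add: algebra_simps)
    then show ?case using hz
      by (simp add: g_def schroedinger_coeff_def field_simps)
  qed
  have inc: "u' b - u' a = integral {a..b} g" if "a \<le> b" for a b
  proof -
    have sg: "set_integrable lebesgue {a..b} g" by (rule absolutely_integrable_continuous_real[OF cg])
    have "set_lebesgue_integral lebesgue {a..b} u'' = set_lebesgue_integral lebesgue {a..b} g"
      unfolding set_lebesgue_integral_def
    proof (rule integral_cong_AE)
      show "(\<lambda>x. indicator {a..b} x *\<^sub>R u'' x) \<in> borel_measurable lebesgue"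
        using u''[OF that] unfolding set_integrable_def by (intro borel_measurable_integrable) simp
      show "(\<lambda>x. indicator {a..b} x *\<^sub>R g x) \<in> borel_measurable lebesgue"
        using sg unfolding set_integrable_def by (rule borel_measurable_integrable)
      show "AE x in lebesgue. indicator {a..b} x *\<^sub>R u'' x = indicator {a..b} x *\<^sub>R g x"
        using AEg by eventually_elim simp
    qed
    then show ?thesis using u''[OF that] set_lebesgue_integral_eq_integral(2)[OF sg] by simp
  qed
  have du': "(u' has_vector_derivative g x) (at x)" for x
  proof -
    have "((\<lambda>y. u' (x - 1) + integral {x - 1..y} g) has_vector_derivative g x) (at x within {x - 1..x + 1})"
      using integral_has_vector_derivative[OF cg, of x "x - 1" "x + 1"]
      by (auto intro!: derivative_eq_intros)
    then have "((\<lambda>y. u' (x - 1) + integral {x - 1..y} g) has_vector_derivative g x) (at x)"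
      by (simp add: at_within_Icc_at)
    then show ?thesis
      by (rule has_vector_derivative_transform_within_open[of _ _ _ "{x - 1<..<x + 1}"])
        (auto simp: inc[symmetric])
  qed
  have bd: "l2_bounded p" if p: "continuous_on UNIV p" "\<And>x. \<bar>p x\<bar> \<le> cmod (u x)" for p
    unfolding l2_bounded_def
  proof (intro exI allI)
    fix a b :: real
    have int: "integrable lebesgue (\<lambda>x. (cmod (u x))\<^sup>2)" using L2 by (auto simp: L2_def)
    have si: "set_integrable lebesgue {a..b} (\<lambda>x. (cmod (u x))\<^sup>2)"
      by (rule absolutely_integrable_continuous_real) (intro continuous_intros cu)
    have "integral {a..b} (\<lambda>x. (p x)\<^sup>2) \<le> integral {a..b} (\<lambda>x. (cmod (u x))\<^sup>2)"
      using p(2) by (intro integral_le integrable_continuous_real continuous_intros cu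
          continuous_on_subset[OF p(1)]) (auto simp: abs_le_square_iff[symmetric])
    also have "\<dots> = (LINT x:{a..b}|lebesgue. (cmod (u x))\<^sup>2)"
      using set_lebesgue_integral_eq_integral(2)[OF si] by simp
    also have "\<dots> \<le> (LINT x|lebesgue. (cmod (u x))\<^sup>2)"
      unfolding set_lebesgue_integral_def
      using si int unfolding set_integrable_def by (intro integral_mono) (auto simp: indicator_def)
    finally show "integral {a..b} (\<lambda>x. (p x)\<^sup>2) \<le> (LINT x|lebesgue. (cmod (u x))\<^sup>2)" .
  qed
  show thesis
  proof (rule that[of u'])
    show "solves ?k (\<lambda>x. Re (u x)) (\<lambda>x. Re (u' x))"
      unfolding solves_def has_real_derivative_iff_has_vector_derivative
      using bounded_linear.has_vector_derivative[OF bounded_linear_Re u']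
        bounded_linear.has_vector_derivative[OF bounded_linear_Re du'] by (simp add: g_def)
    show "solves ?k (\<lambda>x. Im (u x)) (\<lambda>x. Im (u' x))"
      unfolding solves_def has_real_derivative_iff_has_vector_derivative
      using bounded_linear.has_vector_derivative[OF bounded_linear_Im u']
        bounded_linear.has_vector_derivative[OF bounded_linear_Im du'] by (simp add: g_def)
    show "l2_bounded (\<lambda>x. Re (u x))" by (rule bd) (auto intro!: continuous_intros cu abs_Re_le_cmod)
    show "l2_bounded (\<lambda>x. Im (u x))" by (rule bd) (auto intro!: continuous_intros cu abs_Im_le_cmod)
  qed
qed

text \<open>Monotone convergence along the intervals from -j to j.\<close>

lemma l2_bounded_integrable:
  assumes c: "continuous_on UNIV r" and b: "l2_bounded r"
  shows "integrable lebesgue (\<lambda>x. (r x)\<^sup>2)"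
proof -
  obtain B where B: "\<And>a b. integral {a..b} (\<lambda>x. (r x)\<^sup>2) \<le> B" using b by (auto simp: l2_bounded_def)
  have i: "(\<lambda>x. (r x)\<^sup>2) integrable_on {a..b}" for a b
    by (intro integrable_continuous_real continuous_intros continuous_on_subset[OF c]) simp
  define f where "f j x = (if x \<in> {-real j..real j} then (r x)\<^sup>2 else 0)" for j :: nat and x
  have fi: "integral UNIV (f j) = integral {-real j..real j} (\<lambda>x. (r x)\<^sup>2)" for j
    unfolding f_def by (rule integral_restrict_UNIV)
  have "(\<lambda>x. (r x)\<^sup>2) integrable_on UNIV \<and> ((\<lambda>j. integral UNIV (f j)) \<longlonglongrightarrow> integral UNIV (\<lambda>x. (r x)\<^sup>2))"
  proof (rule monotone_convergence_increasing)
    show "f j integrable_on UNIV" for j unfolding f_def integrable_restrict_UNIV by (rule i)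
    show "f j x \<le> f (Suc j) x" for j x by (auto simp: f_def)
    show "(\<lambda>j. f j x) \<longlonglongrightarrow> (r x)\<^sup>2" for x
    proof (rule tendsto_eventually)
      have "\<forall>\<^sub>F j in sequentially. \<bar>x\<bar> \<le> real j"
        by (rule eventually_sequentiallyI[of "nat \<lceil>\<bar>x\<bar>\<rceil>"]) linarith
      then show "\<forall>\<^sub>F j in sequentially. f j x = (r x)\<^sup>2"
        by eventually_elim (auto simp: f_def)
    qed
    have "\<bar>integral UNIV (f j)\<bar> \<le> B" for j
      unfolding fi using B[of "-real j" "real j"]
        Henstock_Kurzweil_Integration.integral_nonneg[OF i[of "-real j" "real j"]] by simp
    then show "bounded (range (\<lambda>j. integral UNIV (f j)))" by (auto simp: bounded_iff)
  qed
  then have "set_integrable lebesgue UNIV (\<lambda>x. (r x)\<^sup>2)"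
    by (intro nonnegative_absolutely_integrable_1) auto
  then show ?thesis by (simp add: set_integrable_def)
qed

lemma bound_state_eigenspace:
  assumes h: "0 < h" and V: "continuous_on UNIV V" and r: "solves (schroedinger_coeff h V E) r r'" "l2_bounded r"
  shows "(\<lambda>x. c * of_real (r x)) \<in> eigenspace h V E"
proof -
  let ?k = "schroedinger_coeff h V E"
  have k: "continuous_on A ?k" for A by (rule continuous_schroedinger_coeff[OF continuous_on_subset[OF V]]) simp
  have cr: "continuous_on A r" for A by (rule solvesD(3)[OF r(1)])
  have L2: "(\<lambda>x. d * of_real (r x)) \<in> L2" for d :: complex
  proof -
    have "continuous_on UNIV (\<lambda>x. d * of_real (r x))" by (intro continuous_intros cr)
    then have "(\<lambda>x. d * of_real (r x)) \<in> borel_measurable lebesgue"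
      by (intro measurable_completion) (simp add: borel_measurable_continuous_onI)
    moreover have "integrable lebesgue (\<lambda>x. (cmod (d * of_real (r x)))\<^sup>2)"
      using l2_bounded_integrable[OF cr r(2)] by (simp add: norm_mult power_mult_distrib)
    ultimately show ?thesis by (simp add: L2_def)
  qed
  let ?u' = "\<lambda>x. c * complex_of_real (r' x)" and ?u'' = "\<lambda>x. c * complex_of_real (?k x * r x)"
  have d: "((\<lambda>x. c * complex_of_real (f x)) has_vector_derivative c * of_real f') (at x within A)"
    if "(f has_real_derivative f') (at x within A)" for f f' x A
    using that unfolding has_real_derivative_iff_has_vector_derivative
    by (intro has_vector_derivative_mult_right bounded_linear.has_vector_derivative[OF bounded_linear_of_real])
  have cu'': "continuous_on A ?u''" for A by (intro continuous_intros k cr)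
  have "schroedinger h V (\<lambda>x. c * of_real (r x)) (\<lambda>x. of_real E * (c * of_real (r x)))"
    unfolding schroedinger_def
  proof (rule conjI[OF L2], rule conjI[rotated], rule exI[of _ ?u'], rule exI[of _ ?u''], intro conjI allI impI)
    show "(\<lambda>x. of_real E * (c * of_real (r x))) \<in> L2" using L2[of "of_real E * c"] by (simp add: mult.assoc)
    show "((\<lambda>x. c * of_real (r x)) has_vector_derivative ?u' x) (at x)" for x
      by (rule d[OF solvesD(1)[OF r(1)]])
    fix a b :: real assume ab: "a \<le> b"
    show si: "set_integrable lebesgue {a..b} ?u''" by (rule absolutely_integrable_continuous_real[OF cu''])
    have "(?u'' has_integral ?u' b - ?u' a) {a..b}"
      by (rule fundamental_theorem_of_calculus[OF ab]) (rule d[OF solvesD(2)[OF r(1)]])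
    from integral_unique[OF this]
    show "?u' b - ?u' a = set_lebesgue_integral lebesgue {a..b} ?u''"
      unfolding set_lebesgue_integral_eq_integral(2)[OF si] by (rule sym)
  next
    show "AE x in lebesgue. of_real E * (c * of_real (r x)) =
        - of_real (h\<^sup>2 / 2) * ?u'' x + of_real (V x) * (c * of_real (r x))"
    proof (rule AE_I2)
      fix x
      have "h\<^sup>2 / 2 * (?k x * r x) = (V x - E) * r x" using h by (simp add: schroedinger_coeff_def)
      then have "complex_of_real (h\<^sup>2 / 2) * (complex_of_real (?k x * r x)) = of_real ((V x - E) * r x)"
        by (metis of_real_mult)
      then have "- of_real (h\<^sup>2 / 2) * ?u'' x = - (c * of_real ((V x - E) * r x))"
        by (simp only: mult.left_commute[of _ c] mult_minus_left mult_minus_right)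
      then show "of_real E * (c * of_real (r x)) =
        - of_real (h\<^sup>2 / 2) * ?u'' x + of_real (V x) * (c * of_real (r x))"
        by (simp add: algebra_simps)
    qed
  qed
  then show ?thesis by (simp add: eigenspace_def)
qed

lemma eigenvalues_iff:
  assumes h: "0 < h" and V: "continuous_on UNIV V"
  shows "E \<in> eigenvalues h V \<longleftrightarrow> bound_state (schroedinger_coeff h V E)"
proof
  assume "E \<in> eigenvalues h V"
  then obtain u where u: "u \<in> eigenspace h V E" "u \<noteq> 0" by (auto simp: eigenvalues_def)
  then obtain x where x: "Re (u x) \<noteq> 0 \<or> Im (u x) \<noteq> 0" by (auto simp: fun_eq_iff complex_eq_iff)
  show "bound_state (schroedinger_coeff h V E)"
    by (rule eigenspace_classical[OF h V u(1)]) (use x in \<open>unfold bound_state_def, blast\<close>)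
next
  assume "bound_state (schroedinger_coeff h V E)"
  then obtain r r' x where r: "solves (schroedinger_coeff h V E) r r'" "l2_bounded r" "r x \<noteq> 0"
    unfolding bound_state_def by blast
  have "(\<lambda>x. complex_of_real (r x)) \<in> eigenspace h V E"
    using bound_state_eigenspace[OF h V r(1,2), of 1] by simp
  moreover have "(\<lambda>x. complex_of_real (r x)) \<noteq> 0" using r(3) by (auto simp: fun_eq_iff)
  ultimately show "E \<in> eigenvalues h V" unfolding eigenvalues_def by blast
qed

text \<open>Real and imaginary parts of any eigenfunction are real multiples of one real bound
  state, so the eigenspace is a complex line. The trace therefore carries no weights.\<close>

lemma multiplicity_eigenvalue:
  assumes h: "0 < h" and V: "continuous_on UNIV V" and lim: "filterlim V at_top at_top"
    and E: "E \<in> eigenvalues h V"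
  shows "multiplicity h V E = 1"
proof -
  let ?k = "schroedinger_coeff h V E"
  have kc: "continuous_on UNIV ?k" by (rule continuous_schroedinger_coeff[OF V])
  obtain r r' x0 where r: "solves ?k r r'" "l2_bounded r" "r x0 \<noteq> 0"
    using E unfolding eigenvalues_iff[OF h V] bound_state_def by blast
  \<comment> \<open>V - E \<ge> h^2 makes the coefficient at least 2, so 1 is an admissible decay
    rate.\<close>
  obtain X where X: "\<And>x. X \<le> x \<Longrightarrow> E + h\<^sup>2 \<le> V x"
    using lim unfolding filterlim_at_top eventually_at_top_linorder by blast
  have k: "1\<^sup>2 \<le> 2 * ?k x" if "X \<le> x" for x
  proof -
    have "h\<^sup>2 + E * 4 \<le> V x * 4" using X[OF that] zero_le_power2[of h] by linarith
    then show ?thesis using h by (simp add: schroedinger_coeff_def field_simps)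
  qed
  interpret vector_space "\<lambda>(c::complex) (u::real \<Rightarrow> complex) x. c * u x" by (rule vector_space_fun)
  define \<phi> where "\<phi> x = complex_of_real (r x)" for x
  have \<phi>0: "\<phi> \<noteq> 0" using r(3) by (auto simp: \<phi>_def fun_eq_iff)
  have "dim (eigenspace h V E) = 1"
  proof (rule dim_unique[of "{\<phi>}"])
    show "{\<phi>} \<subseteq> eigenspace h V E"
      using bound_state_eigenspace[OF h V r(1,2), of 1] by (simp add: \<phi>_def[abs_def])
    show "eigenspace h V E \<subseteq> span {\<phi>}"
    proof
      fix u assume u: "u \<in> eigenspace h V E"
      show "u \<in> span {\<phi>}"
      proof (rule eigenspace_classical[OF h V u])
        fix u' assume s: "solves ?k (\<lambda>x. Re (u x)) (\<lambda>x. Re (u' x))" "solves ?k (\<lambda>x. Im (u x)) (\<lambda>x. Im (u' x))"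
          "l2_bounded (\<lambda>x. Re (u x))" "l2_bounded (\<lambda>x. Im (u x))"
        obtain a where a: "\<And>x. Re (u x) = a * r x"
          using bound_states_proportional[OF kc r s(1,3) k] by auto
        obtain b where b: "\<And>x. Im (u x) = b * r x"
          using bound_states_proportional[OF kc r s(2,4) k] by auto
        have "u = (\<lambda>x. Complex a b * \<phi> x)"
          by (rule ext) (simp add: complex_eq_iff a b \<phi>_def)
        then show ?thesis using span_scale[OF span_base[of \<phi> "{\<phi>}"], of "Complex a b"] by simp
      qed
    qed
    show "independent {\<phi>}" using \<phi>0 by simp
  qed simp
  then show ?thesis by (simp add: multiplicity_def)
qed

section \<open>Truncated bound states as negative directions\<close>

lemma DERIV_glue_at:
  fixes f g :: "real \<Rightarrow> real"
  assumes f: "(f has_real_derivative D) (at a)" and g: "(g has_real_derivative D) (at a)" and fg: "f a = g a"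
  shows "((\<lambda>x. if x \<le> a then f x else g x) has_real_derivative D) (at a)"
proof -
  let ?h = "\<lambda>x. if x \<le> a then f x else g x"
  have "(?h has_real_derivative D) (at a within {..a})"
    by (rule has_field_derivative_transform_within[OF has_field_derivative_at_within[OF f] zero_less_one]) auto
  moreover have "(?h has_real_derivative D) (at a within {a..})"
    by (rule has_field_derivative_transform_within[OF has_field_derivative_at_within[OF g] zero_less_one])
      (use fg in \<open>auto simp: not_le\<close>)
  ultimately have "(?h has_real_derivative D) (at a within {..a} \<union> {a..})"
    unfolding has_field_derivative_iff by (simp only: Lim_within_Un)
  moreover have "{..a} \<union> {a..} = (UNIV :: real set)" by auto
  ultimately show ?thesis by simp
qed

lemma DERIV_glue:
  fixes f g :: "real \<Rightarrow> real"
  assumes f: "\<And>x. x \<le> a \<Longrightarrow> (f has_real_derivative f' x) (at x)"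
    and g: "\<And>x. a \<le> x \<Longrightarrow> (g has_real_derivative g' x) (at x)"
    and fg: "f a = g a" "f' a = g' a"
  shows "((\<lambda>x. if x \<le> a then f x else g x) has_real_derivative (if x \<le> a then f' x else g' x)) (at x)"
proof -
  let ?h = "\<lambda>x. if x \<le> a then f x else g x"
  consider "x < a" | "x = a" | "a < x" by linarith
  then show ?thesis
  proof cases
    case 1
    have "(?h has_real_derivative f' x) (at x)"
      by (rule has_field_derivative_transform_within_open[OF f open_lessThan[of a]]) (use 1 in auto)
    then show ?thesis using 1 by simp
  next
    case 3
    have "(?h has_real_derivative g' x) (at x)"
      by (rule has_field_derivative_transform_within_open[OF g open_greaterThan[of a]]) (use 3 in auto)
    then show ?thesis using 3 by simp
  next
    case 2
    have "(?h has_real_derivative f' a) (at a)"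
      by (rule DERIV_glue_at) (use f[of a] g[of a] fg in auto)
    then show ?thesis using 2 by simp
  qed
qed

lemma continuous_glue:
  fixes f g :: "real \<Rightarrow> real"
  assumes "continuous_on {..a} f" "continuous_on {a..} g" "f a = g a"
  shows "continuous_on UNIV (\<lambda>x. if x \<le> a then f x else g x)"
proof -
  have "continuous_on ({..a} \<union> {a..}) (\<lambda>x. if x \<le> a then f x else g x)"
    by (rule continuous_on_cases) (use assms in auto)
  moreover have "{..a} \<union> {a..} = (UNIV :: real set)" by auto
  ultimately show ?thesis by simp
qed

text \<open>The cubic 3t^2 - 2t^3 is flat to first order at 0 and 1 and has slope at most 3/2. Class
  C^1 is all that multiplying a test function asks for.\<close>

lemma smooth_step_exists:
  obtains \<psi> \<psi>' :: "real \<Rightarrow> real" where "\<And>t. (\<psi> has_real_derivative \<psi>' t) (at t)" "continuous_on UNIV \<psi>'"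
    "\<And>t. t \<le> 0 \<Longrightarrow> \<psi> t = 0" "\<And>t. 1 \<le> t \<Longrightarrow> \<psi> t = 1" "\<And>t. 0 \<le> \<psi> t \<and> \<psi> t \<le> 1" "\<And>t. \<bar>\<psi>' t\<bar> \<le> 2"
proof -
  define p where "p t = (if t \<le> 1 then 3 * t\<^sup>2 - 2 * t ^ 3 else (1::real))" for t
  define p' where "p' t = (if t \<le> 1 then 6 * t - 6 * t\<^sup>2 else (0::real))" for t
  define \<psi> where "\<psi> t = (if t \<le> 0 then 0 else p t)" for t
  define \<psi>' where "\<psi>' t = (if t \<le> 0 then 0 else p' t)" for t
  have p: "(p has_real_derivative p' t) (at t)" for t
    unfolding p_def[abs_def] p'_def
    by (rule DERIV_glue) (auto intro!: derivative_eq_intros simp: power2_eq_square)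
  have cp: "continuous_on UNIV p'"
    unfolding p'_def[abs_def] by (rule continuous_glue) (auto intro!: continuous_intros)
  show thesis
  proof (rule that[of \<psi> \<psi>'])
    show "(\<psi> has_real_derivative \<psi>' t) (at t)" for t
      unfolding \<psi>_def[abs_def] \<psi>'_def
      by (rule DERIV_glue) (rule DERIV_const p | simp add: p_def p'_def)+
    show "continuous_on UNIV \<psi>'"
      unfolding \<psi>'_def[abs_def]
      by (rule continuous_glue) (rule continuous_on_const continuous_on_subset[OF cp] | simp add: p'_def)+
    show "\<psi> t = 0" if "t \<le> 0" for t using that by (simp add: \<psi>_def)
    show "\<psi> t = 1" if "1 \<le> t" for t using that by (cases "t = 1") (auto simp: \<psi>_def p_def)
    show "0 \<le> \<psi> t \<and> \<psi> t \<le> 1" for t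
    proof (cases "0 < t \<and> t \<le> 1")
      case True
      have 1: "3 * t\<^sup>2 - 2 * t ^ 3 = t\<^sup>2 * (3 - 2 * t)" "3 * t\<^sup>2 - 2 * t ^ 3 = 1 - (1 - t)\<^sup>2 * (1 + 2 * t)"
        by (simp_all add: power2_eq_square power3_eq_cube algebra_simps)
      have lo: "0 \<le> 3 * t\<^sup>2 - 2 * t ^ 3" unfolding 1(1) using True by (intro mult_nonneg_nonneg) auto
      have "0 \<le> (1 - t)\<^sup>2 * (1 + 2 * t)" using True by (intro mult_nonneg_nonneg) auto
      then have "3 * t\<^sup>2 - 2 * t ^ 3 \<le> 1" unfolding 1(2) by linarith
      then show ?thesis using lo True by (simp add: \<psi>_def p_def)
    qed (auto simp: \<psi>_def p_def)
    show "\<bar>\<psi>' t\<bar> \<le> 2" for t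
    proof (cases "0 < t \<and> t \<le> 1")
      case True
      have 1: "6 * t - 6 * t\<^sup>2 = 6 * (t * (1 - t))" "6 * t - 6 * t\<^sup>2 = 3 / 2 - 6 * (t - 1 / 2)\<^sup>2"
        by (simp_all add: power2_eq_square algebra_simps)
      have "0 \<le> t * (1 - t)" "0 \<le> (t - 1 / 2)\<^sup>2" using True by auto
      then have "0 \<le> 6 * t - 6 * t\<^sup>2" "6 * t - 6 * t\<^sup>2 \<le> 2" using 1 by linarith+
      then show ?thesis using True by (simp add: \<psi>'_def p'_def)
    qed (auto simp: \<psi>'_def p'_def)
  qed
qed

lemma cutoff_exists:
  fixes b y :: real
  assumes b: "0 \<le> b" "b < y"
  obtains \<phi> \<phi>' :: "real \<Rightarrow> real" where "\<And>x. (\<phi> has_real_derivative \<phi>' x) (at x)" "continuous_on UNIV \<phi>'"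
    "\<And>x. \<bar>x\<bar> \<le> b \<Longrightarrow> \<phi> x = 1" "\<And>x. \<bar>x\<bar> < b \<Longrightarrow> \<phi>' x = 0" "\<And>x. y \<le> \<bar>x\<bar> \<Longrightarrow> \<phi> x = 0"
    "\<And>x. 0 \<le> \<phi> x \<and> \<phi> x \<le> 1" "\<And>x. \<bar>\<phi>' x\<bar> \<le> 4 / (y - b)"
proof -
  obtain \<psi> \<psi>' :: "real \<Rightarrow> real" where \<psi>: "\<And>t. (\<psi> has_real_derivative \<psi>' t) (at t)" "continuous_on UNIV \<psi>'"
    "\<And>t. t \<le> 0 \<Longrightarrow> \<psi> t = 0" "\<And>t. 1 \<le> t \<Longrightarrow> \<psi> t = 1" "\<And>t. 0 \<le> \<psi> t \<and> \<psi> t \<le> 1" "\<And>t. \<bar>\<psi>' t\<bar> \<le> 2"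
    by (rule smooth_step_exists) (rule that)
  define s where "s = y - b"
  have s: "0 < s" using b by (simp add: s_def)
  \<comment> \<open>One step falls to 0 at \<open>y\<close>, the other at \<open>- y\<close>. The
    product rule yields two terms of size at most 2/s, hence the constant 4.\<close>
  define \<phi> where "\<phi> x = \<psi> ((y - x) / s) * \<psi> ((y + x) / s)" for x
  define \<phi>' where "\<phi>' x = (\<psi>' ((y + x) / s) * \<psi> ((y - x) / s) - \<psi>' ((y - x) / s) * \<psi> ((y + x) / s)) / s" for x
  have c\<psi>: "continuous_on UNIV \<psi>" by (rule DERIV_continuous_on[OF has_field_derivative_at_within[OF \<psi>(1)]])
  have d: "(\<phi> has_real_derivative \<phi>' x) (at x)" for x
  proof -
    have 1: "((\<lambda>x. (y - x) / s) has_real_derivative - 1 / s) (at x)"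
      using s by (auto intro!: derivative_eq_intros)
    have 2: "((\<lambda>x. (y + x) / s) has_real_derivative 1 / s) (at x)"
      using s by (auto intro!: derivative_eq_intros)
    show ?thesis unfolding \<phi>_def
      by (rule DERIV_cong[OF DERIV_mult[OF DERIV_chain'[OF 1 \<psi>(1)] DERIV_chain'[OF 2 \<psi>(1)]]])
        (simp add: \<phi>'_def algebra_simps diff_divide_distrib)
  qed
  have one: "\<phi> x = 1" if "\<bar>x\<bar> \<le> b" for x
  proof -
    have "1 \<le> (y - x) / s" "1 \<le> (y + x) / s" using that s by (auto simp: s_def le_divide_eq)
    then show ?thesis by (simp add: \<phi>_def \<psi>(4))
  qed
  show thesis
  proof (rule that[OF d _ one])
    show "continuous_on UNIV \<phi>'" unfolding \<phi>'_def
      using s by (intro continuous_intros continuous_on_compose2[OF \<psi>(2)] continuous_on_compose2[OF c\<psi>]) auto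
    show "\<phi>' x = 0" if "\<bar>x\<bar> < b" for x
    proof -
      have o: "open {x. \<bar>x\<bar> < b}" by (intro open_Collect_less continuous_intros)
      have "(\<phi> has_real_derivative 0) (at x)"
        by (rule has_field_derivative_transform_within_open[OF DERIV_const o]) (use that one in auto)
      then show ?thesis using d DERIV_unique by blast
    qed
    show "\<phi> x = 0" if "y \<le> \<bar>x\<bar>" for x
    proof -
      have "y - x \<le> 0 \<or> y + x \<le> 0" using that by (auto simp: abs_if split: if_splits)
      then have "(y - x) / s \<le> 0 \<or> (y + x) / s \<le> 0" using s by (auto simp: divide_le_0_iff)
      then show ?thesis using \<psi>(3) by (auto simp: \<phi>_def)
    qed
    show "0 \<le> \<phi> x \<and> \<phi> x \<le> 1" for x
      unfolding \<phi>_def using \<psi>(5) by (simp add: mult_le_one)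
    show "\<bar>\<phi>' x\<bar> \<le> 4 / (y - b)" for x
    proof -
      have m: "\<bar>\<psi>' t * \<psi> t'\<bar> \<le> 2 * 1" for t t'
        unfolding abs_mult using \<psi>(5)[of t'] \<psi>(6)[of t] by (intro mult_mono) auto
      have "\<bar>\<psi>' ((y + x) / s) * \<psi> ((y - x) / s) - \<psi>' ((y - x) / s) * \<psi> ((y + x) / s)\<bar> \<le> 4"
        using m[of "(y + x) / s" "(y - x) / s"] m[of "(y - x) / s" "(y + x) / s"] by linarith
      then show ?thesis using s unfolding \<phi>'_def s_def[symmetric] by (simp add: divide_right_mono)
    qed
  qed
qed

section \<open>Normalisation, tails and orthogonality of bound states\<close>

lemma normalized_bound_state:
  assumes "bound_state k"
  obtains u u' where "solves k u u'" "l2_bounded u" "\<And>a b. integral {a..b} (\<lambda>x. (u x)\<^sup>2) \<le> 1"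
    "((\<lambda>T. integral {-T..T} (\<lambda>x. (u x)\<^sup>2)) \<longlongrightarrow> 1) at_top"
proof -
  obtain w w' x0 where w: "solves k w w'" "l2_bounded w" "w x0 \<noteq> 0" using assms by (auto simp: bound_state_def)
  obtain B where B: "\<And>a b. integral {a..b} (\<lambda>x. (w x)\<^sup>2) \<le> B" using w(2) by (auto simp: l2_bounded_def)
  have cw: "continuous_on A w" for A by (rule solvesD(3)[OF w(1)])
  have i: "(\<lambda>x. (w x)\<^sup>2) integrable_on {a..b}" for a b
    by (intro integrable_continuous_real continuous_intros cw)
  \<comment> \<open>The norm is taken as a limit over symmetric intervals, the same exhaustion along
    which orthogonality comes out of the Wronskian identity.\<close>
  define G where "G T = integral {-T..T} (\<lambda>x. (w x)\<^sup>2)" for T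
  have mono: "G s \<le> G t" if "s \<le> t" for s t
    unfolding G_def by (rule integral_subset_le[OF _ i i]) (use that in auto)
  define N where "N = (SUP n::nat. G (real n))"
  have bdd: "bdd_above (range (\<lambda>n::nat. G (real n)))" by (rule bdd_aboveI2[of _ _ B]) (simp add: G_def B)
  have GN: "G T \<le> N" for T
  proof -
    have "G T \<le> G (real (nat \<lceil>\<bar>T\<bar>\<rceil>))" by (rule mono) linarith
    also have "\<dots> \<le> N" unfolding N_def by (rule cSUP_upper[OF _ bdd]) simp
    finally show ?thesis .
  qed
  have lim: "(G \<longlongrightarrow> N) at_top"
  proof (rule order_tendstoI)
    fix a assume "a < N"
    then obtain n :: nat where n: "a < G (real n)" unfolding N_def using less_cSUP_iff[OF _ bdd] by auto
    show "\<forall>\<^sub>F T in at_top. a < G T"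
      using eventually_ge_at_top[of "real n"] by eventually_elim (rule less_le_trans[OF n mono])
  next
    fix a assume a: "N < a"
    show "\<forall>\<^sub>F T in at_top. G T < a" by (intro always_eventually allI) (rule le_less_trans[OF GN a])
  qed
  have Npos: "0 < N"
  proof -
    define T where "T = \<bar>x0\<bar> + 1"
    have "G T \<noteq> 0"
    proof
      assume "G T = 0"
      then have "((\<lambda>x. (w x)\<^sup>2) has_integral 0) (cbox (-T) T)"
        using i[of "-T" T] by (simp add: G_def has_integral_integral)
      then have "(w x0)\<^sup>2 = 0"
        by (rule has_integral_0_cbox_imp_0[rotated 2]) (auto simp: T_def intro!: continuous_intros cw)
      then show False using w(3) by simp
    qed
    moreover have "0 \<le> G T" unfolding G_def by (rule Henstock_Kurzweil_Integration.integral_nonneg[OF i]) simp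
    ultimately show ?thesis using GN[of T] by linarith
  qed
  define c where "c = 1 / sqrt N"
  have c2: "c\<^sup>2 = 1 / N" using Npos by (simp add: c_def power_divide)
  have sq: "integral A (\<lambda>x. (c * w x + 0 * w x)\<^sup>2) = integral A (\<lambda>x. (w x)\<^sup>2) / N" for A
  proof -
    have "(\<lambda>x. (c * w x + 0 * w x)\<^sup>2) = (\<lambda>x. (1 / N) * (w x)\<^sup>2)" by (simp add: power_mult_distrib c2)
    then show ?thesis by (simp only: integral_mult_right) simp
  qed
  have le: "integral {a..b} (\<lambda>x. (w x)\<^sup>2) \<le> N" for a b
  proof -
    have "integral {a..b} (\<lambda>x. (w x)\<^sup>2) \<le> G (\<bar>a\<bar> + \<bar>b\<bar>)"
      unfolding G_def by (rule integral_subset_le[OF _ i i]) auto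
    then show ?thesis using GN order_trans by blast
  qed
  show thesis
  proof (rule that[OF solves_combination[OF w(1) w(1), of c 0]])
    show "integral {a..b} (\<lambda>x. (c * w x + 0 * w x)\<^sup>2) \<le> 1" for a b
      unfolding sq using le[of a b] Npos by simp
    then show "l2_bounded (\<lambda>x. c * w x + 0 * w x)" unfolding l2_bounded_def by blast
    show "((\<lambda>T. integral {-T..T} (\<lambda>x. (c * w x + 0 * w x)\<^sup>2)) \<longlongrightarrow> 1) at_top"
      unfolding sq using tendsto_divide[OF lim tendsto_const[of N]] Npos by (simp add: G_def)
  qed
qed

text \<open>The forbidden stretch from a to a + 2d is used twice. On its first half, monotonicity
  and total mass at most 1 bound u^2 at the midpoint by 1/d; the second half contributes exp(-m d),
  and integrating the exponential the factor 1/m.\<close>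

lemma tail_half_line:
  assumes s: "solves k u u'" and l2: "l2_bounded u" and n: "\<And>a b. integral {a..b} (\<lambda>x. (u x)\<^sup>2) \<le> 1"
    and k: "\<And>x. a \<le> x \<Longrightarrow> m\<^sup>2 \<le> 2 * k x" and m: "0 < m" and d: "0 < d" and b: "b = a + 2 * d"
  shows "integral {b..T} (\<lambda>x. (u x)\<^sup>2) \<le> exp (- m * d) / (d * m)"
proof (cases "b \<le> T")
  case False
  then show ?thesis using d m by simp
next
  case True
  have cu: "continuous_on A u" for A by (rule solvesD(3)[OF s])
  note dec = l2_solution_decay(1)[OF s l2 k m]
  have "integral {a..a + d} (\<lambda>x. (u (a + d))\<^sup>2) \<le> integral {a..a + d} (\<lambda>x. (u x)\<^sup>2)"
  proof (intro integral_le integrable_continuous_real continuous_intros cu)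
    fix x assume x: "x \<in> {a..a + d}"
    have "(u (a + d))\<^sup>2 \<le> (u x)\<^sup>2 * exp (- m * (a + d - x))" by (rule dec) (use x in auto)
    also have "\<dots> \<le> (u x)\<^sup>2 * 1" using x m by (intro mult_left_mono) auto
    finally show "(u (a + d))\<^sup>2 \<le> (u x)\<^sup>2" by simp
  qed
  then have "d * (u (a + d))\<^sup>2 \<le> 1" using n[of a "a + d"] d by simp
  then have ua: "(u (a + d))\<^sup>2 \<le> 1 / d" using d by (simp add: field_simps)
  have i: "((\<lambda>x. (1 / d) * exp (- m * (x - (a + d)))) has_integral
      (- 1 / (d * m)) * exp (- m * (T - (a + d))) - (- 1 / (d * m)) * exp (- m * (b - (a + d)))) {b..T}"
  proof (rule fundamental_theorem_of_calculus[OF True])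
    fix x
    show "((\<lambda>x. (- 1 / (d * m)) * exp (- m * (x - (a + d)))) has_vector_derivative
        (1 / d) * exp (- m * (x - (a + d)))) (at x within {b..T})"
      unfolding has_real_derivative_iff_has_vector_derivative[symmetric]
      using m d by (auto intro!: derivative_eq_intros)
  qed
  have "integral {b..T} (\<lambda>x. (u x)\<^sup>2) \<le> integral {b..T} (\<lambda>x. (1 / d) * exp (- m * (x - (a + d))))"
  proof (intro integral_le integrable_continuous_real continuous_intros cu)
    fix x assume x: "x \<in> {b..T}"
    have "(u x)\<^sup>2 \<le> (u (a + d))\<^sup>2 * exp (- m * (x - (a + d)))" by (rule dec) (use x b d in auto)
    also have "\<dots> \<le> (1 / d) * exp (- m * (x - (a + d)))" using ua by (intro mult_right_mono) auto
    finally show "(u x)\<^sup>2 \<le> (1 / d) * exp (- m * (x - (a + d)))" .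
  qed
  also have "\<dots> = (- 1 / (d * m)) * exp (- m * (T - (a + d))) - (- 1 / (d * m)) * exp (- m * (b - (a + d)))"
    using i by (rule integral_unique)
  also have "\<dots> \<le> exp (- m * d) / (d * m)"
  proof -
    have bd: "b - (a + d) = d" using b by simp
    have "0 \<le> exp (- m * (T - (a + d))) / (d * m)" using m d by simp
    then show ?thesis unfolding bd by simp
  qed
  finally show ?thesis .
qed

lemma l2_bounded_reflect: "l2_bounded u \<Longrightarrow> l2_bounded (\<lambda>x. u (0 - x))"
proof -
  assume "l2_bounded u"
  then obtain B where B: "\<And>a b. integral {a..b} (\<lambda>x. (u x)\<^sup>2) \<le> B" by (auto simp: l2_bounded_def)
  have "integral {a..b} (\<lambda>x. (u (0 - x))\<^sup>2) \<le> B" for a b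
    using B[of "-b" "-a"] Henstock_Kurzweil_Integration.integral_reflect_real[of b a "\<lambda>x. (u (0 - x))\<^sup>2"] by simp
  then show ?thesis unfolding l2_bounded_def by blast
qed

text \<open>The weight is needed for two choices, the squared slope of a cutoff and one minus its
  square; both vanish where the cutoff is 1.\<close>

lemma tail_mass:
  assumes s: "solves k u u'" and l2: "l2_bounded u" and n: "\<And>a b. integral {a..b} (\<lambda>x. (u x)\<^sup>2) \<le> 1"
    and k: "\<And>x. a \<le> \<bar>x\<bar> \<Longrightarrow> m\<^sup>2 \<le> 2 * k x" and a: "0 \<le> a" and m: "0 < m" and d: "0 < d" and b: "b = a + 2 * d"
    and z: "continuous_on UNIV \<zeta>" "\<And>x. \<bar>x\<bar> < b \<Longrightarrow> \<zeta> x = 0" "\<And>x. 0 \<le> \<zeta> x \<and> \<zeta> x \<le> Z" and T: "b \<le> T"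
  shows "integral {-T..T} (\<lambda>x. \<zeta> x * (u x)\<^sup>2) \<le> Z * (2 * exp (- m * d) / (d * m))"
proof -
  have cu: "continuous_on A u" for A by (rule solvesD(3)[OF s])
  have cz: "continuous_on A \<zeta>" for A by (rule continuous_on_subset[OF z(1)]) simp
  have Z: "0 \<le> Z" using z(3)[of 0] by linarith
  have i: "(\<lambda>x. \<zeta> x * (u x)\<^sup>2) integrable_on {c..e}" for c e
    by (intro integrable_continuous_real continuous_intros cu cz)
  have le: "integral {c..e} (\<lambda>x. \<zeta> x * (u x)\<^sup>2) \<le> Z * integral {c..e} (\<lambda>x. (u x)\<^sup>2)" for c e
  proof -
    have "integral {c..e} (\<lambda>x. \<zeta> x * (u x)\<^sup>2) \<le> integral {c..e} (\<lambda>x. Z * (u x)\<^sup>2)"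
      by (intro integral_le i integrable_continuous_real continuous_intros cu mult_right_mono) (use z in auto)
    then show ?thesis by simp
  qed
  have b0: "0 \<le> b" using a b d by simp
  have mid: "integral {-b..b} (\<lambda>x. \<zeta> x * (u x)\<^sup>2) = 0"
  proof -
    have "integral {-b..b} (\<lambda>x. \<zeta> x * (u x)\<^sup>2) = integral {-b..b} (\<lambda>x. 0)"
      by (rule integral_spike[of "{-b, b}"]) (auto simp: z(2) abs_less_iff)
    then show ?thesis by simp
  qed
  have R: "integral {b..T} (\<lambda>x. (u x)\<^sup>2) \<le> exp (- m * d) / (d * m)"
    by (rule tail_half_line[OF s l2 n _ m d b]) (use k a in auto)
  have L: "integral {-T..-b} (\<lambda>x. (u x)\<^sup>2) \<le> exp (- m * d) / (d * m)"
  proof -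
    have "integral {b..T} (\<lambda>x. (u (0 - x))\<^sup>2) \<le> exp (- m * d) / (d * m)"
    proof (rule tail_half_line[OF solves_reflect[OF s, of 0] l2_bounded_reflect[OF l2] _ _ m d b])
      show "integral {c..e} (\<lambda>x. (u (0 - x))\<^sup>2) \<le> 1" for c e
        using n[of "-e" "-c"] Henstock_Kurzweil_Integration.integral_reflect_real[of e c "\<lambda>x. (u (0 - x))\<^sup>2"] by simp
      show "m\<^sup>2 \<le> 2 * k (0 - x)" if "a \<le> x" for x using k[of "-x"] that a by simp
    qed
    then show ?thesis
      using Henstock_Kurzweil_Integration.integral_reflect_real[of T b "\<lambda>x. (u (0 - x))\<^sup>2"] by simp
  qed
  have "integral {-T..T} (\<lambda>x. \<zeta> x * (u x)\<^sup>2) = integral {-T..-b} (\<lambda>x. \<zeta> x * (u x)\<^sup>2) +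
     integral {-b..b} (\<lambda>x. \<zeta> x * (u x)\<^sup>2) + integral {b..T} (\<lambda>x. \<zeta> x * (u x)\<^sup>2)"
    using Henstock_Kurzweil_Integration.integral_combine[OF _ _ i, of "-T" "-b" T]
      Henstock_Kurzweil_Integration.integral_combine[OF _ _ i, of "-b" b T] b0 T by simp
  also have "\<dots> \<le> Z * (exp (- m * d) / (d * m)) + Z * (exp (- m * d) / (d * m))"
    using le[of "-T" "-b"] le[of b T] mult_left_mono[OF R Z] mult_left_mono[OF L Z] mid by linarith
  also have "\<dots> = Z * (2 * exp (- m * d) / (d * m))" by simp
  finally show ?thesis .
qed

lemma integral_zero_outside:
  fixes g :: "real \<Rightarrow> real"
  assumes g: "continuous_on UNIV g" and z: "\<And>x. y \<le> \<bar>x\<bar> \<Longrightarrow> g x = 0" and y: "0 \<le> y" "y \<le> T"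
  shows "integral {-T..T} g = integral {-y..y} g"
proof -
  have i: "g integrable_on {a..b}" for a b
    by (intro integrable_continuous_real continuous_on_subset[OF g]) simp
  have "integral {-T..-y} g = integral {-T..-y} (\<lambda>x. 0)" "integral {y..T} g = integral {y..T} (\<lambda>x. 0)"
    by (intro integral_cong z; use y in auto)+
  then show ?thesis
    using Henstock_Kurzweil_Integration.integral_combine[OF _ _ i, of "-T" "-y" T]
      Henstock_Kurzweil_Integration.integral_combine[OF _ _ i, of "-y" y T] y by simp
qed

text \<open>The Wronskian has derivative c u v, so c times the integral over a symmetric interval is
  a difference of Wronskians at its ends, which tend to 0.\<close>

lemma bound_states_orthogonal:
  assumes u: "solves k u u'" "l2_bounded u" and v: "solves l v v'" "l2_bounded v"
    and kl: "\<And>x. l x - k x = c" and c: "c \<noteq> 0"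
    and k: "\<And>x. a \<le> \<bar>x\<bar> \<Longrightarrow> m\<^sup>2 \<le> 2 * k x" and l: "\<And>x. a \<le> \<bar>x\<bar> \<Longrightarrow> m\<^sup>2 \<le> 2 * l x" and a: "0 \<le> a" and m: "0 < m"
  shows "((\<lambda>T. integral {-T..T} (\<lambda>x. u x * v x)) \<longlongrightarrow> 0) at_top"
proof -
  define W where "W x = u x * v' x - u' x * v x" for x
  have 1: "(W \<longlongrightarrow> 0) at_top" unfolding W_def
    by (rule wronskian_tendsto_0[OF u v, of a m]) (use k l m a in auto)
  have "((\<lambda>x. u (0 - x) * (- v' (0 - x)) - (- u' (0 - x)) * v (0 - x)) \<longlongrightarrow> 0) at_top"
    by (rule wronskian_tendsto_0[OF solves_reflect[OF u(1), of 0] l2_bounded_reflect[OF u(2)]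
          solves_reflect[OF v(1), of 0] l2_bounded_reflect[OF v(2)], of a m]) (use k l m a in auto)
  then have 2: "((\<lambda>x. - W (- x)) \<longlongrightarrow> 0) at_top" by (simp add: W_def)
  have "((\<lambda>T. (W T + - W (- T)) / c) \<longlongrightarrow> (0 + 0) / c) at_top"
    by (intro tendsto_intros 1 2 c)
  then have lim: "((\<lambda>T. (W T + - W (- T)) / c) \<longlongrightarrow> 0) at_top" by simp
  have eq: "(W T + - W (- T)) / c = integral {-T..T} (\<lambda>x. u x * v x)" if T: "0 \<le> T" for T
  proof -
    have "((\<lambda>x. c * (u x * v x)) has_integral W T - W (- T)) {-T..T}"
    proof (rule fundamental_theorem_of_calculus)
      fix x
      have "(W has_real_derivative (l x - k x) * (u x * v x)) (at x within {-T..T})"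
        unfolding W_def by (rule wronskian_deriv[OF u(1) v(1)])
      then show "(W has_vector_derivative c * (u x * v x)) (at x within {-T..T})"
        unfolding kl has_real_derivative_iff_has_vector_derivative .
    qed (use T in simp)
    from integral_unique[OF this] have "c * integral {-T..T} (\<lambda>x. u x * v x) = W T - W (- T)"
      by (simp only: integral_mult_right)
    then show ?thesis using c by (simp add: field_simps)
  qed
  show ?thesis
  proof (rule Lim_transform_eventually[OF lim])
    show "\<forall>\<^sub>F T in at_top. (W T + - W (- T)) / c = integral {-T..T} (\<lambda>x. u x * v x)"
      using eventually_ge_at_top[of 0] by eventually_elim (rule eq)
  qed
qed

text \<open>A Gram matrix within \<tau> of the identity, weighted by \<nu>, is compared with an
  error matrix of size K \<tau>. By (\<Sum> \<bar>c_i\<bar>)^2 \<le> n \<Sum> c_i^2 all errors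
  together cost at most n (K + \<nu>1) \<tau> times the squared length of c, against \<nu>0 times
  the same from the diagonal.\<close>

lemma quadratic_form_negative:
  fixes c :: "nat \<Rightarrow> real"
  assumes nz: "\<exists>i<n. c i \<noteq> 0" and B: "\<And>i j. i < n \<Longrightarrow> j < n \<Longrightarrow> \<bar>B i j\<bar> \<le> K * \<tau>"
    and A: "\<And>i j. i < n \<Longrightarrow> j < n \<Longrightarrow> \<bar>A i j - (if i = j then 1 else 0)\<bar> \<le> \<tau>"
    and \<nu>: "\<And>i. i < n \<Longrightarrow> \<nu>0 \<le> \<nu> i \<and> \<nu> i \<le> \<nu>1" and \<nu>0: "0 \<le> \<nu>0" and \<tau>: "0 \<le> \<tau>" and K: "0 \<le> K"
    and small: "real n * (K + \<nu>1) * \<tau> < \<nu>0"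
  shows "(\<Sum>i<n. \<Sum>j<n. c i * c j * (B i j - \<nu> j * A i j)) < 0"
proof -
  define D where "D i j = (if i = j then 1 else 0 :: real)" for i j :: nat
  have term_bound: "c i * c j * (B i j - \<nu> j * A i j) \<le> \<bar>c i\<bar> * \<bar>c j\<bar> * ((K + \<nu>1) * \<tau>) - c i * c j * \<nu> j * D i j"
    if "i < n" "j < n" for i j
  proof -
    have \<nu>j: "0 \<le> \<nu> j" "\<nu> j \<le> \<nu>1" using \<nu>[OF that(2)] \<nu>0 by auto
    have "\<bar>\<nu> j * (A i j - D i j)\<bar> \<le> \<nu>1 * \<tau>"
      unfolding abs_mult using \<nu>j A[OF that] by (intro mult_mono) (auto simp: D_def)
    then have "\<bar>B i j - \<nu> j * (A i j - D i j)\<bar> \<le> (K + \<nu>1) * \<tau>"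
      using B[OF that] abs_triangle_ineq4[of "B i j" "\<nu> j * (A i j - D i j)"] by (simp add: distrib_right)
    then have "\<bar>c i * c j\<bar> * \<bar>B i j - \<nu> j * (A i j - D i j)\<bar> \<le> \<bar>c i * c j\<bar> * ((K + \<nu>1) * \<tau>)"
      by (rule mult_left_mono) simp
    then have "c i * c j * (B i j - \<nu> j * (A i j - D i j)) \<le> \<bar>c i * c j\<bar> * ((K + \<nu>1) * \<tau>)"
      by (metis abs_ge_self abs_mult order_trans)
    then show ?thesis by (simp add: abs_mult algebra_simps)
  qed
  define Q where "Q = (\<Sum>i<n. (c i)\<^sup>2)"
  have Q: "0 < Q" unfolding Q_def using nz by (auto intro!: sum_pos2)
  have "(\<Sum>i<n. \<Sum>j<n. c i * c j * (B i j - \<nu> j * A i j)) \<le>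
     (\<Sum>i<n. \<Sum>j<n. \<bar>c i\<bar> * \<bar>c j\<bar> * ((K + \<nu>1) * \<tau>) - c i * c j * \<nu> j * D i j)"
    by (intro sum_mono term_bound) auto
  also have "\<dots> = (\<Sum>i<n. \<Sum>j<n. \<bar>c i\<bar> * \<bar>c j\<bar> * ((K + \<nu>1) * \<tau>)) - (\<Sum>i<n. \<Sum>j<n. c i * c j * \<nu> j * D i j)"
    by (simp only: sum_subtractf)
  also have "(\<Sum>i<n. \<Sum>j<n. \<bar>c i\<bar> * \<bar>c j\<bar> * ((K + \<nu>1) * \<tau>)) = (\<Sum>i<n. \<bar>c i\<bar>)\<^sup>2 * ((K + \<nu>1) * \<tau>)"
  proof -
    have "(\<Sum>i<n. \<bar>c i\<bar>)\<^sup>2 = (\<Sum>i<n. \<Sum>j<n. \<bar>c i\<bar> * \<bar>c j\<bar>)"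
      by (simp only: power2_eq_square sum_product)
    then show ?thesis by (simp only: sum_distrib_right)
  qed
  also have "(\<Sum>i<n. \<Sum>j<n. c i * c j * \<nu> j * D i j) = (\<Sum>i<n. (c i)\<^sup>2 * \<nu> i)"
  proof (rule sum.cong[OF refl])
    fix i assume i: "i \<in> {..<n}"
    have "(\<Sum>j<n. c i * c j * \<nu> j * D i j) = (\<Sum>j<n. if j = i then c i * c i * \<nu> i else 0)"
      by (rule sum.cong) (auto simp: D_def)
    then show "(\<Sum>j<n. c i * c j * \<nu> j * D i j) = (c i)\<^sup>2 * \<nu> i"
      using i by (simp add: power2_eq_square)
  qed
  finally have 1: "(\<Sum>i<n. \<Sum>j<n. c i * c j * (B i j - \<nu> j * A i j)) \<le>
     (\<Sum>i<n. \<bar>c i\<bar>)\<^sup>2 * ((K + \<nu>1) * \<tau>) - (\<Sum>i<n. (c i)\<^sup>2 * \<nu> i)" .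
  have n0: "0 < n" using nz by auto
  have \<nu>1: "0 \<le> \<nu>1" using \<nu>[OF n0] \<nu>0 by linarith
  have "(\<Sum>i<n. \<bar>c i\<bar>)\<^sup>2 \<le> Q * real n"
    using sum_squared_le_sum_of_squares[of "\<lambda>i. \<bar>c i\<bar>" "{..<n}"] by (simp add: Q_def)
  then have "(\<Sum>i<n. \<bar>c i\<bar>)\<^sup>2 * ((K + \<nu>1) * \<tau>) \<le> (Q * real n) * ((K + \<nu>1) * \<tau>)"
    using K \<nu>1 \<tau> by (intro mult_right_mono) auto
  also have "\<dots> = Q * (real n * (K + \<nu>1) * \<tau>)" by (simp only: mult_ac)
  also have "\<dots> < Q * \<nu>0" using small Q by (rule mult_strict_left_mono)
  also have "\<dots> \<le> (\<Sum>i<n. (c i)\<^sup>2 * \<nu> i)"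
    unfolding Q_def sum_distrib_right using \<nu> by (intro sum_mono mult_left_mono) auto
  finally show ?thesis using 1 by linarith
qed

text \<open>Localisation of eigenfunctions: if U'' = k' U + Y, the truncation \<phi> U has energy
  equal to the integral of \<phi>'^2 U^2 - \<phi>^2 U Y. The first term and the failure of
  orthonormality live in the tails, of mass at most \<open>2 * exp (- m * d) / (d * m)\<close>; the
  second term has a negative diagonal because every eigenvalue lies at least \<delta> below
  \<open>Em + \<delta>\<close>. Only values on \<bar>x\<bar> \<le> y enter, so \<open>V\<close> may
  be exchanged for \<open>V'\<close>.\<close>

lemma bound_states_neg_family:
  assumes V: "continuous_on UNIV V" and V': "continuous_on UNIV V'" and h: "0 < h"
    and S: "finite S" "\<And>E. E \<in> S \<Longrightarrow> bound_state (schroedinger_coeff h V E) \<and> E0 \<le> E \<and> E \<le> Em"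
    and \<delta>: "0 < \<delta>"
    and k: "\<And>x. a \<le> \<bar>x\<bar> \<Longrightarrow> m\<^sup>2 \<le> 2 * schroedinger_coeff h V Em x" and a: "0 \<le> a" and m: "0 < m"
    and d: "0 < d" and b: "b = a + 2 * d" "b < y" and eq: "\<And>x. \<bar>x\<bar> \<le> y \<Longrightarrow> V' x = V x"
    and small: "real (card S) * ((4 / (y - b))\<^sup>2 + 2 * (Em + \<delta> - E0) / h\<^sup>2) * (2 * exp (- m * d) / (d * m)) < 2 * \<delta> / h\<^sup>2"
  shows "neg_family (schroedinger_coeff h V' (Em + \<delta>)) (card S)"
proof -
  define n where "n = card S"
  let ?k = "schroedinger_coeff h V" and ?k' = "schroedinger_coeff h V' (Em + \<delta>)"
  have k': "continuous_on UNIV ?k'" by (rule continuous_schroedinger_coeff[OF V'])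
  have b0: "0 \<le> b" "0 < y" using a d b by auto
  obtain e where e: "bij_betw e {0..<n} S" unfolding n_def using ex_bij_betw_nat_finite[OF S(1)] by blast
  have eS: "e i \<in> S" if "i < n" for i using e that by (auto simp: bij_betw_def)
  have einj: "e i \<noteq> e j" if "i < n" "j < n" "i \<noteq> j" for i j
    using e that unfolding bij_betw_def inj_on_def by (metis atLeastLessThan_iff zero_le)
  define P where "P i p \<longleftrightarrow> solves (?k (e i)) (fst p) (snd p) \<and> l2_bounded (fst p) \<and>
      (\<forall>a b. integral {a..b} (\<lambda>x. (fst p x)\<^sup>2) \<le> 1) \<and>
      ((\<lambda>T. integral {-T..T} (\<lambda>x. (fst p x)\<^sup>2)) \<longlongrightarrow> 1) at_top" for i p
  have exP: "\<exists>p. P i p" if "i < n" for i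
  proof -
    have "bound_state (?k (e i))" using S(2)[OF eS[OF that]] by simp
    then obtain w w' where "solves (?k (e i)) w w'" "l2_bounded w" "\<And>a b. integral {a..b} (\<lambda>x. (w x)\<^sup>2) \<le> 1"
      "((\<lambda>T. integral {-T..T} (\<lambda>x. (w x)\<^sup>2)) \<longlongrightarrow> 1) at_top"
      by (rule normalized_bound_state) (rule that)
    then show ?thesis by (intro exI[of _ "(w, w')"]) (simp add: P_def)
  qed
  define p where "p i = (SOME p. P i p)" for i
  have p: "P i (p i)" if "i < n" for i unfolding p_def by (rule someI_ex[OF exP[OF that]])
  define u where "u i = fst (p i)" for i
  define u' where "u' i = snd (p i)" for i
  have u: "solves (?k (e i)) (u i) (u' i)" "l2_bounded (u i)" "\<And>a b. integral {a..b} (\<lambda>x. (u i x)\<^sup>2) \<le> 1"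
    "((\<lambda>T. integral {-T..T} (\<lambda>x. (u i x)\<^sup>2)) \<longlongrightarrow> 1) at_top" if "i < n" for i
    using p[OF that] unfolding P_def u_def u'_def by auto
  have cu: "continuous_on A (u i)" "continuous_on A (u' i)" if "i < n" for i A
    using solvesD(3,4)[OF u(1)[OF that]] by auto
  have ki: "m\<^sup>2 \<le> 2 * ?k (e i) x" if "i < n" "a \<le> \<bar>x\<bar>" for i x
  proof -
    have "V x - Em \<le> V x - e i" using S(2)[OF eS[OF that(1)]] by simp
    then have "?k Em x \<le> ?k (e i) x"
      unfolding schroedinger_coeff_def by (intro divide_right_mono mult_left_mono) auto
    then show ?thesis using k[OF that(2)] by linarith
  qed
  obtain \<phi> \<phi>' :: "real \<Rightarrow> real" where \<phi>: "\<And>x. (\<phi> has_real_derivative \<phi>' x) (at x)" "continuous_on UNIV \<phi>'"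
    "\<And>x. \<bar>x\<bar> \<le> b \<Longrightarrow> \<phi> x = 1" "\<And>x. \<bar>x\<bar> < b \<Longrightarrow> \<phi>' x = 0" "\<And>x. y \<le> \<bar>x\<bar> \<Longrightarrow> \<phi> x = 0"
    "\<And>x. 0 \<le> \<phi> x \<and> \<phi> x \<le> 1" "\<And>x. \<bar>\<phi>' x\<bar> \<le> 4 / (y - b)"
    by (rule cutoff_exists[OF b0(1) b(2)]) (rule that)
  have c\<phi>: "continuous_on A \<phi>" "continuous_on A \<phi>'" for A
    using DERIV_continuous_on[OF has_field_derivative_at_within[OF \<phi>(1)]] continuous_on_subset[OF \<phi>(2)] by auto
  define \<tau> where "\<tau> = 2 * exp (- m * d) / (d * m)"
  have \<tau>0: "0 \<le> \<tau>" using d m by (simp add: \<tau>_def)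
  define K where "K = (4 / (y - b))\<^sup>2"
  have K0: "0 \<le> K" by (simp add: K_def)
  \<comment> \<open>By 2\<bar>ab\<bar> \<le> a^2 + b^2 a weighted product is controlled by two
    weighted tail masses. It is used with \<phi>'^2 for the energy and with 1 - \<phi>^2 for the
    Gram matrix.\<close>
  have pair: "\<bar>integral {-T..T} (\<lambda>x. \<zeta> x * (u i x * u j x))\<bar> \<le> Z * \<tau>"
    if ij: "i < n" "j < n" and z: "continuous_on UNIV \<zeta>" "\<And>x. \<bar>x\<bar> < b \<Longrightarrow> \<zeta> x = 0"
      "\<And>x. 0 \<le> \<zeta> x \<and> \<zeta> x \<le> Z" and T: "b \<le> T" for i j T \<zeta> Z
  proof -
    have cz: "continuous_on A \<zeta>" for A by (rule continuous_on_subset[OF z(1)]) simp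
    have t: "integral {-T..T} (\<lambda>x. \<zeta> x * (u i x)\<^sup>2) \<le> Z * \<tau>" if "i < n" for i
      unfolding \<tau>_def by (rule tail_mass[OF u(1,2)[OF that] u(3)[OF that] ki[OF that] a m d b(1) z T])
    have "norm (integral {-T..T} (\<lambda>x. \<zeta> x * (u i x * u j x))) \<le>
       integral {-T..T} (\<lambda>x. (\<zeta> x * (u i x)\<^sup>2 + \<zeta> x * (u j x)\<^sup>2) / 2)"
    proof (intro integral_norm_bound_integral integrable_continuous_real continuous_intros cz cu ij)
      fix x
      have "\<bar>u i x * u j x\<bar> \<le> ((u i x)\<^sup>2 + (u j x)\<^sup>2) / 2"
        using sum_squares_bound[of "\<bar>u i x\<bar>" "\<bar>u j x\<bar>"] by (simp add: abs_mult)
      then have "\<zeta> x * \<bar>u i x * u j x\<bar> \<le> \<zeta> x * (((u i x)\<^sup>2 + (u j x)\<^sup>2) / 2)"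
        using z(3) by (intro mult_left_mono) auto
      then show "norm (\<zeta> x * (u i x * u j x)) \<le> (\<zeta> x * (u i x)\<^sup>2 + \<zeta> x * (u j x)\<^sup>2) / 2"
        using z(3)[of x] by (simp add: abs_mult distrib_left)
    qed auto
    also have "\<dots> = (integral {-T..T} (\<lambda>x. \<zeta> x * (u i x)\<^sup>2) + integral {-T..T} (\<lambda>x. \<zeta> x * (u j x)\<^sup>2)) / 2"
      by (subst Henstock_Kurzweil_Integration.integral_add[symmetric])
        (auto intro!: integrable_continuous_real continuous_intros cz cu ij)
    also have "\<dots> \<le> (Z * \<tau> + Z * \<tau>) / 2" by (intro divide_right_mono add_mono t ij) simp
    finally show ?thesis by simp
  qed
  define A where "A i j = integral {-y..y} (\<lambda>x. (\<phi> x)\<^sup>2 * (u i x * u j x))" for i j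
  define B where "B i j = integral {-y..y} (\<lambda>x. (\<phi>' x)\<^sup>2 * (u i x * u j x))" for i j
  have B: "\<bar>B i j\<bar> \<le> K * \<tau>" if "i < n" "j < n" for i j
    unfolding B_def
  proof (rule pair[OF that])
    fix x
    have "\<bar>\<phi>' x\<bar>\<^sup>2 \<le> (4 / (y - b))\<^sup>2" by (intro power_mono \<phi>(7)) simp
    then show "0 \<le> (\<phi>' x)\<^sup>2 \<and> (\<phi>' x)\<^sup>2 \<le> K" by (simp add: K_def)
  qed (use \<phi>(4) b in \<open>auto intro!: continuous_intros c\<phi>\<close>)
  have A: "\<bar>A i j - (if i = j then 1 else 0)\<bar> \<le> \<tau>" if ij: "i < n" "j < n" for i j
  proof -
    have lim: "((\<lambda>T. integral {-T..T} (\<lambda>x. u i x * u j x)) \<longlongrightarrow> (if i = j then 1 else 0)) at_top"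
    proof (cases "i = j")
      case True then show ?thesis using u(4)[OF ij(1)] by (simp add: power2_eq_square)
    next
      case False
      have "((\<lambda>T. integral {-T..T} (\<lambda>x. u i x * u j x)) \<longlongrightarrow> 0) at_top"
      proof (rule bound_states_orthogonal[OF u(1,2)[OF ij(1)] u(1,2)[OF ij(2)] _ _ ki[OF ij(1)] ki[OF ij(2)] a m])
        show "?k (e j) x - ?k (e i) x = 2 * (e i - e j) / h\<^sup>2" for x
          by (simp add: schroedinger_coeff_def diff_divide_distrib[symmetric] algebra_simps)
        show "2 * (e i - e j) / h\<^sup>2 \<noteq> 0" using einj[OF ij False] h by simp
      qed
      then show ?thesis using False by simp
    qed
    have diff: "\<bar>integral {-T..T} (\<lambda>x. u i x * u j x) - A i j\<bar> \<le> \<tau>" if T: "y \<le> T" for T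
    proof -
      have "A i j = integral {-T..T} (\<lambda>x. (\<phi> x)\<^sup>2 * (u i x * u j x))"
        unfolding A_def by (rule integral_zero_outside[symmetric])
          (use \<phi>(5) b0 T in \<open>auto intro!: continuous_intros c\<phi> cu ij\<close>)
      then have "integral {-T..T} (\<lambda>x. u i x * u j x) - A i j =
         integral {-T..T} (\<lambda>x. u i x * u j x - (\<phi> x)\<^sup>2 * (u i x * u j x))"
        by (simp only:) (rule Henstock_Kurzweil_Integration.integral_diff[symmetric];
            intro integrable_continuous_real continuous_intros c\<phi> cu ij)
      also have "\<dots> = integral {-T..T} (\<lambda>x. (1 - (\<phi> x)\<^sup>2) * (u i x * u j x))"
        by (simp add: left_diff_distrib)
      finally have eq: "integral {-T..T} (\<lambda>x. u i x * u j x) - A i j =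
        integral {-T..T} (\<lambda>x. (1 - (\<phi> x)\<^sup>2) * (u i x * u j x))" .
      have cc: "continuous_on UNIV (\<lambda>x. 1 - (\<phi> x)\<^sup>2)" by (intro continuous_intros c\<phi>)
      have "\<bar>integral {-T..T} (\<lambda>x. (1 - (\<phi> x)\<^sup>2) * (u i x * u j x))\<bar> \<le> 1 * \<tau>"
        by (rule pair[OF ij cc]) (use \<phi>(3,6) T b in \<open>auto simp: power_le_one\<close>)
      then show ?thesis unfolding eq by simp
    qed
    have "((\<lambda>T. \<bar>integral {-T..T} (\<lambda>x. u i x * u j x) - A i j\<bar>) \<longlongrightarrow> \<bar>(if i = j then 1 else 0) - A i j\<bar>) at_top"
      by (intro tendsto_intros lim)
    moreover have "\<forall>\<^sub>F T in at_top. \<bar>integral {-T..T} (\<lambda>x. u i x * u j x) - A i j\<bar> \<le> \<tau>"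
      using eventually_ge_at_top[of y] by eventually_elim (rule diff)
    ultimately have "\<bar>(if i = j then 1 else 0) - A i j\<bar> \<le> \<tau>"
      by (rule tendsto_upperbound) simp
    then show ?thesis by (simp only: abs_minus_commute)
  qed
  \<comment> \<open>Distance of the i-th eigenvalue from the reference energy, scaled so that on the
    support of the cutoff its coefficient is ?k' + \<nu> i.\<close>
  define \<nu> where "\<nu> i = 2 * (Em + \<delta> - e i) / h\<^sup>2" for i
  have \<nu>: "2 * \<delta> / h\<^sup>2 \<le> \<nu> i \<and> \<nu> i \<le> 2 * (Em + \<delta> - E0) / h\<^sup>2" if "i < n" for i
    using S(2)[OF eS[OF that]] unfolding \<nu>_def by (intro conjI divide_right_mono) auto
  define v where "v i x = \<phi> x * u i x" for i x
  define v' where "v' i x = \<phi>' x * u i x + \<phi> x * u' i x" for i x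
  have v: "test_function y (v i) (v' i)" if i: "i < n" for i
    unfolding test_function_def
  proof (intro conjI allI impI)
    show "(v i has_real_derivative v' i x) (at x)" for x
      unfolding v_def v'_def
      by (rule DERIV_cong[OF DERIV_mult[OF \<phi>(1) solvesD(1)[OF u(1)[OF i]]]]) (simp add: mult.commute)
    show "continuous_on UNIV (v' i)" unfolding v'_def by (intro continuous_intros c\<phi> cu i)
    show "v i x = 0" if "y \<le> \<bar>x\<bar>" for x using \<phi>(5)[OF that] by (simp add: v_def)
  qed
  have main: "energy ?k' (-y) y (\<lambda>x. \<Sum>i<n. c i * v i x) (\<lambda>x. \<Sum>i<n. c i * v' i x) =
      (\<Sum>i<n. \<Sum>j<n. c i * c j * (B i j - \<nu> j * A i j))" for c
  proof -
    define U where "U x = (\<Sum>i<n. c i * u i x)" for x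
    define U' where "U' x = (\<Sum>i<n. c i * u' i x)" for x
    define Y where "Y x = (\<Sum>i<n. c i * (\<nu> i * u i x))" for x
    have dU: "(U has_real_derivative U' x) (at x within A)" for x A
      unfolding U_def[abs_def] U'_def by (intro DERIV_sum DERIV_cmult solvesD(1)[OF u(1)]) simp
    have dU': "(U' has_real_derivative ?k' x * U x + Y x) (at x within A)" if x: "\<bar>x\<bar> \<le> y" for x A
    proof -
      have "(U' has_real_derivative (\<Sum>i<n. c i * (?k (e i) x * u i x))) (at x within A)"
        unfolding U'_def[abs_def] by (intro DERIV_sum DERIV_cmult solvesD(2)[OF u(1)]) simp
      moreover have "(\<Sum>i<n. c i * (?k (e i) x * u i x)) = ?k' x * U x + Y x"
      proof -
        have "?k (e i) x = ?k' x + \<nu> i" for i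
          using eq[OF x] by (simp add: schroedinger_coeff_def \<nu>_def add_divide_distrib[symmetric] algebra_simps)
        then show ?thesis
          by (simp add: U_def Y_def sum_distrib_left sum.distrib[symmetric] algebra_simps)
      qed
      ultimately show ?thesis by simp
    qed
    have fv: "(\<Sum>i<n. c i * v i x) = \<phi> x * U x" "(\<Sum>i<n. c i * v' i x) = \<phi>' x * U x + \<phi> x * U' x" for x
      by (simp_all add: v_def v'_def U_def U'_def sum_distrib_left sum.distrib[symmetric] algebra_simps)
    \<comment> \<open>The energy density of \<phi> U exceeds this derivative by exactly \<phi>'^2
      U^2 - \<phi>^2 U Y, and \<phi>^2 U U' vanishes at both ends.\<close>
    have dP: "((\<lambda>x. (\<phi> x)\<^sup>2 * (U x * U' x)) has_real_derivative
        2 * \<phi> x * \<phi>' x * (U x * U' x) + (\<phi> x)\<^sup>2 * ((U' x)\<^sup>2 + U x * (?k' x * U x + Y x))) (at x within A)"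
      if "\<bar>x\<bar> \<le> y" for x A
      by (rule derivative_eq_intros dU dU'[OF that] has_field_derivative_at_within[OF \<phi>(1)] refl)+
        (simp add: power2_eq_square algebra_simps)
    have I1: "((\<lambda>x. 2 * \<phi> x * \<phi>' x * (U x * U' x) + (\<phi> x)\<^sup>2 * ((U' x)\<^sup>2 + U x * (?k' x * U x + Y x)))
       has_integral ((\<phi> y)\<^sup>2 * (U y * U' y) - (\<phi> (-y))\<^sup>2 * (U (-y) * U' (-y)))) {-y..y}"
      by (rule fundamental_theorem_of_calculus)
        (use b0 in \<open>auto simp: has_real_derivative_iff_has_vector_derivative[symmetric] intro!: dP\<close>)
    have I2: "((\<lambda>x. (\<phi>' x)\<^sup>2 * (U x)\<^sup>2 - (\<phi> x)\<^sup>2 * (U x * Y x)) has_integral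
       (\<Sum>i<n. \<Sum>j<n. c i * c j * (B i j - \<nu> j * A i j))) {-y..y}"
    proof -
      have "((\<lambda>x. \<Sum>i<n. \<Sum>j<n. c i * c j * ((\<phi>' x)\<^sup>2 * (u i x * u j x) - \<nu> j * ((\<phi> x)\<^sup>2 * (u i x * u j x)))) has_integral
         (\<Sum>i<n. \<Sum>j<n. c i * c j * (B i j - \<nu> j * A i j))) {-y..y}"
        unfolding A_def B_def
        by (intro has_integral_sum has_integral_mult_right has_integral_diff integrable_integral
            integrable_continuous_real continuous_intros c\<phi> cu) auto
      moreover have "(\<Sum>i<n. \<Sum>j<n. c i * c j * ((\<phi>' x)\<^sup>2 * (u i x * u j x) - \<nu> j * ((\<phi> x)\<^sup>2 * (u i x * u j x)))) =
          (\<phi>' x)\<^sup>2 * (U x)\<^sup>2 - (\<phi> x)\<^sup>2 * (U x * Y x)" for x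
      proof -
        have "(U x)\<^sup>2 = (\<Sum>i<n. \<Sum>j<n. (c i * u i x) * (c j * u j x))"
          by (simp only: U_def power2_eq_square sum_product)
        moreover have "U x * Y x = (\<Sum>i<n. \<Sum>j<n. (c i * u i x) * (c j * (\<nu> j * u j x)))"
          by (simp only: U_def Y_def sum_product)
        ultimately show ?thesis
          by (simp add: sum_distrib_left sum_subtractf[symmetric] algebra_simps)
      qed
      ultimately show ?thesis by simp
    qed
    have "((\<lambda>x. (\<phi>' x * U x + \<phi> x * U' x)\<^sup>2 + ?k' x * (\<phi> x * U x)\<^sup>2) has_integral
        (((\<phi> y)\<^sup>2 * (U y * U' y) - (\<phi> (-y))\<^sup>2 * (U (-y) * U' (-y))) +
         (\<Sum>i<n. \<Sum>j<n. c i * c j * (B i j - \<nu> j * A i j)))) {-y..y}"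
      by (rule has_integral_eq[OF _ has_integral_add[OF I1 I2]])
        (simp add: power2_eq_square algebra_simps)
    then have "((\<lambda>x. (\<phi>' x * U x + \<phi> x * U' x)\<^sup>2 + ?k' x * (\<phi> x * U x)\<^sup>2) has_integral
         (\<Sum>i<n. \<Sum>j<n. c i * c j * (B i j - \<nu> j * A i j))) {-y..y}"
      using \<phi>(5)[of y] \<phi>(5)[of "-y"] by simp
    then show ?thesis unfolding energy_def fv by (rule integral_unique)
  qed
  have "energy ?k' (-y) y (\<lambda>x. \<Sum>i<n. c i * v i x) (\<lambda>x. \<Sum>i<n. c i * v' i x) < 0" if "\<exists>i<n. c i \<noteq> 0" for c
    unfolding main
    by (rule quadratic_form_negative[OF that B A \<nu> _ \<tau>0 K0])
      (use \<delta> small in \<open>auto simp: n_def K_def \<tau>_def\<close>)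
  then show ?thesis unfolding n_def[symmetric] neg_family_def using v b0(2) by blast
qed

section \<open>WKB amplitudes\<close>

text \<open>Bounds on the first \<open>n\<close> derivatives that are uniform in a parameter, later
  the pair of energy and h. Recursion on \<open>n\<close> lets each closure property follow from its
  pointwise bound and the rule for a single derivative.\<close>

primrec bounded_derivs :: "'p set \<Rightarrow> real set \<Rightarrow> nat \<Rightarrow> ('p \<Rightarrow> real \<Rightarrow> real) \<Rightarrow> bool" where
  "bounded_derivs P S 0 F \<longleftrightarrow> (\<exists>C. \<forall>p\<in>P. \<forall>x\<in>S. \<bar>F p x\<bar> \<le> C)"
| "bounded_derivs P S (Suc n) F \<longleftrightarrow> (\<exists>C. \<forall>p\<in>P. \<forall>x\<in>S. \<bar>F p x\<bar> \<le> C) \<and>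
     (\<forall>p\<in>P. \<forall>x\<in>S. (F p has_real_derivative deriv (F p) x) (at x)) \<and> bounded_derivs P S n (\<lambda>p. deriv (F p))"

lemma bounded_derivs_bounded: "bounded_derivs P S n F \<Longrightarrow> \<exists>C. \<forall>p\<in>P. \<forall>x\<in>S. \<bar>F p x\<bar> \<le> C"
  by (cases n) auto

lemma bounded_derivs_SucD: "bounded_derivs P S (Suc n) F \<Longrightarrow> bounded_derivs P S n F"
proof (induction n arbitrary: F)
  case (Suc n)
  have "bounded_derivs P S n (\<lambda>p. deriv (F p))" by (rule Suc.IH) (use Suc.prems in simp)
  then show ?case using Suc.prems by simp
qed simp

lemma bounded_derivs_subset: "bounded_derivs P S n F \<Longrightarrow> P' \<subseteq> P \<Longrightarrow> bounded_derivs P' S n F"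
proof (induction n arbitrary: F)
  case 0
  then obtain C where "\<forall>p\<in>P. \<forall>x\<in>S. \<bar>F p x\<bar> \<le> C" by auto
  then have "\<forall>p\<in>P'. \<forall>x\<in>S. \<bar>F p x\<bar> \<le> C" using 0 by blast
  then show ?case by auto
next
  case (Suc n)
  have "bounded_derivs P' S n (\<lambda>p. deriv (F p))" by (rule Suc.IH) (use Suc.prems in simp_all)
  moreover obtain C where "\<forall>p\<in>P. \<forall>x\<in>S. \<bar>F p x\<bar> \<le> C" using Suc.prems by auto
  then have "\<forall>p\<in>P'. \<forall>x\<in>S. \<bar>F p x\<bar> \<le> C" using Suc.prems by blast
  then have "\<exists>C. \<forall>p\<in>P'. \<forall>x\<in>S. \<bar>F p x\<bar> \<le> C" by blast
  ultimately show ?case using Suc.prems by (auto simp: subset_iff)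
qed

lemma deriv_cong_open:
  fixes f g :: "real \<Rightarrow> real"
  assumes "open S" "x \<in> S" "\<And>y. y \<in> S \<Longrightarrow> f y = g y"
  shows "deriv f x = deriv g x"
  by (rule deriv_cong_ev) (use assms eventually_nhds_in_open[of S x] in \<open>auto elim: eventually_mono\<close>)

text \<open>Values outside \<open>S\<close> are irrelevant to derivatives in the open set
  \<open>S\<close>; this is what allows formulas, such as products with inverses, to be rewritten
  only where denominators are nonzero, and locally finite sums to be truncated.\<close>

lemma bounded_derivs_cong:
  assumes S: "open S" and "\<And>p x. p \<in> P \<Longrightarrow> x \<in> S \<Longrightarrow> F p x = G p x" and "bounded_derivs P S n F"
  shows "bounded_derivs P S n G"
  using assms(2,3)
proof (induction n arbitrary: F G)
  case 0 then show ?case by simp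
next
  case (Suc n)
  have d: "deriv (F p) x = deriv (G p) x" if "p \<in> P" "x \<in> S" for p x
    by (rule deriv_cong_open[OF S that(2)]) (use Suc.prems(1) that in auto)
  have "bounded_derivs P S n (\<lambda>p. deriv (G p))"
    by (rule Suc.IH[of "\<lambda>p. deriv (F p)"]) (use Suc.prems d in auto)
  moreover have "(G p has_real_derivative deriv (G p) x) (at x)" if "p \<in> P" "x \<in> S" for p x
  proof -
    have "(F p has_real_derivative deriv (F p) x) (at x)" using Suc.prems(2) that by simp
    then show ?thesis unfolding d[OF that]
      by (rule has_field_derivative_transform_within_open[OF _ S that(2)]) (use Suc.prems(1) that in simp)
  qed
  moreover have "\<exists>C. \<forall>p\<in>P. \<forall>x\<in>S. \<bar>G p x\<bar> \<le> C" using Suc.prems by simp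
  ultimately show ?case by simp
qed

lemma bounded_derivs_SucI:
  assumes S: "open S" and b: "\<exists>C. \<forall>p\<in>P. \<forall>x\<in>S. \<bar>F p x\<bar> \<le> C"
    and d: "\<And>p x. p \<in> P \<Longrightarrow> x \<in> S \<Longrightarrow> (F p has_real_derivative F' p x) (at x)"
    and F': "bounded_derivs P S n F'"
  shows "bounded_derivs P S (Suc n) F"
proof -
  have e: "F' p x = deriv (F p) x" if "p \<in> P" "x \<in> S" for p x
    using DERIV_imp_deriv[OF d[OF that]] by simp
  have "bounded_derivs P S n (\<lambda>p. deriv (F p))" by (rule bounded_derivs_cong[OF S e F'])
  moreover have "(F p has_real_derivative deriv (F p) x) (at x)" if "p \<in> P" "x \<in> S" for p x
    using d[OF that] e[OF that] by simp
  ultimately show ?thesis using b by simp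
qed

lemma bounded_derivs_const:
  assumes "\<And>p. p \<in> P \<Longrightarrow> \<bar>c p\<bar> \<le> C"
  shows "bounded_derivs P S n (\<lambda>p x. c p)"
  using assms
proof (induction n arbitrary: c C)
  case 0 then show ?case by auto
next
  case (Suc n)
  have "bounded_derivs P S n (\<lambda>p x. 0)" by (rule Suc.IH[of _ 0]) simp
  then show ?case using Suc.prems by auto
qed

lemma bounded_derivs_add:
  assumes S: "open S" and "bounded_derivs P S n F" "bounded_derivs P S n G"
  shows "bounded_derivs P S n (\<lambda>p x. F p x + G p x)"
  using assms(2,3)
proof (induction n arbitrary: F G)
  have b: "\<exists>C. \<forall>p\<in>P. \<forall>x\<in>S. \<bar>F p x + G p x\<bar> \<le> C"
    if F: "bounded_derivs P S n F" and G: "bounded_derivs P S n G" for F G n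
  proof -
    obtain C D where "\<forall>p\<in>P. \<forall>x\<in>S. \<bar>F p x\<bar> \<le> C" "\<forall>p\<in>P. \<forall>x\<in>S. \<bar>G p x\<bar> \<le> D"
      using bounded_derivs_bounded[OF F] bounded_derivs_bounded[OF G] by (elim exE)
    then show ?thesis by (intro exI[of _ "C + D"] ballI) (meson abs_triangle_ineq add_mono order_trans)
  qed
  {
    case 0 then show ?case using b[OF 0] by simp
  next
    case (Suc n)
    show ?case
    proof (rule bounded_derivs_SucI[OF S b[OF Suc.prems]])
      show "bounded_derivs P S n (\<lambda>p x. deriv (F p) x + deriv (G p) x)"
        by (rule Suc.IH) (use Suc.prems in simp_all)
    qed (use Suc.prems in \<open>auto intro!: DERIV_add\<close>)
  }
qed

lemma bounded_derivs_mult: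
  assumes S: "open S" and "bounded_derivs P S n F" "bounded_derivs P S n G"
  shows "bounded_derivs P S n (\<lambda>p x. F p x * G p x)"
  using assms(2,3)
proof (induction n arbitrary: F G)
  have b: "\<exists>C. \<forall>p\<in>P. \<forall>x\<in>S. \<bar>F p x * G p x\<bar> \<le> C"
    if F: "bounded_derivs P S n F" and G: "bounded_derivs P S n G" for F G n
  proof -
    obtain C D where C: "\<forall>p\<in>P. \<forall>x\<in>S. \<bar>F p x\<bar> \<le> C" and D: "\<forall>p\<in>P. \<forall>x\<in>S. \<bar>G p x\<bar> \<le> D"
      using bounded_derivs_bounded[OF F] bounded_derivs_bounded[OF G] by (elim exE)
    show ?thesis
    proof (intro exI[of _ "C * D"] ballI)
      fix p x assume px: "p \<in> P" "x \<in> S"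
      have "\<bar>F p x\<bar> \<le> C" "\<bar>G p x\<bar> \<le> D" using C D px by auto
      then show "\<bar>F p x * G p x\<bar> \<le> C * D" unfolding abs_mult
        by (intro mult_mono) (auto intro: order_trans[OF abs_ge_zero])
    qed
  qed
  {
    case 0 then show ?case using b[OF 0] by simp
  next
    case (Suc n)
    show ?case
    proof (rule bounded_derivs_SucI[OF S b[OF Suc.prems]])
      show "bounded_derivs P S n (\<lambda>p x. deriv (F p) x * G p x + deriv (G p) x * F p x)"
        by (intro bounded_derivs_add[OF S] Suc.IH bounded_derivs_SucD[OF Suc.prems(1)]
            bounded_derivs_SucD[OF Suc.prems(2)]) (use Suc.prems in simp_all)
    qed (use Suc.prems in \<open>auto intro!: DERIV_mult\<close>)
  }
qed

lemma bounded_derivs_inverse: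
  assumes S: "open S" and "bounded_derivs P S n F" and c: "0 < c" "\<And>p x. p \<in> P \<Longrightarrow> x \<in> S \<Longrightarrow> c \<le> F p x"
  shows "bounded_derivs P S n (\<lambda>p x. inverse (F p x))"
  using assms(2)
proof (induction n)
  have b: "\<exists>C. \<forall>p\<in>P. \<forall>x\<in>S. \<bar>inverse (F p x)\<bar> \<le> C"
  proof (intro exI[of _ "inverse c"] ballI)
    fix p x assume px: "p \<in> P" "x \<in> S"
    show "\<bar>inverse (F p x)\<bar> \<le> inverse c"
      using c(2)[OF px] c(1) le_imp_inverse_le[of c "F p x"] by simp
  qed
  {
    case 0 then show ?case using b by simp
  next
    case (Suc n)
    have IH: "bounded_derivs P S n (\<lambda>p x. inverse (F p x))" by (rule Suc.IH[OF bounded_derivs_SucD[OF Suc.prems]])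
    have "bounded_derivs P S n (\<lambda>p x. (- 1) * (deriv (F p) x * (inverse (F p x) * inverse (F p x))))"
      by (intro bounded_derivs_mult[OF S] IH bounded_derivs_const[of _ _ 1]) (use Suc.prems in simp_all)
    then show ?case
    proof (rule bounded_derivs_SucI[OF S b, rotated])
      fix p x assume px: "p \<in> P" "x \<in> S"
      have "(F p has_real_derivative deriv (F p) x) (at x)" "F p x \<noteq> 0"
        using Suc.prems px c(2)[OF px] c(1) by auto
      from DERIV_inverse_fun[OF this]
      show "((\<lambda>x. inverse (F p x)) has_real_derivative - 1 * (deriv (F p) x * (inverse (F p x) * inverse (F p x)))) (at x)"
        by (simp add: mult_ac)
    qed
  }
qed

lemma bounded_derivs_sqrt:
  assumes S: "open S" and "bounded_derivs P S n F" and c: "0 < c" "\<And>p x. p \<in> P \<Longrightarrow> x \<in> S \<Longrightarrow> c \<le> F p x"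
  shows "bounded_derivs P S n (\<lambda>p x. sqrt (F p x))"
  using assms(2)
proof (induction n)
  have b: "\<exists>C. \<forall>p\<in>P. \<forall>x\<in>S. \<bar>sqrt (F p x)\<bar> \<le> C" if F: "bounded_derivs P S n F" for n
  proof -
    obtain C where C: "\<forall>p\<in>P. \<forall>x\<in>S. \<bar>F p x\<bar> \<le> C" using bounded_derivs_bounded[OF F] by (elim exE)
    show ?thesis
    proof (intro exI[of _ "sqrt C"] ballI)
      fix p x assume px: "p \<in> P" "x \<in> S"
      have "0 \<le> F p x" "F p x \<le> C" using C px c(1) c(2)[OF px] abs_le_D1 by force+
      then show "\<bar>sqrt (F p x)\<bar> \<le> sqrt C" by simp
    qed
  qed
  {
    case 0 then show ?case using b[OF 0] by simp
  next
    case (Suc n)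
    have IH: "bounded_derivs P S n (\<lambda>p x. sqrt (F p x))" by (rule Suc.IH[OF bounded_derivs_SucD[OF Suc.prems]])
    have "bounded_derivs P S n (\<lambda>p x. deriv (F p) x * (inverse (sqrt (F p x)) * (1 / 2)))"
      by (intro bounded_derivs_mult[OF S] bounded_derivs_inverse[OF S IH, of "sqrt c"]
          bounded_derivs_const[of _ _ 1]) (use Suc.prems c in simp_all)
    then show ?case
    proof (rule bounded_derivs_SucI[OF S b[OF Suc.prems], rotated])
      fix p x assume px: "p \<in> P" "x \<in> S"
      have 1: "(F p has_real_derivative deriv (F p) x) (at x)" "0 < F p x"
        using Suc.prems px c(2)[OF px] c(1) by auto
      from DERIV_chain'[OF 1(1) DERIV_real_sqrt[OF 1(2)]]
      show "((\<lambda>x. sqrt (F p x)) has_real_derivative deriv (F p) x * (inverse (sqrt (F p x)) * (1 / 2))) (at x)"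
        by (simp add: mult_ac)
    qed
  }
qed

lemma bounded_derivs_smooth:
  fixes V :: "real \<Rightarrow> real"
  assumes V: "smooth V" and S: "open S" "bounded S"
  shows "bounded_derivs P S n (\<lambda>p. V)"
proof -
  obtain D where D: "D 0 = V" "\<And>n x. (D n has_vector_derivative D (Suc n) x) (at x)"
    using V unfolding smooth_def by auto
  have d: "(D n has_real_derivative D (Suc n) x) (at x)" for n x
    using D(2) by (simp add: has_real_derivative_iff_has_vector_derivative)
  have b: "\<exists>C. \<forall>p\<in>P. \<forall>x\<in>S. \<bar>D m x\<bar> \<le> C" for m
  proof -
    have "continuous_on (closure S) (D m)"
      by (rule DERIV_continuous_on[OF has_field_derivative_at_within[OF d]])
    then have "bounded (D m ` closure S)"
      by (intro compact_imp_bounded compact_continuous_image) (use S in \<open>auto simp: compact_closure\<close>)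
    then obtain C where "\<forall>x\<in>closure S. \<bar>D m x\<bar> \<le> C" unfolding bounded_iff by auto
    then show ?thesis using closure_subset[of S] by blast
  qed
  have "bounded_derivs P S n (\<lambda>p. D m)" for m
  proof (induction n arbitrary: m)
    case 0 then show ?case using b by simp
  next
    case (Suc n)
    show ?case by (rule bounded_derivs_SucI[OF S(1) b d Suc.IH])
  qed
  from this[of 0] show ?thesis by (simp add: D(1))
qed

lemma deriv_parity:
  fixes f :: "real \<Rightarrow> real"
  assumes G: "open G" "\<And>x. x \<in> G \<Longrightarrow> - x \<in> G" and f: "\<And>x. x \<in> G \<Longrightarrow> f (- x) = s * f x"
    and d: "\<And>x. x \<in> G \<Longrightarrow> (f has_real_derivative deriv f x) (at x)" and x: "x \<in> G"
  shows "deriv f (- x) = - s * deriv f x"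
proof -
  have "((\<lambda>x. f (- x)) has_real_derivative deriv f (- x) * - 1) (at x)"
    by (rule DERIV_chain'[where f = uminus]) (auto intro!: derivative_eq_intros d G(2) x)
  moreover have "((\<lambda>x. f (- x)) has_real_derivative s * deriv f x) (at x)"
    by (rule has_field_derivative_transform_within_open[OF DERIV_cmult[OF d[OF x]] G(1) x]) (simp add: f)
  ultimately have "deriv f (- x) * - 1 = s * deriv f x" by (rule DERIV_unique)
  then show ?thesis by simp
qed

section \<open>Families smooth with all bounds uniform in the parameter\<close>

definition smooth_bounded :: "'p set \<Rightarrow> real set \<Rightarrow> ('p \<Rightarrow> real \<Rightarrow> real) \<Rightarrow> bool" where
  "smooth_bounded P S F \<longleftrightarrow> (\<forall>n. bounded_derivs P S n F)"

lemma smooth_boundedD: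
  assumes "smooth_bounded P S F"
  shows "\<exists>C. \<forall>p\<in>P. \<forall>x\<in>S. \<bar>F p x\<bar> \<le> C" "smooth_bounded P S (\<lambda>p. deriv (F p))"
    "p \<in> P \<Longrightarrow> x \<in> S \<Longrightarrow> (F p has_real_derivative deriv (F p) x) (at x)"
proof -
  have b: "bounded_derivs P S n F" for n using assms unfolding smooth_bounded_def by blast
  show "\<exists>C. \<forall>p\<in>P. \<forall>x\<in>S. \<bar>F p x\<bar> \<le> C" by (rule bounded_derivs_bounded[OF b])
  show "smooth_bounded P S (\<lambda>p. deriv (F p))"
    unfolding smooth_bounded_def
  proof
    fix n show "bounded_derivs P S n (\<lambda>p. deriv (F p))" using b[of "Suc n"] by simp
  qed
  show "p \<in> P \<Longrightarrow> x \<in> S \<Longrightarrow> (F p has_real_derivative deriv (F p) x) (at x)" using b[of "Suc 0"] by simp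
qed

lemma smooth_bounded_subset: "smooth_bounded P S F \<Longrightarrow> P' \<subseteq> P \<Longrightarrow> smooth_bounded P' S F"
  unfolding smooth_bounded_def by (auto intro: bounded_derivs_subset)

lemma smooth_bounded_const: "(\<And>p. p \<in> P \<Longrightarrow> \<bar>c p\<bar> \<le> C) \<Longrightarrow> smooth_bounded P S (\<lambda>p x. c p)"
  unfolding smooth_bounded_def by (auto intro: bounded_derivs_const)

context
  fixes S :: "real set"
  assumes S: "open S"
begin

lemma smooth_bounded_add: "smooth_bounded P S F \<Longrightarrow> smooth_bounded P S G \<Longrightarrow> smooth_bounded P S (\<lambda>p x. F p x + G p x)"
  unfolding smooth_bounded_def by (auto intro: bounded_derivs_add[OF S])

lemma smooth_bounded_mult: "smooth_bounded P S F \<Longrightarrow> smooth_bounded P S G \<Longrightarrow> smooth_bounded P S (\<lambda>p x. F p x * G p x)"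
  unfolding smooth_bounded_def by (auto intro: bounded_derivs_mult[OF S])

lemma smooth_bounded_cmult: "smooth_bounded P S F \<Longrightarrow> smooth_bounded P S (\<lambda>p x. c * F p x)"
  by (rule smooth_bounded_mult[OF smooth_bounded_const[of _ _ "\<bar>c\<bar>"]]) auto

lemma smooth_bounded_inverse:
  "smooth_bounded P S F \<Longrightarrow> 0 < c \<Longrightarrow> (\<And>p x. p \<in> P \<Longrightarrow> x \<in> S \<Longrightarrow> c \<le> F p x) \<Longrightarrow>
   smooth_bounded P S (\<lambda>p x. inverse (F p x))"
  unfolding smooth_bounded_def by (auto intro: bounded_derivs_inverse[OF S])

lemma smooth_bounded_sqrt:
  "smooth_bounded P S F \<Longrightarrow> 0 < c \<Longrightarrow> (\<And>p x. p \<in> P \<Longrightarrow> x \<in> S \<Longrightarrow> c \<le> F p x) \<Longrightarrow>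
   smooth_bounded P S (\<lambda>p x. sqrt (F p x))"
  unfolding smooth_bounded_def by (auto intro: bounded_derivs_sqrt[OF S])

end

section \<open>The WKB recursion\<close>

definition log_deriv :: "(real \<Rightarrow> real) \<Rightarrow> real \<Rightarrow> real" where
  "log_deriv p x = deriv p x * inverse (p x)"

text \<open>With $g = p^{-1/2}$ the correction is $g''/g$.\<close>
definition wkb_correction :: "(real \<Rightarrow> real) \<Rightarrow> real \<Rightarrow> real" where
  "wkb_correction p x = (log_deriv p x)\<^sup>2 / 4 - deriv (log_deriv p) x / 2"

lemma smooth_bounded_log_deriv:
  assumes "open S" "smooth_bounded P S p" "0 < c" "\<And>a x. a \<in> P \<Longrightarrow> x \<in> S \<Longrightarrow> c \<le> p a x"
  shows "smooth_bounded P S (\<lambda>a. log_deriv (p a))"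
  unfolding log_deriv_def
  by (intro smooth_bounded_mult smooth_boundedD(2) smooth_bounded_inverse assms) (use assms in auto)

lemma smooth_bounded_wkb_correction:
  assumes "open S" "smooth_bounded P S p" "0 < c" "\<And>a x. a \<in> P \<Longrightarrow> x \<in> S \<Longrightarrow> c \<le> p a x"
  shows "smooth_bounded P S (\<lambda>a. wkb_correction (p a))"
proof -
  note L = smooth_bounded_log_deriv[OF assms]
  have "smooth_bounded P S (\<lambda>a x. 1 / 4 * (log_deriv (p a) x * log_deriv (p a) x) + (- (1 / 2)) * deriv (log_deriv (p a)) x)"
    by (intro smooth_bounded_add smooth_bounded_cmult smooth_bounded_mult L smooth_boundedD(2)[OF L] assms(1))
  then show ?thesis by (simp add: wkb_correction_def[abs_def] power2_eq_square)
qed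

text \<open>The logarithmic derivative of an even function is odd, its square and its derivative are
  even. So evenness on the gap survives every step of the recursion, and the final amplitude
  inherits it.\<close>

lemma wkb_correction_even:
  assumes G: "open G" "\<And>x. x \<in> G \<Longrightarrow> - x \<in> G" and p: "\<And>x. x \<in> G \<Longrightarrow> p (- x) = p x"
    and d: "\<And>x. x \<in> G \<Longrightarrow> (p has_real_derivative deriv p x) (at x)"
    and d2: "\<And>x. x \<in> G \<Longrightarrow> (log_deriv p has_real_derivative deriv (log_deriv p) x) (at x)" and x: "x \<in> G"
  shows "wkb_correction p (- x) = wkb_correction p x"
proof -
  have L: "log_deriv p (- x) = (- 1) * log_deriv p x" if "x \<in> G" for x
    using deriv_parity[OF G, of p 1 x] p d that by (simp add: log_deriv_def)
  have "deriv (log_deriv p) (- x) = - (- 1) * deriv (log_deriv p) x"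
    by (rule deriv_parity[OF G L d2 x])
  then show ?thesis using L[OF x] by (simp add: wkb_correction_def)
qed

text \<open>The factor \<open>H\<close> is carried explicitly instead of being divided out
  afterwards, because what multiplies it must again be smooth with bounds uniform in h. The
  logarithmic derivatives of \<open>pn\<close> and \<open>p\<close> differ by H \<rho>, and the
  correction is a polynomial in the logarithmic derivative and its derivative.\<close>

lemma wkb_step_identity:
  fixes p d :: "real \<Rightarrow> real"
  assumes S: "open S" and x: "x \<in> S" and H: "\<And>x. x \<in> S \<Longrightarrow> pn x = p x + H * d x"
    and p: "\<And>x. x \<in> S \<Longrightarrow> (p has_real_derivative deriv p x) (at x)"
    and d: "\<And>x. x \<in> S \<Longrightarrow> (d has_real_derivative deriv d x) (at x)"
    and nz: "\<And>x. x \<in> S \<Longrightarrow> p x \<noteq> 0 \<and> pn x \<noteq> 0"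
    and L: "(log_deriv p has_real_derivative deriv (log_deriv p) x) (at x)"
    and \<rho>: "\<And>x. \<rho> x = deriv d x * inverse (pn x) + (- 1) * (deriv p x * d x * (inverse (pn x) * inverse (p x)))"
    and d\<rho>: "(\<rho> has_real_derivative deriv \<rho> x) (at x)"
  shows "wkb_correction pn x - wkb_correction p x =
    H * (1 / 4 * (\<rho> x * (log_deriv pn x + log_deriv p x)) + (- (1 / 2)) * deriv \<rho> x)"
proof -
  have dpn: "deriv pn y = deriv p y + H * deriv d y" if y: "y \<in> S" for y
  proof -
    have "((\<lambda>x. p x + H * d x) has_real_derivative deriv p y + H * deriv d y) (at y)"
      by (intro DERIV_add DERIV_cmult p d y)
    then have "(pn has_real_derivative deriv p y + H * deriv d y) (at y)"
      by (rule has_field_derivative_transform_within_open[OF _ S y]) (simp add: H)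
    then show ?thesis by (rule DERIV_imp_deriv)
  qed
  have Ln: "log_deriv pn y = log_deriv p y + H * \<rho> y" if y: "y \<in> S" for y
  proof -
    have n: "p y \<noteq> 0" "pn y \<noteq> 0" using nz[OF y] by auto
    have "(log_deriv pn y - log_deriv p y - H * \<rho> y) * (p y * pn y) = deriv p y * (p y + H * d y - pn y)"
      unfolding log_deriv_def \<rho> dpn[OF y] using n by (simp add: field_simps)
    also have "\<dots> = 0" using H[OF y] by simp
    finally show ?thesis using n by simp
  qed
  have "((\<lambda>x. log_deriv p x + H * \<rho> x) has_real_derivative deriv (log_deriv p) x + H * deriv \<rho> x) (at x)"
    by (intro DERIV_add DERIV_cmult L d\<rho>)
  then have "(log_deriv pn has_real_derivative deriv (log_deriv p) x + H * deriv \<rho> x) (at x)"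
    by (rule has_field_derivative_transform_within_open[OF _ S x]) (simp add: Ln)
  then have dLn: "deriv (log_deriv pn) x = deriv (log_deriv p) x + H * deriv \<rho> x" by (rule DERIV_imp_deriv)
  show ?thesis unfolding wkb_correction_def dLn Ln[OF x]
    by (simp add: power2_eq_square algebra_simps add_divide_distrib diff_divide_distrib)
qed

lemma smooth_bounded_kinetic:
  assumes V: "smooth V" and S: "open S" "bounded S"
  shows "smooth_bounded ({e..M} \<times> {0<..h0}) S (\<lambda>a x. 2 * (fst a - V x))"
proof -
  have "smooth_bounded ({e..M} \<times> {0<..h0}) S (\<lambda>a x. 2 * fst a + (- 2) * V x)"
    by (intro smooth_bounded_add S smooth_bounded_cmult smooth_bounded_const[of _ _ "2 * (\<bar>e\<bar> + \<bar>M\<bar>)"])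
      (auto simp: smooth_bounded_def intro: bounded_derivs_smooth[OF V S])
  then show ?thesis by (simp add: algebra_simps)
qed

text \<open>Fixed-point iteration for p^2 = 2(E - V) + h^2 wkb_correction p: the next p is the
  square root of the right-hand side. If the residual has order h^(2n+2), the step moves p by that
  order, and the new residual, h^2 times the change of the correction, gains two powers. The
  parameter \<open>a\<close> is the pair of energy and h; uniformity comes from E staying at least
  \<open>c0\<close> above V on \<open>S\<close>.\<close>

lemma wkb_iteration:
  fixes V :: "real \<Rightarrow> real"
  assumes V: "smooth V" and S: "open S" "bounded S" and c0: "0 < c0" "\<And>x. x \<in> S \<Longrightarrow> V x + c0 \<le> e"
    and G: "open G" "G \<subseteq> S" "\<And>x. x \<in> G \<Longrightarrow> - x \<in> G" "\<And>x. x \<in> G \<Longrightarrow> V (- x) = V x"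
  shows "\<exists>h0 p r c. 0 < h0 \<and> h0 \<le> 1 \<and> 0 < c \<and>
     smooth_bounded ({e..M} \<times> {0<..h0}) S p \<and> smooth_bounded ({e..M} \<times> {0<..h0}) S r \<and>
     (\<forall>a\<in>{e..M} \<times> {0<..h0}. (\<forall>x\<in>S. c \<le> p a x \<and>
        2 * (fst a - V x) + (snd a)\<^sup>2 * wkb_correction (p a) x - (p a x)\<^sup>2 = (snd a) ^ (2 * n + 2) * r a x) \<and>
        (\<forall>x\<in>G. p a (- x) = p a x))"
proof (induction n)
  note q = smooth_bounded_kinetic[OF V S]
  case 0
  let ?P = "{e..M} \<times> {0<..1::real}"
  define p where "p a x = sqrt (2 * (fst a - V x))" for a :: "real \<times> real" and x
  have qc: "2 * c0 \<le> 2 * (fst a - V x)" if "a \<in> ?P" "x \<in> S" for a x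
    using c0(2)[OF that(2)] that(1) by auto
  have p: "smooth_bounded ?P S p" unfolding p_def
    by (rule smooth_bounded_sqrt[OF S(1) q, of "2 * c0"]) (use c0 qc in auto)
  have pc: "sqrt (2 * c0) \<le> p a x" if "a \<in> ?P" "x \<in> S" for a x
    unfolding p_def using qc[OF that] by simp
  have sc: "0 < sqrt (2 * c0)" using c0 by simp
  have r: "smooth_bounded ?P S (\<lambda>a. wkb_correction (p a))"
    by (rule smooth_bounded_wkb_correction[OF S(1) p sc pc])
  have p2: "(p a x)\<^sup>2 = 2 * (fst a - V x)" if "a \<in> ?P" "x \<in> S" for a x
    unfolding p_def using qc[OF that] c0(1) by (intro real_sqrt_pow2) linarith
  show ?case
  proof (rule exI[of _ 1], rule exI[of _ p], rule exI[of _ "\<lambda>a. wkb_correction (p a)"],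
      rule exI[of _ "sqrt (2 * c0)"], intro conjI ballI)
    fix a x assume a: "a \<in> ?P" and x: "x \<in> S"
    show "sqrt (2 * c0) \<le> p a x" by (rule pc[OF a x])
    show "2 * (fst a - V x) + (snd a)\<^sup>2 * wkb_correction (p a) x - (p a x)\<^sup>2 =
      snd a ^ (2 * 0 + 2) * wkb_correction (p a) x"
      by (simp add: p2[OF a x] power2_eq_square[of "snd a"])
  next
    fix a :: "real \<times> real" and x assume "x \<in> G"
    then show "p a (- x) = p a x" using G(4) by (simp add: p_def)
  qed (use p r sc in auto)
next
  note q = smooth_bounded_kinetic[OF V S]
  case (Suc n)
  obtain h0 p r c where h0: "0 < h0" "h0 \<le> 1" and c: "0 < c"
    and p0: "smooth_bounded ({e..M} \<times> {0<..h0}) S p" and r0: "smooth_bounded ({e..M} \<times> {0<..h0}) S r"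
    and all: "\<forall>a\<in>{e..M} \<times> {0<..h0}. (\<forall>x\<in>S. c \<le> p a x \<and>
        2 * (fst a - V x) + (snd a)\<^sup>2 * wkb_correction (p a) x - (p a x)\<^sup>2 = (snd a) ^ (2 * n + 2) * r a x) \<and>
        (\<forall>x\<in>G. p a (- x) = p a x)"
    using Suc.IH by (elim exE conjE)
  obtain C where C: "\<forall>a\<in>{e..M} \<times> {0<..h0}. \<forall>x\<in>S. \<bar>r a x\<bar> \<le> C" using smooth_boundedD(1)[OF r0] by (elim exE)
  \<comment> \<open>Small enough for the residual to consume at most three quarters of c^2, which
    keeps the new radicand above c^2/4 and the new p above c/2.\<close>
  define h1 where "h1 = min h0 (3 * c\<^sup>2 / (4 * (\<bar>C\<bar> + 1)))"
  have h1: "0 < h1" "h1 \<le> h0" "h1 \<le> 1" using h0 c by (auto simp: h1_def)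
  let ?P = "{e..M} \<times> {0<..h1}"
  have sub: "?P \<subseteq> {e..M} \<times> {0<..h0}" using h1 by auto
  have p: "smooth_bounded ?P S p" and r: "smooth_bounded ?P S r"
    by (rule smooth_bounded_subset[OF p0 sub], rule smooth_bounded_subset[OF r0 sub])
  have pc: "c \<le> p a x" and res: "2 * (fst a - V x) + (snd a)\<^sup>2 * wkb_correction (p a) x - (p a x)\<^sup>2 = (snd a) ^ (2 * n + 2) * r a x"
    and rC: "\<bar>r a x\<bar> \<le> C" if "a \<in> ?P" "x \<in> S" for a x
    using all C that subsetD[OF sub that(1)] by blast+
  have pe: "p a (- x) = p a x" if "a \<in> ?P" "x \<in> G" for a x
    using all that subsetD[OF sub that(1)] by blast
  have R: "smooth_bounded ?P S (\<lambda>a. wkb_correction (p a))"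
    by (rule smooth_bounded_wkb_correction[OF S(1) p c pc])
  define Q where "Q a x = 2 * (fst a - V x) + (snd a)\<^sup>2 * wkb_correction (p a) x" for a x
  have Q: "smooth_bounded ?P S Q" unfolding Q_def[abs_def]
  proof (rule smooth_bounded_add[OF S(1) q smooth_bounded_mult[OF S(1) smooth_bounded_const[of _ _ 1] R]])
    fix a assume "a \<in> ?P"
    then have "0 \<le> snd a" "snd a \<le> 1" using h1 by auto
    then show "\<bar>(snd a)\<^sup>2\<bar> \<le> 1" by (simp add: power_le_one)
  qed
  have Qeq: "Q a x = (p a x)\<^sup>2 + snd a ^ (2 * n + 2) * r a x" if "a \<in> ?P" "x \<in> S" for a x
    using res[OF that] unfolding Q_def by linarith
  have Qc: "c\<^sup>2 / 4 \<le> Q a x" if a: "a \<in> ?P" and x: "x \<in> S" for a x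
  proof -
    have s: "0 \<le> snd a" "snd a \<le> 1" "snd a \<le> 3 * c\<^sup>2 / (4 * (\<bar>C\<bar> + 1))" using a h1 by (auto simp: h1_def)
    have "snd a ^ (2 * n + 2) \<le> snd a ^ 1" by (rule power_decreasing) (use s in auto)
    then have "\<bar>snd a ^ (2 * n + 2) * r a x\<bar> \<le> snd a * (\<bar>C\<bar> + 1)"
      unfolding abs_mult using rC[OF a x] s by (intro mult_mono) auto
    also have "\<dots> \<le> (3 * c\<^sup>2 / (4 * (\<bar>C\<bar> + 1))) * (\<bar>C\<bar> + 1)" by (intro mult_right_mono s) simp
    also have "\<dots> = 3 / 4 * c\<^sup>2"
      using abs_ge_zero[of C] by (simp add: field_simps)
    finally have 1: "- (3 / 4 * c\<^sup>2) \<le> snd a ^ (2 * n + 2) * r a x" by linarith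
    have "c\<^sup>2 \<le> (p a x)\<^sup>2" using pc[OF a x] c by (intro power_mono) auto
    then show ?thesis using 1 unfolding Qeq[OF a x] by linarith
  qed
  define pn where "pn a x = sqrt (Q a x)" for a x
  have pn: "smooth_bounded ?P S pn" unfolding pn_def[abs_def]
    by (rule smooth_bounded_sqrt[OF S(1) Q, of "c\<^sup>2 / 4"]) (use c Qc in auto)
  have pnc: "c / 2 \<le> pn a x" if "a \<in> ?P" "x \<in> S" for a x
  proof -
    have "sqrt ((c / 2)\<^sup>2) \<le> sqrt (Q a x)"
      using Qc[OF that] by (intro real_sqrt_le_mono) (simp add: power_divide)
    then show ?thesis using c by (simp add: pn_def)
  qed
  have pn2: "(pn a x)\<^sup>2 = Q a x" if "a \<in> ?P" "x \<in> S" for a x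
  proof -
    have "0 \<le> Q a x" by (rule order_trans[OF _ Qc[OF that]]) simp
    then show ?thesis unfolding pn_def by (rule real_sqrt_pow2)
  qed
  have sumc: "c \<le> pn a x + p a x" if "a \<in> ?P" "x \<in> S" for a x
    using pc[OF that] pnc[OF that] c by linarith
  \<comment> \<open>The difference of squares divided by the sum, which is bounded below: it
    exhibits \<open>pn - p\<close> as h^(2n+2) times a uniformly smooth function.\<close>
  define d where "d a x = r a x * inverse (pn a x + p a x)" for a x
  have d: "smooth_bounded ?P S d" unfolding d_def[abs_def]
    by (intro smooth_bounded_mult r smooth_bounded_inverse[OF S(1) smooth_bounded_add[OF S(1) pn p] c sumc] S)
  have pnd: "pn a x = p a x + snd a ^ (2 * n + 2) * d a x" if a: "a \<in> ?P" and x: "x \<in> S" for a x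
  proof -
    have nz: "pn a x + p a x \<noteq> 0" using sumc[OF a x] c by linarith
    have "(pn a x - p a x) * (pn a x + p a x) = snd a ^ (2 * n + 2) * r a x"
      using pn2[OF a x] Qeq[OF a x] by (simp add: power2_eq_square algebra_simps)
    then have "pn a x - p a x = snd a ^ (2 * n + 2) * r a x / (pn a x + p a x)"
      using nz by (simp add: eq_divide_eq)
    then show ?thesis by (simp add: d_def divide_inverse)
  qed
  have c2: "0 < c / 2" using c by simp
  define \<rho> where "\<rho> a x = deriv (d a) x * inverse (pn a x) + (- 1) * (deriv (p a) x * d a x * (inverse (pn a x) * inverse (p a x)))" for a x
  have \<rho>: "smooth_bounded ?P S \<rho>" unfolding \<rho>_def[abs_def]
    by (intro smooth_bounded_add smooth_bounded_mult smooth_bounded_cmult smooth_boundedD(2)[OF d] smooth_boundedD(2)[OF p]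
        d smooth_bounded_inverse[OF S(1) pn c2 pnc] smooth_bounded_inverse[OF S(1) p c pc] S)
  define rn where "rn a x = 1 / 4 * (\<rho> a x * (log_deriv (pn a) x + log_deriv (p a) x)) + (- (1 / 2)) * deriv (\<rho> a) x" for a x
  have Lp: "smooth_bounded ?P S (\<lambda>a. log_deriv (p a))" by (rule smooth_bounded_log_deriv[OF S(1) p c pc])
  have Lpn: "smooth_bounded ?P S (\<lambda>a. log_deriv (pn a))" by (rule smooth_bounded_log_deriv[OF S(1) pn c2 pnc])
  have rn: "smooth_bounded ?P S rn" unfolding rn_def[abs_def]
    by (intro smooth_bounded_add smooth_bounded_cmult smooth_bounded_mult \<rho> Lp Lpn smooth_boundedD(2)[OF \<rho>] S)
  have nz: "p a x \<noteq> 0 \<and> pn a x \<noteq> 0" if "a \<in> ?P" "x \<in> S" for a x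
    using pc[OF that] pnc[OF that] c by auto
  have resn: "2 * (fst a - V x) + (snd a)\<^sup>2 * wkb_correction (pn a) x - (pn a x)\<^sup>2 = snd a ^ (2 * Suc n + 2) * rn a x"
    if a: "a \<in> ?P" and x: "x \<in> S" for a x
  proof -
    have id: "wkb_correction (pn a) x - wkb_correction (p a) x = snd a ^ (2 * n + 2) * rn a x"
      unfolding rn_def
      by (rule wkb_step_identity[OF S(1) x pnd[OF a] smooth_boundedD(3)[OF p a] smooth_boundedD(3)[OF d a] _
            smooth_boundedD(3)[OF Lp a x] \<rho>_def smooth_boundedD(3)[OF \<rho> a x]]) (rule nz[OF a] | assumption)+
    have "2 * (fst a - V x) + (snd a)\<^sup>2 * wkb_correction (pn a) x - (pn a x)\<^sup>2 =
        (snd a)\<^sup>2 * (wkb_correction (pn a) x - wkb_correction (p a) x)"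
      unfolding pn2[OF a x] Q_def by (simp add: algebra_simps)
    also have "\<dots> = snd a ^ (2 * Suc n + 2) * rn a x" unfolding id by (simp add: power_add power2_eq_square)
    finally show ?thesis .
  qed
  have pne: "pn a (- x) = pn a x" if a: "a \<in> ?P" and x: "x \<in> G" for a x
  proof -
    have "wkb_correction (p a) (- x) = wkb_correction (p a) x"
      by (rule wkb_correction_even[OF G(1,3) pe[OF a] smooth_boundedD(3)[OF p a] smooth_boundedD(3)[OF Lp a] x])
        (use G(2) in auto)
    then show ?thesis using G(4)[OF x] by (simp add: pn_def Q_def)
  qed
  show ?case
    by (rule exI[of _ h1], rule exI[of _ pn], rule exI[of _ rn], rule exI[of _ "c / 2"],
        intro conjI ballI h1 c2 pn rn pnc resn pne)
qed

text \<open>For g = sqrt(h/p) one has g''/g = \<open>wkb_correction\<close> of p and g^(-4) =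
  p^2/h^2, so the error is the residual of the recursion divided by h^2. Its order h^(2n) is
  weakened to h^n, which h \<le> 1 permits.\<close>

lemma wkb_amplitude:
  fixes V :: "real \<Rightarrow> real"
  assumes V: "smooth V" and S: "open S" "bounded S" and c0: "0 < c0" "\<And>x. x \<in> S \<Longrightarrow> V x + c0 \<le> e"
    and G: "open G" "G \<subseteq> S" "\<And>x. x \<in> G \<Longrightarrow> - x \<in> G" "\<And>x. x \<in> G \<Longrightarrow> V (- x) = V x"
  shows "\<exists>h0 C. 0 < h0 \<and> h0 \<le> 1 \<and> 0 \<le> C \<and> (\<forall>E h. e \<le> E \<longrightarrow> E \<le> M \<longrightarrow> 0 < h \<longrightarrow> h \<le> h0 \<longrightarrow>
    (\<exists>g g' g''. (\<forall>x\<in>S. 0 < g x \<and> (g has_real_derivative g' x) (at x) \<and> (g' has_real_derivative g'' x) (at x)) \<and>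
      continuous_on S g'' \<and> (\<forall>x\<in>G. g (- x) = g x) \<and>
      (\<forall>x\<in>S. \<bar>g'' x / g x - 1 / g x ^ 4 - schroedinger_coeff h V E x\<bar> \<le> C * h ^ n)))"
proof -
  have "\<exists>h0 p r c. 0 < h0 \<and> h0 \<le> 1 \<and> 0 < c \<and>
     smooth_bounded ({e..M} \<times> {0<..h0}) S p \<and> smooth_bounded ({e..M} \<times> {0<..h0}) S r \<and>
     (\<forall>a\<in>{e..M} \<times> {0<..h0}. (\<forall>x\<in>S. c \<le> p a x \<and>
        2 * (fst a - V x) + (snd a)\<^sup>2 * wkb_correction (p a) x - (p a x)\<^sup>2 = (snd a) ^ (2 * n + 2) * r a x) \<and>
        (\<forall>x\<in>G. p a (- x) = p a x))"
    by (rule wkb_iteration[OF V S c0 G])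
  then obtain h0 p r c where h0: "0 < h0" "h0 \<le> 1" and c: "0 < c"
    and p: "smooth_bounded ({e..M} \<times> {0<..h0}) S p" and r: "smooth_bounded ({e..M} \<times> {0<..h0}) S r"
    and all: "\<forall>a\<in>{e..M} \<times> {0<..h0}. (\<forall>x\<in>S. c \<le> p a x \<and>
        2 * (fst a - V x) + (snd a)\<^sup>2 * wkb_correction (p a) x - (p a x)\<^sup>2 = (snd a) ^ (2 * n + 2) * r a x) \<and>
        (\<forall>x\<in>G. p a (- x) = p a x)"
    by (elim exE conjE)
  let ?P = "{e..M} \<times> {0<..h0}"
  obtain C where C: "\<forall>a\<in>?P. \<forall>x\<in>S. \<bar>r a x\<bar> \<le> C" using smooth_boundedD(1)[OF r] by (elim exE)
  have pc: "c \<le> p a x" if "a \<in> ?P" "x \<in> S" for a x using all that by blast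
  have Lp: "smooth_bounded ?P S (\<lambda>a. log_deriv (p a))" by (rule smooth_bounded_log_deriv[OF S(1) p c pc])
  have R: "smooth_bounded ?P S (\<lambda>a. wkb_correction (p a))" by (rule smooth_bounded_wkb_correction[OF S(1) p c pc])
  show ?thesis
  proof (rule exI[of _ h0], rule exI[of _ "\<bar>C\<bar>"], intro conjI allI impI h0)
    fix E h :: real assume E: "e \<le> E" "E \<le> M" and h: "0 < h" "h \<le> h0"
    define a where "a = (E, h)"
    have a: "a \<in> ?P" using E h by (simp add: a_def)
    define g where "g x = sqrt (h / p a x)" for x
    define g' where "g' x = - (1 / 2) * (g x * log_deriv (p a) x)" for x
    define g'' where "g'' x = g x * wkb_correction (p a) x" for x
    have pp: "0 < p a x" if "x \<in> S" for x using pc[OF a that] c by linarith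
    have g0: "0 < g x" if "x \<in> S" for x using pp[OF that] h by (simp add: g_def)
    have dg: "(g has_real_derivative g' x) (at x)" if x: "x \<in> S" for x
    proof -
      have "((\<lambda>x. h * inverse (p a x)) has_real_derivative h * (- (inverse (p a x) * deriv (p a) x * inverse (p a x)))) (at x)"
        using pp[OF x] by (intro DERIV_cmult DERIV_inverse' smooth_boundedD(3)[OF p a x]) simp
      moreover have "0 < h * inverse (p a x)" using pp[OF x] h by simp
      ultimately have "((\<lambda>x. sqrt (h * inverse (p a x))) has_real_derivative
         inverse (sqrt (h * inverse (p a x))) / 2 * (h * (- (inverse (p a x) * deriv (p a) x * inverse (p a x))))) (at x)"
        by (rule DERIV_chain'[OF _ DERIV_real_sqrt])
      then have "(g has_real_derivative inverse (g x) / 2 * (h * (- (inverse (p a x) * deriv (p a) x * inverse (p a x))))) (at x)"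
        unfolding g_def[abs_def] divide_inverse .
      moreover have "inverse (g x) / 2 * (h * (- (inverse (p a x) * deriv (p a) x * inverse (p a x)))) = g' x"
      proof -
        have gg: "g x * g x = h * inverse (p a x)" using pp[OF x] h by (simp add: g_def divide_inverse)
        have "inverse (g x) / 2 * (h * (- (inverse (p a x) * deriv (p a) x * inverse (p a x)))) =
           inverse (g x) / 2 * (- ((h * inverse (p a x)) * (deriv (p a) x * inverse (p a x))))" by (simp only: mult_ac mult_minus_right)
        also have "\<dots> = g' x" unfolding gg[symmetric] g'_def log_deriv_def using g0[OF x] by (simp add: field_simps)
        finally show ?thesis .
      qed
      ultimately show ?thesis by simp
    qed
    have dg': "(g' has_real_derivative g'' x) (at x)" if x: "x \<in> S" for x
    proof -
      have "((\<lambda>x. - (1 / 2) * (g x * log_deriv (p a) x)) has_real_derivative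
          - (1 / 2) * (g' x * log_deriv (p a) x + deriv (log_deriv (p a)) x * g x)) (at x)"
        by (intro DERIV_cmult DERIV_mult dg x smooth_boundedD(3)[OF Lp a])
      moreover have "- (1 / 2) * (g' x * log_deriv (p a) x + deriv (log_deriv (p a)) x * g x) = g'' x"
        by (simp add: g'_def g''_def wkb_correction_def power2_eq_square algebra_simps)
      ultimately show ?thesis unfolding g'_def[abs_def] by simp
    qed
    have cg'': "continuous_on S g''"
      unfolding g''_def
      by (intro continuous_on_mult DERIV_continuous_on[OF has_field_derivative_at_within[OF dg]]
          DERIV_continuous_on[OF has_field_derivative_at_within[OF smooth_boundedD(3)[OF R a]]])
    have ge: "g (- x) = g x" if "x \<in> G" for x using all a that by (auto simp: g_def)
    have err: "\<bar>g'' x / g x - 1 / g x ^ 4 - schroedinger_coeff h V E x\<bar> \<le> \<bar>C\<bar> * h ^ n" if x: "x \<in> S" for x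
    proof -
      have res: "2 * (E - V x) + h\<^sup>2 * wkb_correction (p a) x - (p a x)\<^sup>2 = h ^ (2 * n + 2) * r a x"
        using all a x by (auto simp: a_def)
      have g4: "1 / g x ^ 4 = (p a x)\<^sup>2 / h\<^sup>2"
      proof -
        have "g x ^ 4 = (g x ^ 2) ^ 2" by simp
        also have "g x ^ 2 = h / p a x" using pp[OF x] h by (simp add: g_def)
        finally show ?thesis by (simp add: power_divide)
      qed
      have "g'' x / g x - 1 / g x ^ 4 - schroedinger_coeff h V E x =
         (2 * (E - V x) + h\<^sup>2 * wkb_correction (p a) x - (p a x)\<^sup>2) / h\<^sup>2"
        unfolding g4 schroedinger_coeff_def g''_def using g0[OF x] h
        by (simp add: add_divide_distrib diff_divide_distrib)
      also have "\<dots> = h ^ (2 * n) * r a x" unfolding res using h by (simp add: power_add power2_eq_square)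
      finally have eq: "g'' x / g x - 1 / g x ^ 4 - schroedinger_coeff h V E x = h ^ (2 * n) * r a x" .
      have "h ^ (2 * n) \<le> h ^ n" by (rule power_decreasing) (use h h0 in auto)
      then have "h ^ (2 * n) * \<bar>r a x\<bar> \<le> h ^ n * \<bar>C\<bar>"
        using C a x h by (intro mult_mono) (auto intro: order_trans[OF _ abs_ge_self])
      then show ?thesis unfolding eq using h by (simp add: abs_mult mult.commute)
    qed
    show "\<exists>g g' g''. (\<forall>x\<in>S. 0 < g x \<and> (g has_real_derivative g' x) (at x) \<and> (g' has_real_derivative g'' x) (at x)) \<and>
      continuous_on S g'' \<and> (\<forall>x\<in>G. g (- x) = g x) \<and>
      (\<forall>x\<in>S. \<bar>g'' x / g x - 1 / g x ^ 4 - schroedinger_coeff h V E x\<bar> \<le> \<bar>C\<bar> * h ^ n)"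
      by (rule exI[of _ g], rule exI[of _ g'], rule exI[of _ g''], intro conjI ballI g0 dg dg' cg'' ge err)
  qed simp
qed

section \<open>Reflection of a reflectionless region\<close>

lemma antiderivative_on_interval:
  fixes f :: "real \<Rightarrow> real"
  assumes z: "0 < z" and f: "continuous_on {-z<..<z} f"
  obtains F where "\<And>x. x \<in> {-z<..<z} \<Longrightarrow> (F has_real_derivative f x) (at x)"
proof -
  have "\<exists>F. \<forall>x. ereal (-z) < ereal x \<longrightarrow> ereal x < ereal z \<longrightarrow> (F has_vector_derivative f x) (at x)"
    by (rule einterval_antiderivative) (use z f in \<open>auto simp: continuous_on_eq_continuous_at\<close>)
  then obtain F where F: "\<forall>x. ereal (-z) < ereal x \<longrightarrow> ereal x < ereal z \<longrightarrow> (F has_vector_derivative f x) (at x)"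
    by (elim exE)
  show thesis
    by (rule that[of F]) (use F in \<open>simp add: has_real_derivative_iff_has_vector_derivative\<close>)
qed

text \<open>In the coordinate t = F(x) this is the reflection about the midpoint of F(-y) and
  F(y).\<close>

lemma reflection_map:
  fixes F D :: "real \<Rightarrow> real"
  assumes y: "0 < y" "y < z" and F: "\<And>x. x \<in> {-z<..<z} \<Longrightarrow> (F has_real_derivative D x) (at x)"
    and D: "\<And>x. x \<in> {-z<..<z} \<Longrightarrow> 0 < D x"
  obtains \<sigma> where "\<And>x. \<bar>x\<bar> \<le> y \<Longrightarrow> \<bar>\<sigma> x\<bar> \<le> y"
    "\<And>x. \<bar>x\<bar> \<le> y \<Longrightarrow> (\<sigma> has_real_derivative - (D x / D (\<sigma> x))) (at x)" "\<sigma> y = - y" "\<sigma> (- y) = y"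
proof -
  \<comment> \<open>Inverting F on an interval larger than [-y,y] gives two-sided derivatives at the
    ends, where the inner and outer pieces of a reflected function are glued.\<close>
  define w where "w = (y + z) / 2"
  have w: "y < w" "w < z" using y by (auto simp: w_def)
  have inz: "x \<in> {-z<..<z}" if "\<bar>x\<bar> \<le> w" for x using that w by auto
  have mono: "F a < F b" if "\<bar>a\<bar> \<le> w" "\<bar>b\<bar> \<le> w" "a < b" for a b
  proof (rule DERIV_pos_imp_increasing[OF that(3)])
    fix x assume "a \<le> x" "x \<le> b"
    then have "x \<in> {-z<..<z}" using that w by auto
    then show "\<exists>d. (F has_real_derivative d) (at x) \<and> 0 < d" using F D by blast
  qed
  have cF: "isCont F x" if "\<bar>x\<bar> \<le> w" for x using DERIV_isCont[OF F[OF inz[OF that]]] .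
  define r where "r v = (THE s. \<bar>s\<bar> \<le> w \<and> F s = v)" for v
  have rF: "r (F s) = s" if "\<bar>s\<bar> \<le> w" for s
    unfolding r_def
  proof (rule the_equality)
    fix s' assume s': "\<bar>s'\<bar> \<le> w \<and> F s' = F s"
    then show "s' = s" using mono[of s s'] mono[of s' s] that by (cases s s' rule: linorder_cases) auto
  qed (use that in simp)
  have surj: "\<exists>s. a \<le> s \<and> s \<le> b \<and> F s = v" if "F a \<le> v" "v \<le> F b" "a \<le> b" "\<bar>a\<bar> \<le> w" "\<bar>b\<bar> \<le> w" for v a b
  proof (rule IVT'[OF that(1,2,3)])
    show "continuous_on {a..b} F"
      by (rule continuous_at_imp_continuous_on) (use cF that in auto)
  qed
  have dr: "(r has_real_derivative inverse (D s)) (at (F s))" if s: "\<bar>s\<bar> \<le> y" for s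
  proof (rule DERIV_inverse_function[where f = F and a = "F (- w)" and b = "F w"])
    have rs: "r (F s) = s" by (rule rF) (use s w in simp)
    show "(F has_real_derivative D s) (at (r (F s)))" unfolding rs by (rule F[OF inz]) (use s w in simp)
    show "D s \<noteq> 0" using D[OF inz[of s]] s w by simp
    show "F (- w) < F s" "F s < F w" by (rule mono; use s w y in auto)+
    show "F (r v) = v" if vw: "F (- w) < v" "v < F w" for v
    proof -
      obtain t where t: "- w \<le> t" "t \<le> w" "F t = v"
        using surj[of "- w" v w] vw w y by auto
      then have "r (F t) = t" by (intro rF) auto
      then show ?thesis using t by simp
    qed
    show "isCont r (F s)"
    proof (rule isCont_inverse_function[where f = F and x = s and d = "w - y"])
      show "0 < w - y" using w by simp
      show "r (F t) = t" if "\<bar>t - s\<bar> \<le> w - y" for t by (rule rF) (use that s in linarith)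
      show "isCont F t" if "\<bar>t - s\<bar> \<le> w - y" for t by (rule cF) (use that s in linarith)
    qed
  qed
  define c where "c = F y + F (- y)"
  define \<sigma> where "\<sigma> x = r (c - F x)" for x
  have yw: "\<bar>y\<bar> \<le> w" "\<bar>- y\<bar> \<le> w" using w y by auto
  have mle: "F a \<le> F b" if "\<bar>a\<bar> \<le> w" "\<bar>b\<bar> \<le> w" "a \<le> b" for a b
    using mono[of a b] that by (cases "a = b") auto
  have key: "\<bar>\<sigma> x\<bar> \<le> y \<and> F (\<sigma> x) = c - F x" if x: "\<bar>x\<bar> \<le> y" for x
  proof -
    have xw: "\<bar>x\<bar> \<le> w" using x w by simp
    have "F (- y) \<le> F x" "F x \<le> F y" by (rule mle; use x xw yw in auto)+
    then obtain s where s: "- y \<le> s" "s \<le> y" "F s = c - F x"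
      using surj[of "- y" "c - F x" y] yw y unfolding c_def by auto
    then have "\<sigma> x = s" unfolding \<sigma>_def s(3)[symmetric] using w by (intro rF) auto
    then show ?thesis using s by auto
  qed
  show thesis
  proof (rule that[of \<sigma>])
    show "\<bar>\<sigma> x\<bar> \<le> y" if "\<bar>x\<bar> \<le> y" for x using key[OF that] by simp
    show "\<sigma> y = - y" "\<sigma> (- y) = y" unfolding \<sigma>_def c_def using rF[OF yw(1)] rF[OF yw(2)] by simp_all
    show "(\<sigma> has_real_derivative - (D x / D (\<sigma> x))) (at x)" if x: "\<bar>x\<bar> \<le> y" for x
    proof -
      have d1: "((\<lambda>x. c - F x) has_real_derivative - D x) (at x)"
        by (rule DERIV_cong[OF DERIV_diff[OF DERIV_const F[OF inz]]]) (use x w in auto)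
      have d2: "(r has_real_derivative inverse (D (\<sigma> x))) (at (c - F x))"
        using dr[of "\<sigma> x"] key[OF x] by simp
      show ?thesis unfolding \<sigma>_def[abs_def]
        by (rule DERIV_cong[OF DERIV_chain'[OF d1 d2]]) (simp add: \<sigma>_def divide_inverse mult.commute)
    qed
  qed
qed

text \<open>In the coordinate $t = \int g^{-2}$ and for $v = g w$ the form $v'^2 + (g''/g - g^{-4}) v^2$ becomes
  $\dot w^2 - w^2$ up to a boundary term, which is invariant under reflection in $t$. Since $g$ is even
  near $\pm y$, this reflection (the map $\sigma$ in the coordinate $x$) fits together with $x \mapsto -x$
  outside $[-y,y]$.\<close>
locale liouville_flip =
  fixes y z :: real and g g' g'' \<sigma> :: "real \<Rightarrow> real"
  assumes y: "0 < y" "y < z"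
    and g: "\<And>x. x \<in> {-z<..<z} \<Longrightarrow> 0 < g x"
      "\<And>x. x \<in> {-z<..<z} \<Longrightarrow> (g has_real_derivative g' x) (at x)"
      "\<And>x. x \<in> {-z<..<z} \<Longrightarrow> (g' has_real_derivative g'' x) (at x)" "continuous_on {-z<..<z} g''"
    and sym: "g (- y) = g y" "g' (- y) = - g' y"
    and \<sigma>: "\<And>x. \<bar>x\<bar> \<le> y \<Longrightarrow> \<bar>\<sigma> x\<bar> \<le> y" "\<sigma> y = - y" "\<sigma> (- y) = y"
      "\<And>x. \<bar>x\<bar> \<le> y \<Longrightarrow> (\<sigma> has_real_derivative - ((g (\<sigma> x))\<^sup>2 / (g x)\<^sup>2)) (at x)"
begin

definition flip :: "(real \<Rightarrow> real) \<Rightarrow> real \<Rightarrow> real" where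
  "flip v x = (if \<bar>x\<bar> \<le> y then g x * (v (\<sigma> x) / g (\<sigma> x)) else v (- x))"

text \<open>With w = v/g and dt = g^(-2) dx, the expression v' g - v g' is the derivative of w in t;
  its sign changes because t is reversed.\<close>

definition flip' :: "(real \<Rightarrow> real) \<Rightarrow> (real \<Rightarrow> real) \<Rightarrow> real \<Rightarrow> real" where
  "flip' v v' x = (if \<bar>x\<bar> \<le> y then g' x * (v (\<sigma> x) / g (\<sigma> x))
      - (v' (\<sigma> x) * g (\<sigma> x) - v (\<sigma> x) * g' (\<sigma> x)) / g x else - v' (- x))"

lemma inside: "\<bar>x\<bar> \<le> y \<Longrightarrow> x \<in> {-z<..<z}" "\<bar>x\<bar> \<le> y \<Longrightarrow> \<sigma> x \<in> {-z<..<z}"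
  using y \<sigma>(1)[of x] by auto

text \<open>The content is at \<bar>x\<bar> = y: there g takes equal values and opposite slopes on
  the two sides, so the inner formulas agree with x \<mapsto> -x to first order.\<close>

lemma outer_values:
  assumes "y \<le> \<bar>x\<bar>"
  shows "flip v x = v (- x)" "flip' v v' x = - v' (- x)"
proof -
  have gy: "0 < g y" using g(1) y by simp
  have "flip v x = v (- x) \<and> flip' v v' x = - v' (- x)"
  proof (cases "\<bar>x\<bar> = y")
    case True
    then have "x = y \<or> x = - y" by linarith
    then show ?thesis using gy y by (auto simp: flip_def flip'_def \<sigma> sym field_simps)
  qed (use assms in \<open>auto simp: flip_def flip'_def\<close>)
  then show "flip v x = v (- x)" "flip' v v' x = - v' (- x)" by auto
qed

lemma inner_deriv:
  assumes v: "\<And>x. (v has_real_derivative v' x) (at x)" and x: "\<bar>x\<bar> \<le> y"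
  shows "((\<lambda>x. g x * (v (\<sigma> x) / g (\<sigma> x))) has_real_derivative flip' v v' x) (at x)"
proof -
  have gp: "0 < g x" "0 < g (\<sigma> x)" using g(1) inside[OF x] by auto
  have 1: "((\<lambda>x. v (\<sigma> x)) has_real_derivative v' (\<sigma> x) * - ((g (\<sigma> x))\<^sup>2 / (g x)\<^sup>2)) (at x)"
    by (rule DERIV_chain'[OF \<sigma>(4)[OF x] v])
  have 2: "((\<lambda>x. g (\<sigma> x)) has_real_derivative g' (\<sigma> x) * - ((g (\<sigma> x))\<^sup>2 / (g x)\<^sup>2)) (at x)"
    by (rule DERIV_chain'[OF \<sigma>(4)[OF x] g(2)[OF inside(2)[OF x]]])
  have "((\<lambda>x. g x * (v (\<sigma> x) / g (\<sigma> x))) has_real_derivative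
      g' x * (v (\<sigma> x) / g (\<sigma> x)) + (v' (\<sigma> x) * - ((g (\<sigma> x))\<^sup>2 / (g x)\<^sup>2) * g (\<sigma> x) -
        v (\<sigma> x) * (g' (\<sigma> x) * - ((g (\<sigma> x))\<^sup>2 / (g x)\<^sup>2))) / (g (\<sigma> x) * g (\<sigma> x)) * g x) (at x)"
    using gp by (intro DERIV_mult DERIV_divide 1 2 g(2) inside x) auto
  then show ?thesis
    by (rule DERIV_cong) (use gp x in \<open>simp add: flip'_def field_simps power2_eq_square\<close>)
qed

text \<open>Only the points y and -y need care. The inner formula is differentiable slightly beyond
  them, and \<open>outer_values\<close> matches values and slopes.\<close>

lemma flip_deriv:
  assumes v: "\<And>x. (v has_real_derivative v' x) (at x)"
  shows "(flip v has_real_derivative flip' v v' x) (at x)"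
proof -
  let ?i = "\<lambda>x. g x * (v (\<sigma> x) / g (\<sigma> x))" and ?o = "\<lambda>x. v (- x)"
  have o: "(?o has_real_derivative - v' (- x)) (at x)" for x
    by (rule DERIV_cong[OF DERIV_chain'[OF DERIV_minus[OF DERIV_ident] v]]) simp
  have in0: "?i x = flip v x" if "\<bar>x\<bar> \<le> y" for x using that by (simp add: flip_def)
  consider "\<bar>x\<bar> < y" | "y < \<bar>x\<bar>" | "x = y" | "x = - y" by linarith
  then show ?thesis
  proof cases
    case 1
    have op: "open {-y<..<y}" "x \<in> {-y<..<y}" using 1 by auto
    show ?thesis
      by (rule has_field_derivative_transform_within_open[OF inner_deriv[OF v] op]) (use 1 in \<open>auto simp: flip_def\<close>)
  next
    case 2
    have op: "open {x. y < \<bar>x\<bar>}" by (intro open_Collect_less continuous_intros)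
    have "(flip v has_real_derivative - v' (- x)) (at x)"
      by (rule has_field_derivative_transform_within_open[OF o op]) (use 2 in \<open>auto simp: flip_def\<close>)
    then show ?thesis using outer_values(2)[of x v v'] 2 by simp
  next
    case 3
    have ov: "flip' v v' y = - v' (- y)" by (rule outer_values(2)) (use y in simp)
    have "((\<lambda>x. if x \<le> y then ?i x else ?o x) has_real_derivative - v' (- y)) (at y)"
    proof (rule DERIV_glue_at)
      show "(?i has_real_derivative - v' (- y)) (at y)" using inner_deriv[OF v, of y] y ov by simp
      show "?i y = ?o y" using in0[of y] outer_values(1)[of y v] y by simp
    qed (rule o)
    then have "(flip v has_real_derivative - v' (- y)) (at y)"
      by (rule has_field_derivative_transform_within_open[OF _ open_greaterThan[of 0]]) (use y in \<open>auto simp: flip_def\<close>)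
    then show ?thesis using 3 ov by simp
  next
    case 4
    have ov: "flip' v v' (- y) = - v' (- (- y))" by (rule outer_values(2)) (use y in simp)
    have eq: "?o (- y) = ?i (- y)" using in0[of "- y"] outer_values(1)[of "- y" v] y by simp
    have "((\<lambda>x. if x \<le> - y then ?o x else ?i x) has_real_derivative - v' (- (- y))) (at (- y))"
    proof (rule DERIV_glue_at)
      show "(?i has_real_derivative - v' (- (- y))) (at (- y))" using inner_deriv[OF v, of "- y"] y ov by simp
      show "?o (- y) = ?i (- y)" by (rule eq)
    qed (rule o)
    then have "(flip v has_real_derivative - v' (- (- y))) (at (- y))"
    proof (rule has_field_derivative_transform_within_open[OF _ open_lessThan[of 0]])
      fix x :: real assume "x \<in> {..<0}"
      then show "(if x \<le> - y then ?o x else ?i x) = flip v x" using eq by (cases "x = - y") (auto simp: flip_def)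
    qed (use y in simp)
    then show ?thesis using 4 ov by simp
  qed
qed

lemma cont_inside:
  "continuous_on {-y..y} \<sigma>" "continuous_on {-y..y} g" "continuous_on {-y..y} g'" "continuous_on {-y..y} g''"
proof -
  have i: "x \<in> {-z<..<z}" if "x \<in> {-y..y}" for x using that y by auto
  show "continuous_on {-y..y} \<sigma>"
    by (rule continuous_at_imp_continuous_on) (use DERIV_isCont[OF \<sigma>(4)] in auto)
  show "continuous_on {-y..y} g"
    by (rule continuous_at_imp_continuous_on) (use DERIV_isCont[OF g(2)[OF i]] in blast)
  show "continuous_on {-y..y} g'"
    by (rule continuous_at_imp_continuous_on) (use DERIV_isCont[OF g(3)[OF i]] in blast)
  show "continuous_on {-y..y} g''" by (rule continuous_on_subset[OF g(4)]) (use i in auto)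
qed

lemma flip_test_function:
  assumes v: "test_function R v v'" and R: "y < R"
  shows "test_function R (flip v) (flip' v v')"
  unfolding test_function_def
proof (intro conjI allI impI)
  show "(flip v has_real_derivative flip' v v' x) (at x)" for x
    by (rule flip_deriv[OF test_functionD(1)[OF v]])
  show "flip v x = 0" if "R \<le> \<bar>x\<bar>" for x
    using that R test_functionD(4)[OF v, of "- x"] by (simp add: flip_def)
  have \<sigma>in: "\<sigma> ` {-y..y} \<subseteq> {-y..y}"
  proof
    fix s assume "s \<in> \<sigma> ` {-y..y}"
    then obtain x where "x \<in> {-y..y}" "s = \<sigma> x" by auto
    then show "s \<in> {-y..y}" using \<sigma>(1)[of x] by (simp add: abs_le_iff)
  qed
  have gnz: "g x \<noteq> 0" "g (\<sigma> x) \<noteq> 0" if "x \<in> {-y..y}" for x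
  proof -
    have "\<bar>x\<bar> \<le> y" using that by (simp add: abs_le_iff)
    then show "g x \<noteq> 0" "g (\<sigma> x) \<noteq> 0"
      using g(1)[OF inside(1)[of x]] g(1)[OF inside(2)[of x]] by auto
  qed
  have "continuous_on ({-y..y} \<union> {x. y \<le> \<bar>x\<bar>}) (\<lambda>x. if \<bar>x\<bar> \<le> y then g' x * (v (\<sigma> x) / g (\<sigma> x))
      - (v' (\<sigma> x) * g (\<sigma> x) - v (\<sigma> x) * g' (\<sigma> x)) / g x else - v' (- x))"
  proof (rule continuous_on_cases)
    show "closed {x::real. y \<le> \<bar>x\<bar>}" by (intro closed_Collect_le continuous_intros)
    show "continuous_on {-y..y} (\<lambda>x. g' x * (v (\<sigma> x) / g (\<sigma> x))
      - (v' (\<sigma> x) * g (\<sigma> x) - v (\<sigma> x) * g' (\<sigma> x)) / g x)"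
      by (intro continuous_intros cont_inside continuous_on_compose2[OF test_functionD(2)[OF v]]
          continuous_on_compose2[OF test_functionD(3)[OF v]] continuous_on_compose2[OF cont_inside(2) cont_inside(1) \<sigma>in]
          continuous_on_compose2[OF cont_inside(3) cont_inside(1) \<sigma>in]) (use gnz in auto)
    show "continuous_on {x. y \<le> \<bar>x\<bar>} (\<lambda>x. - v' (- x))"
      by (intro continuous_intros continuous_on_compose2[OF test_functionD(3)[OF v]]) auto
    show "\<forall>x. x \<in> {- y..y} \<and> \<not> \<bar>x\<bar> \<le> y \<or> x \<in> {x. y \<le> \<bar>x\<bar>} \<and> \<bar>x\<bar> \<le> y \<longrightarrow>
      g' x * (v (\<sigma> x) / g (\<sigma> x)) - (v' (\<sigma> x) * g (\<sigma> x) - v (\<sigma> x) * g' (\<sigma> x)) / g x = - v' (- x)"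
    proof (intro allI impI)
      fix x assume "x \<in> {- y..y} \<and> \<not> \<bar>x\<bar> \<le> y \<or> x \<in> {x. y \<le> \<bar>x\<bar>} \<and> \<bar>x\<bar> \<le> y"
      then have "\<bar>x\<bar> = y" by auto
      then show "g' x * (v (\<sigma> x) / g (\<sigma> x)) - (v' (\<sigma> x) * g (\<sigma> x) - v (\<sigma> x) * g' (\<sigma> x)) / g x = - v' (- x)"
        using outer_values(2)[of x v v'] by (simp add: flip'_def)
    qed
  qed simp
  moreover have "{-y..y} \<union> {x. y \<le> \<bar>x\<bar>} = (UNIV :: real set)" by auto
  ultimately show "continuous_on UNIV (flip' v v')" by (simp add: flip'_def[abs_def])
qed

text \<open>Pointwise, v'^2 + (g''/g - g^(-4)) v^2 is the derivative of (g'/g) v^2 plus (v' g - v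
  g')^2/g^2 - v^2/g^4. Since g'/g is opposite at the two ends, the boundary term weighs v(y)^2 and
  v(-y)^2 equally and survives their exchange.\<close>

lemma inner_energy_formula:
  assumes v: "test_function R v v'"
  shows "energy (\<lambda>x. g'' x / g x - 1 / g x ^ 4) (-y) y v v' =
    g' y / g y * ((v y)\<^sup>2 + (v (- y))\<^sup>2) +
    integral {-y..y} (\<lambda>x. (v' x * g x - v x * g' x)\<^sup>2 / (g x)\<^sup>2 - (v x)\<^sup>2 / g x ^ 4)"
proof -
  have gnz: "g x \<noteq> 0" if "x \<in> {-y..y}" for x
    using g(1)[OF inside(1)[of x]] that by (auto simp: abs_le_iff)
  have dB: "((\<lambda>x. g' x / g x * (v x)\<^sup>2) has_real_derivative
      (g'' x * g x - g' x * g' x) / (g x * g x) * (v x)\<^sup>2 + 2 * v x * v' x * (g' x / g x)) (at x within A)"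
    if x: "x \<in> {-y..y}" for x A
  proof -
    have xz: "x \<in> {-z<..<z}" using x y by auto
    have "((\<lambda>x. g' x / g x) has_real_derivative (g'' x * g x - g' x * g' x) / (g x * g x)) (at x within A)"
      by (intro DERIV_divide has_field_derivative_at_within[OF g(2)[OF xz]] has_field_derivative_at_within[OF g(3)[OF xz]] gnz x)
    moreover have "((\<lambda>x. (v x)\<^sup>2) has_real_derivative 2 * v x * v' x) (at x within A)"
      by (auto intro!: derivative_eq_intros test_functionD(1)[OF v])
    ultimately show ?thesis by (rule DERIV_mult)
  qed
  have I1: "((\<lambda>x. (g'' x * g x - g' x * g' x) / (g x * g x) * (v x)\<^sup>2 + 2 * v x * v' x * (g' x / g x))
     has_integral (g' y / g y * (v y)\<^sup>2 - g' (- y) / g (- y) * (v (- y))\<^sup>2)) {-y..y}"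
    by (rule fundamental_theorem_of_calculus)
      (use y dB in \<open>auto simp: has_real_derivative_iff_has_vector_derivative[symmetric]\<close>)
  have "(\<lambda>x. (v' x * g x - v x * g' x)\<^sup>2 / (g x)\<^sup>2 - (v x)\<^sup>2 / g x ^ 4) integrable_on {-y..y}"
    by (intro integrable_continuous_real continuous_intros cont_inside test_functionD[OF v]) (use gnz in auto)
  then have I2: "((\<lambda>x. (v' x * g x - v x * g' x)\<^sup>2 / (g x)\<^sup>2 - (v x)\<^sup>2 / g x ^ 4) has_integral
    integral {-y..y} (\<lambda>x. (v' x * g x - v x * g' x)\<^sup>2 / (g x)\<^sup>2 - (v x)\<^sup>2 / g x ^ 4)) {-y..y}"
    by (rule integrable_integral)
  have "((\<lambda>x. (v' x)\<^sup>2 + (g'' x / g x - 1 / g x ^ 4) * (v x)\<^sup>2) has_integral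
    ((g' y / g y * (v y)\<^sup>2 - g' (- y) / g (- y) * (v (- y))\<^sup>2) +
      integral {-y..y} (\<lambda>x. (v' x * g x - v x * g' x)\<^sup>2 / (g x)\<^sup>2 - (v x)\<^sup>2 / g x ^ 4))) {-y..y}"
  proof (rule has_integral_eq[OF _ has_integral_add[OF I1 I2]])
    fix x assume x: "x \<in> {-y..y}"
    have id: "(g2 * a - b * b) / (a * a) * v0\<^sup>2 + 2 * v0 * v1 * (b / a) + ((v1 * a - v0 * b)\<^sup>2 / a\<^sup>2 - v0\<^sup>2 / q) =
      v1\<^sup>2 + (g2 / a - 1 / q) * v0\<^sup>2" if "a \<noteq> 0" for a b g2 v0 v1 q :: real
      using that by (simp add: divide_simps) (simp add: power2_eq_square algebra_simps)
    show "(g'' x * g x - g' x * g' x) / (g x * g x) * (v x)\<^sup>2 + 2 * v x * v' x * (g' x / g x) +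
       ((v' x * g x - v x * g' x)\<^sup>2 / (g x)\<^sup>2 - (v x)\<^sup>2 / g x ^ 4) =
       (v' x)\<^sup>2 + (g'' x / g x - 1 / g x ^ 4) * (v x)\<^sup>2" by (rule id[OF gnz[OF x]])
  qed
  from integral_unique[OF this] show ?thesis
    unfolding energy_def by (simp add: sym algebra_simps)
qed

text \<open>Each term of \<Phi> dx is a function of w and its t-derivative times dt, hence reversing
  t only changes variables by \<sigma>. The change of variables is read off from an antiderivative
  of \<Phi> on the larger interval, and \<sigma> exchanges the ends.\<close>

lemma inner_energy_flip:
  assumes v: "test_function R v v'" and R: "y < R"
  shows "energy (\<lambda>x. g'' x / g x - 1 / g x ^ 4) (-y) y (flip v) (flip' v v') =
    energy (\<lambda>x. g'' x / g x - 1 / g x ^ 4) (-y) y v v'"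
proof -
  define \<Phi> where "\<Phi> x = (v' x * g x - v x * g' x)\<^sup>2 / (g x)\<^sup>2 - (v x)\<^sup>2 / g x ^ 4" for x
  have gnz: "g x \<noteq> 0" if "x \<in> {-z<..<z}" for x using g(1)[OF that] by simp
  have "continuous_on {-z<..<z} \<Phi>" unfolding \<Phi>_def
    by (intro continuous_intros test_functionD[OF v] DERIV_continuous_on[OF has_field_derivative_at_within[OF g(2)]]
        DERIV_continuous_on[OF has_field_derivative_at_within[OF g(3)]]) (use gnz in auto)
  then obtain \<Psi> where \<Psi>: "\<And>x. x \<in> {-z<..<z} \<Longrightarrow> (\<Psi> has_real_derivative \<Phi> x) (at x)"
    using antiderivative_on_interval[of z \<Phi>] y by fastforce
  have 1: "(\<Phi> has_integral (\<Psi> y - \<Psi> (- y))) {-y..y}"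
    by (rule fundamental_theorem_of_calculus)
      (use y in \<open>auto simp: has_real_derivative_iff_has_vector_derivative[symmetric] intro!: has_field_derivative_at_within[OF \<Psi>]\<close>)
  have 2: "((\<lambda>x. \<Phi> (\<sigma> x) * ((g (\<sigma> x))\<^sup>2 / (g x)\<^sup>2)) has_integral (- \<Psi> (\<sigma> y) - - \<Psi> (\<sigma> (- y)))) {-y..y}"
  proof (rule fundamental_theorem_of_calculus)
    fix x assume "x \<in> {-y..y}"
    then have x: "\<bar>x\<bar> \<le> y" by auto
    have "((\<lambda>x. - \<Psi> (\<sigma> x)) has_real_derivative - (\<Phi> (\<sigma> x) * - ((g (\<sigma> x))\<^sup>2 / (g x)\<^sup>2))) (at x)"
      by (rule DERIV_minus[OF DERIV_chain'[OF \<sigma>(4)[OF x] \<Psi>[OF inside(2)[OF x]]]])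
    then have "((\<lambda>x. - \<Psi> (\<sigma> x)) has_real_derivative \<Phi> (\<sigma> x) * ((g (\<sigma> x))\<^sup>2 / (g x)\<^sup>2)) (at x within {-y..y})"
      by (simp add: has_field_derivative_at_within)
    then show "((\<lambda>x. - \<Psi> (\<sigma> x)) has_vector_derivative \<Phi> (\<sigma> x) * ((g (\<sigma> x))\<^sup>2 / (g x)\<^sup>2)) (at x within {-y..y})"
      by (simp add: has_real_derivative_iff_has_vector_derivative)
  qed (use y in simp)
  have 3: "(flip' v v' x * g x - flip v x * g' x)\<^sup>2 / (g x)\<^sup>2 - (flip v x)\<^sup>2 / g x ^ 4 =
     \<Phi> (\<sigma> x) * ((g (\<sigma> x))\<^sup>2 / (g x)\<^sup>2)" if "x \<in> {-y..y}" for x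
  proof -
    have x: "\<bar>x\<bar> \<le> y" using that by auto
    have nz: "g x \<noteq> 0" "g (\<sigma> x) \<noteq> 0" using gnz inside[OF x] by auto
    have Z: "flip' v v' x * g x - flip v x * g' x = - (v' (\<sigma> x) * g (\<sigma> x) - v (\<sigma> x) * g' (\<sigma> x))"
      using x nz by (simp add: flip_def flip'_def field_simps)
    have id: "(- Zs)\<^sup>2 / a\<^sup>2 - (a * (vs / b))\<^sup>2 / a ^ 4 = (Zs\<^sup>2 / b\<^sup>2 - vs\<^sup>2 / b ^ 4) * (b\<^sup>2 / a\<^sup>2)"
      if "a \<noteq> 0" "b \<noteq> 0" for Zs vs a b :: real
    proof -
      have "(a * (vs / b))\<^sup>2 / a ^ 4 = vs\<^sup>2 / (b\<^sup>2 * a\<^sup>2)"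
        using that by (simp add: power2_eq_square power4_eq_xxxx)
      moreover have "vs\<^sup>2 / b ^ 4 * (b\<^sup>2 / a\<^sup>2) = vs\<^sup>2 / (b\<^sup>2 * a\<^sup>2)"
        using that by (simp add: power2_eq_square power4_eq_xxxx)
      moreover have "Zs\<^sup>2 / b\<^sup>2 * (b\<^sup>2 / a\<^sup>2) = Zs\<^sup>2 / a\<^sup>2" using that by simp
      ultimately show ?thesis unfolding left_diff_distrib by (simp only: power2_minus)
    qed
    have f: "flip v x = g x * (v (\<sigma> x) / g (\<sigma> x))" using x by (simp add: flip_def)
    show ?thesis unfolding Z \<Phi>_def unfolding f by (rule id[OF nz])
  qed
  have "integral {-y..y} (\<lambda>x. (flip' v v' x * g x - flip v x * g' x)\<^sup>2 / (g x)\<^sup>2 - (flip v x)\<^sup>2 / g x ^ 4) =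
     integral {-y..y} (\<lambda>x. \<Phi> (\<sigma> x) * ((g (\<sigma> x))\<^sup>2 / (g x)\<^sup>2))"
    by (rule integral_cong[OF 3])
  also have "\<dots> = \<Psi> y - \<Psi> (- y)" using integral_unique[OF 2] by (simp add: \<sigma>)
  also have "\<dots> = integral {-y..y} \<Phi>" using integral_unique[OF 1] by simp
  finally have I: "integral {-y..y} (\<lambda>x. (flip' v v' x * g x - flip v x * g' x)\<^sup>2 / (g x)\<^sup>2 - (flip v x)\<^sup>2 / g x ^ 4) =
    integral {-y..y} \<Phi>" .
  have "flip v y = v (- y)" "flip v (- y) = v y"
    using outer_values(1)[of y v] outer_values(1)[of "- y" v] y by auto
  then show ?thesis
    unfolding inner_energy_formula[OF v] inner_energy_formula[OF flip_test_function[OF v R]] I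
    by (simp add: \<Phi>_def[abs_def] add.commute)
qed

lemma flip_sum:
  "flip (\<lambda>x. \<Sum>i<n. c i * v i x) x = (\<Sum>i<n. c i * flip (v i) x)"
  "flip' (\<lambda>x. \<Sum>i<n. c i * v i x) (\<lambda>x. \<Sum>i<n. c i * v' i x) x = (\<Sum>i<n. c i * flip' (v i) (v' i) x)"
  by (simp_all add: flip_def flip'_def sum_distrib_left sum_distrib_right sum_divide_distrib
      sum_subtractf[symmetric] sum_negf[symmetric] algebra_simps diff_divide_distrib)

text \<open>The flip is linear, preserves the reflectionless form inside and reflects the form
  outside. A negative family therefore carries over as soon as the reflectionless coefficient lies
  between \<open>k2\<close> and \<open>k1\<close> inside and the reflected \<open>k1\<close>
  dominates \<open>k2\<close> outside.\<close>

lemma neg_family_flip: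
  assumes k1: "continuous_on UNIV k1" and k2: "continuous_on UNIV k2"
    and inn: "\<And>x. \<bar>x\<bar> \<le> y \<Longrightarrow> g'' x / g x - 1 / g x ^ 4 \<le> k1 x"
      "\<And>x. \<bar>x\<bar> \<le> y \<Longrightarrow> k2 x \<le> g'' x / g x - 1 / g x ^ 4"
    and out: "\<And>x. y \<le> \<bar>x\<bar> \<Longrightarrow> k2 x \<le> k1 (- x)" and n: "neg_family k1 n"
  shows "neg_family k2 n"
proof -
  obtain R v v' where R: "y + 1 \<le> R" "0 < R" and v: "\<And>i. i < n \<Longrightarrow> test_function R (v i) (v' i)"
    and e: "\<And>c. \<exists>i<n. c i \<noteq> 0 \<Longrightarrow>
        energy k1 (-R) R (\<lambda>x. \<Sum>i<n. c i * v i x) (\<lambda>x. \<Sum>i<n. c i * v' i x) < 0"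
    by (rule neg_family_radius[OF k1 n, of "y + 1"]) (rule that)
  have yR: "y < R" using R by simp
  let ?k = "\<lambda>x. g'' x / g x - 1 / g x ^ 4"
  have kc: "continuous_on {-y..y} ?k"
    by (intro continuous_intros cont_inside) (use g(1)[OF inside(1)] in \<open>force simp: abs_le_iff\<close>)+
  have le: "energy k2 (-R) R (flip f) (flip' f f') \<le> energy k1 (-R) R f f'" if f: "test_function R f f'" for f f'
  proof -
    note Tf = flip_test_function[OF f yR]
    have split: "energy k (-R) R w w' = energy k (-R) (-y) w w' + energy k (-y) y w w' + energy k y R w w'"
      if "continuous_on UNIV k" "test_function R w w'" for k w w'
      using energy_split[OF that, of "-R" "-y" R] energy_split[OF that, of "-y" y R] y yR by simp
    have mid: "energy k2 (-y) y (flip f) (flip' f f') \<le> energy k1 (-y) y f f'"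
    proof -
      have "energy k2 (-y) y (flip f) (flip' f f') \<le> energy ?k (-y) y (flip f) (flip' f f')"
        unfolding energy_def
        by (intro integral_le energy_integrable[OF _ Tf] kc continuous_on_subset[OF k2] add_left_mono mult_right_mono inn(2)) auto
      also have "\<dots> = energy ?k (-y) y f f'" by (rule inner_energy_flip[OF f yR])
      also have "\<dots> \<le> energy k1 (-y) y f f'"
        unfolding energy_def
        by (intro integral_le energy_integrable[OF _ f] kc continuous_on_subset[OF k1] add_left_mono mult_right_mono inn(1)) auto
      finally show ?thesis .
    qed
    have outer: "energy k2 a b (flip f) (flip' f f') \<le> energy k1 (-b) (-a) f f'"
      if ab: "\<And>x. x \<in> {a..b} \<Longrightarrow> y \<le> \<bar>x\<bar>" for a b
    proof -
      have "energy k2 a b (flip f) (flip' f f') \<le> integral {a..b} (\<lambda>x. (f' (- x))\<^sup>2 + k1 (- x) * (f (- x))\<^sup>2)"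
        unfolding energy_def
      proof (rule integral_le)
        show "(\<lambda>x. (flip' f f' x)\<^sup>2 + k2 x * (flip f x)\<^sup>2) integrable_on {a..b}"
          by (rule energy_integrable[OF continuous_on_subset[OF k2] Tf]) simp
        show "(\<lambda>x. (f' (- x))\<^sup>2 + k1 (- x) * (f (- x))\<^sup>2) integrable_on {a..b}"
          by (intro integrable_continuous_real continuous_intros continuous_on_compose2[OF k1]
              continuous_on_compose2[OF test_functionD(2)[OF f]] continuous_on_compose2[OF test_functionD(3)[OF f]]) auto
        fix x assume x: "x \<in> {a..b}"
        show "(flip' f f' x)\<^sup>2 + k2 x * (flip f x)\<^sup>2 \<le> (f' (- x))\<^sup>2 + k1 (- x) * (f (- x))\<^sup>2"
          unfolding outer_values[OF ab[OF x]] using mult_right_mono[OF out[OF ab[OF x]], of "(f (- x))\<^sup>2"] by simp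
      qed
      also have "\<dots> = energy k1 (-b) (-a) f f'"
        unfolding energy_def
        using Henstock_Kurzweil_Integration.integral_reflect_real[of "- a" "- b" "\<lambda>x. (f' x)\<^sup>2 + k1 x * (f x)\<^sup>2"] by simp
      finally show ?thesis .
    qed
    show ?thesis
      unfolding split[OF k2 Tf] split[OF k1 f]
      using mid outer[of "-R" "-y"] outer[of y R] y by force
  qed
  show ?thesis
    unfolding neg_family_def
  proof (rule exI[of _ R], rule exI[of _ "\<lambda>i. flip (v i)"], rule exI[of _ "\<lambda>i. flip' (v i) (v' i)"], intro conjI allI impI)
    show "test_function R (flip (v i)) (flip' (v i) (v' i))" if "i < n" for i
      by (rule flip_test_function[OF v[OF that] yR])
    fix c :: "nat \<Rightarrow> real" assume c: "\<exists>i<n. c i \<noteq> 0"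
    have f: "test_function R (\<lambda>x. \<Sum>i<n. c i * v i x) (\<lambda>x. \<Sum>i<n. c i * v' i x)"
      by (rule test_function_sum[OF v])
    show "energy k2 (- R) R (\<lambda>x. \<Sum>i<n. c i * flip (v i) x) (\<lambda>x. \<Sum>i<n. c i * flip' (v i) (v' i) x) < 0"
      using le_less_trans[OF le[OF f] e[OF c]] unfolding flip_sum[abs_def] .
  qed (use R in simp)
qed

end

section \<open>Wells with flipped bumps\<close>

lemma bounded_derivs_funpow:
  "bounded_derivs P S (Suc n) F \<Longrightarrow> p \<in> P \<Longrightarrow> x \<in> S \<Longrightarrow>
    ((deriv ^^ n) (F p) has_real_derivative (deriv ^^ Suc n) (F p) x) (at x)"
proof (induction n arbitrary: F)
  case 0 then show ?case by simp
next
  case (Suc n)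
  have "((deriv ^^ n) (deriv (F p)) has_real_derivative (deriv ^^ Suc n) (deriv (F p)) x) (at x)"
    by (rule Suc.IH[of "\<lambda>p. deriv (F p)"]) (use Suc.prems in simp_all)
  then show ?case by (simp add: funpow_swap1)
qed

lemma smoothI:
  fixes V :: "real \<Rightarrow> real"
  assumes "\<And>R n. 0 < R \<Longrightarrow> bounded_derivs (UNIV :: unit set) {-R<..<R} n (\<lambda>_. V)"
  shows "smooth V"
  unfolding smooth_def
proof (intro exI[of _ "\<lambda>n. (deriv ^^ n) V"] conjI allI)
  fix n x
  have "((deriv ^^ n) V has_real_derivative (deriv ^^ Suc n) V x) (at x)"
    by (rule bounded_derivs_funpow[OF assms[of "\<bar>x\<bar> + 1" "Suc n"], of "()" x]) auto
  then show "((deriv ^^ n) V has_vector_derivative (deriv ^^ Suc n) V x) (at x)"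
    by (simp add: has_real_derivative_iff_has_vector_derivative)
qed simp

lemma smooth_affine:
  fixes f :: "real \<Rightarrow> real"
  assumes "smooth f"
  shows "smooth (\<lambda>x. f (s * x + c))"
proof -
  obtain D where D: "D 0 = f" "\<And>n x. (D n has_real_derivative D (Suc n) x) (at x)"
    using assms unfolding smooth_def has_real_derivative_iff_has_vector_derivative by auto
  show ?thesis unfolding smooth_def
  proof (intro exI[of _ "\<lambda>n x. s ^ n * D n (s * x + c)"] conjI allI)
    show "(\<lambda>x. s ^ 0 * D 0 (s * x + c)) = (\<lambda>x. f (s * x + c))" by (simp add: D(1))
    fix n x
    have "((\<lambda>x. s * x + c) has_real_derivative s) (at x)" by (auto intro!: derivative_eq_intros)
    from DERIV_cmult[OF DERIV_chain'[OF this D(2)], of "s ^ n" n]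
    have "((\<lambda>x. s ^ n * D n (s * x + c)) has_real_derivative s ^ Suc n * D (Suc n) (s * x + c)) (at x)"
      by (simp add: mult_ac)
    then show "((\<lambda>x. s ^ n * D n (s * x + c)) has_vector_derivative s ^ Suc n * D (Suc n) (s * x + c)) (at x)"
      by (simp only: has_real_derivative_iff_has_vector_derivative)
  qed
qed

text \<open>The n-th derivative of exp(-1/x) is p_n(1/x) exp(-1/x); the chain rule with t = 1/x
  gives the recursion p_(n+1) = t^2 (p_n - p_n').\<close>

fun flat_poly :: "nat \<Rightarrow> real poly" where
  "flat_poly 0 = 1"
| "flat_poly (Suc n) = [:0, 0, 1:] * (flat_poly n - pderiv (flat_poly n))"

definition flat_derivs :: "nat \<Rightarrow> real \<Rightarrow> real" where
  "flat_derivs n x = (if x \<le> 0 then 0 else poly (flat_poly n) (1 / x) * exp (- (1 / x)))"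

lemma poly_exp_tendsto_0: "((\<lambda>t::real. poly q t * exp (- t)) \<longlongrightarrow> 0) at_top"
proof -
  have "((\<lambda>t::real. \<Sum>i\<le>degree q. coeff q i * (t ^ i / exp t)) \<longlongrightarrow> (\<Sum>i\<le>degree q. coeff q i * 0)) at_top"
    by (intro tendsto_intros tendsto_power_div_exp_0)
  then show ?thesis by (simp add: poly_altdef sum_distrib_right exp_minus divide_inverse mult.assoc)
qed

lemma flat_derivs_deriv: "(flat_derivs n has_real_derivative flat_derivs (Suc n) x) (at x)"
proof -
  consider "x < 0" | "x = 0" | "0 < x" by linarith
  then show ?thesis
  proof cases
    case 1
    have "(flat_derivs n has_real_derivative 0) (at x)"
      by (rule has_field_derivative_transform_within_open[OF DERIV_const open_lessThan[of 0]])
        (use 1 in \<open>auto simp: flat_derivs_def\<close>)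
    then show ?thesis using 1 by (simp add: flat_derivs_def)
  next
    case 3
    let ?p = "flat_poly n"
    have inv: "((\<lambda>x. 1 / x) has_real_derivative - (1 / x\<^sup>2)) (at x)"
      using 3 by (auto intro!: derivative_eq_intros simp: power2_eq_square)
    have a: "((\<lambda>x. poly ?p (1 / x)) has_real_derivative poly (pderiv ?p) (1 / x) * - (1 / x\<^sup>2)) (at x)"
      by (rule DERIV_chain'[OF inv poly_DERIV])
    have b: "((\<lambda>x. exp (- (1 / x))) has_real_derivative exp (- (1 / x)) * - (- (1 / x\<^sup>2))) (at x)"
      by (rule DERIV_chain'[OF DERIV_minus[OF inv] DERIV_exp])
    have "((\<lambda>x. poly ?p (1 / x) * exp (- (1 / x))) has_real_derivative flat_derivs (Suc n) x) (at x)"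
      by (rule DERIV_cong[OF DERIV_mult[OF a b]])
        (use 3 in \<open>simp add: flat_derivs_def power2_eq_square algebra_simps\<close>)
    then show ?thesis
      by (rule has_field_derivative_transform_within_open[OF _ open_greaterThan[of 0]])
        (use 3 in \<open>auto simp: flat_derivs_def\<close>)
  next
    case 2
    have "((\<lambda>y. flat_derivs n y / y) \<longlongrightarrow> 0) (at_right 0)"
    proof -
      \<comment> \<open>With t = 1/y the difference quotient at 0 is t p(t) exp(-t);
        \<open>pCons 0\<close> supplies the extra factor t.\<close>
      have "((\<lambda>y. poly (pCons 0 (flat_poly n)) (1 / y) * exp (- (1 / y))) \<longlongrightarrow> 0) (at_right 0)"
        by (rule filterlim_compose[OF poly_exp_tendsto_0])
          (simp add: divide_inverse filterlim_inverse_at_top_right)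
      moreover have "\<forall>\<^sub>F y in at_right 0. poly (pCons 0 (flat_poly n)) (1 / y) * exp (- (1 / y)) = flat_derivs n y / y"
        by (rule eventually_at_right_less[THEN eventually_mono]) (simp add: flat_derivs_def)
      ultimately show ?thesis by (rule Lim_transform_eventually)
    qed
    moreover have "((\<lambda>y. flat_derivs n y / y) \<longlongrightarrow> 0) (at_left 0)"
    proof (rule tendsto_eventually)
      show "\<forall>\<^sub>F y in at_left (0::real). flat_derivs n y / y = 0"
        unfolding eventually_at_filter by (auto simp: flat_derivs_def)
    qed
    ultimately have "((\<lambda>y. flat_derivs n y / y) \<longlongrightarrow> 0) (at 0)" by (simp add: filterlim_split_at)
    then show ?thesis using 2 by (simp add: has_field_derivative_iff flat_derivs_def)
  qed
qed

definition bump :: "real \<Rightarrow> real" where "bump x = flat_derivs 0 x * flat_derivs 0 (1 - x)"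
definition bump' :: "real \<Rightarrow> real" where
  "bump' x = flat_derivs 1 x * flat_derivs 0 (1 - x) - flat_derivs 0 x * flat_derivs 1 (1 - x)"

lemma smooth_flat: "smooth (flat_derivs 0)"
  unfolding smooth_def by (intro exI[of _ flat_derivs])
    (simp add: flat_derivs_deriv has_real_derivative_iff_has_vector_derivative[symmetric])

lemma bump_deriv: "(bump has_real_derivative bump' x) (at x)"
proof -
  have d: "((\<lambda>x. 1 - x) has_real_derivative -1) (at x)" by (auto intro!: derivative_eq_intros)
  show ?thesis unfolding bump_def[abs_def]
    by (rule DERIV_cong[OF DERIV_mult[OF flat_derivs_deriv DERIV_chain'[OF d flat_derivs_deriv]]])
      (simp add: bump'_def)
qed

lemma smooth_bump: "smooth bump"
proof (rule smoothI)
  fix R :: real and n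
  have b: "bounded_derivs (UNIV :: unit set) {-R<..<R} n (\<lambda>_ x. flat_derivs 0 x * flat_derivs 0 (-1 * x + 1))"
    by (intro bounded_derivs_mult bounded_derivs_smooth smooth_flat smooth_affine[OF smooth_flat]) auto
  have "bump = (\<lambda>x. flat_derivs 0 x * flat_derivs 0 (-1 * x + 1))" by (rule ext) (simp add: bump_def)
  then show "bounded_derivs (UNIV :: unit set) {-R<..<R} n (\<lambda>_. bump)" using b by simp
qed

lemma bump_outside: "x \<le> 0 \<or> 1 \<le> x \<Longrightarrow> bump x = 0 \<and> bump' x = 0"
  by (auto simp: bump_def bump'_def flat_derivs_def)

lemma bump_nonneg: "0 \<le> bump x" by (simp add: bump_def flat_derivs_def)

lemma bump_half: "0 < bump (1 / 2)" by (simp add: bump_def flat_derivs_def)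

text \<open>4 is the slope of 2x^2 at x = 1, where the first bump interval begins. A bump slope
  strictly below it keeps the wells monotone on each side. The bound rests on t^2 < 2 exp t with t =
  1/x.\<close>

lemma bump'_bound: "\<bar>bump' x\<bar> < 4"
proof -
  have a: "0 \<le> flat_derivs 0 x \<and> flat_derivs 0 x \<le> 1" for x by (auto simp: flat_derivs_def)
  have b: "0 \<le> flat_derivs 1 x \<and> flat_derivs 1 x < 2" for x
  proof (cases "x \<le> 0")
    case False
    define t where "t = 1 / x"
    have t: "0 < t" using False by (simp add: t_def)
    have "t\<^sup>2 < 2 * exp t" using exp_lower_Taylor_quadratic[of t] t by simp
    then have "t\<^sup>2 * exp (- t) < 2" by (simp add: exp_minus field_simps)
    then show ?thesis using False by (simp add: flat_derivs_def t_def[symmetric] power2_eq_square)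
  qed (simp add: flat_derivs_def)
  have c: "0 \<le> flat_derivs 1 u * flat_derivs 0 w \<and> flat_derivs 1 u * flat_derivs 0 w < 2" for u w
  proof -
    have "flat_derivs 1 u * flat_derivs 0 w \<le> flat_derivs 1 u * 1" using a b by (intro mult_left_mono) auto
    then show ?thesis using a[of w] b[of u] by (auto intro: le_less_trans)
  qed
  have "\<bar>A - B\<bar> < 4" if "0 \<le> A \<and> A < 2" "0 \<le> B \<and> B < 2" for A B :: real using that by linarith
  from this[OF c c] show ?thesis unfolding bump'_def mult.commute[of "flat_derivs 0 x"] .
qed

section \<open>The wells and their sign sequences\<close>

definition side :: "bool \<Rightarrow> real" where "side b = (if b then 1 else -1)"

definition bumps :: "(nat \<Rightarrow> bool) \<Rightarrow> nat \<Rightarrow> real \<Rightarrow> real" where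
  "bumps s n x = 2 * x\<^sup>2 + (\<Sum>j<n. bump (side (s j) * x + - (2 * real j + 1)))"

definition bumps' :: "(nat \<Rightarrow> bool) \<Rightarrow> nat \<Rightarrow> real \<Rightarrow> real" where
  "bumps' s n x = 4 * x + (\<Sum>j<n. side (s j) * bump' (side (s j) * x + - (2 * real j + 1)))"

text \<open>The bump number $j$ sits on the interval $[2j+1,2j+2]$ or on its mirror image, depending on
  $s_j$; the sum is locally finite.\<close>
definition well :: "(nat \<Rightarrow> bool) \<Rightarrow> real \<Rightarrow> real" where
  "well s x = bumps s (nat \<lceil>\<bar>x\<bar>\<rceil>) x"

lemma side_abs: "\<bar>side b * x\<bar> = \<bar>x\<bar>" by (simp add: side_def)

lemma bump_term_zero:
  assumes "\<bar>x\<bar> \<le> 2 * real j + 1 \<or> 2 * real j + 2 \<le> \<bar>x\<bar>"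
  shows "bump (side b * x + - (2 * real j + 1)) = 0 \<and> bump' (side b * x + - (2 * real j + 1)) = 0"
proof (rule bump_outside)
  show "side b * x + - (2 * real j + 1) \<le> 0 \<or> 1 \<le> side b * x + - (2 * real j + 1)"
    using assms unfolding side_def by (auto simp: abs_if split: if_splits)
qed

lemma bumps_extend:
  assumes "n \<le> m" "\<bar>x\<bar> \<le> 2 * real n + 1"
  shows "bumps s m x = bumps s n x"
proof -
  have "(\<Sum>j<m. bump (side (s j) * x + - (2 * real j + 1))) = (\<Sum>j<n. bump (side (s j) * x + - (2 * real j + 1)))"
  proof (rule sum.mono_neutral_right)
    show "\<forall>j\<in>{..<m} - {..<n}. bump (side (s j) * x + - (2 * real j + 1)) = 0"
      using bump_term_zero[of x] assms(2) by (auto simp: not_less)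
  qed (use assms in auto)
  then show ?thesis by (simp add: bumps_def)
qed

lemma well_eq:
  assumes "\<bar>x\<bar> \<le> 2 * real n + 1"
  shows "well s x = bumps s n x"
proof -
  let ?k = "nat \<lceil>\<bar>x\<bar>\<rceil>"
  have "\<bar>x\<bar> \<le> real ?k" by linarith
  then have "\<bar>x\<bar> \<le> 2 * real ?k + 1" by linarith
  then show ?thesis
    unfolding well_def using bumps_extend[of ?k "max ?k n" x s] bumps_extend[of n "max ?k n" x s] assms by simp
qed

lemma bumps_deriv: "(bumps s n has_real_derivative bumps' s n x) (at x)"
proof -
  have "((\<lambda>x. bump (side b * x + c)) has_real_derivative side b * bump' (side b * x + c)) (at x)" for b c
  proof -
    have "((\<lambda>x. side b * x + c) has_real_derivative side b) (at x)" by (auto intro!: derivative_eq_intros)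
    from DERIV_chain'[OF this bump_deriv] show ?thesis by (simp add: mult.commute)
  qed
  moreover have "((\<lambda>x. 2 * x\<^sup>2) has_real_derivative 4 * x) (at x)" by (auto intro!: derivative_eq_intros)
  ultimately show ?thesis unfolding bumps_def[abs_def] bumps'_def by (intro DERIV_add DERIV_sum)
qed

lemma well_deriv:
  assumes "\<bar>x\<bar> < 2 * real n + 1"
  shows "(well s has_real_derivative bumps' s n x) (at x)"
proof -
  have o: "open {x::real. \<bar>x\<bar> < 2 * real n + 1}" by (intro open_Collect_less continuous_intros)
  show ?thesis
    by (rule has_field_derivative_transform_within_open[OF bumps_deriv o]) (use assms in simp, rule well_eq[symmetric], simp)
qed

lemma smooth_bumps: "smooth (bumps s n)"
proof (rule smoothI)
  fix R :: real and m
  have poly: "bounded_derivs (UNIV :: unit set) {-R<..<R} m (\<lambda>_ x. x)"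
  proof -
    have b: "\<exists>C. \<forall>p\<in>UNIV :: unit set. \<forall>x\<in>{-R<..<R}. \<bar>x\<bar> \<le> C" by (intro exI[of _ R]) auto
    show ?thesis
    proof (cases m)
      case 0 then show ?thesis using b by simp
    next
      case (Suc k)
      show ?thesis unfolding Suc
        by (rule bounded_derivs_SucI[OF open_greaterThanLessThan b DERIV_ident]) (rule bounded_derivs_const[of _ _ 1], simp)
    qed
  qed
  have sq: "bounded_derivs (UNIV :: unit set) {-R<..<R} m (\<lambda>_ x. 2 * x\<^sup>2)"
    unfolding power2_eq_square
    by (intro bounded_derivs_mult open_greaterThanLessThan poly bounded_derivs_const[of _ _ 2]) simp
  show "bounded_derivs (UNIV :: unit set) {-R<..<R} m (\<lambda>_. bumps s n)"
  proof (induction n)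
    case 0
    show ?case using sq by (simp add: bumps_def[abs_def])
  next
    case (Suc n)
    have "bounded_derivs (UNIV :: unit set) {-R<..<R} m (\<lambda>_ x. bumps s n x + bump (side (s n) * x + - (2 * real n + 1)))"
      by (intro bounded_derivs_add open_greaterThanLessThan Suc bounded_derivs_smooth smooth_affine smooth_bump) auto
    then show ?case by (simp add: bumps_def[abs_def] add.assoc)
  qed
qed

lemma smooth_well: "smooth (well s)"
proof (rule smoothI)
  fix R :: real and m assume R: "0 < R"
  define n where "n = nat \<lceil>R\<rceil>"
  show "bounded_derivs (UNIV :: unit set) {-R<..<R} m (\<lambda>_. well s)"
  proof (rule bounded_derivs_cong[OF open_greaterThanLessThan _ bounded_derivs_smooth[OF smooth_bumps]])
    fix x assume "x \<in> {-R<..<R}"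
    moreover have "R \<le> real n" unfolding n_def by linarith
    ultimately have "\<bar>x\<bar> \<le> 2 * real n + 1" by auto
    then show "bumps s n x = well s x" using well_eq by simp
  qed auto
qed

lemma continuous_well: "continuous_on A (well s)"
proof (rule continuous_at_imp_continuous_on, rule ballI)
  fix x
  show "isCont (well s) x"
    by (rule DERIV_isCont[OF well_deriv[of x "nat \<lceil>\<bar>x\<bar>\<rceil>"]]) linarith
qed

lemma well_lower: "2 * x\<^sup>2 \<le> well s x"
  unfolding well_def bumps_def using bump_nonneg by (simp add: sum_nonneg)

lemma well_gap:
  assumes "2 * real j \<le> \<bar>x\<bar>" "\<bar>x\<bar> \<le> 2 * real j + 1"
  shows "well s x = 2 * x\<^sup>2"
proof -
  have "bump (side (s i) * x + - (2 * real i + 1)) = 0" if "i < j" for i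
  proof -
    have "real i + 1 \<le> real j" using that by simp
    then show ?thesis using bump_term_zero[of x i "s i"] assms by simp
  qed
  then show ?thesis using well_eq[OF assms(2)] by (simp add: bumps_def)
qed

text \<open>For a given \<bar>x\<bar> at most one bump is active, whichever sides are chosen, so the
  bound for one bump bounds the sum.\<close>

lemma bumps'_sum_bound:
  "\<bar>\<Sum>j<n. side (s j) * bump' (side (s j) * x + - (2 * real j + 1))\<bar> < 4"
  "\<bar>x\<bar> \<le> 1 \<Longrightarrow> (\<Sum>j<n. side (s j) * bump' (side (s j) * x + - (2 * real j + 1))) = 0"
proof -
  let ?t = "\<lambda>j. side (s j) * bump' (side (s j) * x + - (2 * real j + 1))"
  \<comment> \<open>The only index whose bump interval can contain \<bar>x\<bar> in its interior.
    For \<bar>x\<bar> < 1 the floor is negative and \<open>nat\<close> gives 0, whose term vanishes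
    there.\<close>
  define j0 where "j0 = nat \<lfloor>(\<bar>x\<bar> - 1) / 2\<rfloor>"
  have z: "?t j = 0" if j: "j \<noteq> j0" for j
  proof -
    have "\<bar>x\<bar> \<le> 2 * real j + 1 \<or> 2 * real j + 2 \<le> \<bar>x\<bar>"
    proof (rule ccontr)
      assume "\<not> ?thesis"
      then have "real j \<le> (\<bar>x\<bar> - 1) / 2" "(\<bar>x\<bar> - 1) / 2 < real j + 1" by auto
      then have "\<lfloor>(\<bar>x\<bar> - 1) / 2\<rfloor> = int j" by (intro floor_unique) auto
      then show False using j by (simp add: j0_def)
    qed
    then show ?thesis using bump_term_zero[of x j "s j"] by simp
  qed
  have "(\<Sum>j<n. ?t j) = (\<Sum>j<n. if j = j0 then ?t j0 else 0)"
    by (rule sum.cong) (use z in auto)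
  also have "\<dots> = (if j0 < n then ?t j0 else 0)" by simp
  finally have eq: "(\<Sum>j<n. ?t j) = (if j0 < n then ?t j0 else 0)" .
  show "\<bar>\<Sum>j<n. ?t j\<bar> < 4" unfolding eq using bump'_bound by (simp add: side_abs)
  assume "\<bar>x\<bar> \<le> 1"
  then have "?t j = 0" for j using bump_term_zero[of x j "s j"] by simp
  then show "(\<Sum>j<n. ?t j) = 0" by (intro sum.neutral ballI)
qed

lemma bumps'_sign: "0 < x \<Longrightarrow> 0 < bumps' s n x" "x < 0 \<Longrightarrow> bumps' s n x < 0"
proof -
  let ?S = "\<Sum>j<n. side (s j) * bump' (side (s j) * x + - (2 * real j + 1))"
  have S: "?S = 0 \<or> \<bar>?S\<bar> < 4 \<and> 1 < \<bar>x\<bar>"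
  proof (cases "\<bar>x\<bar> \<le> 1")
    case True
    then show ?thesis by (intro disjI1 bumps'_sum_bound(2))
  next
    case False
    then show ?thesis using bumps'_sum_bound(1)[of s x n] by (intro disjI2) simp
  qed
  show "0 < x \<Longrightarrow> 0 < bumps' s n x" "x < 0 \<Longrightarrow> bumps' s n x < 0"
    using S unfolding bumps'_def by (auto simp: abs_less_iff)
qed

lemma well_deriv': "deriv (well s) x = bumps' s (nat \<lceil>\<bar>x\<bar>\<rceil>) x"
  by (rule DERIV_imp_deriv[OF well_deriv]) linarith

lemma well_increasing: "0 \<le> a \<Longrightarrow> a < b \<Longrightarrow> well s a < well s b"
proof (rule DERIV_pos_imp_increasing_open[of a b])
  fix x assume ab: "0 \<le> a" "a < x"
  have "(well s has_real_derivative bumps' s (nat \<lceil>\<bar>x\<bar>\<rceil>) x) (at x)" by (rule well_deriv) linarith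
  then show "\<exists>y. (well s has_real_derivative y) (at x) \<and> 0 < y" using bumps'_sign(1)[of x] ab by auto
qed (auto intro: continuous_well)

lemma well_decreasing: "b \<le> 0 \<Longrightarrow> a < b \<Longrightarrow> well s b < well s a"
proof (rule DERIV_neg_imp_decreasing_open[of a b])
  fix x assume ab: "b \<le> 0" "x < b"
  have "(well s has_real_derivative bumps' s (nat \<lceil>\<bar>x\<bar>\<rceil>) x) (at x)" by (rule well_deriv) linarith
  then show "\<exists>y. (well s has_real_derivative y) (at x) \<and> y < 0" using bumps'_sign(2)[of x] ab by auto
qed (auto intro: continuous_well)

text \<open>Monotonicity on each side together with the unperturbed value 2a^2 at both ends; thus
  the energy thresholds in a gap do not depend on the sign sequence.\<close>

lemma well_beyond_gap:
  assumes a: "2 * real j \<le> a" "a \<le> 2 * real j + 1"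
  shows "a \<le> \<bar>x\<bar> \<Longrightarrow> 2 * a\<^sup>2 \<le> well s x" "\<bar>x\<bar> \<le> a \<Longrightarrow> well s x \<le> 2 * a\<^sup>2"
proof -
  have a0: "0 \<le> a" using a(1) by (rule order_trans[rotated]) simp
  have e: "well s a = 2 * a\<^sup>2" "well s (- a) = 2 * a\<^sup>2" using well_gap[of j a s] well_gap[of j "- a" s] a a0 by auto
  have inc: "well s u \<le> well s v" if "0 \<le> u" "u \<le> v" for u v using well_increasing[of u v s] that by (cases "u = v") auto
  have dec: "well s v \<le> well s u" if "v \<le> 0" "u \<le> v" for u v using well_decreasing[of v u s] that by (cases "u = v") auto
  show "a \<le> \<bar>x\<bar> \<Longrightarrow> 2 * a\<^sup>2 \<le> well s x"
    using inc[of a x] dec[of "- a" x] e a0 by (cases "0 \<le> x") auto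
  show "\<bar>x\<bar> \<le> a \<Longrightarrow> well s x \<le> 2 * a\<^sup>2"
    using inc[of x a] dec[of x "- a"] e a0 by (cases "0 \<le> x") auto
qed

lemma single_well_well: "single_well (well s)"
  unfolding single_well_def
proof (intro conjI allI)
  show "smooth (well s)" by (rule smooth_well)
  show "deriv (well s) x = 0 \<longleftrightarrow> x = 0" for x
  proof (cases "x = 0")
    case True
    then show ?thesis using bumps'_sum_bound(2)[of 0 s] by (simp add: well_deriv' bumps'_def)
  next
    case False
    then show ?thesis unfolding well_deriv'
      using bumps'_sign[where s = s and x = x and n = "nat \<lceil>\<bar>x\<bar>\<rceil>"] by (cases "0 < x") auto
  qed
  have "deriv (well s) x = 4 * x" if "x \<in> {-1<..<1}" for x
  proof -
    have "\<bar>x\<bar> \<le> 1" using that by auto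
    from bumps'_sum_bound(2)[OF this] show ?thesis unfolding well_deriv' bumps'_def by simp
  qed
  then have "deriv (deriv (well s)) 0 = deriv (\<lambda>x. 4 * x) 0"
    by (intro deriv_cong_open[of "{-1<..<1}"]) auto
  also have "deriv (\<lambda>x. 4 * x) (0::real) = 4" by (rule DERIV_imp_deriv) (auto intro!: derivative_eq_intros)
  finally show "deriv (deriv (well s)) 0 \<noteq> 0" by simp
  show "well s 0 = 0" using well_gap[of 0 0 s] by simp
  show "strict_mono_on {0<..} (well s)" by (rule strict_mono_onI) (auto intro: well_increasing)
  show "strict_antimono_on {..<0} (well s)" by (rule monotone_onI) (auto intro: well_decreasing)
  have 1: "filterlim (\<lambda>x::real. 2 * x\<^sup>2) at_top at_top" by real_asymp
  have 2: "filterlim (\<lambda>x::real. 2 * x\<^sup>2) at_top at_bot" by real_asymp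
  show "filterlim (well s) at_top at_top"
    by (rule filterlim_at_top_mono[OF 1]) (simp add: well_lower)
  show "filterlim (well s) at_top at_bot"
    by (rule filterlim_at_top_mono[OF 2]) (simp add: well_lower)
qed

lemma well_cong:
  assumes "\<And>i. i < j \<Longrightarrow> s i = t i" "\<bar>x\<bar> \<le> 2 * real j + 1"
  shows "well s x = well t x"
  unfolding well_eq[OF assms(2)] bumps_def using assms(1) by simp

text \<open>Switching all signs from \<open>j\<close> on is a reflection of the potential outside
  the j-th clean gap; switching one sign alone is not of this form.\<close>

definition flip_from :: "nat \<Rightarrow> (nat \<Rightarrow> bool) \<Rightarrow> nat \<Rightarrow> bool" where
  "flip_from j s k = (if k < j then s k else \<not> s k)"

lemma well_flip_outside:
  assumes "2 * real j \<le> \<bar>x\<bar>"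
  shows "well (flip_from j s) x = well s (- x)"
proof -
  let ?n = "nat \<lceil>\<bar>x\<bar>\<rceil>"
  have "\<bar>x\<bar> \<le> real ?n" by linarith
  then have n: "\<bar>x\<bar> \<le> 2 * real ?n + 1" "\<bar>- x\<bar> \<le> 2 * real ?n + 1" by linarith+
  have "bump (side (flip_from j s i) * x + - (2 * real i + 1)) = bump (side (s i) * - x + - (2 * real i + 1))" for i
  proof (cases "i < j")
    case True
    then have "real i + 1 \<le> real j" by simp
    then have *: "2 * real i + 2 \<le> \<bar>x\<bar>" using assms by linarith
    then show ?thesis using bump_term_zero[of x i] bump_term_zero[of "- x" i] by simp
  next
    case False
    then have "side (flip_from j s i) * x = side (s i) * - x" by (simp add: flip_from_def side_def)
    then show ?thesis by (simp only:)
  qed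
  then show ?thesis unfolding well_eq[OF n(1)] well_eq[OF n(2)] bumps_def by simp
qed

lemma inj_well: "inj well"
proof (rule injI)
  fix s t assume eq: "well s = well t"
  \<comment> \<open>2j + 3/2 is the centre of the j-th bump interval on the right, so the value
    there reveals on which side the bump sits.\<close>
  have val: "well s (2 * real j + 3 / 2) - 2 * (2 * real j + 3 / 2)\<^sup>2 = (if s j then bump (1 / 2) else 0)" for s j
  proof -
    let ?x = "2 * real j + 3 / 2"
    have "(\<Sum>i<Suc j. bump (side (s i) * ?x + - (2 * real i + 1))) =
        (\<Sum>i<j. bump (side (s i) * ?x + - (2 * real i + 1))) + bump (side (s j) * ?x + - (2 * real j + 1))" by simp
    also have "(\<Sum>i<j. bump (side (s i) * ?x + - (2 * real i + 1))) = 0"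
    proof (rule sum.neutral, rule ballI)
      fix i assume "i \<in> {..<j}"
      then have "real i + 1 \<le> real j" by simp
      then have "2 * real i + 2 \<le> \<bar>?x\<bar>" by linarith
      then show "bump (side (s i) * ?x + - (2 * real i + 1)) = 0" using bump_term_zero by blast
    qed
    also have "bump (side (s j) * ?x + - (2 * real j + 1)) = (if s j then bump (1 / 2) else 0)"
    proof (cases "s j")
      case True
      have "?x + - (2 * real j + 1) = 1 / 2" by simp
      then show ?thesis using True by (simp only: side_def if_True mult_1)
    next
      case False
      have "bump (- ?x + - (2 * real j + 1)) = 0" using bump_outside by simp
      then show ?thesis using False by (simp add: side_def)
    qed
    finally show ?thesis using well_eq[of ?x "Suc j" s] by (simp add: bumps_def)
  qed
  show "s = t"
  proof
    fix j
    have "(if s j then bump (1 / 2) else 0) = (if t j then bump (1 / 2) else 0)"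
      using val[of s j] val[of t j] unfolding eq by (rule trans[OF sym])
    then show "s j = t j" using bump_half by (auto split: if_splits)
  qed
qed

definition rational_cut :: "real \<Rightarrow> nat \<Rightarrow> bool" where
  "rational_cut \<alpha> j \<longleftrightarrow> real_of_rat (from_nat j) < \<alpha>"

lemma inj_rational_cut: "inj rational_cut"
proof (rule linorder_injI)
  fix \<alpha> \<beta> :: real assume "\<alpha> < \<beta>"
  then obtain q where q: "\<alpha> < real_of_rat q" "real_of_rat q < \<beta>" using of_rat_dense by blast
  have "\<not> rational_cut \<alpha> (to_nat q)" "rational_cut \<beta> (to_nat q)" using q by (auto simp: rational_cut_def)
  then show "rational_cut \<alpha> \<noteq> rational_cut \<beta>" by metis
qed

section \<open>Closeness of spectra\<close>

lemma quadratic_growth: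
  fixes v :: real
  assumes V: "2 * x\<^sup>2 \<le> v" and c: "1 \<le> c" "c \<le> \<bar>x\<bar>"
  shows "c \<le> v"
proof -
  have "c \<le> c * c" using c(1) by simp
  also have "\<dots> \<le> \<bar>x\<bar> * \<bar>x\<bar>" using c by (intro mult_mono) auto
  also have "\<dots> = x\<^sup>2" by (simp add: power2_eq_square)
  also have "\<dots> \<le> 2 * x\<^sup>2" by simp
  also have "\<dots> \<le> v" by (rule V)
  finally show ?thesis .
qed

lemma neg_family_eigenvalues:
  assumes V: "continuous_on UNIV V" "\<And>x. 2 * x\<^sup>2 \<le> V x" and h: "0 < h"
    and nf: "neg_family (schroedinger_coeff h V Es) n"
  shows "\<exists>S. finite S \<and> card S = n \<and> (\<forall>E\<in>S. E < Es \<and> bound_state (schroedinger_coeff h V E))"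
proof -
  \<comment> \<open>Below both 0 and \<open>Es\<close>: the coefficient at this energy is positive
    everywhere, so shooting starts below the first eigenvalue.\<close>
  define E0 where "E0 = min (- 1) (Es - 1)"
  have "\<exists>S. finite S \<and> card S = n \<and> (\<forall>E\<in>S. E0 < E \<and> E < Es \<and> bound_state (schroedinger_coeff h V E))"
  proof (rule neg_family_bound_states[where ?X0.0 = "\<bar>Es\<bar> + 1" and \<kappa> = "2 / h\<^sup>2"])
    show "continuous_on UNIV (\<lambda>(E, x). schroedinger_coeff h V E x)"
      unfolding schroedinger_coeff_def split_beta
      using h by (intro continuous_intros continuous_on_compose2[OF V(1)]) auto
    show "2 / h\<^sup>2 \<le> schroedinger_coeff h V E x" if "E \<le> Es" "\<bar>Es\<bar> + 1 \<le> \<bar>x\<bar>" for E x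
    proof -
      have "\<bar>Es\<bar> + 1 \<le> V x" by (rule quadratic_growth[OF V(2) _ that(2)]) simp
      then have "1 \<le> V x - E" using that(1) by linarith
      then have "2 * 1 \<le> 2 * (V x - E)" by (rule mult_left_mono) simp
      then show ?thesis unfolding schroedinger_coeff_def by (intro divide_right_mono) auto
    qed
    show "0 < schroedinger_coeff h V E0 x" for x
    proof -
      have "0 \<le> V x" by (rule order_trans[OF _ V(2)]) simp
      then have "0 < V x - E0" by (simp add: E0_def)
      then show ?thesis unfolding schroedinger_coeff_def using h by simp
    qed
  qed (use h nf in \<open>auto simp: E0_def\<close>)
  then show ?thesis by blast
qed

lemma coeff_mono:
  assumes "V' x - E' \<le> V x - E"
  shows "schroedinger_coeff h V' E' x \<le> schroedinger_coeff h V E x"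
  unfolding schroedinger_coeff_def using assms by (intro divide_right_mono mult_left_mono) auto

lemma neg_family_energy_mono:
  assumes "continuous_on UNIV V" "E \<le> E'" "neg_family (schroedinger_coeff h V E) n"
  shows "neg_family (schroedinger_coeff h V E') n"
  by (rule neg_family_mono[OF _ _ _ assms(3)])
    (use assms in \<open>auto intro!: continuous_schroedinger_coeff coeff_mono\<close>)

lemma neg_family_nonneg: "(\<And>x. 0 \<le> k x) \<Longrightarrow> continuous_on UNIV k \<Longrightarrow> neg_family k n \<Longrightarrow> n = 0"
proof (rule ccontr)
  assume k: "\<And>x. 0 \<le> k x" and c: "continuous_on UNIV k" and nf: "neg_family k n" and n: "n \<noteq> 0"
  obtain R v v' where v: "\<And>i. i < n \<Longrightarrow> test_function R (v i) (v' i)"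
    and e: "\<And>c. \<exists>i<n. c i \<noteq> 0 \<Longrightarrow>
        energy k (-R) R (\<lambda>x. \<Sum>i<n. c i * v i x) (\<lambda>x. \<Sum>i<n. c i * v' i x) < 0"
    using nf unfolding neg_family_def by blast
  have "0 \<le> energy k (-R) R (\<lambda>x. \<Sum>i<n. 1 * v i x) (\<lambda>x. \<Sum>i<n. 1 * v' i x)"
    unfolding energy_def
    by (rule Henstock_Kurzweil_Integration.integral_nonneg[OF energy_integrable[OF continuous_on_subset[OF c]
          test_function_sum[OF v]]]) (use k in auto)
  moreover have "\<exists>i<n. (1::real) \<noteq> 0" using n by auto
  ultimately show False using e[of "\<lambda>_. 1"] by simp
qed

text \<open>For fixed h the cutoff can be pushed outwards until the tails are as small as required;
  no uniformity in h is claimed. With \<open>neg_family_eigenvalues\<close> this gives both halves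
  of the counting principle, up to the loss of an arbitrary \<delta>.\<close>

lemma eigenvalues_neg_family:
  assumes V: "continuous_on UNIV V" "\<And>x. 2 * x\<^sup>2 \<le> V x" and h: "0 < h" and S: "finite S"
    "\<And>E. E \<in> S \<Longrightarrow> bound_state (schroedinger_coeff h V E) \<and> E \<le> M" and \<delta>: "0 < \<delta>"
  shows "neg_family (schroedinger_coeff h V (M + \<delta>)) (card S)"
proof -
  define E0 where "E0 = (if S = {} then M else Min S)"
  have E0: "E0 \<le> E" if "E \<in> S" for E using that S(1) by (auto simp: E0_def)
  define m where "m = 1 / h"
  have m: "0 < m" using h by (simp add: m_def)
  define A where "A = real (card S) * ((4 / 1)\<^sup>2 + 2 * (M + \<delta> - E0) / h\<^sup>2)"
  have "((\<lambda>d. A * (2 * exp (- m * d) / (d * m))) \<longlongrightarrow> 0) at_top" using m by real_asymp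
  then have "\<forall>\<^sub>F d in at_top. A * (2 * exp (- m * d) / (d * m)) < 2 * \<delta> / h\<^sup>2"
    by (rule order_tendstoD) (use \<delta> h in simp)
  then have "\<forall>\<^sub>F d in at_top. 0 < d \<and> A * (2 * exp (- m * d) / (d * m)) < 2 * \<delta> / h\<^sup>2"
    using eventually_gt_at_top[of 0] by eventually_elim simp
  moreover have "at_top \<noteq> (bot :: real filter)" by simp
  ultimately have "\<exists>d. 0 < d \<and> A * (2 * exp (- m * d) / (d * m)) < 2 * \<delta> / h\<^sup>2"
    by (intro eventually_happens')
  then obtain d where d: "0 < d" "A * (2 * exp (- m * d) / (d * m)) < 2 * \<delta> / h\<^sup>2" by blast
  define a where "a = \<bar>M\<bar> + 1"
  show ?thesis
  proof (rule bound_states_neg_family[OF V(1) V(1) h S(1) _ \<delta> _ _ m d(1) refl])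
    show "bound_state (schroedinger_coeff h V E) \<and> E0 \<le> E \<and> E \<le> M" if "E \<in> S" for E
      using S(2)[OF that] E0[OF that] by simp
    show "0 \<le> a" by (simp add: a_def)
    show "m\<^sup>2 \<le> 2 * schroedinger_coeff h V M x" if "a \<le> \<bar>x\<bar>" for x
    proof -
      have "\<bar>M\<bar> + 1 \<le> V x" by (rule quadratic_growth[OF V(2)]) (use that in \<open>auto simp: a_def\<close>)
      then have "1 / h\<^sup>2 \<le> 2 * (2 * (V x - M)) / h\<^sup>2" by (intro divide_right_mono) auto
      then show ?thesis by (simp add: m_def schroedinger_coeff_def power_divide)
    qed
    show "a + 2 * d < (a + 2 * d) + 1" by simp
    show "real (card S) * ((4 / (a + 2 * d + 1 - (a + 2 * d)))\<^sup>2 + 2 * (M + \<delta> - E0) / h\<^sup>2) *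
        (2 * exp (- m * d) / (d * m)) < 2 * \<delta> / h\<^sup>2"
      using d(2) by (simp add: A_def)
  qed simp
qed

text \<open>A negative eigenvalue would produce a negative direction at energy 0, where the form is
  nonnegative. It confines the spectrum below any bound to a compact interval.\<close>

lemma bound_state_energy_nonneg:
  assumes V: "continuous_on UNIV V" "\<And>x. 2 * x\<^sup>2 \<le> V x" and h: "0 < h"
    and b: "bound_state (schroedinger_coeff h V E)"
  shows "0 \<le> E"
proof (rule ccontr)
  assume "\<not> 0 \<le> E"
  then have E: "E < 0" by simp
  have "neg_family (schroedinger_coeff h V (E + - E)) (card {E})"
    by (rule eigenvalues_neg_family[OF V h]) (use b E in auto)
  then have nf: "neg_family (schroedinger_coeff h V 0) 1" by simp
  have "0 \<le> schroedinger_coeff h V 0 x" for x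
    unfolding schroedinger_coeff_def using V(2)[of x] order_trans[of 0 "2 * x\<^sup>2" "V x"] by simp
  from neg_family_nonneg[OF this continuous_schroedinger_coeff[OF V(1)] nf] show False by simp
qed

text \<open>The order 1/h is the correct one. It multiplies both the exponentially small
  localisation errors and the termwise error of the traces.\<close>

lemma eigenvalue_count:
  assumes V: "continuous_on UNIV V" "\<And>x. 2 * x\<^sup>2 \<le> V x" and h: "0 < h" "h \<le> 1" and M: "0 \<le> M"
    and nf: "neg_family (schroedinger_coeff h V M) n"
  shows "real n \<le> (2 * (M + 1) * sqrt (2 * (M + 1)) + 2) / h"
proof -
  have lb: "- (2 * (M + 1) / h\<^sup>2) \<le> schroedinger_coeff h V M x" for x
  proof -
    have "0 \<le> V x" by (rule order_trans[OF _ V(2)]) simp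
    then have "- (2 * (M + 1)) \<le> 2 * (V x - M)" by simp
    then have "- (2 * (M + 1)) / h\<^sup>2 \<le> 2 * (V x - M) / h\<^sup>2" by (intro divide_right_mono) auto
    then show ?thesis unfolding schroedinger_coeff_def by (simp only: minus_divide_left)
  qed
  have "real n \<le> 2 * (M + 1) * sqrt (2 * (M + 1) / h\<^sup>2) + 2"
  proof (rule neg_family_bound[OF continuous_schroedinger_coeff[OF V(1)] nf lb])
    show "0 \<le> schroedinger_coeff h V M x" if "M + 1 \<le> \<bar>x\<bar>" for x
    proof -
      have "M + 1 \<le> V x" by (rule quadratic_growth[OF V(2) _ that]) (use M in simp)
      then show ?thesis by (simp add: schroedinger_coeff_def)
    qed
  qed (use M h in auto)
  also have "sqrt (2 * (M + 1) / h\<^sup>2) = sqrt (2 * (M + 1)) / h"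
    using h by (simp add: real_sqrt_divide)
  also have "2 * (M + 1) * (sqrt (2 * (M + 1)) / h) + 2 \<le> 2 * (M + 1) * (sqrt (2 * (M + 1)) / h) + 2 / h"
    using h by (simp add: field_simps)
  also have "\<dots> = (2 * (M + 1) * sqrt (2 * (M + 1)) + 2) / h" by (simp add: add_divide_distrib)
  finally show ?thesis .
qed

text \<open>Energies beyond the $n$th eigenvalue are those admitting an $n$-dimensional family of negative
  directions, so this compares $n$th eigenvalues below $M$ uniformly in $n$.\<close>
definition spec_close :: "real \<Rightarrow> (real \<Rightarrow> real) \<Rightarrow> (real \<Rightarrow> real) \<Rightarrow> bool" where
  "spec_close M V V' \<longleftrightarrow> (\<forall>N::nat. \<exists>C h0. 0 < C \<and> 0 < h0 \<and>
     (\<forall>h E n. 0 < h \<longrightarrow> h < h0 \<longrightarrow> E \<le> M \<longrightarrow> neg_family (schroedinger_coeff h V E) n \<longrightarrow>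
        neg_family (schroedinger_coeff h V' (E + C * h ^ N)) n))"

lemma spec_closeE:
  assumes "spec_close M V V'"
  obtains C h0 where "0 < C" "0 < h0"
    "\<And>h E n. 0 < h \<Longrightarrow> h < h0 \<Longrightarrow> E \<le> M \<Longrightarrow> neg_family (schroedinger_coeff h V E) n \<Longrightarrow>
        neg_family (schroedinger_coeff h V' (E + C * h ^ N)) n"
proof -
  obtain C h0 where *: "0 < C \<and> 0 < h0 \<and>
     (\<forall>h E n. 0 < h \<longrightarrow> h < h0 \<longrightarrow> E \<le> M \<longrightarrow> neg_family (schroedinger_coeff h V E) n \<longrightarrow>
        neg_family (schroedinger_coeff h V' (E + C * h ^ N)) n)"
    using assms[unfolded spec_close_def, THEN spec, of N] by (elim exE)
  show thesis
    by (rule that[OF *[THEN conjunct1] *[THEN conjunct2, THEN conjunct1]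
          *[THEN conjunct2, THEN conjunct2, rule_format]])
qed

lemma spec_close_mono:
  assumes "spec_close M V V'" "M' \<le> M"
  shows "spec_close M' V V'"
  unfolding spec_close_def
proof
  fix N
  obtain C h0 where C: "0 < C" "0 < h0"
    and f: "\<And>h E n. 0 < h \<Longrightarrow> h < h0 \<Longrightarrow> E \<le> M \<Longrightarrow> neg_family (schroedinger_coeff h V E) n \<Longrightarrow>
        neg_family (schroedinger_coeff h V' (E + C * h ^ N)) n"
    by (rule spec_closeE[OF assms(1), of N]) (rule that)
  show "\<exists>C h0. 0 < C \<and> 0 < h0 \<and>
     (\<forall>h E n. 0 < h \<longrightarrow> h < h0 \<longrightarrow> E \<le> M' \<longrightarrow> neg_family (schroedinger_coeff h V E) n \<longrightarrow>
        neg_family (schroedinger_coeff h V' (E + C * h ^ N)) n)"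
    by (rule exI[of _ C], rule exI[of _ h0], intro conjI allI impI C f) (use assms(2) in simp_all)
qed

text \<open>The intermediate energy may exceed \<open>M\<close>, by at most 1 once h is small, hence
  the second assumption reaches to \<open>M + 1\<close>. The first one is used with exponent N + 1
  so that its shift tends to 0 even when N = 0.\<close>

lemma spec_close_trans:
  assumes 1: "spec_close M U V" and 2: "spec_close (M + 1) V W" and W: "continuous_on UNIV W"
  shows "spec_close M U W"
  unfolding spec_close_def
proof
  fix N
  obtain C1 h1 where C1: "0 < C1" "0 < h1"
    and f1: "\<And>h E n. 0 < h \<Longrightarrow> h < h1 \<Longrightarrow> E \<le> M \<Longrightarrow> neg_family (schroedinger_coeff h U E) n \<Longrightarrow>
      neg_family (schroedinger_coeff h V (E + C1 * h ^ Suc N)) n"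
    by (rule spec_closeE[OF 1, of "Suc N"]) (rule that)
  obtain C2 h2 where C2: "0 < C2" "0 < h2"
    and f2: "\<And>h E n. 0 < h \<Longrightarrow> h < h2 \<Longrightarrow> E \<le> M + 1 \<Longrightarrow> neg_family (schroedinger_coeff h V E) n \<Longrightarrow>
      neg_family (schroedinger_coeff h W (E + C2 * h ^ N)) n"
    by (rule spec_closeE[OF 2, of N]) (rule that)
  define h0 where "h0 = Min {h1, h2, 1, 1 / C1}"
  have h0: "0 < h0" "h0 \<le> h1" "h0 \<le> h2" "h0 \<le> 1" "h0 \<le> 1 / C1" using C1 C2 by (auto simp: h0_def)
  show "\<exists>C h0. 0 < C \<and> 0 < h0 \<and>
     (\<forall>h E n. 0 < h \<longrightarrow> h < h0 \<longrightarrow> E \<le> M \<longrightarrow> neg_family (schroedinger_coeff h U E) n \<longrightarrow>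
        neg_family (schroedinger_coeff h W (E + C * h ^ N)) n)"
  proof (rule exI[of _ "C1 + C2"], rule exI[of _ h0], intro conjI allI impI)
    fix h E n assume h: "0 < h" "h < h0" and E: "E \<le> M" and nf: "neg_family (schroedinger_coeff h U E) n"
    have hN: "h ^ Suc N \<le> h ^ N" "h ^ N \<le> 1" using h h0 by (auto intro!: power_decreasing power_le_one)
    have "C1 * h ^ Suc N \<le> C1 * (h * 1)" using C1 h hN by (simp add: mult_left_le)
    also have "\<dots> \<le> C1 * (h0 * 1)" using C1 h by (intro mult_left_mono) auto
    also have "\<dots> \<le> 1" using h0 C1 by (simp add: field_simps)
    finally have le: "E + C1 * h ^ Suc N \<le> M + 1" using E by simp
    have "neg_family (schroedinger_coeff h V (E + C1 * h ^ Suc N)) n"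
      by (rule f1[OF h(1) _ E nf]) (use h h0 in simp)
    from f2[OF h(1) _ le this] h h0
    have nf2: "neg_family (schroedinger_coeff h W (E + C1 * h ^ Suc N + C2 * h ^ N)) n" by simp
    have "C1 * h ^ Suc N \<le> C1 * h ^ N" using C1 by (intro mult_left_mono hN) auto
    then have "E + C1 * h ^ Suc N + C2 * h ^ N \<le> E + (C1 + C2) * h ^ N" by (simp only: distrib_right)
    then show "neg_family (schroedinger_coeff h W (E + (C1 + C2) * h ^ N)) n"
      by (rule neg_family_energy_mono[OF W _ nf2])
  qed (use C1 C2 h0 in auto)
qed

section \<open>Closeness under changes in the forbidden region and under reflection\<close>

lemma exp_minus_inverse_le:
  assumes c: "0 < c"
  shows "\<forall>\<^sub>F h in at_right 0. exp (- (c / h)) \<le> (h::real) ^ k"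
proof -
  have "filterlim (\<lambda>h. c / h) at_top (at_right (0::real))"
    using c by real_asymp
  from filterlim_compose[OF tendsto_power_div_exp_0[of k] this]
  have "((\<lambda>h. (c / h) ^ k / exp (c / h)) \<longlongrightarrow> 0) (at_right 0)" .
  then have "\<forall>\<^sub>F h in at_right 0. (c / h) ^ k / exp (c / h) < c ^ k"
    by (rule order_tendstoD) (use c in simp)
  then show ?thesis using eventually_at_right_less[of 0]
  proof eventually_elim
    case (elim h)
    have e1: "(c / h) ^ k * h ^ k = c ^ k" using elim(2) by (simp add: power_divide)
    have "c ^ k * exp (- (c / h)) = ((c / h) ^ k * h ^ k) * exp (- (c / h))" unfolding e1 ..
    also have "\<dots> = ((c / h) ^ k / exp (c / h)) * h ^ k"
      by (simp only: exp_minus divide_inverse mult_ac)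
    also have "\<dots> \<le> c ^ k * h ^ k" using elim by (intro mult_right_mono) auto
    finally show ?case using c by simp
  qed
qed

text \<open>For energies up to \<open>e\<close> all of \<bar>x\<bar> \<ge> a is classically
  forbidden, so eigenfunctions are of size exp(-c/h) where the cutoff varies. This beats the number
  of eigenvalues, of order 1/h, and the factor 1/h^2 in the coefficient, so truncation at
  \<open>y\<close> costs less than the shift h^N.\<close>

lemma forbidden_shell_close:
  assumes V: "continuous_on UNIV V" "\<And>x. 2 * x\<^sup>2 \<le> V x" and V': "continuous_on UNIV V'"
    and a: "0 \<le> a" "a < b" "b < y" and \<kappa>: "0 < \<kappa>" "\<And>x. a \<le> \<bar>x\<bar> \<Longrightarrow> e + \<kappa> \<le> V x" and e: "0 \<le> e"
    and eq: "\<And>x. \<bar>x\<bar> \<le> y \<Longrightarrow> V' x = V x"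
  shows "spec_close e V V'"
  unfolding spec_close_def
proof
  fix N :: nat
  \<comment> \<open>V - E \<ge> \<kappa> beyond \<open>a\<close> makes twice the coefficient at
    least 4\<kappa>/h^2, the square of \<mu>/h. The length \<open>d\<close> below is half of b - a
    because the tail estimate spends two such lengths.\<close>
  define \<mu> where "\<mu> = 2 * sqrt \<kappa>"
  define d where "d = (b - a) / 2"
  define C3 where "C3 = 2 * (e + 1) * sqrt (2 * (e + 1)) + 2"
  define K where "K = (4 / (y - b))\<^sup>2 + 2 * (e + 1)"
  \<comment> \<open>Collects the constants of the final estimate: the left side of the smallness
    condition is at most h Q times h^N/h, and h Q < 1 by the choice of \<open>h0\<close>.\<close>
  define Q where "Q = C3 * K * (2 / (d * \<mu>))"
  have pos: "0 < \<mu>" "0 < d" "0 < C3" "0 < K"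
    using \<kappa> a e by (auto simp: \<mu>_def d_def C3_def K_def intro!: add_nonneg_pos)
  have Q: "0 < Q" using pos by (simp add: Q_def)
  have "\<forall>\<^sub>F h in at_right 0. exp (- ((\<mu> * d) / h)) \<le> h ^ (N + 2)"
    by (rule exp_minus_inverse_le) (use pos in simp)
  then obtain h1 where h1: "0 < h1" "\<And>h. 0 < h \<Longrightarrow> h < h1 \<Longrightarrow> exp (- ((\<mu> * d) / h)) \<le> h ^ (N + 2)"
    unfolding eventually_at_right_field by auto
  define h0 where "h0 = Min {h1, 1, 1 / Q}"
  have h0: "0 < h0" "h0 \<le> h1" "h0 \<le> 1" "h0 \<le> 1 / Q" using h1 Q by (auto simp: h0_def)
  show "\<exists>C h0. 0 < C \<and> 0 < h0 \<and>
     (\<forall>h E n. 0 < h \<longrightarrow> h < h0 \<longrightarrow> E \<le> e \<longrightarrow> neg_family (schroedinger_coeff h V E) n \<longrightarrow>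
        neg_family (schroedinger_coeff h V' (E + C * h ^ N)) n)"
  proof (rule exI[of _ 1], rule exI[of _ h0], intro conjI allI impI)
    fix h E n assume h: "0 < h" "h < h0" and E: "E \<le> e" and nf: "neg_family (schroedinger_coeff h V E) n"
    have "h * Q < h0 * Q" using h Q by (intro mult_strict_right_mono) auto
    also have "\<dots> \<le> (1 / Q) * Q" using h0 Q by (intro mult_right_mono) auto
    finally have "h * Q < 1" using Q by simp
    then have hl: "h < 1" "h < h1" "h * Q < 1" using h h0 by auto
    obtain S where S: "finite S" "card S = n" "\<And>E'. E' \<in> S \<Longrightarrow> E' < E \<and> bound_state (schroedinger_coeff h V E')"
      using neg_family_eigenvalues[OF V h(1) nf] by blast
    show "neg_family (schroedinger_coeff h V' (E + 1 * h ^ N)) n"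
    \<comment> \<open>A nonempty family provides an eigenvalue below \<open>E\<close>, hence E \<ge>
      0, which the bounds below use; the empty family is trivial.\<close>
    proof (cases "n = 0")
      case True
      then show ?thesis unfolding neg_family_def by (auto intro: exI[of _ 1])
    next
      case False
      have "E \<ge> 0"
      proof -
        have "S \<noteq> {}" using False S by auto
        then obtain E' where "E' \<in> S" by blast
        then show ?thesis using S(3)[of E'] bound_state_energy_nonneg[OF V h(1), of E'] by auto
      qed
      have n: "real n \<le> C3 / h"
        unfolding C3_def
        by (rule eigenvalue_count[OF V h(1) _ e neg_family_energy_mono[OF V(1) E nf]]) (use hl in simp)
      define m where "m = \<mu> / h"
      have m: "0 < m" using pos h by (simp add: m_def)
      define \<delta> where "\<delta> = h ^ N"
      have \<delta>: "0 < \<delta>" "\<delta> \<le> 1" using h hl by (auto simp: \<delta>_def intro: power_le_one)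
      have "neg_family (schroedinger_coeff h V' (E + \<delta>)) (card S)"
      proof (rule bound_states_neg_family[OF V(1) V' h(1) S(1) _ \<delta>(1) _ a(1) m pos(2) _ a(3) eq, where ?E0.0 = 0])
        show "bound_state (schroedinger_coeff h V E') \<and> 0 \<le> E' \<and> E' \<le> E" if "E' \<in> S" for E'
          using S(3)[OF that] bound_state_energy_nonneg[OF V h(1), of E'] by auto
        show "b = a + 2 * d" by (simp add: d_def field_simps)
        show "m\<^sup>2 \<le> 2 * schroedinger_coeff h V E x" if "a \<le> \<bar>x\<bar>" for x
        proof -
          have "\<kappa> \<le> V x - E" using \<kappa>(2)[OF that] E by linarith
          then have "4 * \<kappa> / h\<^sup>2 \<le> 4 * (V x - E) / h\<^sup>2" by (intro divide_right_mono mult_left_mono) auto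
          moreover have "m\<^sup>2 = 4 * \<kappa> / h\<^sup>2"
            using \<kappa> by (simp add: m_def \<mu>_def power_divide power_mult_distrib)
          ultimately show ?thesis by (simp add: schroedinger_coeff_def)
        qed
        have hN2: "exp (- m * d) \<le> h ^ (N + 2)" using h1(2)[of h] h hl by (simp add: m_def)
        have k1: "(4 / (y - b))\<^sup>2 + 2 * (E + \<delta> - 0) / h\<^sup>2 \<le> K / h\<^sup>2"
        proof -
          have "(4 / (y - b))\<^sup>2 * h\<^sup>2 \<le> (4 / (y - b))\<^sup>2 * 1" using h hl by (intro mult_left_mono) (auto simp: power_le_one)
          moreover have "2 * (E + \<delta>) \<le> 2 * (e + 1)" using E \<delta> by simp
          ultimately have "(4 / (y - b))\<^sup>2 * h\<^sup>2 + 2 * (E + \<delta>) \<le> K" unfolding K_def by linarith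
          then have "((4 / (y - b))\<^sup>2 * h\<^sup>2 + 2 * (E + \<delta>)) / h\<^sup>2 \<le> K / h\<^sup>2" by (rule divide_right_mono) simp
          then show ?thesis using h by (simp add: add_divide_distrib)
        qed
        have "real (card S) * ((4 / (y - b))\<^sup>2 + 2 * (E + \<delta> - 0) / h\<^sup>2) * (2 * exp (- m * d) / (d * m))
           \<le> (C3 / h) * (K / h\<^sup>2) * (2 * h ^ (N + 2) / (d * m))"
          unfolding S(2)
        proof (intro mult_mono n k1 divide_right_mono mult_left_mono hN2)
          show "0 \<le> (4 / (y - b))\<^sup>2 + 2 * (E + \<delta> - 0) / h\<^sup>2" using \<open>E \<ge> 0\<close> \<delta> by (intro add_nonneg_nonneg) auto
          show "0 \<le> C3 / h * (K / h\<^sup>2)" "0 \<le> C3 / h" "0 \<le> d * m" using pos h m by auto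
          show "0 \<le> 2 * exp (- m * d) / (d * m)" using pos m by simp
        qed auto
        also have "\<dots> = (h * Q) * (\<delta> / h) "
          using h pos by (simp add: m_def Q_def \<delta>_def power_add field_simps power2_eq_square)
        also have "\<dots> < 1 * (\<delta> / h)" using hl \<delta> h by (intro mult_strict_right_mono) auto
        also have "\<dots> \<le> 2 * \<delta> / h\<^sup>2"
        proof -
          have "\<delta> * h \<le> \<delta> * 1" using hl \<delta> by (intro mult_left_mono) auto
          also have "\<dots> \<le> 2 * \<delta>" using \<delta> by simp
          finally have "\<delta> * h / h\<^sup>2 \<le> 2 * \<delta> / h\<^sup>2" by (rule divide_right_mono) simp
          moreover have "\<delta> * h / h\<^sup>2 = \<delta> / h" by (simp add: power2_eq_square)
          ultimately show ?thesis by simp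
        qed
        finally show "real (card S) * ((4 / (y - b))\<^sup>2 + 2 * (E + \<delta> - 0) / h\<^sup>2) * (2 * exp (- m * d) / (d * m)) < 2 * \<delta> / h\<^sup>2" .
      qed
      then show ?thesis by (simp add: S(2) \<delta>_def)
    qed
  qed (use h0 in auto)
qed

text \<open>Radii in the j-th gap: the allowed region at the threshold energy ends at 2j + 1/2,
  decay is counted from 2j + 5/8, the cutoff acts between 2j + 3/4 and 2j + 1, and up to 2j + 1 only
  bumps of index below j are seen.\<close>

lemma well_shell_close:
  assumes "\<And>i. i < j \<Longrightarrow> s i = t i"
  shows "spec_close (2 * (2 * real j + 1 / 2)\<^sup>2) (well s) (well t)"
proof (rule forbidden_shell_close[where a = "2 * real j + 5 / 8" and b = "2 * real j + 3 / 4" and y = "2 * real j + 1"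
      and \<kappa> = "2 * (2 * real j + 5 / 8)\<^sup>2 - 2 * (2 * real j + 1 / 2)\<^sup>2"])
  show "well t x = well s x" if "\<bar>x\<bar> \<le> 2 * real j + 1" for x
    by (rule well_cong[OF _ that]) (use assms in simp)
  show "2 * (2 * real j + 1 / 2)\<^sup>2 + (2 * (2 * real j + 5 / 8)\<^sup>2 - 2 * (2 * real j + 1 / 2)\<^sup>2) \<le> well s x"
    if "2 * real j + 5 / 8 \<le> \<bar>x\<bar>" for x
    using well_beyond_gap(1)[OF _ _ that, of j s] by simp
qed (auto simp: continuous_well well_lower intro!: power_strict_mono)

text \<open>The WKB error is paid for in energy: a shift by \<epsilon> h^2/2 changes the coefficient
  by exactly \<epsilon>. Shifting down for \<open>V\<close> and up for \<open>V'\<close> places the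
  exactly reflectionless coefficient between the two.\<close>

lemma reflectionless_flip:
  assumes y: "0 < y" "y < z"
    and g: "\<And>x. x \<in> {-z<..<z} \<Longrightarrow> 0 < g x"
      "\<And>x. x \<in> {-z<..<z} \<Longrightarrow> (g has_real_derivative g' x) (at x)"
      "\<And>x. x \<in> {-z<..<z} \<Longrightarrow> (g' has_real_derivative g'' x) (at x)" "continuous_on {-z<..<z} g''"
    and G: "open G" "y \<in> G" "\<And>x. x \<in> G \<Longrightarrow> g (- x) = g x"
    and err: "\<And>x. x \<in> {-z<..<z} \<Longrightarrow> \<bar>g'' x / g x - 1 / g x ^ 4 - schroedinger_coeff h V E x\<bar> \<le> \<epsilon>"
    and h: "0 < h" and V: "continuous_on UNIV V" "continuous_on UNIV V'"
    and inn: "\<And>x. \<bar>x\<bar> \<le> y \<Longrightarrow> V' x = V x" and out: "\<And>x. y \<le> \<bar>x\<bar> \<Longrightarrow> V' x = V (- x)"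
    and nf: "neg_family (schroedinger_coeff h V (E - \<epsilon> * h\<^sup>2 / 2)) n"
  shows "neg_family (schroedinger_coeff h V' (E + \<epsilon> * h\<^sup>2 / 2)) n"
proof -
  have sym': "g' (- y) = - g' y"
  proof -
    have "((\<lambda>x. g (- x)) has_real_derivative g' (- y) * - 1) (at y)"
      by (rule DERIV_chain'[OF DERIV_minus[OF DERIV_ident] g(2)]) (use y in auto)
    moreover have "((\<lambda>x. g (- x)) has_real_derivative g' y) (at y)"
      by (rule has_field_derivative_transform_within_open[OF g(2) G(1,2)]) (use y G(3) in auto)
    ultimately have "g' (- y) * - 1 = g' y" by (rule DERIV_unique)
    then show ?thesis by simp
  qed
  have cg: "continuous_on {-z<..<z} g"
    by (rule DERIV_continuous_on[OF has_field_derivative_at_within[OF g(2)]])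
  have "continuous_on {-z<..<z} (\<lambda>x. 1 / (g x)\<^sup>2)"
    by (intro continuous_intros cg) (use g(1) in force)
  then obtain F where F: "\<And>x. x \<in> {-z<..<z} \<Longrightarrow> (F has_real_derivative 1 / (g x)\<^sup>2) (at x)"
    by (rule antiderivative_on_interval[rotated]) (use y in auto)
  obtain \<sigma> where \<sigma>: "\<And>x. \<bar>x\<bar> \<le> y \<Longrightarrow> \<bar>\<sigma> x\<bar> \<le> y"
    "\<And>x. \<bar>x\<bar> \<le> y \<Longrightarrow> (\<sigma> has_real_derivative - ((1 / (g x)\<^sup>2) / (1 / (g (\<sigma> x))\<^sup>2))) (at x)"
    "\<sigma> y = - y" "\<sigma> (- y) = y"
    by (rule reflection_map[OF y F]) (use g(1) that in \<open>auto simp: zero_less_power2 less_le\<close>)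
  interpret liouville_flip y z g g' g'' \<sigma>
  proof
    show "(\<sigma> has_real_derivative - ((g (\<sigma> x))\<^sup>2 / (g x)\<^sup>2)) (at x)" if "\<bar>x\<bar> \<le> y" for x
      using \<sigma>(2)[OF that] by simp
    show "g (- y) = g y" by (rule G(3)[OF G(2)])
  qed (fact y g sym' \<sigma>)+
  have shift: "schroedinger_coeff h U (E + c * h\<^sup>2 / 2) x = schroedinger_coeff h U E x - c" for U c x
    using h by (simp add: schroedinger_coeff_def field_simps)
  have shift': "schroedinger_coeff h U (E - c * h\<^sup>2 / 2) x = schroedinger_coeff h U E x + c" for U c x
    using h by (simp add: schroedinger_coeff_def field_simps)
  have V'V: "schroedinger_coeff h V' E x = schroedinger_coeff h V E x" if "\<bar>x\<bar> \<le> y" for x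
    using inn[OF that] by (simp add: schroedinger_coeff_def)
  have e0: "0 \<le> \<epsilon>" using err[of 0] y abs_ge_zero order_trans by fastforce
  show ?thesis
  proof (rule neg_family_flip[OF _ _ _ _ _ nf])
    fix x assume x: "\<bar>x\<bar> \<le> y"
    have "x \<in> {-z<..<z}" using x y by auto
    from err[OF this] show "g'' x / g x - 1 / g x ^ 4 \<le> schroedinger_coeff h V (E - \<epsilon> * h\<^sup>2 / 2) x"
      "schroedinger_coeff h V' (E + \<epsilon> * h\<^sup>2 / 2) x \<le> g'' x / g x - 1 / g x ^ 4"
      unfolding shift shift' V'V[OF x] by linarith+
  next
    fix x assume x: "y \<le> \<bar>x\<bar>"
    have "schroedinger_coeff h V' E x = schroedinger_coeff h V E (- x)"
      using out[OF x] by (simp add: schroedinger_coeff_def)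
    then show "schroedinger_coeff h V' (E + \<epsilon> * h\<^sup>2 / 2) x \<le> schroedinger_coeff h V (E - \<epsilon> * h\<^sup>2 / 2) (- x)"
      unfolding shift shift' using e0 by linarith
  qed (auto intro!: continuous_schroedinger_coeff V)
qed

text \<open>Energies up to \<open>e\<close> are settled by tails. For higher ones the amplitude
  lives on \<bar>x\<bar> < z, where the well stays at most 2z^2 < e, so the distance to turning
  points is uniform. The reflection radius \<open>y\<close> lies strictly inside, which leaves room
  for gluing.\<close>

lemma well_flip_close: "spec_close M (well s) (well (flip_from j s))"
  unfolding spec_close_def
proof
  fix N :: nat
  define e where "e = 2 * (2 * real j + 1 / 2)\<^sup>2"
  define z where "z = 2 * real j + 3 / 8"
  define y where "y = 2 * real j + 1 / 4"
  define G where "G = {x::real. 2 * real j < \<bar>x\<bar>} \<inter> {x. \<bar>x\<bar> < z}"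
  let ?V = "well s" and ?V' = "well (flip_from j s)"
  have yz: "0 < y" "y < z" by (auto simp: y_def z_def)
  have z2: "2 * z\<^sup>2 < e" unfolding e_def z_def by (simp add: power_strict_mono)
  have "\<exists>h0 C. 0 < h0 \<and> h0 \<le> 1 \<and> 0 \<le> C \<and> (\<forall>E h. e \<le> E \<longrightarrow> E \<le> M + 1 \<longrightarrow> 0 < h \<longrightarrow> h \<le> h0 \<longrightarrow>
    (\<exists>g g' g''. (\<forall>x\<in>{-z<..<z}. 0 < g x \<and> (g has_real_derivative g' x) (at x) \<and> (g' has_real_derivative g'' x) (at x)) \<and>
      continuous_on {-z<..<z} g'' \<and> (\<forall>x\<in>G. g (- x) = g x) \<and>
      (\<forall>x\<in>{-z<..<z}. \<bar>g'' x / g x - 1 / g x ^ 4 - schroedinger_coeff h ?V E x\<bar> \<le> C * h ^ N)))"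
  proof (rule wkb_amplitude[OF smooth_well open_greaterThanLessThan])
    show "0 < e - 2 * z\<^sup>2" using z2 by simp
    show "?V x + (e - 2 * z\<^sup>2) \<le> e" if "x \<in> {-z<..<z}" for x
      using well_beyond_gap(2)[of j z x s] that by (auto simp: z_def abs_le_iff)
    show "open G" unfolding G_def by (intro open_Int open_Collect_less continuous_intros)
    show "G \<subseteq> {-z<..<z}" by (auto simp: G_def)
    show "- x \<in> G" if "x \<in> G" for x using that by (simp add: G_def)
    show "?V (- x) = ?V x" if "x \<in> G" for x
      using well_gap[of j x s] well_gap[of j "- x" s] that by (simp add: G_def z_def)
  qed simp
  then obtain h0 C where h0: "0 < h0" "h0 \<le> 1" and C: "0 \<le> C" and W': "\<forall>E h. e \<le> E \<longrightarrow> E \<le> M + 1 \<longrightarrow> 0 < h \<longrightarrow> h \<le> h0 \<longrightarrow>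
    (\<exists>g g' g''. (\<forall>x\<in>{-z<..<z}. 0 < g x \<and> (g has_real_derivative g' x) (at x) \<and> (g' has_real_derivative g'' x) (at x)) \<and>
      continuous_on {-z<..<z} g'' \<and> (\<forall>x\<in>G. g (- x) = g x) \<and>
      (\<forall>x\<in>{-z<..<z}. \<bar>g'' x / g x - 1 / g x ^ 4 - schroedinger_coeff h ?V E x\<bar> \<le> C * h ^ N))"
    by (elim exE conjE)
  note W = W'[rule_format]
  have "spec_close e ?V ?V'" unfolding e_def by (rule well_shell_close) (simp add: flip_from_def)
  then obtain C1 h1 where C1: "0 < C1" "0 < h1"
    and f1: "\<And>h E n. 0 < h \<Longrightarrow> h < h1 \<Longrightarrow> E \<le> e \<Longrightarrow> neg_family (schroedinger_coeff h ?V E) n \<Longrightarrow>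
        neg_family (schroedinger_coeff h ?V' (E + C1 * h ^ N)) n"
    by (rule spec_closeE[where N = N]) (rule that)
  define h2 where "h2 = Min {h0, h1, 1 / (C + 1)}"
  have h2: "0 < h2" "h2 \<le> h0" "h2 \<le> h1" "h2 \<le> 1 / (C + 1)" using h0 C1 C by (auto simp: h2_def)
  show "\<exists>C h0. 0 < C \<and> 0 < h0 \<and>
     (\<forall>h E n. 0 < h \<longrightarrow> h < h0 \<longrightarrow> E \<le> M \<longrightarrow> neg_family (schroedinger_coeff h ?V E) n \<longrightarrow>
        neg_family (schroedinger_coeff h ?V' (E + C * h ^ N)) n)"
  proof (rule exI[of _ "C + C1"], rule exI[of _ h2], intro conjI allI impI)
    fix h E n assume h: "0 < h" "h < h2" and E: "E \<le> M" and nf: "neg_family (schroedinger_coeff h ?V E) n"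
    have hl: "h < h1" "h \<le> h0" "h \<le> 1" using h h2 h0 by auto
    have hN: "0 < h ^ N" "h ^ N \<le> 1" using h hl by (auto intro: power_le_one)
    show "neg_family (schroedinger_coeff h ?V' (E + (C + C1) * h ^ N)) n"
    proof (cases "E \<le> e")
      case True
      have "E + C1 * h ^ N \<le> E + (C + C1) * h ^ N" using C hN by simp
      then show ?thesis
        by (rule neg_family_energy_mono[OF continuous_well _ f1[OF h(1) hl(1) True nf]])
    next
      case False
      define \<epsilon> where "\<epsilon> = C * h ^ N"
      \<comment> \<open>The amplitude belongs to the midpoint of the two shifted energies, so the
        given energy is E' - \<epsilon> h^2/2. As E' may exceed \<open>M\<close>, the amplitudes
        were prepared up to \<open>M + 1\<close>.\<close>
      define E' where "E' = E + \<epsilon> * h\<^sup>2 / 2"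
      have \<epsilon>0: "0 \<le> \<epsilon>" "\<epsilon> \<le> C" using C hN by (auto simp: \<epsilon>_def mult_left_le)
      have h21: "h\<^sup>2 \<le> h" "h\<^sup>2 \<le> 1" using h hl by (auto simp: power2_eq_square mult_le_one)
      have "\<epsilon> * h\<^sup>2 / 2 \<le> \<epsilon> * h\<^sup>2" using \<epsilon>0 by simp
      also have "\<dots> \<le> C * h" using \<epsilon>0 h21 h C by (intro mult_mono) auto
      also have "\<dots> \<le> C * (1 / (C + 1))" using C h h2 by (intro mult_left_mono) auto
      also have "\<dots> \<le> 1" using C by simp
      finally have "\<epsilon> * h\<^sup>2 / 2 \<le> 1" .
      moreover have "0 \<le> \<epsilon> * h\<^sup>2 / 2" using \<epsilon>0 by simp
      ultimately have E'M: "e \<le> E'" "E' \<le> M + 1" using False E unfolding E'_def by linarith+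
      obtain g g' g'' where g: "\<forall>x\<in>{-z<..<z}. 0 < g x \<and> (g has_real_derivative g' x) (at x) \<and> (g' has_real_derivative g'' x) (at x)"
        "continuous_on {-z<..<z} g''" "\<forall>x\<in>G. g (- x) = g x"
        "\<forall>x\<in>{-z<..<z}. \<bar>g'' x / g x - 1 / g x ^ 4 - schroedinger_coeff h ?V E' x\<bar> \<le> C * h ^ N"
        using W[OF E'M h(1) hl(2)] by (elim exE conjE)
      have "neg_family (schroedinger_coeff h ?V' (E' + \<epsilon> * h\<^sup>2 / 2)) n"
      proof (rule reflectionless_flip[OF yz, of g g' g'' G])
        show "open G" unfolding G_def by (intro open_Int open_Collect_less continuous_intros)
        show "y \<in> G" using yz by (simp add: G_def y_def)
        show "\<bar>g'' x / g x - 1 / g x ^ 4 - schroedinger_coeff h ?V E' x\<bar> \<le> \<epsilon>" if "x \<in> {-z<..<z}" for x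
          using g(4) that by (simp add: \<epsilon>_def)
        show "neg_family (schroedinger_coeff h ?V (E' - \<epsilon> * h\<^sup>2 / 2)) n" using nf by (simp add: E'_def)
        show "?V' x = ?V x" if "\<bar>x\<bar> \<le> y" for x
          by (rule well_cong[of j]) (use that in \<open>auto simp: flip_from_def y_def\<close>)
        show "?V' x = ?V (- x)" if "y \<le> \<bar>x\<bar>" for x
          by (rule well_flip_outside) (use that in \<open>simp add: y_def\<close>)
      qed (use g h in \<open>auto intro: continuous_well\<close>)
      moreover have "E' + \<epsilon> * h\<^sup>2 / 2 \<le> E + (C + C1) * h ^ N"
      proof -
        have "\<epsilon> * h\<^sup>2 \<le> \<epsilon> * 1" using \<epsilon>0 h21 by (intro mult_left_mono) auto
        also have "\<epsilon> * 1 \<le> (C + C1) * h ^ N" using C1 hN by (simp add: \<epsilon>_def)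
        finally show ?thesis by (simp add: E'_def)
      qed
      ultimately show ?thesis by (rule neg_family_energy_mono[OF continuous_well, rotated])
    qed
  qed (use h2 C C1 in auto)
qed

text \<open>Signs are corrected in increasing order: if index J is wrong, switching all signs from J
  on repairs it without touching smaller indices, and what this does to larger ones is dealt with
  when their turn comes.\<close>

lemma well_agree_close: "\<exists>s'. (\<forall>i<J. s' i = t i) \<and> (\<forall>M. spec_close M (well s) (well s'))"
proof (induction J)
  case 0
  have "spec_close M (well s) (well s)" for M
    unfolding spec_close_def
  proof
    fix N :: nat
    show "\<exists>C h0. 0 < C \<and> 0 < h0 \<and>
     (\<forall>h E n. 0 < h \<longrightarrow> h < h0 \<longrightarrow> E \<le> M \<longrightarrow> neg_family (schroedinger_coeff h (well s) E) n \<longrightarrow>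
        neg_family (schroedinger_coeff h (well s) (E + C * h ^ N)) n)"
      by (rule exI[of _ 1], rule exI[of _ 1], intro conjI allI impI)
        (auto elim!: neg_family_energy_mono[OF continuous_well, rotated])
  qed
  then show ?case by blast
next
  case (Suc J)
  then obtain s' where s': "\<forall>i<J. s' i = t i" "\<And>M. spec_close M (well s) (well s')" by blast
  show ?case
  proof (cases "s' J = t J")
    case True
    then show ?thesis using s' less_Suc_eq by (intro exI[of _ s']) auto
  next
    case False
    have "spec_close M (well s) (well (flip_from J s'))" for M
      by (rule spec_close_trans[OF s'(2) well_flip_close continuous_well])
    moreover have "\<forall>i<Suc J. flip_from J s' i = t i" using s'(1) False by (auto simp: flip_from_def less_Suc_eq)
    ultimately show ?thesis by blast
  qed
qed

text \<open>Only finitely many bumps matter below a given energy: \<open>J\<close> is so large that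
  the threshold of its gap is at least \<open>M + 1\<close>, and then all remaining signs may be
  replaced at once.\<close>

lemma well_close: "spec_close M (well s) (well t)"
proof -
  define J where "J = nat \<lceil>\<bar>M\<bar> + 1\<rceil>"
  obtain s' where s': "\<forall>i<J. s' i = t i" "\<And>M. spec_close M (well s) (well s')"
    using well_agree_close[of J t s] by blast
  have "spec_close (2 * (2 * real J + 1 / 2)\<^sup>2) (well s') (well t)"
    by (rule well_shell_close) (use s' in simp)
  then have "spec_close (M + 1) (well s') (well t)"
  proof (rule spec_close_mono)
    have J: "\<bar>M\<bar> + 1 \<le> real J" unfolding J_def by (rule real_nat_ceiling_ge)
    have "\<bar>M\<bar> + 1 \<le> 2 * (2 * real J + 1 / 2)\<^sup>2"
      by (rule quadratic_growth[OF order_refl]) (use J in auto)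
    then show "M + 1 \<le> 2 * (2 * real J + 1 / 2)\<^sup>2" by linarith
  qed
  from spec_close_trans[OF s'(2) this continuous_well] show ?thesis .
qed

section \<open>Finiteness of the spectrum below a bound; traces as finite sums\<close>

lemma eigenvalues_finite:
  assumes V: "continuous_on UNIV V" "\<And>x. 2 * x\<^sup>2 \<le> V x" and h: "0 < h" "h \<le> 1" and M: "0 \<le> M"
  shows "finite (eigenvalues h V \<inter> {..M}) \<and>
    real (card (eigenvalues h V \<inter> {..M})) \<le> (2 * (M + 2) * sqrt (2 * (M + 2)) + 2) / h"
proof -
  let ?B = "(2 * (M + 2) * sqrt (2 * (M + 2)) + 2) / h"
  have sub: "real (card S) \<le> ?B" if S: "S \<subseteq> eigenvalues h V \<inter> {..M}" "finite S" for S
  proof -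
    have "neg_family (schroedinger_coeff h V (M + 1)) (card S)"
      by (rule eigenvalues_neg_family[OF V h(1) S(2)]) (use S(1) eigenvalues_iff[OF h(1) V(1)] in auto)
    from eigenvalue_count[OF V h _ this] M show ?thesis by (simp add: add.commute)
  qed
  have "finite (eigenvalues h V \<inter> {..M}) \<and> card (eigenvalues h V \<inter> {..M}) \<le> nat \<lfloor>?B\<rfloor>"
    by (rule finite_if_finite_subsets_card_bdd) (use sub in \<open>simp add: le_nat_floor\<close>)
  then show ?thesis using sub by blast
qed

text \<open>Eigenvalues between b and b + 1 contribute 0; they are kept so that the comparison of
  counts has room for an energy shift.\<close>

lemma trace_fun_eq_sum:
  assumes V: "continuous_on UNIV V" "filterlim V at_top at_top" and h: "0 < h"
    and f: "\<And>x. b < x \<Longrightarrow> f x = 0" and fin: "finite (eigenvalues h V \<inter> {..b + 1})"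
  shows "trace_fun f h V = (\<Sum>E\<in>eigenvalues h V \<inter> {..b + 1}. f E)"
proof -
  have "trace_fun f h V = (\<Sum>\<^sub>\<infinity>E\<in>eigenvalues h V \<inter> {..b + 1}. f E)"
    unfolding trace_fun_def
  proof (rule infsum_cong_neutral)
    fix E assume "E \<in> eigenvalues h V - eigenvalues h V \<inter> {..b + 1}"
    then have "b < E" by auto
    then show "of_nat (multiplicity h V E) * f E = 0" using f by simp
  qed (auto simp: multiplicity_eigenvalue[OF h V])
  then show ?thesis using fin by simp
qed

section \<open>Comparison of traces\<close>

text \<open>The dictionary between counting functions and the k-th smallest element, with k starting
  from 0: the counts deliver one, the pairing of eigenvalues needs the other.\<close>

lemma less_card_sorted_list:
  fixes A :: "real set"
  assumes A: "finite A"
  shows "k < card A \<Longrightarrow> k < card {E\<in>A. E \<le> sorted_list_of_set A ! k}"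
    and "k < card {E\<in>A. E < z} \<Longrightarrow> k < card A \<and> sorted_list_of_set A ! k < z"
proof -
  let ?xs = "sorted_list_of_set A"
  have len: "length ?xs = card A" by simp
  have mono: "?xs ! i \<le> ?xs ! j" if "i \<le> j" "j < card A" for i j
    by (rule sorted_nth_mono) (use that len in auto)
  have mem: "?xs ! i \<in> A" if "i < card A" for i
    using nth_mem[of i ?xs] that len set_sorted_list_of_set[OF A] by simp
  have inj: "inj_on (\<lambda>i. ?xs ! i) {..<card A}"
    by (rule inj_onI) (use len nth_eq_iff_index_eq[OF distinct_sorted_list_of_set[of A]] in auto)
  show "k < card {E\<in>A. E \<le> ?xs ! k}" if k: "k < card A"
  proof -
    have "(\<lambda>i. ?xs ! i) ` {..k} \<subseteq> {E\<in>A. E \<le> ?xs ! k}" using mono mem k by auto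
    then have "card ((\<lambda>i. ?xs ! i) ` {..k}) \<le> card {E\<in>A. E \<le> ?xs ! k}" by (rule card_mono[rotated]) (use A in simp)
    moreover have "card ((\<lambda>i. ?xs ! i) ` {..k}) = card {..k}"
      by (rule card_image[OF inj_on_subset[OF inj]]) (use k in auto)
    ultimately show ?thesis by simp
  qed
  show "k < card A \<and> ?xs ! k < z" if k: "k < card {E\<in>A. E < z}"
  proof -
    have "card {E\<in>A. E < z} \<le> card A" by (rule card_mono[OF A]) auto
    then have kA: "k < card A" using k by simp
    moreover have "?xs ! k < z"
    proof (rule ccontr)
      assume "\<not> ?xs ! k < z"
      then have z: "z \<le> ?xs ! k" by simp
      have "{E\<in>A. E < z} \<subseteq> (\<lambda>i. ?xs ! i) ` {..<k}"
      proof
        fix E assume E: "E \<in> {E\<in>A. E < z}"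
        then have "E \<in> set ?xs" using A by simp
        then obtain i where i: "i < card A" "E = ?xs ! i" using len by (auto simp: in_set_conv_nth)
        have "i < k"
        proof (rule ccontr)
          assume "\<not> i < k"
          then have "?xs ! k \<le> ?xs ! i" using mono[of k i] i by simp
          then show False using E z i by simp
        qed
        then show "E \<in> (\<lambda>i. ?xs ! i) ` {..<k}" using i by blast
      qed
      then have "card {E\<in>A. E < z} \<le> card ((\<lambda>i. ?xs ! i) ` {..<k})" by (rule card_mono[rotated]) simp
      also have "\<dots> \<le> card {..<k}" by (rule card_image_le) simp
      finally show False using k by simp
    qed
    ultimately show ?thesis by simp
  qed
qed

text \<open>Pair the k-th smallest elements of \<open>A\<close> and \<open>B\<close>. If one of the
  pair is at most b, the counting hypotheses give it a partner within \<delta>; otherwise f vanishes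
  at whatever elements there are. Unpaired elements lie above b and cost nothing.\<close>

lemma sum_difference_le:
  fixes f :: "real \<Rightarrow> complex" and A B :: "real set"
  assumes fin: "finite A" "finite B" and f0: "\<And>x. b < x \<Longrightarrow> f x = 0" and L: "0 \<le> L" and \<delta>: "0 \<le> \<delta>"
    and lip: "\<And>x y. x \<in> A \<Longrightarrow> y \<in> B \<Longrightarrow> cmod (f x - f y) \<le> L * \<bar>x - y\<bar>"
    and AB: "\<And>x. x \<le> b \<Longrightarrow> card {E\<in>A. E \<le> x} \<le> card {E\<in>B. E < x + \<delta>}"
    and BA: "\<And>x. x \<le> b \<Longrightarrow> card {E\<in>B. E \<le> x} \<le> card {E\<in>A. E < x + \<delta>}"
    and card: "card A \<le> m" "card B \<le> m"
  shows "cmod ((\<Sum>E\<in>A. f E) - (\<Sum>E\<in>B. f E)) \<le> real m * (L * \<delta>)"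
proof -
  \<comment> \<open>Padding by 0 lets both sums run over the same m indices.\<close>
  define p where "p A k = (if k < card A then f (sorted_list_of_set A ! k) else 0)" for A k
  have sum_p: "(\<Sum>E\<in>A. f E) = (\<Sum>k<m. p A k)" if "finite A" "card A \<le> m" for A
  proof -
    have "(\<Sum>E\<in>A. f E) = sum_list (map f (sorted_list_of_set A))"
      using that(1) by (simp add: sum_list_distinct_conv_sum_set)
    also have "\<dots> = (\<Sum>k<card A. f (sorted_list_of_set A ! k))"
      by (simp add: sum_list_sum_nth atLeast0LessThan)
    also have "\<dots> = (\<Sum>k<card A. p A k)" by (simp add: p_def)
    also have "\<dots> = (\<Sum>k<m. p A k)" by (rule sum.mono_neutral_left) (use that(2) in \<open>auto simp: p_def\<close>)
    finally show ?thesis .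
  qed
  have mem: "sorted_list_of_set A ! k \<in> A" if "finite A" "k < card A" for A :: "real set" and k
    using nth_mem[of k "sorted_list_of_set A"] that by simp
  have next_le: "k < card B \<and> sorted_list_of_set B ! k < sorted_list_of_set A ! k + \<delta>"
    if "finite A" "finite B" "k < card A" "sorted_list_of_set A ! k \<le> b"
      "\<And>x. x \<le> b \<Longrightarrow> card {E\<in>A. E \<le> x} \<le> card {E\<in>B. E < x + \<delta>}" for A B :: "real set" and k
  proof -
    have "k < card {E\<in>B. E < sorted_list_of_set A ! k + \<delta>}"
      using less_card_sorted_list(1)[OF that(1,3)] that(5)[OF that(4)] by linarith
    then show ?thesis by (rule less_card_sorted_list(2)[OF that(2)])
  qed
  have diff: "cmod (p A k - p B k) \<le> L * \<delta>" for k
  proof -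
    define x where "x = sorted_list_of_set A ! k"
    define y where "y = sorted_list_of_set B ! k"
    have 1: "k < card B \<and> y < x + \<delta>" if "k < card A" "x \<le> b"
      using next_le[OF fin that(1) _ AB] that(2) by (simp add: x_def y_def)
    have 2: "k < card A \<and> x < y + \<delta>" if "k < card B" "y \<le> b"
      using next_le[OF fin(2,1) that(1) _ BA] that(2) by (simp add: x_def y_def)
    have L\<delta>: "0 \<le> L * \<delta>" using L \<delta> by simp
    consider "k < card A" "k < card B" "x \<le> b \<or> y \<le> b" | "\<not> (k < card A \<and> x \<le> b)" "\<not> (k < card B \<and> y \<le> b)"
      using 1 2 by blast
    then show ?thesis
    proof cases
      case 1
      have "\<bar>x - y\<bar> \<le> \<delta>"
      proof (cases "x \<le> b \<and> y \<le> b")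
        case True then show ?thesis using \<open>k < card A\<close> \<open>k < card B\<close> next_le[OF fin \<open>k < card A\<close> _ AB] 2
          by (auto simp: x_def y_def abs_le_iff)
      next
        case False
        then show ?thesis using 1 next_le[OF fin \<open>k < card A\<close> _ AB] 2 \<delta>
          by (auto simp: x_def[symmetric] y_def[symmetric] abs_le_iff)
      qed
      then have "L * \<bar>x - y\<bar> \<le> L * \<delta>" using L by (rule mult_left_mono)
      moreover have "cmod (f x - f y) \<le> L * \<bar>x - y\<bar>"
        by (rule lip) (use mem fin 1 in \<open>auto simp: x_def y_def\<close>)
      ultimately show ?thesis using 1 by (simp add: p_def x_def y_def)
    next
      case 2
      have "p A k = 0" "p B k = 0" using 2 f0 by (auto simp: p_def x_def y_def not_le)
      then show ?thesis using L\<delta> by simp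
    qed
  qed
  have "cmod ((\<Sum>E\<in>A. f E) - (\<Sum>E\<in>B. f E)) = cmod (\<Sum>k<m. p A k - p B k)"
    using sum_p[OF fin(1) card(1)] sum_p[OF fin(2) card(2)] by (simp add: sum_subtractf)
  also have "\<dots> \<le> (\<Sum>k<m. L * \<delta>)" by (rule sum_norm_le[OF diff])
  finally show ?thesis by simp
qed

lemma smooth_lipschitz:
  fixes f :: "real \<Rightarrow> complex"
  assumes "smooth f"
  obtains L where "0 \<le> L" "\<And>x y. x \<in> {0..c} \<Longrightarrow> y \<in> {0..c} \<Longrightarrow> cmod (f x - f y) \<le> L * \<bar>x - y\<bar>"
proof -
  obtain D where D: "D 0 = f" "\<And>n x. (D n has_vector_derivative D (Suc n) x) (at x)"
    using assms unfolding smooth_def by auto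
  have "continuous_on {0..c} (D 1)"
    by (rule continuous_at_imp_continuous_on) (use has_vector_derivative_continuous[OF D(2)] in blast)
  then have "bounded (D 1 ` {0..c})" by (intro compact_imp_bounded compact_continuous_image) auto
  then obtain L where L: "\<forall>x\<in>{0..c}. cmod (D 1 x) \<le> L" unfolding bounded_iff by auto
  show thesis
  proof (rule that[of "\<bar>L\<bar>"])
    fix x y assume xy: "x \<in> {0..c}" "y \<in> {0..c}"
    have "norm (f x - f y) \<le> \<bar>L\<bar> * norm (x - y)"
    proof (rule differentiable_bound[of "{0..c}" f "\<lambda>x h. h *\<^sub>R D 1 x"])
      show "(f has_derivative (\<lambda>h. h *\<^sub>R D 1 x)) (at x within {0..c})" for x
        using has_vector_derivative_at_within[OF D(2)[of 0 x]] by (simp add: D(1) has_vector_derivative_def)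
      show "onorm (\<lambda>h. h *\<^sub>R D 1 x) \<le> \<bar>L\<bar>" if "x \<in> {0..c}" for x
      proof (rule onorm_le)
        fix h :: real
        have "cmod (D 1 x) \<le> \<bar>L\<bar>" using L that by force
        then have "\<bar>h\<bar> * cmod (D 1 x) \<le> \<bar>h\<bar> * \<bar>L\<bar>" by (rule mult_left_mono) simp
        then show "norm (h *\<^sub>R D 1 x) \<le> \<bar>L\<bar> * norm h" by (simp add: mult.commute)
      qed
    qed (use xy in auto)
    then show "cmod (f x - f y) \<le> \<bar>L\<bar> * \<bar>x - y\<bar>" by simp
  qed simp
qed

text \<open>Two shifts add up: \<eta> turns the eigenvalues up to x into a negative family at x +
  \<eta>, and C \<eta> passes to the other potential. The bound on x + (1 + C) \<eta> keeps the
  resulting eigenvalues inside the window ending at \<open>c\<close>.\<close>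

lemma spec_close_count:
  assumes V: "continuous_on UNIV V" "\<And>x. 2 * x\<^sup>2 \<le> V x" and W: "continuous_on UNIV W" "\<And>x. 2 * x\<^sup>2 \<le> W x"
    and h: "0 < h" and \<eta>: "0 < \<eta>" and x: "x + (1 + C) * \<eta> \<le> c" "0 \<le> C"
    and close: "\<And>n. neg_family (schroedinger_coeff h V (x + \<eta>)) n \<Longrightarrow>
      neg_family (schroedinger_coeff h W (x + \<eta> + C * \<eta>)) n"
    and fin: "finite (eigenvalues h V \<inter> {..c})" "finite (eigenvalues h W \<inter> {..c})"
  shows "card {E\<in>eigenvalues h V \<inter> {..c}. E \<le> x} \<le> card {E\<in>eigenvalues h W \<inter> {..c}. E < x + (1 + C) * \<eta>}"
proof -
  let ?S = "{E\<in>eigenvalues h V \<inter> {..c}. E \<le> x}"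
  have "neg_family (schroedinger_coeff h V (x + \<eta>)) (card ?S)"
  proof (rule eigenvalues_neg_family[OF V h _ _ \<eta>])
    show "finite ?S" by (rule finite_subset[OF _ fin(1)]) auto
    show "bound_state (schroedinger_coeff h V E) \<and> E \<le> x" if "E \<in> ?S" for E
      using that eigenvalues_iff[OF h V(1)] by auto
  qed
  from neg_family_eigenvalues[OF W h close[OF this]]
  obtain T where T: "finite T" "card T = card ?S" "\<And>E. E \<in> T \<Longrightarrow> E < x + \<eta> + C * \<eta> \<and> bound_state (schroedinger_coeff h W E)"
    by blast
  have "T \<subseteq> {E\<in>eigenvalues h W \<inter> {..c}. E < x + (1 + C) * \<eta>}"
  proof
    fix E assume "E \<in> T"
    from T(3)[OF this] have "E < x + (1 + C) * \<eta>" "E \<in> eigenvalues h W"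
      using eigenvalues_iff[OF h W(1)] by (auto simp: distrib_right)
    then show "E \<in> {E\<in>eigenvalues h W \<inter> {..c}. E < x + (1 + C) * \<eta>}" using x by auto
  qed
  then have "card T \<le> card {E\<in>eigenvalues h W \<inter> {..c}. E < x + (1 + C) * \<eta>}"
    by (rule card_mono[OF finite_subset[OF _ fin(2)], rotated]) auto
  then show ?thesis by (simp only: T(2))
qed

text \<open>At most O(1/h) pairs of eigenvalues, each O(h^(N+1)) apart, under a function that is
  Lipschitz where they lie; this is why closeness is invoked at exponent
  \<open>Suc N\<close>.\<close>

lemma trace_close:
  assumes V: "continuous_on UNIV V" "\<And>x. 2 * x\<^sup>2 \<le> V x" "filterlim V at_top at_top"
    and W: "continuous_on UNIV W" "\<And>x. 2 * x\<^sup>2 \<le> W x" "filterlim W at_top at_top"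
    and VW: "spec_close (b + 1) V W" and WV: "spec_close (b + 1) W V"
    and f: "smooth f" "\<And>x. b < x \<Longrightarrow> f x = 0" and b: "0 \<le> b"
  shows "\<exists>K h0. 0 < h0 \<and> (\<forall>h. 0 < h \<longrightarrow> h < h0 \<longrightarrow> cmod (trace_fun f h V - trace_fun f h W) \<le> K * h ^ N)"
proof -
  obtain C1 h1 where C1: "0 < C1" "0 < h1"
    and f1: "\<And>h E n. 0 < h \<Longrightarrow> h < h1 \<Longrightarrow> E \<le> b + 1 \<Longrightarrow> neg_family (schroedinger_coeff h V E) n \<Longrightarrow>
      neg_family (schroedinger_coeff h W (E + C1 * h ^ Suc N)) n"
    by (rule spec_closeE[OF VW, of "Suc N"]) (rule that)
  obtain C2 h2 where C2: "0 < C2" "0 < h2"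
    and f2: "\<And>h E n. 0 < h \<Longrightarrow> h < h2 \<Longrightarrow> E \<le> b + 1 \<Longrightarrow> neg_family (schroedinger_coeff h W E) n \<Longrightarrow>
      neg_family (schroedinger_coeff h V (E + C2 * h ^ Suc N)) n"
    by (rule spec_closeE[OF WV, of "Suc N"]) (rule that)
  define C where "C = C1 + C2"
  have C: "0 < C" "C1 \<le> C" "C2 \<le> C" using C1 C2 by (auto simp: C_def)
  define B where "B = 2 * (b + 1 + 2) * sqrt (2 * (b + 1 + 2)) + 2"
  \<comment> \<open>The support of f is bounded only above, so no global Lipschitz constant exists
    in general; nonnegativity of the eigenvalues makes the interval from 0 to b + 1
    sufficient.\<close>
  obtain L where L: "0 \<le> L" "\<And>x y. x \<in> {0..b + 1} \<Longrightarrow> y \<in> {0..b + 1} \<Longrightarrow> cmod (f x - f y) \<le> L * \<bar>x - y\<bar>"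
    by (rule smooth_lipschitz[OF f(1)]) (rule that)
  define h0 where "h0 = Min {h1, h2, 1, 1 / (1 + C)}"
  have "h0 \<le> y" if "y \<in> {h1, h2, 1, 1 / (1 + C)}" for y
    unfolding h0_def by (rule Min_le) (use that in auto)
  moreover have "0 < h0" using C1 C2 C by (simp add: h0_def)
  ultimately have h0: "0 < h0" "h0 \<le> h1" "h0 \<le> h2" "h0 \<le> 1" "h0 \<le> 1 / (1 + C)" by simp_all
  show ?thesis
  proof (rule exI[of _ "B * (L * (1 + C))"], rule exI[of _ h0], intro conjI allI impI)
    fix h assume h: "0 < h" "h < h0"
    define \<eta> where "\<eta> = h ^ Suc N"
    have hl: "h < h1" "h < h2" "h \<le> 1" using h h0 by auto
    have \<eta>: "0 < \<eta>" "\<eta> \<le> h" using h hl by (auto simp: \<eta>_def mult_left_le power_le_one)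
    define \<delta> where "\<delta> = (1 + C) * \<eta>"
    have "\<delta> \<le> (1 + C) * h0" unfolding \<delta>_def using C \<eta> h by (intro mult_left_mono) auto
    also have "\<dots> \<le> (1 + C) * (1 / (1 + C))" using C by (intro mult_left_mono h0) auto
    also have "\<dots> = 1" using C by simp
    finally have \<delta>: "0 \<le> \<delta>" "\<delta> \<le> 1" using C \<eta> by (auto simp: \<delta>_def)
    let ?A = "eigenvalues h V \<inter> {..b + 1}" and ?B = "eigenvalues h W \<inter> {..b + 1}"
    have b1: "0 \<le> b + 1" using b by simp
    have A: "finite ?A" "real (card ?A) \<le> B / h" and Bf: "finite ?B" "real (card ?B) \<le> B / h"
      using eigenvalues_finite[OF V(1,2) h(1) hl(3) b1] eigenvalues_finite[OF W(1,2) h(1) hl(3) b1]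
      by (auto simp: B_def)
    define m where "m = max (card ?A) (card ?B)"
    have m: "real m \<le> B / h" using A Bf by (simp add: m_def max_def)
    have \<eta>\<delta>: "\<eta> \<le> \<delta>" unfolding \<delta>_def using C \<eta> by (simp add: distrib_right)
    have "cmod ((\<Sum>E\<in>?A. f E) - (\<Sum>E\<in>?B. f E)) \<le> real m * (L * \<delta>)"
    proof (rule sum_difference_le[OF A(1) Bf(1) f(2) L(1) \<delta>(1)])
      fix x y assume x: "x \<in> ?A" and y: "y \<in> ?B"
      have "0 \<le> x" using x bound_state_energy_nonneg[OF V(1,2) h(1)] eigenvalues_iff[OF h(1) V(1)] by blast
      moreover have "0 \<le> y" using y bound_state_energy_nonneg[OF W(1,2) h(1)] eigenvalues_iff[OF h(1) W(1)] by blast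
      ultimately show "cmod (f x - f y) \<le> L * \<bar>x - y\<bar>" using x y by (intro L(2)) auto
    next
      fix x assume x: "x \<le> b"
      show "card {E \<in> ?A. E \<le> x} \<le> card {E \<in> ?B. E < x + \<delta>}" unfolding \<delta>_def
      proof (rule spec_close_count[OF V(1,2) W(1,2) h(1) \<eta>(1) _ _ _ A(1) Bf(1)])
        show "x + (1 + C) * \<eta> \<le> b + 1" using x \<delta> by (simp add: \<delta>_def)
        fix n assume nf: "neg_family (schroedinger_coeff h V (x + \<eta>)) n"
        have "neg_family (schroedinger_coeff h W (x + \<eta> + C1 * h ^ Suc N)) n"
          by (rule f1[OF h(1) hl(1) _ nf]) (use x \<eta>\<delta> \<delta> in linarith)
        moreover have "x + \<eta> + C1 * h ^ Suc N \<le> x + \<eta> + C * \<eta>"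
          using mult_right_mono[OF C(2), of \<eta>] \<eta> by (simp add: \<eta>_def)
        ultimately show "neg_family (schroedinger_coeff h W (x + \<eta> + C * \<eta>)) n"
          by (rule neg_family_energy_mono[OF W(1), rotated])
      qed (use C in simp)
    next
      fix x assume x: "x \<le> b"
      show "card {E \<in> ?B. E \<le> x} \<le> card {E \<in> ?A. E < x + \<delta>}" unfolding \<delta>_def
      proof (rule spec_close_count[OF W(1,2) V(1,2) h(1) \<eta>(1) _ _ _ Bf(1) A(1)])
        show "x + (1 + C) * \<eta> \<le> b + 1" using x \<delta> by (simp add: \<delta>_def)
        fix n assume nf: "neg_family (schroedinger_coeff h W (x + \<eta>)) n"
        have "neg_family (schroedinger_coeff h V (x + \<eta> + C2 * h ^ Suc N)) n"
          by (rule f2[OF h(1) hl(2) _ nf]) (use x \<eta>\<delta> \<delta> in linarith)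
        moreover have "x + \<eta> + C2 * h ^ Suc N \<le> x + \<eta> + C * \<eta>"
          using mult_right_mono[OF C(3), of \<eta>] \<eta> by (simp add: \<eta>_def)
        ultimately show "neg_family (schroedinger_coeff h V (x + \<eta> + C * \<eta>)) n"
          by (rule neg_family_energy_mono[OF V(1), rotated])
      qed (use C in simp)
    qed (auto simp: m_def)
    also have "\<dots> \<le> B / h * (L * \<delta>)" using m L \<delta> by (intro mult_right_mono) auto
    also have "\<dots> = B * (L * (1 + C)) * h ^ N" using h by (simp add: \<delta>_def \<eta>_def)
    finally show "cmod (trace_fun f h V - trace_fun f h W) \<le> B * (L * (1 + C)) * h ^ N"
      using trace_fun_eq_sum[of V h b f] trace_fun_eq_sum[of W h b f] V W h f(2) A(1) Bf(1) by simp
  qed (rule h0(1))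
qed

theorem mainTheorem3:
  shows "\<exists>V :: real \<Rightarrow> real \<Rightarrow> real.
    (\<forall>\<alpha>\<in>{0<..<1}. single_well (V \<alpha>)) \<and>
    inj_on V {0<..<1} \<and>
    (\<forall>\<alpha>\<in>{0<..<1}. \<forall>\<beta>\<in>{0<..<1}. \<forall>f :: real \<Rightarrow> complex.
       smooth f \<and> bdd_above (closure {x. f x \<noteq> 0}) \<longrightarrow>
       (\<forall>N :: nat.
          (\<lambda>h :: real. 2 * of_real pi * of_real h * (trace_fun f h (V \<alpha>) - trace_fun f h (V \<beta>)))
            \<in> O[at_right 0](\<lambda>h. of_real h ^ N)))"
proof (rule exI[of _ "\<lambda>\<alpha>. well (rational_cut \<alpha>)"], intro conjI ballI allI impI)
  fix \<alpha> :: real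
  show "single_well (well (rational_cut \<alpha>))" by (rule single_well_well)
next
  show "inj_on (\<lambda>\<alpha>. well (rational_cut \<alpha>)) {0<..<1}"
    using inj_compose[OF inj_well inj_rational_cut] by (auto simp: inj_on_def)
next
  fix \<alpha> \<beta> :: real and f :: "real \<Rightarrow> complex" and N :: nat
  assume f: "smooth f \<and> bdd_above (closure {x. f x \<noteq> 0})"
  obtain b0 where b0: "\<And>x. x \<in> closure {x. f x \<noteq> 0} \<Longrightarrow> x \<le> b0"
    using f unfolding bdd_above_def by blast
  \<comment> \<open>\<open>trace_close\<close> asks for a nonnegative bound, and enlarging
    \<open>b0\<close> keeps f zero above it.\<close>
  define b where "b = max b0 0"
  have fb: "f x = 0" if "b < x" for x
    using b0[of x] closure_subset[of "{x. f x \<noteq> 0}"] that by (fastforce simp: b_def)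
  have lim: "filterlim (well s) at_top at_top" for s using single_well_well by (simp add: single_well_def)
  have "\<exists>K h0. 0 < h0 \<and> (\<forall>h. 0 < h \<longrightarrow> h < h0 \<longrightarrow>
      cmod (trace_fun f h (well (rational_cut \<alpha>)) - trace_fun f h (well (rational_cut \<beta>))) \<le> K * h ^ N)"
    by (rule trace_close[of "well (rational_cut \<alpha>)" "well (rational_cut \<beta>)" b f N, OF continuous_well well_lower lim
        continuous_well well_lower lim well_close well_close conjunct1[OF f] fb]) (simp_all add: b_def)
  then obtain K h0 where K: "0 < h0" "\<forall>h. 0 < h \<longrightarrow> h < h0 \<longrightarrow>
      cmod (trace_fun f h (well (rational_cut \<alpha>)) - trace_fun f h (well (rational_cut \<beta>))) \<le> K * h ^ N"
    by (elim exE conjE)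
  show "(\<lambda>h :: real. 2 * of_real pi * of_real h *
      (trace_fun f h (well (rational_cut \<alpha>)) - trace_fun f h (well (rational_cut \<beta>)))) \<in> O[at_right 0](\<lambda>h. of_real h ^ N)"
  \<comment> \<open>The prefactor h is estimated by 1, which leaves 2 pi times the constant from
    \<open>trace_close\<close>.\<close>
  proof (rule bigoI[where c = "2 * pi * K"])
    have "\<forall>\<^sub>F h in at_right 0. h < min h0 1" using K(1) by (intro eventually_at_rightI[of 0 "min h0 1"]) auto
    then show "\<forall>\<^sub>F h in at_right 0. norm (2 * complex_of_real pi * complex_of_real h *
        (trace_fun f h (well (rational_cut \<alpha>)) - trace_fun f h (well (rational_cut \<beta>)))) \<le> 2 * pi * K * norm (complex_of_real h ^ N)"
      using eventually_at_right_less[of 0]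
    proof eventually_elim
      case (elim h)
      let ?d = "cmod (trace_fun f h (well (rational_cut \<alpha>)) - trace_fun f h (well (rational_cut \<beta>)))"
      have "h * ?d \<le> 1 * ?d" using elim by (intro mult_right_mono) auto
      also have "\<dots> \<le> K * h ^ N" using K(2)[rule_format, of h] elim by simp
      finally have "2 * pi * (h * ?d) \<le> 2 * pi * (K * h ^ N)" by (intro mult_left_mono) auto
      then show ?case using elim by (simp add: norm_mult norm_power mult.assoc)
    qed
  qed
qed

end
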